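(* Let $R$ be an $\omega$-categorical ring of finite burden. Then $R$ is virtually finite-by-null, i.e. $R$ has a subring $R_0$ of finite (additive) index which has a finite ideal $I$ such that the multiplication of $R_0/I$ is trivial (that is, $R_0\cdot R_0\subseteq I$).
   Context: Rings are associative, and are not assumed to be commutative or to have a unit; subrings need not contain a unit. An $\omega$-categorical ring is a ring, considered as a first-order structure (possibly with additional structure, in a countable language), whose complete theory has exactly one countable model up to isomorphism. A ring is null if its multiplication is trivial (all products are $0$). Burden. Work in a monster (sufficiently saturated and homogeneous) model of the theory. An inp-pattern of depth $\kappa$ in a partial type $\pi(\bar x)$ is a sequence of formulas $\langle\varphi_i(\bar x,\bar y_i):i<\kappa\rangle$ together with an array of parameters $\langle \bar a_{i,j}:i<\kappa,j<\omega\rangle$ such that (a) for each $i<\kappa$ there is $k_i<\omega$ such that $\{\varphi_i(\bar x,\bar a_{i,j}):j<\omega\}$ is $k_i$-inconsistent; (b) for each $\eta:\kappa\to\omega$ the partial type $\pi(\bar x)\cup\{\varphi_i(\bar x,\bar a_{i,\eta(i)}):i<\kappa\}$ is consistent. The ring has finite burden if there is $n<\omega$ such that there is no inp-pattern of depth $n+1$ in the partial type $x=x$ ($x$ a single variable ranging over the ring). *)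

theory Defs
  imports "HOL-Library.Countable_Set"
begin

section \<open>First-order logic\<close>

text \<open>The types \<open>'f\<close> and \<open>'r\<close> only supply names; the symbols of a language are the
  elements of \<open>fn_syms\<close> and \<open>rel_syms\<close>. Equality is a logical symbol.\<close>

record ('f, 'r) language =
  fn_syms :: "'f set"
  fn_arity :: "'f \<Rightarrow> nat"
  rel_syms :: "'r set"
  rel_arity :: "'r \<Rightarrow> nat"

record ('f, 'r, 'm) struct =
  dom :: "'m set"
  fn :: "'f \<Rightarrow> 'm list \<Rightarrow> 'm"
  rel :: "'r \<Rightarrow> 'm list \<Rightarrow> bool"

datatype 'f tm = Var nat | Fn 'f "'f tm list"

datatype ('f, 'r) fm =
    Falsum
  | Equal "'f tm" "'f tm"
  | Rel 'r "'f tm list"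
  | Imp "('f, 'r) fm" "('f, 'r) fm"
  | All nat "('f, 'r) fm"

definition countable_language :: "('f, 'r) language \<Rightarrow> bool" where
  "countable_language L \<longleftrightarrow> countable (fn_syms L) \<and> countable (rel_syms L)"

definition structure_of :: "('f, 'r) language \<Rightarrow> ('f, 'r, 'm) struct \<Rightarrow> bool" where
  "structure_of L M \<longleftrightarrow> dom M \<noteq> {} \<and>
     (\<forall>f \<in> fn_syms L. \<forall>xs. length xs = fn_arity L f \<and> set xs \<subseteq> dom M \<longrightarrow> fn M f xs \<in> dom M)"

fun tm_in :: "('f, 'r) language \<Rightarrow> 'f tm \<Rightarrow> bool" where
  "tm_in L (Var v) \<longleftrightarrow> True"
| "tm_in L (Fn f ts) \<longleftrightarrow> f \<in> fn_syms L \<and> length ts = fn_arity L f \<and> (\<forall>t \<in> set ts. tm_in L t)"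

fun fm_in :: "('f, 'r) language \<Rightarrow> ('f, 'r) fm \<Rightarrow> bool" where
  "fm_in L Falsum \<longleftrightarrow> True"
| "fm_in L (Equal t u) \<longleftrightarrow> tm_in L t \<and> tm_in L u"
| "fm_in L (Rel r ts) \<longleftrightarrow> r \<in> rel_syms L \<and> length ts = rel_arity L r \<and> (\<forall>t \<in> set ts. tm_in L t)"
| "fm_in L (Imp p q) \<longleftrightarrow> fm_in L p \<and> fm_in L q"
| "fm_in L (All v p) \<longleftrightarrow> fm_in L p"

fun fv_tm :: "'f tm \<Rightarrow> nat set" where
  "fv_tm (Var v) = {v}"
| "fv_tm (Fn f ts) = (\<Union>t \<in> set ts. fv_tm t)"

fun fv :: "('f, 'r) fm \<Rightarrow> nat set" where
  "fv Falsum = {}"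
| "fv (Equal t u) = fv_tm t \<union> fv_tm u"
| "fv (Rel r ts) = (\<Union>t \<in> set ts. fv_tm t)"
| "fv (Imp p q) = fv p \<union> fv q"
| "fv (All v p) = fv p - {v}"

fun val :: "('f, 'r, 'm) struct \<Rightarrow> (nat \<Rightarrow> 'm) \<Rightarrow> 'f tm \<Rightarrow> 'm" where
  "val M s (Var v) = s v"
| "val M s (Fn f ts) = fn M f (map (val M s) ts)"

fun sat :: "('f, 'r, 'm) struct \<Rightarrow> (nat \<Rightarrow> 'm) \<Rightarrow> ('f, 'r) fm \<Rightarrow> bool" where
  "sat M s Falsum \<longleftrightarrow> False"
| "sat M s (Equal t u) \<longleftrightarrow> val M s t = val M s u"
| "sat M s (Rel r ts) \<longleftrightarrow> rel M r (map (val M s) ts)"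
| "sat M s (Imp p q) \<longleftrightarrow> (sat M s p \<longrightarrow> sat M s q)"
| "sat M s (All v p) \<longleftrightarrow> (\<forall>x \<in> dom M. sat M (s(v := x)) p)"

definition sentence :: "('f, 'r) language \<Rightarrow> ('f, 'r) fm \<Rightarrow> bool" where
  "sentence L p \<longleftrightarrow> fm_in L p \<and> fv p = {}"

definition holds :: "('f, 'r, 'm) struct \<Rightarrow> ('f, 'r) fm \<Rightarrow> bool" where
  "holds M p \<longleftrightarrow> (\<forall>s. range s \<subseteq> dom M \<longrightarrow> sat M s p)"

definition complete_theory ::
  "('f, 'r) language \<Rightarrow> ('f, 'r, 'm) struct \<Rightarrow> ('f, 'r) fm set" where
  "complete_theory L M = {p. sentence L p \<and> holds M p}"

definition model_of ::
  "('f, 'r) language \<Rightarrow> ('f, 'r) fm set \<Rightarrow> ('f, 'r, 'm) struct \<Rightarrow> bool" where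
  "model_of L T M \<longleftrightarrow> structure_of L M \<and> (\<forall>p \<in> T. holds M p)"

definition isomorphism ::
  "('f, 'r) language \<Rightarrow> ('f, 'r, 'm) struct \<Rightarrow> ('f, 'r, 'n) struct \<Rightarrow> ('m \<Rightarrow> 'n) \<Rightarrow> bool" where
  "isomorphism L M N g \<longleftrightarrow> bij_betw g (dom M) (dom N) \<and>
     (\<forall>f \<in> fn_syms L. \<forall>xs. length xs = fn_arity L f \<and> set xs \<subseteq> dom M \<longrightarrow>
        g (fn M f xs) = fn N f (map g xs)) \<and>
     (\<forall>r \<in> rel_syms L. \<forall>xs. length xs = rel_arity L r \<and> set xs \<subseteq> dom M \<longrightarrow>
        rel M r xs = rel N r (map g xs))"

text \<open>Every countable structure is isomorphic to one whose domain is a subset of \<open>nat\<close>, so it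
  suffices to let the countable models range over such structures. Finite models count as
  countable.\<close>

definition omega_categorical_theory :: "('f, 'r) language \<Rightarrow> ('f, 'r) fm set \<Rightarrow> bool" where
  "omega_categorical_theory L T \<longleftrightarrow>
     (\<exists>N :: ('f, 'r, nat) struct. model_of L T N \<and>
        (\<forall>N' :: ('f, 'r, nat) struct. model_of L T N' \<longrightarrow> (\<exists>g. isomorphism L N N' g)))"

section \<open>Types and monster models\<close>

text \<open>A pair \<open>(p, b)\<close> stands for the formula \<open>p(x, b)\<close> with parameter tuple \<open>b\<close>: the tuple
  \<open>x\<close> of length \<open>m\<close> is substituted for the variables \<open>0, \<dots>, m - 1\<close> and \<open>b\<close> for those from
  \<open>m\<close> on.\<close>

definition formulas_over ::
  "('f, 'r) language \<Rightarrow> nat \<Rightarrow> 'm set \<Rightarrow> (('f, 'r) fm \<times> 'm list) set" where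
  "formulas_over L m A =
     {(p, b). fm_in L p \<and> set b \<subseteq> A \<and> fv p \<subseteq> {..<m + length b}}"

definition realizes ::
  "('f, 'r, 'm) struct \<Rightarrow> 'm list \<Rightarrow> (('f, 'r) fm \<times> 'm list) set \<Rightarrow> bool" where
  "realizes M x \<pi> \<longleftrightarrow> (\<forall>(p, b) \<in> \<pi>. sat M (nth (x @ b)) p)"

text \<open>Consistency of a set of formulas over \<open>M\<close> in \<open>m\<close> variables means consistency with the
  elementary diagram of \<open>M\<close>, that is, finite satisfiability in \<open>M\<close>.\<close>

definition consistent ::
  "('f, 'r, 'm) struct \<Rightarrow> nat \<Rightarrow> (('f, 'r) fm \<times> 'm list) set \<Rightarrow> bool" where
  "consistent M m \<pi> \<longleftrightarrow>
     (\<forall>\<pi>0. finite \<pi>0 \<and> \<pi>0 \<subseteq> \<pi> \<longrightarrow>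
        (\<exists>x. length x = m \<and> set x \<subseteq> dom M \<and> realizes M x \<pi>0))"

definition saturated ::
  "('f, 'r) language \<Rightarrow> 'k rel \<Rightarrow> ('f, 'r, 'm) struct \<Rightarrow> bool" where
  "saturated L \<kappa> M \<longleftrightarrow>
     (\<forall>A \<pi>. A \<subseteq> dom M \<and> (card_of A, \<kappa>) \<in> ordLess \<and>
        \<pi> \<subseteq> formulas_over L 1 A \<and> consistent M 1 \<pi> \<longrightarrow>
        (\<exists>x \<in> dom M. realizes M [x] \<pi>))"

definition partial_elementary ::
  "('f, 'r) language \<Rightarrow> ('f, 'r, 'm) struct \<Rightarrow> 'm set \<Rightarrow> ('m \<Rightarrow> 'm) \<Rightarrow> bool" where
  "partial_elementary L M A h \<longleftrightarrow> A \<subseteq> dom M \<and> h ` A \<subseteq> dom M \<and>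
     (\<forall>(p, b) \<in> formulas_over L 0 A. sat M (nth b) p \<longleftrightarrow> sat M (nth (map h b)) p)"

definition strongly_homogeneous ::
  "('f, 'r) language \<Rightarrow> 'k rel \<Rightarrow> ('f, 'r, 'm) struct \<Rightarrow> bool" where
  "strongly_homogeneous L \<kappa> M \<longleftrightarrow>
     (\<forall>A h. (card_of A, \<kappa>) \<in> ordLess \<and> partial_elementary L M A h \<longrightarrow>
        (\<exists>g. isomorphism L M M g \<and> (\<forall>a \<in> A. g a = h a)))"

text \<open>In a countable language, ``sufficiently'' saturated and homogeneous means: for some
  uncountable cardinal \<open>\<kappa>\<close>.\<close>

definition monster_model ::
  "('f, 'r) language \<Rightarrow> ('f, 'r) fm set \<Rightarrow> 'k rel \<Rightarrow> ('f, 'r, 'm) struct \<Rightarrow> bool" where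
  "monster_model L T \<kappa> M \<longleftrightarrow> Card_order \<kappa> \<and> (natLeq, \<kappa>) \<in> ordLess \<and>
     model_of L T M \<and> saturated L \<kappa> M \<and> strongly_homogeneous L \<kappa> M"

section \<open>Burden\<close>

text \<open>Inconsistency is that of the indexed family, not of its range: a family with repeated
  members is not \<open>k\<close>-inconsistent merely because its range has fewer than \<open>k\<close> elements.\<close>

definition k_inconsistent ::
  "('f, 'r, 'm) struct \<Rightarrow> nat \<Rightarrow> nat \<Rightarrow> (nat \<Rightarrow> ('f, 'r) fm \<times> 'm list) \<Rightarrow> bool" where
  "k_inconsistent M m k F \<longleftrightarrow>
     (\<forall>J. finite J \<and> card J = k \<longrightarrow> \<not> consistent M m (F ` J))"

text \<open>The depth of the pattern is the cardinality of the index set \<open>S\<close>. The length of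
  the variable tuple \<open>y\<close> of the \<open>i\<close>-th formula \<open>p i (x, y)\<close> is \<open>l i\<close>.\<close>

definition inp_pattern ::
  "('f, 'r) language \<Rightarrow> ('f, 'r, 'm) struct \<Rightarrow> nat \<Rightarrow> (('f, 'r) fm \<times> 'm list) set \<Rightarrow>
   'i set \<Rightarrow> ('i \<Rightarrow> ('f, 'r) fm) \<Rightarrow> ('i \<Rightarrow> nat) \<Rightarrow> ('i \<Rightarrow> nat \<Rightarrow> 'm list) \<Rightarrow> bool" where
  "inp_pattern L M m \<pi> S p l a \<longleftrightarrow>
     (\<forall>i \<in> S. \<forall>j. length (a i j) = l i \<and> (p i, a i j) \<in> formulas_over L m (dom M)) \<and>
     (\<forall>i \<in> S. \<exists>k. k_inconsistent M m k (\<lambda>j. (p i, a i j))) \<and>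
     (\<forall>\<eta> :: 'i \<Rightarrow> nat. consistent M m (\<pi> \<union> (\<lambda>i. (p i, a i (\<eta> i))) ` S))"

text \<open>To be applied to a monster model \<open>M\<close>; the partial type is \<open>x = x\<close> in a single variable.\<close>

definition finite_burden :: "('f, 'r) language \<Rightarrow> ('f, 'r, 'm) struct \<Rightarrow> bool" where
  "finite_burden L M \<longleftrightarrow>
     (\<exists>n :: nat. \<not> (\<exists>p l a.
        inp_pattern L M 1 {(Equal (Var 0) (Var 0), [])} {..<n + 1} p l a))"

section \<open>Rings\<close>

datatype 'f ring_fn = Zero | Plus | Minus | Times | Extra 'f

definition expands_ring_language :: "('f ring_fn, 'r) language \<Rightarrow> bool" where
  "expands_ring_language L \<longleftrightarrow> {Zero, Plus, Minus, Times} \<subseteq> fn_syms L \<and>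
     fn_arity L Zero = 0 \<and> fn_arity L Plus = 2 \<and> fn_arity L Minus = 1 \<and> fn_arity L Times = 2"

text \<open>The type class \<open>ring\<close> requires neither commutativity nor a unit.\<close>

definition expands_ring :: "('f ring_fn, 'r, 'a :: ring) struct \<Rightarrow> bool" where
  "expands_ring R \<longleftrightarrow> dom R = UNIV \<and> fn R Zero [] = 0 \<and>
     (\<forall>x y. fn R Plus [x, y] = x + y) \<and> (\<forall>x. fn R Minus [x] = - x) \<and>
     (\<forall>x y. fn R Times [x, y] = x * y)"

definition additive_subgroup :: "'a :: ring set \<Rightarrow> bool" where
  "additive_subgroup H \<longleftrightarrow> 0 \<in> H \<and> (\<forall>x \<in> H. \<forall>y \<in> H. x - y \<in> H)"

definition nonunital_subring :: "'a :: ring set \<Rightarrow> bool" where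
  "nonunital_subring S \<longleftrightarrow> additive_subgroup S \<and> (\<forall>x \<in> S. \<forall>y \<in> S. x * y \<in> S)"

definition finite_additive_index :: "'a :: ring set \<Rightarrow> bool" where
  "finite_additive_index H \<longleftrightarrow> finite (range (\<lambda>x. (\<lambda>h. x + h) ` H))"

definition two_sided_ideal_in :: "'a :: ring set \<Rightarrow> 'a set \<Rightarrow> bool" where
  "two_sided_ideal_in I S \<longleftrightarrow> I \<subseteq> S \<and> additive_subgroup I \<and>
     (\<forall>i \<in> I. \<forall>s \<in> S. i * s \<in> I \<and> s * i \<in> I)"

end

theory Submission
  imports "HOL-Algebra.QuotRing" "HOL-Algebra.Multiplicative_Group"
    "HOL-Computational_Algebra.Polynomial" "HOL-Library.Function_Algebras" "HOL-Library.Set_Algebras"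
    Complex_Main Defs
begin

text \<open>
  Additive subgroups are compared up to finite index: \<open>A \<preceq> B\<close> means that finitely many cosets of \<open>B\<close>
  cover \<open>A\<close>. Two consequences of the hypotheses carry the proof. By the theorem of Ryll-Nardzewski
  (\<open>finitely_many\<close>) only boundedly many relations in a given number of variables are definable over a
  parameter set of given finite size. And finite burden bounds the breadth of definable subgroups
  (\<open>breadth_bound\<close>): among sufficiently many of them, one almost contains the intersection of the others,
  since otherwise their cosets would form an inp-pattern. The locale \<open>tame\<close> collects both; in it every
  definable descending or ascending chain is stationary and almost containment is definable.

  Multiplication is then studied as a biadditive map from \<open>V\<close> and \<open>W\<close> to \<open>L\<close> modulo \<open>K\<close>, for definable subgroups.
  The claim is that every such form is trivial: almost every \<open>v\<close> sends \<open>W\<close> almost into \<open>K\<close>. A nontrivial form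
  is taken of minimal breadth (\<open>minform\<close>). Restricting it or enlarging \<open>K\<close> lowers the breadth, so minimality
  yields the comparison principles \<open>S1\<close> and \<open>S3\<close>; they force the definable subgroups of \<open>W\<close> to form a chain
  that is in Galois correspondence with annihilators in \<open>V\<close>. Suppose that, for a suitable \<open>v0\<close>, infinitely many
  elements \<open>u\<close> have pairwise differences with the same annihilator as \<open>v0\<close>, up to finite index. Dividing \<open>u\<close> by \<open>v0\<close>
  gives definable endomorphisms of \<open>W\<close> modulo the annihilator of \<open>v0\<close>. Finitely many of them lie in a finite
  ring. Idempotents of that ring are trivial because kernel and image of an idempotent are comparable. So it is
  local, its residue ring is a field by Wedderburn's theorem, and the given endomorphisms are distinct roots of
  \<open>X ^ t - 1\<close> there, for an exponent \<open>t\<close> that does not depend on their number. This is absurd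
  (\<open>residue\<close>). So almost all elements that kill the annihilator of \<open>v0\<close> kill properly more, and comparing the
  subgroups of \<open>W\<close> obtained from such elements by division by \<open>v0\<close> excludes this as well
  (\<open>impossible\<close>).

  Triviality of the form given by multiplication modulo \<open>0\<close> produces the subring and the finite ideal by means
  of B. H. Neumann's theorem on coverings by cosets.
\<close>

section \<open>Values of cyclotomic polynomials\<close>

definition ip :: "complex poly \<Rightarrow> bool" where "ip p \<longleftrightarrow> (\<forall>i. coeff p i \<in> \<int>)"

lemma ip_mult: "ip p \<Longrightarrow> ip q \<Longrightarrow> ip (p * q)" by (auto simp: ip_def coeff_mult intro!: Ints_sum)
lemma ip_diff: "ip p \<Longrightarrow> ip q \<Longrightarrow> ip (p - q)" by (auto simp: ip_def)
lemma ip_monom: "c \<in> \<int> \<Longrightarrow> ip (monom c n)" by (auto simp: ip_def)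
lemma ip_1: "ip 1" by (auto simp: ip_def coeff_1)
lemma ip_prod: "(\<And>i. i \<in> S \<Longrightarrow> ip (f i)) \<Longrightarrow> ip (\<Prod>i\<in>S. f i)"
  by (induction S rule: infinite_finite_induct) (auto intro: ip_1 ip_mult)
lemma ip_poly: "ip p \<Longrightarrow> poly p (of_nat q) \<in> \<int>"
  by (auto simp: ip_def poly_altdef intro!: Ints_sum Ints_mult Ints_power)

lemma ip_quotient: "ip A \<Longrightarrow> ip B \<Longrightarrow> lead_coeff B = 1 \<Longrightarrow> A = B * C \<Longrightarrow> ip C"
proof (induction "degree C" arbitrary: A C rule: less_induct)
  case less
  show ?case
  proof (cases "C = 0")
    case True then show ?thesis by (simp add: ip_def)
  next
    case False
    have "lead_coeff A = lead_coeff C" using less.prems by (simp add: lead_coeff_mult)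
    then have c: "lead_coeff C \<in> \<int>" using less.prems(1) by (metis ip_def)
    let ?M = "monom (lead_coeff C) (degree C)"
    have M: "ip ?M" by (rule ip_monom[OF c])
    have "ip (C - ?M)"
    proof (cases "degree C = 0")
      case True
      then have "C = ?M" by (metis degree_0_id lead_coeff_monom monom_0 degree_eq_zeroE lead_coeff_pCons(2) pCons_0_0 coeff_pCons_0)
      then have "C - ?M = 0" by simp
      then show ?thesis by (simp add: ip_def)
    next
      case False
      have "degree (C - ?M) \<le> degree C" by (rule degree_diff_le) (auto simp: degree_monom_le)
      moreover have "coeff (C - ?M) (degree C) = 0" by simp
      ultimately have "degree (C - ?M) < degree C"
        using False by (metis eq_zero_or_degree_less degree_0 neq0_conv)
      then show ?thesis
      proof (rule less.hyps)
        show "ip (A - B * ?M)" by (intro ip_diff ip_mult less.prems M)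
        show "A - B * ?M = B * (C - ?M)" using less.prems by (simp add: algebra_simps)
      qed (use less.prems in auto)
    qed
    then have "ip (C - ?M + ?M)" using M by (auto simp: ip_def)
    then show ?thesis by simp
  qed
qed

text \<open>The primitive roots of unity of order \<open>n\<close>; \<open>cyc n\<close> below is the cyclotomic polynomial.\<close>
definition prim :: "nat \<Rightarrow> complex set" where
  "prim n = {z. z ^ n = 1 \<and> (\<forall>m. 0 < m \<and> m < n \<longrightarrow> z ^ m \<noteq> 1)}"
definition cyc :: "nat \<Rightarrow> complex poly" where "cyc n = (\<Prod>z\<in>prim n. [:- z, 1:])"

lemma finite_unity: "n > 0 \<Longrightarrow> finite {z :: complex. z ^ n = 1}"
  using card_roots_unity_eq[of n] by (intro card_ge_0_finite) simp
lemma finite_prim: "n > 0 \<Longrightarrow> finite (prim n)"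
  by (rule finite_subset[OF _ finite_unity[of n]]) (auto simp: prim_def)
lemma root_dvd: assumes z: "z \<in> prim d" and "d > 0" shows "(z :: complex) ^ n = 1 \<longleftrightarrow> d dvd n"
proof
  assume 1: "z ^ n = 1"
  have "z ^ n = (z ^ d) ^ (n div d) * z ^ (n mod d)" by (simp flip: power_mult power_add)
  then have "z ^ (n mod d) = 1" using z 1 by (simp add: prim_def)
  then have "n mod d = 0" using z \<open>d > 0\<close> mod_less_divisor[of d n] by (auto simp: prim_def)
  then show "d dvd n" by auto
next
  assume "d dvd n"
  then show "z ^ n = 1" using z by (auto simp: prim_def power_mult)
qed
lemma roots_split: assumes "n > 0" shows "{z :: complex. z ^ n = 1} = (\<Union>d\<in>{d. d dvd n}. prim d)"
proof (intro equalityI subsetI)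
  fix z :: complex assume "z \<in> {z. z ^ n = 1}"
  then have ex: "\<exists>d. d > 0 \<and> z ^ d = 1" using assms by blast
  define d where "d = (LEAST d. d > 0 \<and> z ^ d = 1)"
  have d: "d > 0" "z ^ d = 1" using LeastI_ex[OF ex] by (auto simp: d_def)
  have "z ^ m \<noteq> 1" if "0 < m" "m < d" for m using not_less_Least[of m "\<lambda>d. d > 0 \<and> z ^ d = 1"] that by (auto simp: d_def)
  then have "z \<in> prim d" using d by (auto simp: prim_def)
  then show "z \<in> (\<Union>d\<in>{d. d dvd n}. prim d)" using root_dvd[OF _ d(1)] \<open>z \<in> {z. z ^ n = 1}\<close> by auto
next
  fix z assume "z \<in> (\<Union>d\<in>{d. d dvd n}. prim d)"
  then obtain d where d: "d dvd n" "z \<in> prim d" by blast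
  then have "d > 0" using assms by (auto intro: Nat.gr0I)
  then show "z \<in> {z. z ^ n = 1}" using root_dvd d by auto
qed
lemma prim_disj: "d > 0 \<Longrightarrow> e > 0 \<Longrightarrow> d \<noteq> e \<Longrightarrow> prim d \<inter> prim e = {}"
proof (rule ccontr)
  assume d: "d > 0" "e > 0" "d \<noteq> e" and "prim d \<inter> prim e \<noteq> {}"
  then obtain z where z: "z \<in> prim d" "z \<in> prim e" by blast
  have "d dvd e" using root_dvd[OF z(1) d(1), of e] z(2) by (simp add: prim_def)
  moreover have "e dvd d" using root_dvd[OF z(2) d(2), of d] z(1) by (simp add: prim_def)
  ultimately show False using d(3) dvd_antisym by blast
qed

lemma prod_roots: assumes "n > 0" shows "(\<Prod>z\<in>{z :: complex. z ^ n = 1}. [:- z, 1:]) = monom 1 n - 1"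
proof -
  let ?U = "{z :: complex. z ^ n = 1}"
  let ?p = "monom 1 n - 1 :: complex poly"
  have dp: "degree ?p = n" "lead_coeff ?p = 1"
  proof -
    show "degree ?p = n" using degree_add_eq_left[of "- 1 :: complex poly" "monom 1 n"] assms by (simp add: degree_monom_eq)
    then show "lead_coeff ?p = 1" using assms by (simp add: coeff_1)
  qed
  have fU: "finite ?U" by (rule finite_unity[OF assms])
  have cU: "card ?U = n" by (rule card_roots_unity_eq[OF assms])
  have "(\<Prod>z\<in>S. [:- z, 1:]) dvd ?p" if "S \<subseteq> ?U" "finite S" for S
    using that(2,1)
  proof (induction S)
    case (insert a S)
    then obtain r where r: "?p = (\<Prod>z\<in>S. [:- z, 1:]) * r" by (auto elim: dvdE)
    have "poly ?p a = 0" using insert.prems by (simp add: poly_monom)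
    moreover have "poly (\<Prod>z\<in>S. [:- z, 1:]) a \<noteq> 0" using insert.hyps by (auto simp: poly_prod)
    ultimately have "poly r a = 0" unfolding r by simp
    then have "[:- a, 1:] dvd r" by (simp add: poly_eq_0_iff_dvd)
    then have "[:- a, 1:] * (\<Prod>z\<in>S. [:- z, 1:]) dvd r * (\<Prod>z\<in>S. [:- z, 1:])" by (rule mult_dvd_mono) simp
    then show ?case unfolding r prod.insert[OF insert.hyps] by (simp only: mult.commute[of r])
  qed simp
  from this[OF subset_refl fU] obtain r where r: "?p = (\<Prod>z\<in>?U. [:- z, 1:]) * r" by (auto elim: dvdE)
  have dg: "degree (\<Prod>z\<in>?U. [:- z, 1:]) = n" using degree_prod_eq_sum_degree[of ?U "\<lambda>z. [:- z, 1:]"] cU by simp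
  have r0: "r \<noteq> 0" using r dp assms by auto
  then have "degree r = 0" using r dp(1) dg degree_mult_eq[of "\<Prod>z\<in>?U. [:- z, 1:]" r] assms by (metis add_cancel_right_right degree_0 mult_zero_left not_gr0)
  moreover have "lead_coeff r = 1"
  proof -
    have "lead_coeff (\<Prod>z\<in>?U. [:- z, 1:]) = 1" by (simp add: lead_coeff_prod)
    then show ?thesis using dp(2) r lead_coeff_mult[of "\<Prod>z\<in>?U. [:- z, 1:]" r] by simp
  qed
  ultimately have "r = 1" by (metis degree_0_id one_pCons)
  then show ?thesis using r by simp
qed

lemma cyc_prod: assumes "n > 0" shows "(\<Prod>d\<in>{d. d dvd n}. cyc d) = monom 1 n - 1"
proof -
  have "(\<Prod>z\<in>(\<Union>d\<in>{d. d dvd n}. prim d). [:- z, 1:]) = (\<Prod>d\<in>{d. d dvd n}. cyc d)"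
    unfolding cyc_def
  proof (rule prod.UNION_disjoint)
    have p: "d > 0" if "d dvd n" for d using that assms by (auto intro: Nat.gr0I)
    show "\<forall>i\<in>{d. d dvd n}. finite (prim i)" using p finite_prim by blast
    show "\<forall>i\<in>{d. d dvd n}. \<forall>j\<in>{d. d dvd n}. i \<noteq> j \<longrightarrow> prim i \<inter> prim j = {}"
      using p prim_disj by blast
  qed (use assms in simp)
  then show ?thesis using prod_roots[OF assms] roots_split[OF assms] by simp
qed
lemma cyc_monic: "lead_coeff (cyc n) = 1" unfolding cyc_def by (simp add: lead_coeff_prod)
lemma cyc_ip: "n > 0 \<Longrightarrow> ip (cyc n)"
proof (induction n rule: less_induct)
  case (less n)
  let ?B = "\<Prod>d\<in>{d. d dvd n \<and> d < n}. cyc d"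
  have fin: "finite {d. d dvd n}" using less.prems by simp
  have e: "{d. d dvd n} = insert n {d. d dvd n \<and> d < n}" using less.prems by (auto dest: dvd_imp_le)
  have "monom 1 n - 1 = ?B * cyc n"
    unfolding cyc_prod[OF less.prems, symmetric] e using fin by (subst prod.insert) auto
  moreover have "ip (monom 1 n - 1)" by (intro ip_diff ip_monom ip_1) auto
  moreover have "ip ?B" by (rule ip_prod) (use less in \<open>auto intro: Nat.gr0I\<close>)
  moreover have "lead_coeff ?B = 1" by (simp add: lead_coeff_prod cyc_monic)
  ultimately show ?case using ip_quotient by blast
qed

text \<open>The witness is the value at \<open>q\<close> of the cyclotomic polynomial of order \<open>n\<close>. It divides
  \<open>q ^ n - 1\<close>, and also its quotient by \<open>q ^ d - 1\<close> for each proper divisor \<open>d\<close>; it exceeds \<open>q - 1\<close>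
  in absolute value because every primitive root of unity is further from \<open>q\<close> than \<open>1\<close> is. These are
  the arithmetical facts in Witt's proof of Wedderburn's theorem.\<close>
lemma cyclotomic_value: assumes n: "n \<ge> 2" and q: "(q :: nat) \<ge> 2"
  shows "\<exists>c :: int. c dvd int q ^ n - 1 \<and> \<not> c dvd int q - 1 \<and>
    (\<forall>d. d dvd n \<longrightarrow> d < n \<longrightarrow> (\<exists>k. int q ^ n - 1 = (int q ^ d - 1) * c * k))"
proof -
  have n0: "n > 0" using n by simp
  have iv: "\<exists>k :: int. poly p (of_nat q) = of_int k" if "ip p" for p using ip_poly[OF that, of q] by (auto elim: Ints_cases)
  obtain c where c: "poly (cyc n) (of_nat q) = of_int c" using iv[OF cyc_ip[OF n0]] by blast
  have fin: "finite {d. d dvd m}" if "m > 0" for m :: nat using that by simp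
  have val: "poly (monom 1 m - 1) (of_nat q :: complex) = of_int (int q ^ m - 1)" for m by (simp add: poly_monom)
  have div: "\<exists>k. int q ^ n - 1 = (int q ^ d - 1) * c * k" if d: "d dvd n" "d < n" for d
  proof -
    have d0: "d > 0" using d n0 by (auto intro: Nat.gr0I)
    let ?R = "{e. e dvd n} - {e. e dvd d} - {n}"
    have nd: "n \<notin> {e. e dvd d}" using d d0 by (auto dest: dvd_imp_le)
    have e: "{e. e dvd n} = {e. e dvd d} \<union> insert n ?R" using d by auto
    have "monom 1 n - 1 = (\<Prod>e\<in>{e. e dvd d} \<union> insert n ?R. cyc e)" using cyc_prod[OF n0] e by simp
    also have "\<dots> = (\<Prod>e\<in>{e. e dvd d}. cyc e) * (\<Prod>e\<in>insert n ?R. cyc e)"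
      by (rule prod.union_disjoint) (use fin n0 d0 nd in auto)
    also have "(\<Prod>e\<in>insert n ?R. cyc e) = cyc n * (\<Prod>e\<in>?R. cyc e)"
      by (rule prod.insert) (use fin[OF n0] in auto)
    finally have m: "monom 1 n - 1 = (monom 1 d - 1) * (cyc n * (\<Prod>e\<in>?R. cyc e))" by (simp add: cyc_prod[OF d0])
    have "ip (\<Prod>e\<in>?R. cyc e)" by (rule ip_prod, rule cyc_ip) (use n0 in \<open>auto intro: Nat.gr0I\<close>)
    then obtain k where k: "poly (\<Prod>e\<in>?R. cyc e) (of_nat q) = of_int k" using iv by blast
    have "(of_int (int q ^ n - 1) :: complex) = of_int ((int q ^ d - 1) * c * k)"
      using arg_cong[OF m, of "\<lambda>p. poly p (of_nat q)"] unfolding poly_mult val c k by simp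
    then show ?thesis by (metis of_int_eq_iff)
  qed
  have "c dvd int q ^ n - 1" using div[of 1] n by auto
  moreover have "\<not> c dvd int q - 1"
  proof
    assume dv: "c dvd int q - 1"
    have big: "cmod (of_nat q - z) > real q - 1" if z: "z \<in> prim n" for z
    proof -
      have z1: "z ^ n = 1" "z \<noteq> 1" using z n by (auto simp: prim_def dest: spec[of _ 1])
      then have nz: "cmod z = 1" using power_eq_1_iff[of z n] n0 by simp
      have "Re z \<noteq> 1"
      proof
        assume r: "Re z = 1"
        then have "Im z = 0" using nz cmod_power2[of z] by simp
        then show False using r z1(2) by (simp add: complex_eq_iff)
      qed
      moreover have "Re z \<le> 1" using complex_Re_le_cmod[of z] nz by simp
      ultimately have "real q - 1 < Re (of_nat q - z)" by simp
      also have "\<dots> \<le> cmod (of_nat q - z)" by (rule complex_Re_le_cmod)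
      finally show ?thesis .
    qed
    define w where "w = cis (2 * pi * real 1 / real n)"
    have w: "w \<in> prim n"
    proof -
      have inj: "inj_on (\<lambda>k. cis (2 * pi * real k / real n)) {..<n}"
        using bij_betw_roots_unity[OF n0] by (auto simp: bij_betw_def)
      have "w ^ m \<noteq> 1" if "0 < m" "m < n" for m
      proof
        assume "w ^ m = 1"
        then have "cis (2 * pi * real m / real n) = cis (2 * pi * real 0 / real n)"
          by (simp add: w_def DeMoivre mult_ac)
        then show False using inj_onD[OF inj, of m 0] that by auto
      qed
      moreover have "w ^ n = 1" using n0 by (simp add: w_def DeMoivre)
      ultimately show ?thesis by (simp add: prim_def)
    qed
    have "real_of_int \<bar>c\<bar> = cmod (poly (cyc n) (of_nat q))" by (simp add: c)
    also have "\<dots> = (\<Prod>z\<in>prim n. cmod (of_nat q - z))"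
      by (simp add: cyc_def poly_prod prod_norm)
    also have "\<dots> = cmod (of_nat q - w) * (\<Prod>z\<in>prim n - {w}. cmod (of_nat q - z))"
      by (rule prod.remove[OF finite_prim[OF n0] w])
    also have "\<dots> \<ge> cmod (of_nat q - w) * 1"
    proof (rule mult_left_mono)
      show "1 \<le> (\<Prod>z\<in>prim n - {w}. cmod (of_nat q - z))"
      proof (rule prod_ge_1)
        fix z assume "z \<in> prim n - {w}"
        then show "1 \<le> cmod (of_nat q - z)" using big[of z] q by simp
      qed
    qed simp
    finally have "real_of_int \<bar>c\<bar> > real q - 1" using big[OF w] by simp
    then have "\<bar>c\<bar> > int q - 1" by linarith
    moreover have "\<bar>c\<bar> \<le> int q - 1" by (rule zdvd_imp_le) (use dv q in auto)
    ultimately show False by simp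
  qed
  ultimately show ?thesis using div by blast
qed

section \<open>Finite division rings are commutative\<close>

context ring begin

text \<open>A sub-division-ring; left inverses suffice in a finite ring.\<close>
definition sdr :: "'a set \<Rightarrow> bool" where
  "sdr K \<longleftrightarrow> K \<subseteq> carrier R \<and> \<zero> \<in> K \<and> \<one> \<in> K \<and> (\<forall>x\<in>K. \<forall>y\<in>K. x \<ominus> y \<in> K \<and> x \<otimes> y \<in> K) \<and>
     (\<forall>x\<in>K. x \<noteq> \<zero> \<longrightarrow> (\<exists>y\<in>K. y \<otimes> x = \<one>))"
definition lvs :: "'a set \<Rightarrow> 'a set \<Rightarrow> bool" where
  "lvs K E \<longleftrightarrow> E \<subseteq> carrier R \<and> \<zero> \<in> E \<and> (\<forall>x\<in>E. \<forall>y\<in>E. x \<ominus> y \<in> E) \<and> (\<forall>k\<in>K. \<forall>x\<in>E. k \<otimes> x \<in> E)"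

text \<open>A left vector space over a finite division ring has as many elements as a power of it. This is
  what makes the class equation a statement about numbers \<open>q ^ d - 1\<close>.\<close>
lemma card_lvs: assumes fin: "finite (carrier R)" and K: "sdr K" and E: "lvs K E" and ne: "\<one> \<noteq> \<zero>"
  shows "\<exists>d. card E = card K ^ d"
proof -
  let ?Q = "\<lambda>U. lvs K U \<and> U \<subseteq> E \<and> (\<exists>d. card U = card K ^ d)"
  have Kc: "K \<subseteq> carrier R" using K by (simp add: sdr_def)
  have Ec: "E \<subseteq> carrier R" using E by (simp add: lvs_def)
  have finE: "finite E" using finite_subset[OF Ec fin] .
  have finK: "finite K" using finite_subset[OF Kc fin] .
  have "{\<zero>, \<one>} \<subseteq> K" using K by (auto simp: sdr_def)
  from card_mono[OF finK this] have K2: "card K \<ge> 2" using ne by simp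
  have "?Q {\<zero>}" using E Kc by (auto simp: lvs_def a_minus_def intro: exI[of _ 0])
  moreover have "\<forall>U. ?Q U \<longrightarrow> card U < Suc (card E)" using card_mono[OF finE] by (auto simp: less_Suc_eq_le)
  ultimately obtain U where U: "?Q U" "\<And>U'. ?Q U' \<Longrightarrow> card U' \<le> card U"
    using ex_has_greatest_nat[of ?Q "{\<zero>}" card "Suc (card E)"] by blast
  have "U = E"
  proof (rule ccontr)
    assume "U \<noteq> E"
    then obtain x where x: "x \<in> E" "x \<notin> U" using U(1) by blast
    have xc: "x \<in> carrier R" using x Ec by blast
    have Uc: "U \<subseteq> carrier R" using U(1) by (simp add: lvs_def)
    let ?f = "\<lambda>(u, k). u \<oplus> k \<otimes> x"
    let ?U = "?f ` (U \<times> K)"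
    have Usub: "u \<ominus> v \<in> U" if "u \<in> U" "v \<in> U" for u v using U(1) that by (simp add: lvs_def)
    have Esub: "u \<ominus> v \<in> E" if "u \<in> E" "v \<in> E" for u v using E that by (simp add: lvs_def)
    have Ksub: "u \<ominus> v \<in> K" if "u \<in> K" "v \<in> K" for u v using K that by (simp add: sdr_def)
    have KU: "k \<otimes> u \<in> U" if "k \<in> K" "u \<in> U" for k u using U(1) that by (simp add: lvs_def)
    have U0: "\<zero> \<in> U" using U(1) by (simp add: lvs_def)
    have K0: "\<zero> \<in> K" using K by (simp add: sdr_def)
    have inj: "inj_on ?f (U \<times> K)"
    proof (rule inj_onI, clarify)
      fix u k u' k' assume a: "u \<in> U" "k \<in> K" "u' \<in> U" "k' \<in> K" and e: "u \<oplus> k \<otimes> x = u' \<oplus> k' \<otimes> x"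
      have c: "u \<in> carrier R" "k \<in> carrier R" "u' \<in> carrier R" "k' \<in> carrier R" using a Uc Kc by auto
      have "(k \<ominus> k') \<otimes> x = (u \<oplus> k \<otimes> x) \<ominus> k' \<otimes> x \<ominus> u" using c xc by (simp add: a_minus_def l_distr l_minus a_ac r_neg1 r_neg2)
      also have "\<dots> = u' \<ominus> u" unfolding e using c xc by (simp add: a_minus_def a_ac r_neg r_neg1 r_neg2)
      finally have kx: "(k \<ominus> k') \<otimes> x = u' \<ominus> u" .
      have "k = k'"
      proof (rule ccontr)
        assume "k \<noteq> k'"
        then have "k \<ominus> k' \<noteq> \<zero>" using c by simp
        then obtain y where y: "y \<in> K" "y \<otimes> (k \<ominus> k') = \<one>" using K Ksub[OF a(2,4)] by (auto simp: sdr_def)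
        have "x = y \<otimes> ((k \<ominus> k') \<otimes> x)" using y c xc Kc by (simp add: m_assoc[symmetric] subsetD)
        then have "x \<in> U" unfolding kx using KU[OF y(1) Usub[OF a(3,1)]] by simp
        then show False using x by simp
      qed
      then show "u = u' \<and> k = k'" using e c xc by simp
    qed
    have "card ?U = card U * card K" using card_image[OF inj] by (simp add: card_cartesian_product)
    moreover have "card U > 0" using U0 finite_subset[OF _ finE, of U] U(1) by (auto simp: card_gt_0_iff)
    ultimately have big: "card ?U > card U" and pw: "\<exists>d. card ?U = card K ^ d"
      using K2 U(1) by (auto intro: exI[of _ "Suc _"])
    have "?Q ?U"
    proof (intro conjI pw)
      show "?U \<subseteq> E"
      proof clarify
        fix u k assume a: "u \<in> U" "k \<in> K"
        have "u \<in> E" "k \<otimes> x \<in> E" using a x U(1) E by (auto simp: lvs_def)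
        moreover have "u \<oplus> k \<otimes> x = u \<ominus> (\<zero> \<ominus> k \<otimes> x)" using a xc Uc Kc by (simp add: a_minus_def subsetD)
        ultimately show "u \<oplus> k \<otimes> x \<in> E" using Esub E by (simp add: lvs_def)
      qed
      show "lvs K ?U" unfolding lvs_def
      proof (intro conjI ballI)
        show "?U \<subseteq> carrier R" using Uc Kc xc by auto
        show "\<zero> \<in> ?U" using U0 K0 xc by (auto intro!: image_eqI[of _ _ "(\<zero>, \<zero>)"])
      next
        fix a b assume "a \<in> ?U" "b \<in> ?U"
        then obtain u k u' k' where ab: "u \<in> U" "k \<in> K" "u' \<in> U" "k' \<in> K" "a = u \<oplus> k \<otimes> x" "b = u' \<oplus> k' \<otimes> x" by auto
        have c: "u \<in> carrier R" "k \<in> carrier R" "u' \<in> carrier R" "k' \<in> carrier R" using ab Uc Kc by auto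
        have "a \<ominus> b = (u \<ominus> u') \<oplus> (k \<ominus> k') \<otimes> x" unfolding ab using c xc
          by (simp add: a_minus_def l_distr l_minus minus_add a_ac)
        then show "a \<ominus> b \<in> ?U" using Usub[OF ab(1,3)] Ksub[OF ab(2,4)] by (auto intro!: image_eqI[of _ _ "(u \<ominus> u', k \<ominus> k')"])
      next
        fix l a assume "l \<in> K" "a \<in> ?U"
        then obtain u k where a: "u \<in> U" "k \<in> K" "a = u \<oplus> k \<otimes> x" by auto
        have c: "u \<in> carrier R" "k \<in> carrier R" "l \<in> carrier R" using a \<open>l \<in> K\<close> Uc Kc by auto
        have "l \<otimes> a = l \<otimes> u \<oplus> (l \<otimes> k) \<otimes> x" unfolding a using c xc by (simp add: r_distr m_assoc)
        moreover have "l \<otimes> k \<in> K" using K \<open>l \<in> K\<close> a by (simp add: sdr_def)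
        ultimately show "l \<otimes> a \<in> ?U" using KU[OF \<open>l \<in> K\<close> a(1)] by (auto intro!: image_eqI[of _ _ "(l \<otimes> u, l \<otimes> k)"])
      qed
    qed
    from U(2)[OF this] big show False by simp
  qed
  then show ?thesis using U(1) by blast
qed

text \<open>Witt's argument: if the centre has \<open>q\<close> elements then in the class equation of the unit group every term
  except \<open>q - 1\<close> is divisible by the value at \<open>q\<close> of a cyclotomic polynomial, which is too large
  to divide \<open>q - 1\<close>.\<close>
theorem wedderburn:
  assumes fin: "finite (carrier R)" and ne: "\<one> \<noteq> \<zero>" and un: "\<And>x. x \<in> carrier R \<Longrightarrow> x \<noteq> \<zero> \<Longrightarrow> x \<in> Units R"
    and ab: "a \<in> carrier R" "b \<in> carrier R"
  shows "a \<otimes> b = b \<otimes> a"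
proof (rule ccontr)
  assume nc: "a \<otimes> b \<noteq> b \<otimes> a"
  define C where "C x = {y \<in> carrier R. y \<otimes> x = x \<otimes> y}" for x
  define Z where "Z = {z \<in> carrier R. \<forall>x\<in>carrier R. z \<otimes> x = x \<otimes> z}"
  have inv0: "inv x \<in> carrier R" "inv x \<otimes> x = \<one>" "x \<otimes> inv x = \<one>" if "x \<in> carrier R" "x \<noteq> \<zero>" for x
    using un[OF that] by auto
  have invcomm: "inv y \<otimes> x = x \<otimes> inv y" if "x \<in> carrier R" "y \<in> carrier R" "y \<noteq> \<zero>" "y \<otimes> x = x \<otimes> y" for x y
  proof -
    note i = inv0[OF that(2,3)]
    have "inv y \<otimes> x = inv y \<otimes> (x \<otimes> (y \<otimes> inv y))" using that i by simp
    also have "\<dots> = inv y \<otimes> (x \<otimes> y) \<otimes> inv y" using that(1,2) i by (simp add: m_assoc)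
    also have "\<dots> = inv y \<otimes> (y \<otimes> x) \<otimes> inv y" using that(4) by simp
    also have "\<dots> = x \<otimes> inv y" using that(1,2) i by (simp add: m_assoc[symmetric])
    finally show ?thesis .
  qed
  have sC: "sdr (C x)" if x: "x \<in> carrier R" for x
    unfolding sdr_def C_def using x invcomm[OF x] inv0
    by (auto simp: m_assoc r_distr l_distr a_minus_def l_minus r_minus) (metis m_assoc)
  have sZ: "sdr Z"
    unfolding sdr_def
  proof (intro conjI ballI impI)
    fix x assume x: "x \<in> Z" "x \<noteq> \<zero>"
    then have "inv x \<in> Z" using invcomm inv0(1) by (auto simp: Z_def)
    moreover have "inv x \<otimes> x = \<one>" by (rule inv0(2)) (use x in \<open>auto simp: Z_def\<close>)
    ultimately show "\<exists>y\<in>Z. y \<otimes> x = \<one>" by blast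
  next
    fix x y assume xy: "x \<in> Z" "y \<in> Z"
    then show "x \<ominus> y \<in> Z" by (auto simp: Z_def a_minus_def l_distr r_distr l_minus r_minus)
    have c: "x \<in> carrier R" "y \<in> carrier R" using xy by (auto simp: Z_def)
    have "x \<otimes> y \<otimes> w = w \<otimes> (x \<otimes> y)" if w: "w \<in> carrier R" for w
    proof -
      have "y \<otimes> w = w \<otimes> y" "x \<otimes> w = w \<otimes> x" using xy w unfolding Z_def by blast+
      then show ?thesis using c w by (metis m_assoc)
    qed
    then show "x \<otimes> y \<in> Z" using c by (simp add: Z_def)
  qed (auto simp: Z_def)
  have Zc: "Z \<subseteq> carrier R" and Cc: "C x \<subseteq> carrier R" for x by (auto simp: Z_def C_def)
  have ZC: "Z \<subseteq> C x" if "x \<in> carrier R" for x using that by (auto simp: Z_def C_def)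
  have fZ: "finite Z" and fC: "finite (C x)" for x using finite_subset[OF Zc fin] finite_subset[OF Cc fin] by auto
  define q where "q = card Z"
  have "{\<zero>, \<one>} \<subseteq> Z" using sZ by (auto simp: sdr_def)
  from card_mono[OF fZ this] have q2: "q \<ge> 2" using ne by (simp add: q_def)
  have lR: "lvs K (carrier R)" if "K \<subseteq> carrier R" for K using that by (auto simp: lvs_def)
  have lC: "lvs Z (C x)" if "x \<in> carrier R" for x
    using sC[OF that] ZC[OF that] by (auto simp: lvs_def sdr_def)
  obtain n where n: "card (carrier R) = q ^ n" using card_lvs[OF fin sZ lR[OF Zc] ne] by (auto simp: q_def)
  have "Z \<noteq> carrier R" using nc ab by (auto simp: Z_def)
  then have "card Z < card (carrier R)" using psubset_card_mono[OF fin] Zc by auto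
  then have n2: "n \<ge> 2" using q2 n q_def by (metis One_nat_def Suc_1 Suc_leI less_2_cases not_less power_0 power_one_right less_irrefl less_one not_numeral_le_zero)
  obtain c where c: "c dvd int q ^ n - 1" "\<not> c dvd int q - 1"
    "\<And>d. d dvd n \<Longrightarrow> d < n \<Longrightarrow> \<exists>k. int q ^ n - 1 = (int q ^ d - 1) * c * k"
    using cyclotomic_value[OF n2 q2] by blast
  define U where "U = carrier R - {\<zero>}"
  have U: "g \<in> carrier R" "inv g \<in> carrier R" "inv g \<otimes> g = \<one>" "g \<otimes> inv g = \<one>" if "g \<in> U" for g
    using that inv0[of g] by (auto simp: U_def)
  have fU: "finite U" using fin by (simp add: U_def)
  have cU: "int (card U) = int q ^ n - 1"
  proof -
    have "card (carrier R) > 0" using n q2 by simp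
    then have "int (card (carrier R) - 1) = int (card (carrier R)) - 1" by linarith
    then show ?thesis unfolding U_def using fin n by (simp add: card_Diff_singleton)
  qed
  have Um: "g \<otimes> h \<in> U" if "g \<in> U" "h \<in> U" for g h
  proof -
    have "g \<otimes> h \<noteq> \<zero>"
    proof
      assume "g \<otimes> h = \<zero>"
      then have "inv g \<otimes> (g \<otimes> h) = \<zero>" using U[OF that(1)] by simp
      then have "h = \<zero>" using U[OF that(1)] U(1)[OF that(2)] by (simp add: m_assoc[symmetric])
      then show False using that by (simp add: U_def)
    qed
    then show ?thesis using U(1) that by (simp add: U_def)
  qed
  have Ui: "inv g \<in> U" if "g \<in> U" for g
  proof -
    have "inv g \<noteq> \<zero>" using U[OF that] ne by auto
    then show ?thesis using U[OF that] by (simp add: U_def)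
  qed
  define cj where "cj x g = g \<otimes> x \<otimes> inv g" for x g
  define cl where "cl x = cj x ` U" for x
  have cjc: "cj x g \<in> carrier R" if "x \<in> carrier R" "g \<in> U" for x g using that U by (simp add: cj_def)
  have cj_eq: "cj x g = y \<longleftrightarrow> g \<otimes> x = y \<otimes> g" if "x \<in> carrier R" "y \<in> carrier R" "g \<in> U" for x y g
  proof
    assume "cj x g = y"
    then have "y \<otimes> g = g \<otimes> x \<otimes> inv g \<otimes> g" by (simp add: cj_def)
    also have "\<dots> = g \<otimes> x" using that(1) U[OF that(3)] by (simp add: m_assoc)
    finally show "g \<otimes> x = y \<otimes> g" by simp
  next
    assume "g \<otimes> x = y \<otimes> g"
    then have "cj x g = y \<otimes> g \<otimes> inv g" by (simp add: cj_def)
    then show "cj x g = y" using that(2) U[OF that(3)] by (simp add: m_assoc)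
  qed
  have cl_card: "int q ^ n - 1 = int (card (cl x)) * (int (card (C x)) - 1)" if x: "x \<in> carrier R" for x
  proof -
    have fib: "card {g \<in> U. cj x g = y} = card (C x - {\<zero>})" if "y \<in> cl x" for y
    proof -
      obtain g where g: "g \<in> U" "y = cj x g" using \<open>y \<in> cl x\<close> by (auto simp: cl_def)
      have yc: "y \<in> carrier R" using cjc[OF x g(1)] g(2) by simp
      note Ug = U[OF g(1)]
      have gx: "g \<otimes> x = y \<otimes> g" using cj_eq[OF x yc g(1)] g(2) by simp
      have "bij_betw (\<lambda>h. g \<otimes> h) (C x - {\<zero>}) {h \<in> U. cj x h = y}"
      proof (rule bij_betwI[where g = "\<lambda>h. inv g \<otimes> h"])
        show "(\<lambda>h. g \<otimes> h) \<in> C x - {\<zero>} \<rightarrow> {h \<in> U. cj x h = y}"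
        proof
          fix h assume h: "h \<in> C x - {\<zero>}"
          then have hU: "h \<in> U" by (auto simp: C_def U_def)
          have "h \<otimes> x = x \<otimes> h" using h by (simp add: C_def)
          then have "g \<otimes> h \<otimes> x = y \<otimes> (g \<otimes> h)" using gx Ug x yc U(1)[OF hU] by (metis m_assoc)
          then show "g \<otimes> h \<in> {h \<in> U. cj x h = y}" using cj_eq[OF x yc] Um[OF g(1) hU] by simp
        qed
        show "(\<lambda>h. inv g \<otimes> h) \<in> {h \<in> U. cj x h = y} \<rightarrow> C x - {\<zero>}"
        proof
          fix h assume h: "h \<in> {h \<in> U. cj x h = y}"
          then have hx: "h \<otimes> x = y \<otimes> h" and hU: "h \<in> U" using cj_eq[OF x yc] by auto
          have "y = g \<otimes> x \<otimes> inv g" using g by (simp add: cj_def)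
          then have "inv g \<otimes> y = x \<otimes> inv g" using Ug x by (simp add: m_assoc[symmetric])
          then have "inv g \<otimes> h \<otimes> x = x \<otimes> (inv g \<otimes> h)" using Ug x yc hx U(1)[OF hU]
            by (metis m_assoc)
          then show "inv g \<otimes> h \<in> C x - {\<zero>}" using Um[OF Ui[OF g(1)] hU] by (auto simp: C_def U_def)
        qed
      qed (use Ug in \<open>auto simp: C_def U_def m_assoc[symmetric]\<close>)
      then show ?thesis by (simp add: bij_betw_same_card)
    qed
    have "card U = (\<Sum>y\<in>cl x. card {g \<in> U. cj x g = y})"
      using sum.image_gen[OF fU, of "\<lambda>_. 1 :: nat" "cj x"] by (simp add: cl_def)
    also have "\<dots> = card (cl x) * card (C x - {\<zero>})" using fib by simp
    finally have e: "card U = card (cl x) * card (C x - {\<zero>})" .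
    have z: "\<zero> \<in> C x" using sC[OF x] by (simp add: sdr_def)
    then have "card (C x) > 0" using fC[of x] by (auto simp: card_gt_0_iff)
    then have "int (card (C x) - 1) = int (card (C x)) - 1" by linarith
    then have "int (card (C x - {\<zero>})) = int (card (C x)) - 1"
      using z fC[of x] by (simp add: card_Diff_singleton)
    then show ?thesis using e cU by simp
  qed
  have c_dvd: "nat \<bar>c\<bar> dvd card (cl x)" if x: "x \<in> carrier R" "x \<notin> Z" for x
  proof -
    obtain d where d: "card (C x) = q ^ d" using card_lvs[OF fin sZ lC[OF x(1)] ne] by (auto simp: q_def)
    obtain s where "card (carrier R) = card (C x) ^ s" using card_lvs[OF fin sC[OF x(1)] lR[OF Cc] ne] by auto
    then have "q ^ n = q ^ (d * s)" using n d by (simp add: power_mult)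
    then have nds: "n = d * s" using q2 power_inject_exp[of q n "d * s"] by simp
    obtain y where "y \<in> carrier R" "x \<otimes> y \<noteq> y \<otimes> x" using x unfolding Z_def by blast
    then have "y \<in> carrier R" "y \<notin> C x" by (auto simp: C_def)
    then have "C x \<noteq> carrier R" by blast
    then have "card (C x) < card (carrier R)" using psubset_card_mono[OF fin] Cc by auto
    then have dn: "d < n" using n d q2 power_strict_increasing_iff[of q d n] by simp
    have d0: "d > 0" using nds n2 by (cases d) auto
    obtain k where "int q ^ n - 1 = (int q ^ d - 1) * c * k" using c(3)[of d] nds dn by auto
    then have "int (card (cl x)) * (int q ^ d - 1) = (c * k) * (int q ^ d - 1)" using cl_card[OF x(1)] d by (simp add: mult_ac)
    moreover have "int q ^ d - 1 \<noteq> 0"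
    proof -
      have "1 < int q ^ d" by (rule one_less_power) (use q2 d0 in auto)
      then show ?thesis by simp
    qed
    ultimately have "int (card (cl x)) = c * k" by simp
    then have "c dvd int (card (cl x))" by simp
    then show ?thesis by (metis abs_dvd_iff int_dvd_int_iff nat_0_le abs_ge_zero)
  qed
  let ?N = "carrier R - Z"
  have self: "x \<in> cl x" if "x \<in> carrier R" for x
  proof -
    have "\<one> \<in> U" using ne by (simp add: U_def)
    moreover have "cj x \<one> = x" using that by (simp add: cj_def)
    ultimately show ?thesis by (metis cl_def imageI)
  qed
  have trans: "cl y = cl x" if x: "x \<in> carrier R" and y: "y \<in> cl x" for x y
  proof -
    obtain g where g: "g \<in> U" "y = cj x g" using y by (auto simp: cl_def)
    note Ug = U[OF g(1)]
    have iv: "inv (h \<otimes> k) = inv k \<otimes> inv h" if hk: "h \<in> U" "k \<in> U" for h k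
    proof -
      note u = U[OF hk(1)] U[OF hk(2)]
      have "h \<otimes> k \<otimes> (inv k \<otimes> inv h) = h \<otimes> (k \<otimes> inv k) \<otimes> inv h" using u(1,2,5,6) by (simp add: m_assoc)
      then have 1: "h \<otimes> k \<otimes> (inv k \<otimes> inv h) = \<one>" using u by simp
      have "inv k \<otimes> inv h \<otimes> (h \<otimes> k) = inv k \<otimes> (inv h \<otimes> h) \<otimes> k" using u(1,2,5,6) by (simp add: m_assoc)
      then have 2: "inv k \<otimes> inv h \<otimes> (h \<otimes> k) = \<one>" using u by simp
      show ?thesis using inv_char[OF _ _ 1 2] u by simp
    qed
    have 1: "cj y h = cj x (h \<otimes> g)" if h: "h \<in> U" for h
      unfolding g(2) cj_def iv[OF h g(1)] using Ug U[OF h] x by (simp add: m_assoc)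
    have "cl x \<subseteq> cl y"
    proof
      fix z assume "z \<in> cl x"
      then obtain h where h: "h \<in> U" "z = cj x h" by (auto simp: cl_def)
      have "cj y (h \<otimes> inv g) = cj x (h \<otimes> inv g \<otimes> g)" by (rule 1[OF Um[OF h(1) Ui[OF g(1)]]])
      also have "h \<otimes> inv g \<otimes> g = h" using Ug U[OF h(1)] by (simp add: m_assoc)
      finally have "z = cj y (h \<otimes> inv g)" using h by simp
      then show "z \<in> cl y" using Um[OF h(1) Ui[OF g(1)]] unfolding cl_def by (rule image_eqI)
    qed
    moreover have "cl y \<subseteq> cl x" using 1 Um[OF _ g(1)] by (auto simp: cl_def)
    ultimately show ?thesis by blast
  qed
  have clN: "cl x \<subseteq> ?N" if x: "x \<in> ?N" for x
  proof
    fix y assume y: "y \<in> cl x"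
    then obtain g where g: "g \<in> U" "y = cj x g" by (auto simp: cl_def)
    have yc: "y \<in> carrier R" using cjc g x by auto
    have "y \<notin> Z"
    proof
      assume yz: "y \<in> Z"
      have "g \<otimes> x = y \<otimes> g" using cj_eq[OF _ yc g(1)] g x by auto
      also have "\<dots> = g \<otimes> y" using yz U(1)[OF g(1)] by (simp add: Z_def)
      finally have "inv g \<otimes> (g \<otimes> x) = inv g \<otimes> (g \<otimes> y)" by simp
      then have "x = y" using U[OF g(1)] x yc by (simp add: m_assoc[symmetric])
      then show False using x yz by simp
    qed
    then show "y \<in> ?N" using yc by simp
  qed
  have UN: "\<Union>(cl ` ?N) = ?N" using clN self by blast
  have "nat \<bar>c\<bar> dvd card (\<Union>(cl ` ?N))"
  proof (rule dvd_partition)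
    show "finite (\<Union>(cl ` ?N))" unfolding UN using fin by simp
    show "\<forall>A\<in>cl ` ?N. nat \<bar>c\<bar> dvd card A" using c_dvd by auto
    show "\<forall>A\<in>cl ` ?N. \<forall>B\<in>cl ` ?N. A \<noteq> B \<longrightarrow> A \<inter> B = {}"
    proof (intro ballI impI)
      fix A B assume "A \<in> cl ` ?N" "B \<in> cl ` ?N" "A \<noteq> B"
      then obtain x y where xy: "x \<in> carrier R" "y \<in> carrier R" "A = cl x" "B = cl y" by auto
      show "A \<inter> B = {}"
      proof (rule ccontr)
        assume "A \<inter> B \<noteq> {}"
        then obtain z where "z \<in> cl x" "z \<in> cl y" using xy by blast
        then show False using trans[OF xy(1)] trans[OF xy(2)] \<open>A \<noteq> B\<close> xy by blast
      qed
    qed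
  qed
  then have "nat \<bar>c\<bar> dvd q ^ n - q" unfolding UN using card_Diff_subset[OF fZ Zc] n by (simp add: q_def)
  then have "int (nat \<bar>c\<bar>) dvd int (q ^ n - q)" by (simp only: int_dvd_int_iff)
  moreover have "q \<le> q ^ n" using n2 q2 by (simp add: self_le_power)
  ultimately have "c dvd int q ^ n - int q" by (simp add: of_nat_diff)
  from dvd_diff[OF c(1) this] have "c dvd int q - 1" by simp
  then show False using c(2) by simp
qed

end

section \<open>Roots of unity in finite local rings\<close>

context ring begin

text \<open>The powers of \<open>x\<close> are eventually periodic, and a multiple of the period beyond the preperiod is an
  exponent with idempotent power.\<close>
lemma pow_idem: assumes fin: "finite (carrier R)" and x: "x \<in> carrier R"
  shows "\<exists>m>0. x [^] (m::nat) \<otimes> x [^] m = x [^] m"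
proof -
  let ?f = "\<lambda>i :: nat. x [^] i"
  have "finite (range ?f)" by (rule finite_subset[OF _ fin]) (use x in auto)
  then have "\<not> inj ?f" using finite_imageD infinite_UNIV_nat by blast
  then obtain i j where "i < j" "?f i = ?f j" by (metis injI linorder_neqE_nat)
  then obtain p where p: "p > 0" "?f (i + p) = ?f i" by (metis less_imp_add_positive)
  have s: "?f (a + p) = ?f a" if "a \<ge> i" for a
  proof -
    have "?f (a + p) = ?f (i + p) \<otimes> ?f (a - i)" using x that by (simp add: nat_pow_mult add.commute)
    also have "\<dots> = ?f a" using x that p(2) by (simp add: nat_pow_mult)
    finally show ?thesis .
  qed
  have s2: "?f (a + p * b) = ?f a" if "a \<ge> i" for a b
  proof (induction b)
    case (Suc b)
    have "?f (a + p * Suc b) = ?f (a + p * b + p)" by (simp add: algebra_simps)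
    then show ?case using Suc s[of "a + p * b"] that by simp
  qed simp
  let ?m = "p * Suc i"
  have "?m \<ge> i" using p(1) by (metis Suc_leD mult_le_mono1 One_nat_def Suc_leI nat_mult_1)
  from s2[OF this, of "Suc i"] have "?f ?m \<otimes> ?f ?m = ?f ?m" using x by (simp add: nat_pow_mult)
  then show ?thesis using p(1) by (intro exI[of _ ?m]) auto
qed

text \<open>In the absence of proper idempotents each element is nilpotent or a unit, the nilpotent elements form an
  ideal and the quotient is a finite division ring, hence a field. The elements of \<open>S\<close> stay
  distinct there and are roots of \<open>X ^ t - 1\<close>.\<close>
theorem local_ring_roots:
  assumes fin: "finite (carrier R)" and ne: "\<one> \<noteq> \<zero>"
    and idem: "\<And>e. e \<in> carrier R \<Longrightarrow> e \<otimes> e = e \<Longrightarrow> e = \<zero> \<or> e = \<one>"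
    and S: "S \<subseteq> carrier R" "\<And>x. x \<in> S \<Longrightarrow> x [^] t = \<one>" and t: "(t :: nat) > 0"
    and d: "\<And>x y k. x \<in> S \<Longrightarrow> y \<in> S \<Longrightarrow> x \<noteq> y \<Longrightarrow> (x \<ominus> y) [^] (k :: nat) \<noteq> \<zero>"
  shows "card S \<le> t"
proof -
  define J where "J = {x \<in> carrier R. \<exists>k :: nat. x [^] k = \<zero>}"
  have nilp: "\<exists>k :: nat. k > 0 \<and> x [^] k = \<zero>" if "x \<in> J" for x
  proof -
    obtain k :: nat where k: "x [^] k = \<zero>" and x: "x \<in> carrier R" using \<open>x \<in> J\<close> by (auto simp: J_def)
    then have "x [^] Suc k = \<zero>" by simp
    then show ?thesis by blast
  qed
  have unit: "\<exists>y\<in>carrier R. x \<otimes> y = \<one> \<and> y \<otimes> x = \<one>" if x: "x \<in> carrier R" "x \<notin> J" for x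
  proof -
    obtain m :: nat where m: "m > 0" "x [^] m \<otimes> x [^] m = x [^] m" using pow_idem[OF fin x(1)] by blast
    have "x [^] m = \<one>" using idem[OF _ m(2)] x by (auto simp: J_def)
    moreover obtain k where "m = Suc k" using m(1) gr0_implies_Suc by blast
    ultimately show ?thesis using x(1) nat_pow_Suc2[OF x(1), of k] by (intro bexI[of _ "x [^] k"]) auto
  qed
  have one: "\<one> \<notin> J" using ne by (auto simp: J_def)
  \<comment> \<open>a one-sided multiple of a nilpotent is not a unit\<close>
  have l: "r \<otimes> x \<in> J" if r: "r \<in> carrier R" and x: "x \<in> J" for r x
  proof (rule ccontr)
    have xc: "x \<in> carrier R" using x by (simp add: J_def)
    assume "r \<otimes> x \<notin> J"
    then obtain y where y: "y \<in> carrier R" "y \<otimes> (r \<otimes> x) = \<one>" using unit[of "r \<otimes> x"] r xc by auto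
    have yr: "y \<otimes> r \<in> carrier R" and e: "y \<otimes> r \<otimes> x = \<one>" using y r xc by (auto simp: m_assoc)
    have "x [^] (k :: nat) \<noteq> \<zero>" for k
    proof (induction k)
      case (Suc k)
      show ?case
      proof
        assume "x [^] Suc k = \<zero>"
        then have "x \<otimes> x [^] k = \<zero>" using nat_pow_Suc2[OF xc, of k] by simp
        then have "y \<otimes> r \<otimes> (x \<otimes> x [^] k) = \<zero>" using yr by simp
        moreover have "y \<otimes> r \<otimes> (x \<otimes> x [^] k) = (y \<otimes> r \<otimes> x) \<otimes> x [^] k" by (rule m_assoc[symmetric]) (use yr xc in auto)
        ultimately have "x [^] k = \<zero>" using e xc by simp
        then show False using Suc by simp
      qed
    qed (use ne in simp)
    then show False using x by (auto simp: J_def)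
  qed
  have r: "x \<otimes> r \<in> J" if r: "r \<in> carrier R" and x: "x \<in> J" for r x
  proof (rule ccontr)
    have xc: "x \<in> carrier R" using x by (simp add: J_def)
    assume "x \<otimes> r \<notin> J"
    then obtain y where y: "y \<in> carrier R" "x \<otimes> r \<otimes> y = \<one>" using unit[of "x \<otimes> r"] r xc by auto
    have ry: "r \<otimes> y \<in> carrier R" and e: "x \<otimes> (r \<otimes> y) = \<one>" using y r xc by (auto simp: m_assoc)
    have "x [^] (k :: nat) \<noteq> \<zero>" for k
    proof (induction k)
      case (Suc k)
      show ?case
      proof
        assume "x [^] Suc k = \<zero>"
        then have "x [^] k \<otimes> x \<otimes> (r \<otimes> y) = \<zero>" using ry by simp
        moreover have "x [^] k \<otimes> x \<otimes> (r \<otimes> y) = x [^] k \<otimes> (x \<otimes> (r \<otimes> y))" by (rule m_assoc) (use xc ry in auto)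
        ultimately have "x [^] k = \<zero>" using e xc by simp
        then show False using Suc by simp
      qed
    qed (use ne in simp)
    then show False using x by (auto simp: J_def)
  qed
  have add: "x \<oplus> y \<in> J" if x: "x \<in> J" and y: "y \<in> J" for x y
  proof (rule ccontr)
    have xc: "x \<in> carrier R" and yc: "y \<in> carrier R" using x y by (auto simp: J_def)
    assume "x \<oplus> y \<notin> J"
    then obtain u where u: "u \<in> carrier R" "u \<otimes> (x \<oplus> y) = \<one>" using unit[of "x \<oplus> y"] xc yc by auto
    define a where "a = u \<otimes> x"
    define b where "b = u \<otimes> y"
    have ab: "a \<in> J" "b \<in> J" "a \<in> carrier R" "b \<in> carrier R" unfolding a_def b_def using l[OF u(1)] x y xc yc u by auto
    have s: "a \<oplus> b = \<one>" using u xc yc by (simp add: a_def b_def r_distr)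
    \<comment> \<open>\<open>b = 1 - a\<close>, so \<open>b\<close> acts invertibly on the powers of \<open>a\<close>\<close>
    obtain k :: nat where k: "a [^] k = \<zero>" using ab(1) by (auto simp: J_def)
    have "b [^] (n :: nat) \<noteq> \<zero>" for n
    proof
      assume n: "b [^] n = \<zero>"
      have ba: "b \<otimes> a [^] i = a [^] i \<ominus> a [^] Suc i" for i :: nat
      proof -
        have "a [^] i = (a \<oplus> b) \<otimes> a [^] i" using s ab by simp
        also have "\<dots> = a [^] Suc i \<oplus> b \<otimes> a [^] i" using ab by (simp only: l_distr nat_pow_Suc2[OF ab(3)] nat_pow_closed)
        finally have e: "a [^] i = a [^] Suc i \<oplus> b \<otimes> a [^] i" .
        have c: "a [^] Suc i \<in> carrier R" "b \<otimes> a [^] i \<in> carrier R" using ab by auto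
        have "a [^] i \<ominus> a [^] Suc i = (a [^] Suc i \<oplus> b \<otimes> a [^] i) \<ominus> a [^] Suc i" using e by simp
        also have "\<dots> = b \<otimes> a [^] i" using c by (simp only: a_comm[OF c] a_minus_def a_assoc[OF c(2,1) a_inv_closed[OF c(1)]] r_neg[OF c(1)] r_zero)
        finally show ?thesis by simp
      qed
      have step: "a [^] i = \<zero>" if "a [^] Suc i = \<zero>" for i :: nat
      proof -
        have b1: "b \<otimes> a [^] i = a [^] i" using ba[of i] that ab by (simp add: a_minus_def)
        have "b [^] j \<otimes> a [^] i = a [^] i" for j :: nat
        proof (induction j)
          case (Suc j)
          have "b [^] Suc j \<otimes> a [^] i = b [^] j \<otimes> (b \<otimes> a [^] i)" using ab by (simp add: m_assoc)
          then show ?case using b1 Suc by simp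
        qed (use ab in simp)
        from this[of n] show ?thesis using n ab by simp
      qed
      have "a [^] (k - j) = \<zero>" if "j \<le> k" for j
        using that
      proof (induction j)
        case (Suc j)
        then have "k - j = Suc (k - Suc j)" by simp
        then show ?case using Suc step[of "k - Suc j"] by simp
      qed (use k in simp)
      from this[of k] show False using ne by simp
    qed
    then show False using ab(2) by (auto simp: J_def)
  qed
  have neg: "\<ominus> x \<in> J" if x: "x \<in> J" for x
  proof -
    have xc: "x \<in> carrier R" using x by (simp add: J_def)
    have "(\<ominus> \<one>) \<otimes> x \<in> J" by (rule l[OF _ x]) simp
    then show ?thesis using xc by (simp add: l_minus)
  qed
  have idl: "ideal J R"
  proof (rule idealI)
    show "ring R" by (rule ring_axioms)
    show "subgroup J (add_monoid R)"
    proof (rule add.subgroupI)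
      show "J \<subseteq> carrier R" by (auto simp: J_def)
      have "\<zero> [^] (1 :: nat) = \<zero>" by simp
      then have "\<zero> \<in> J" unfolding J_def by blast
      then show "J \<noteq> {}" by blast
      show "\<ominus> a \<in> J" if "a \<in> J" for a by (rule neg[OF that])
    qed (use add in auto)
    show "x \<otimes> a \<in> J" if "a \<in> J" "x \<in> carrier R" for a x using l that by blast
    show "a \<otimes> x \<in> J" if "a \<in> J" "x \<in> carrier R" for a x using r that by blast
  qed
  interpret J: ideal J R by (rule idl)
  let ?Q = "R Quot J"
  interpret Q: ring ?Q by (rule J.quotient_is_ring)
  interpret h: ring_hom_ring R ?Q "(+>) J" by (rule J.rcos_ring_hom_ring)
  have car: "carrier ?Q = (+>) J ` carrier R" unfolding FactRing_def A_RCOSETS_def' by auto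
  have z: "J +> x = \<zero>\<^bsub>?Q\<^esub> \<longleftrightarrow> x \<in> J" if "x \<in> carrier R" for x
    using J.rcos_const_imp_mem[OF that] J.a_rcos_const[of x] unfolding FactRing_def ring_record_simps by blast
  have finQ: "finite (carrier ?Q)" unfolding car using fin by simp
  have neQ: "\<one>\<^bsub>?Q\<^esub> \<noteq> \<zero>\<^bsub>?Q\<^esub>" using z[OF one_closed] one h.hom_one by auto
  have unQ: "y \<in> Units ?Q" if y: "y \<in> carrier ?Q" "y \<noteq> \<zero>\<^bsub>?Q\<^esub>" for y
  proof -
    obtain x where x: "x \<in> carrier R" "y = J +> x" using y(1) car by blast
    then obtain w where w: "w \<in> carrier R" "x \<otimes> w = \<one>" "w \<otimes> x = \<one>" using unit[of x] y(2) z[of x] by auto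
    have "y \<otimes>\<^bsub>?Q\<^esub> (J +> w) = \<one>\<^bsub>?Q\<^esub>" "(J +> w) \<otimes>\<^bsub>?Q\<^esub> y = \<one>\<^bsub>?Q\<^esub>"
      using x w h.hom_mult[of x w] h.hom_mult[of w x] h.hom_one by auto
    moreover have "J +> w \<in> carrier ?Q" using w h.hom_closed by blast
    ultimately show ?thesis using y(1) unfolding Units_def by blast
  qed
  interpret Q: cring ?Q
    by (unfold_locales) (use Q.wedderburn[OF finQ neQ unQ] in auto)
  interpret Q: field ?Q
  proof (rule Q.cring_fieldI)
    have "\<zero>\<^bsub>?Q\<^esub> \<notin> Units ?Q" using neQ by (auto simp: Units_def)
    then show "Units ?Q = carrier ?Q - {\<zero>\<^bsub>?Q\<^esub>}" using unQ Q.Units_closed by blast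
  qed
  have pw: "(J +> x) [^]\<^bsub>?Q\<^esub> (k :: nat) = J +> (x [^] k)" if "x \<in> carrier R" for x k
  proof (induction k)
    case 0 then show ?case using h.hom_one by simp
  next
    case (Suc k) then show ?case using that h.hom_mult[of "x [^] k" x] by simp
  qed
  have inj: "inj_on ((+>) J) S"
  proof
    fix x y assume xy: "x \<in> S" "y \<in> S" "J +> x = J +> y"
    have c: "x \<in> carrier R" "y \<in> carrier R" using xy S by auto
    have "J +> (x \<ominus> y) = \<zero>\<^bsub>?Q\<^esub>" using c xy(3) h.hom_add[of x "\<ominus> y"] h.hom_a_inv[of y]
      by (simp add: a_minus_def Q.r_neg h.hom_closed)
    then have "x \<ominus> y \<in> J" using z[OF minus_closed[OF c]] by blast
    then obtain k :: nat where "(x \<ominus> y) [^] k = \<zero>" unfolding J_def by blast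
    then show "x = y" using d[OF xy(1,2)] by blast
  qed
  have "(+>) J ` S \<subseteq> {y \<in> carrier ?Q. y [^]\<^bsub>?Q\<^esub> t = \<one>\<^bsub>?Q\<^esub>}"
    using S pw h.hom_one h.hom_closed by auto
  then have "card ((+>) J ` S) \<le> card {y \<in> carrier ?Q. y [^]\<^bsub>?Q\<^esub> t = \<one>\<^bsub>?Q\<^esub>}"
    by (rule card_mono[rotated]) (use finQ in simp)
  also have "\<dots> \<le> t" by (rule Q.num_roots_le_deg[OF finQ]) (use t in simp)
  finally show ?thesis using card_image[OF inj] by simp
qed

end

section \<open>Subgroups up to finite index\<close>

definition ssum :: "'a :: ab_group_add set \<Rightarrow> 'a set \<Rightarrow> 'a set" (infixl "\<uplus>" 65) where
  "A \<uplus> B = {a + b |a b. a \<in> A \<and> b \<in> B}"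
lemma ssumI: "a \<in> A \<Longrightarrow> b \<in> B \<Longrightarrow> a + b \<in> A \<uplus> B" by (auto simp: ssum_def)
lemma ssumE: "x \<in> A \<uplus> B \<Longrightarrow> (\<And>a b. a \<in> A \<Longrightarrow> b \<in> B \<Longrightarrow> x = a + b \<Longrightarrow> P) \<Longrightarrow> P"
  by (auto simp: ssum_def)
lemma finite_ssum: "finite A \<Longrightarrow> finite B \<Longrightarrow> finite (A \<uplus> B)"
  unfolding ssum_def by (rule finite_image_set2) simp_all

definition sg :: "'a :: ab_group_add set \<Rightarrow> bool" where
  "sg H \<longleftrightarrow> 0 \<in> H \<and> (\<forall>x \<in> H. \<forall>y \<in> H. x - y \<in> H)"

lemma sg_0: "sg H \<Longrightarrow> 0 \<in> H" by (simp add: sg_def)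
lemma sg_diff: "sg H \<Longrightarrow> x \<in> H \<Longrightarrow> y \<in> H \<Longrightarrow> x - y \<in> H" by (simp add: sg_def)
lemma sg_neg: "sg H \<Longrightarrow> x \<in> H \<Longrightarrow> - x \<in> H" using sg_diff[of H 0 x] sg_0 by force
lemma sg_add: "sg H \<Longrightarrow> x \<in> H \<Longrightarrow> y \<in> H \<Longrightarrow> x + y \<in> H"
  using sg_diff[of H x "- y"] sg_neg by force
lemma sg_I: "0 \<in> H \<Longrightarrow> (\<And>x y. x \<in> H \<Longrightarrow> y \<in> H \<Longrightarrow> x - y \<in> H) \<Longrightarrow> sg H"
  by (simp add: sg_def)
lemma sg_Int: "sg A \<Longrightarrow> sg B \<Longrightarrow> sg (A \<inter> B)" by (simp add: sg_def)
lemma sg_INT: "(\<And>i. i \<in> I \<Longrightarrow> sg (A i)) \<Longrightarrow> sg (\<Inter>i\<in>I. A i)" by (simp add: sg_def)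
lemma sg_plus: assumes "sg A" "sg B" shows "sg (A \<uplus> B)"
proof (rule sg_I)
  show "0 \<in> A \<uplus> B" using ssumI[OF sg_0[OF assms(1)] sg_0[OF assms(2)]] by simp
  fix x y assume "x \<in> A \<uplus> B" "y \<in> A \<uplus> B"
  then obtain a b c d where "a \<in> A" "b \<in> B" "c \<in> A" "d \<in> B" "x = a + b" "y = c + d"
    by (auto elim!: ssumE)
  then have "(a - c) + (b - d) \<in> A \<uplus> B" using assms sg_diff by (intro ssumI) blast+
  then show "x - y \<in> A \<uplus> B" using \<open>x = a + b\<close> \<open>y = c + d\<close> by (simp add: algebra_simps)
qed
lemma sg_UNIV [simp]: "sg UNIV" and sg_zero [simp]: "sg {0}" by (simp_all add: sg_def)
lemma plus_sub1: "sg B \<Longrightarrow> A \<subseteq> A \<uplus> B" using ssumI[of _ A 0 B] sg_0 by fastforce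
lemma plus_sub2: "sg A \<Longrightarrow> B \<subseteq> A \<uplus> B" using ssumI[of 0 A _ B] sg_0 by fastforce
lemma plus_least: "sg C \<Longrightarrow> A \<subseteq> C \<Longrightarrow> B \<subseteq> C \<Longrightarrow> A \<uplus> B \<subseteq> C"
  by (auto elim!: ssumE intro: sg_add)

definition addv :: "('a :: ab_group_add \<Rightarrow> 'b :: ab_group_add) \<Rightarrow> bool" where
  "addv h \<longleftrightarrow> (\<forall>x y. h (x + y) = h x + h y)"
lemma addv_add: "addv h \<Longrightarrow> h (x + y) = h x + h y" by (simp add: addv_def)
lemma addv_0: "addv h \<Longrightarrow> h 0 = 0" by (metis add_cancel_right_right addv_def)
lemma addv_diff: "addv h \<Longrightarrow> h (x - y) = h x - h y"
  by (metis add_diff_cancel addv_def diff_add_cancel)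
lemma sg_img: assumes h: "addv h" and "sg A" shows "sg (h ` A)"
proof (rule sg_I)
  show "0 \<in> h ` A" using addv_0[OF h] sg_0[OF assms(2)] by (metis imageI)
  fix x y assume "x \<in> h ` A" "y \<in> h ` A"
  then obtain a b where "a \<in> A" "b \<in> A" "x = h a" "y = h b" by blast
  then show "x - y \<in> h ` A" using sg_diff[OF assms(2)] addv_diff[OF h, of a b] by (metis imageI)
qed
lemma sg_pre: "addv h \<Longrightarrow> sg A \<Longrightarrow> sg B \<Longrightarrow> sg {x \<in> A. h x \<in> B}"
  by (auto simp: sg_def addv_0 addv_diff)

text \<open>Almost containment: finitely many cosets of \<open>B\<close> cover \<open>A\<close>. For subgroups this says that
  \<open>A \<inter> B\<close> has finite index in \<open>A\<close>.\<close>
definition alm :: "'a :: ab_group_add set \<Rightarrow> 'a set \<Rightarrow> bool" (infix "\<preceq>" 50) where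
  "A \<preceq> B \<longleftrightarrow> (\<exists>F. finite F \<and> (\<forall>a\<in>A. \<exists>f\<in>F. a - f \<in> B))"

lemma alm_sub: "sg B \<Longrightarrow> A \<subseteq> B \<Longrightarrow> A \<preceq> B"
  unfolding alm_def by (rule exI[of _ "{0}"]) auto
lemma alm_refl: "sg B \<Longrightarrow> B \<preceq> B" by (simp add: alm_sub)
lemma alm_mono: "A \<preceq> B \<Longrightarrow> A' \<subseteq> A \<Longrightarrow> B \<subseteq> B' \<Longrightarrow> A' \<preceq> B'"
  unfolding alm_def by (meson subsetD)
lemma alm_trans: assumes "A \<preceq> B" "B \<preceq> C" shows "A \<preceq> C"
proof -
  from assms obtain F G where FG: "finite F" "\<forall>a\<in>A. \<exists>f\<in>F. a - f \<in> B" "finite G" "\<forall>a\<in>B. \<exists>f\<in>G. a - f \<in> C"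
    unfolding alm_def by blast
  have "\<forall>a\<in>A. \<exists>f\<in>F \<uplus> G. a - f \<in> C"
  proof
    fix a assume "a \<in> A"
    then obtain f where "f \<in> F" "a - f \<in> B" using FG by blast
    then obtain g where "g \<in> G" "a - f - g \<in> C" using FG by blast
    then show "\<exists>f\<in>F \<uplus> G. a - f \<in> C" using \<open>f \<in> F\<close>
      by (intro bexI[of _ "f + g"]) (auto simp: diff_diff_eq intro: ssumI)
  qed
  moreover have "finite (F \<uplus> G)" using FG by (simp add: finite_ssum)
  ultimately show ?thesis unfolding alm_def by blast
qed

lemma alm_reps: assumes "A \<preceq> B" and B: "sg B"
  shows "\<exists>F. finite F \<and> F \<subseteq> A \<and> (\<forall>a\<in>A. \<exists>f\<in>F. a - f \<in> B)"
proof -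
  obtain F where F: "finite F" "\<forall>a\<in>A. \<exists>f\<in>F. a - f \<in> B" using assms(1) unfolding alm_def by blast
  define r where "r f = (SOME a. a \<in> A \<and> a - f \<in> B)" for f
  let ?G = "r ` {f\<in>F. \<exists>a\<in>A. a - f \<in> B}"
  have r: "r f \<in> A \<and> r f - f \<in> B" if "\<exists>a\<in>A. a - f \<in> B" for f
  proof -
    from that obtain a where "a \<in> A \<and> a - f \<in> B" by auto
    then show ?thesis unfolding r_def by (rule someI)
  qed
  have "\<exists>g\<in>?G. a - g \<in> B" if aA: "a \<in> A" for a
  proof -
    obtain f where f: "f \<in> F" "a - f \<in> B" using F aA by blast
    then have ex: "\<exists>a\<in>A. a - f \<in> B" using aA by blast
    have "a - r f \<in> B" using sg_diff[OF B f(2), of "r f - f"] r[OF ex] by simp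
    then show ?thesis using ex f(1) by (intro bexI[of _ "r f"]) simp_all
  qed
  moreover have "?G \<subseteq> A" using r by auto
  ultimately show ?thesis using F(1) by (intro exI[of _ ?G]) auto
qed

lemma alm_pre: assumes h: "addv h" and C: "sg C" and A: "sg A" and hC: "h ` S \<preceq> C" and "S \<subseteq> A"
  shows "S \<preceq> {x \<in> A. h x \<in> C}"
proof -
  obtain F where F: "finite F" "F \<subseteq> h ` S" "\<forall>a\<in>h ` S. \<exists>f\<in>F. a - f \<in> C"
    using alm_reps[OF hC C] by blast
  obtain G where G: "G \<subseteq> S" "finite G" "F = h ` G" using finite_subset_image[OF F(1,2)] by blast
  have "\<exists>g\<in>G. x - g \<in> {x \<in> A. h x \<in> C}" if x: "x \<in> S" for x
  proof -
    obtain g where g: "g \<in> G" "h x - h g \<in> C" using F(3) G(3) x by blast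
    have "x - g \<in> A" using g(1) G(1) \<open>S \<subseteq> A\<close> x A by (meson sg_diff subsetD)
    then show ?thesis using g by (intro bexI[of _ g]) (auto simp: addv_diff[OF h])
  qed
  then show ?thesis unfolding alm_def using G(2) by blast
qed

lemma alm_int: assumes "A \<preceq> B" "A \<preceq> C" "sg B" "sg C" shows "A \<preceq> B \<inter> C"
proof -
  obtain F where F: "finite F" "F \<subseteq> A" "\<forall>a\<in>A. \<exists>f\<in>F. a - f \<in> B" using alm_reps[OF assms(1,3)] by auto
  obtain G where G: "finite G" "\<forall>a\<in>A. \<exists>g\<in>G. a - g \<in> C" using assms(2) unfolding alm_def by blast
  define r where "r p = (SOME a. a \<in> A \<and> a - fst p \<in> B \<and> a - snd p \<in> C)" for p
  have "\<exists>g\<in>r ` (F \<times> G). a - g \<in> B \<inter> C" if a: "a \<in> A" for a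
  proof -
    obtain f g where fg: "f \<in> F" "a - f \<in> B" "g \<in> G" "a - g \<in> C" using F G a by blast
    have "r (f,g) \<in> A \<and> r (f,g) - f \<in> B \<and> r (f,g) - g \<in> C"
      unfolding r_def fst_conv snd_conv by (rule someI[of _ a]) (use fg a in simp)
    then have "a - r (f,g) \<in> B \<inter> C" using fg sg_diff[OF assms(3), of "a - f" "r (f,g) - f"]
      sg_diff[OF assms(4), of "a - g" "r (f,g) - g"] by simp
    then show ?thesis using fg by blast
  qed
  moreover have "finite (r ` (F \<times> G))" using F G by simp
  ultimately show ?thesis unfolding alm_def by blast
qed
lemma alm_int2: assumes "A \<preceq> B" "sg A" "sg B" shows "A \<preceq> A \<inter> B"
  using alm_int[OF alm_refl[OF assms(2)] assms(1)] assms by blast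

lemma alm_plus: assumes "A \<preceq> C" "B \<preceq> C" "sg C" shows "A \<uplus> B \<preceq> C"
proof -
  from assms obtain F G where FG: "finite F" "\<forall>a\<in>A. \<exists>f\<in>F. a - f \<in> C" "finite G" "\<forall>a\<in>B. \<exists>f\<in>G. a - f \<in> C"
    unfolding alm_def by blast
  have "\<exists>h\<in>F \<uplus> G. x - h \<in> C" if x: "x \<in> A \<uplus> B" for x
  proof -
    obtain a b where ab: "a \<in> A" "b \<in> B" "x = a + b" using x by (auto elim: ssumE)
    obtain f g where fg: "f \<in> F" "a - f \<in> C" "g \<in> G" "b - g \<in> C" using FG ab by blast
    have "x - (f + g) \<in> C" using sg_add[OF assms(3) fg(2,4)] ab by (simp add: algebra_simps)
    then show ?thesis using fg by (intro bexI[of _ "f + g"]) (auto intro: ssumI)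
  qed
  then show ?thesis unfolding alm_def using FG by (intro exI[of _ "F \<uplus> G"]) (auto simp: finite_ssum)
qed
lemma alm_plus_mono: assumes "A \<preceq> B" "C \<preceq> D" "sg B" "sg D" shows "A \<uplus> C \<preceq> B \<uplus> D"
proof (rule alm_plus)
  show "A \<preceq> B \<uplus> D" by (rule alm_mono[OF assms(1) subset_refl plus_sub1[OF assms(4)]])
  show "C \<preceq> B \<uplus> D" by (rule alm_mono[OF assms(2) subset_refl plus_sub2[OF assms(3)]])
  show "sg (B \<uplus> D)" by (rule sg_plus[OF assms(3,4)])
qed

lemma alm_img: assumes h: "addv h" and "A \<preceq> B" shows "h ` A \<preceq> h ` B"
proof -
  from assms obtain F where F: "finite F" "\<forall>a\<in>A. \<exists>f\<in>F. a - f \<in> B" unfolding alm_def by blast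
  have "\<exists>f\<in>h ` F. x - f \<in> h ` B" if "x \<in> h ` A" for x
  proof -
    obtain a where a: "a \<in> A" "x = h a" using \<open>x \<in> h ` A\<close> by blast
    obtain f where "f \<in> F" "a - f \<in> B" using F(2) a by blast
    then show ?thesis using addv_diff[OF h, of a f] a by (metis imageI)
  qed
  then show ?thesis unfolding alm_def using F(1) by (intro exI[of _ "h ` F"]) blast
qed

text \<open>Failure of almost containment is used through an infinite sequence with differences outside \<open>B\<close>.\<close>
lemma alm_seq: assumes B: "sg B" and n: "\<not> A \<preceq> B"
  shows "\<exists>x :: nat \<Rightarrow> 'a :: ab_group_add. (\<forall>i. x i \<in> A) \<and> (\<forall>i j. i \<noteq> j \<longrightarrow> x i - x j \<notin> B)"
proof -
  have ex: "\<exists>a. a \<in> A \<and> (\<forall>y\<in>F. a - y \<notin> B)" if "finite F" for F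
    using n that unfolding alm_def by blast
  define P where "P F a \<longleftrightarrow> a \<in> A \<and> (\<forall>y\<in>F. a - y \<notin> B)" for F a
  define L where "L = rec_nat [] (\<lambda>_ l. (SOME a. P (set l) a) # l)"
  have L: "L 0 = []" "\<And>n. L (Suc n) = (SOME a. P (set (L n)) a) # L n" by (simp_all add: L_def)
  define x where "x n = hd (L (Suc n))" for n
  have px: "P (set (L n)) (x n)" for n
    unfolding x_def L list.sel by (rule someI_ex) (use ex[of "set (L n)"] in \<open>auto simp: P_def\<close>)
  have "set (L n) = x ` {..<n}" for n
  proof (induction n)
    case (Suc n) then show ?case using L(2)[of n] by (simp add: x_def lessThan_Suc)
  qed (simp add: L)
  then have lt: "x i - x j \<notin> B" if "j < i" for i j using px[of i] that by (auto simp: P_def)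
  have "x i - x j \<notin> B" if "i \<noteq> j" for i j
    using lt[of i j] lt[of j i] that sg_neg[OF B, of "x i - x j"] by (cases "i < j") auto
  then show ?thesis using px by (auto simp: P_def)
qed
lemma seq_not_alm: assumes B: "sg B" and "\<And>i. x i \<in> A" "\<And>i j :: nat. i \<noteq> j \<Longrightarrow> x i - x j \<notin> B"
  shows "\<not> A \<preceq> B"
proof
  assume "A \<preceq> B"
  then obtain F where F: "finite F" "\<forall>a\<in>A. \<exists>f\<in>F. a - f \<in> B" unfolding alm_def by blast
  have "\<forall>i. \<exists>f. f \<in> F \<and> x i - f \<in> B" using F(2) assms(2) by (meson bexE)
  then obtain f where f: "\<And>i. f i \<in> F" "\<And>i. x i - f i \<in> B" using choice[of "\<lambda>i f. f \<in> F \<and> x i - f \<in> B"] by auto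
  have "\<not> inj f" using finite_subset[of "range f" F] f(1) F(1) finite_imageD[of f UNIV] by auto
  then obtain i j where "i \<noteq> j" "f i = f j" by (auto simp: inj_def)
  then have "x i - x j \<in> B" using sg_diff[OF B f(2)[of i] f(2)[of j]] by simp
  with assms(3) \<open>i \<noteq> j\<close> show False by blast
qed

lemma alm_subseq: assumes "A \<preceq> B" and B: "sg B" and x: "\<And>i. x i \<in> A"
  shows "\<exists>r :: nat \<Rightarrow> nat. strict_mono r \<and> (\<forall>i j. x (r i) - x (r j) \<in> B)"
proof -
  obtain F where F: "finite F" "\<forall>a\<in>A. \<exists>f\<in>F. a - f \<in> B" using assms(1) unfolding alm_def by blast
  have "\<forall>i. \<exists>f. f \<in> F \<and> x i - f \<in> B" using F(2) x by (meson bexE)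
  then obtain f where f: "\<And>i. f i \<in> F" "\<And>i. x i - f i \<in> B" using choice[of "\<lambda>i f. f \<in> F \<and> x i - f \<in> B"] by auto
  have fin: "finite (range f)" by (rule finite_subset[OF _ F(1)]) (use f(1) in blast)
  obtain k where "infinite {n \<in> UNIV. f n = f k}"
    using pigeonhole_infinite[of "UNIV :: nat set" f] fin by auto
  then obtain r :: "nat \<Rightarrow> nat" where r: "strict_mono r" "\<And>n. r n \<in> {n. f n = f k}"
    using infinite_enumerate[of "{n. f n = f k}"] by auto
  have "x (r i) - x (r j) \<in> B" for i j
    using sg_diff[OF B f(2)[of "r i"] f(2)[of "r j"]] r(2) by simp
  then show ?thesis using r by blast
qed

definition almk :: "nat \<Rightarrow> 'a :: ab_group_add set \<Rightarrow> 'a set \<Rightarrow> bool" where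
  "almk k A B \<longleftrightarrow> (\<exists>F. finite F \<and> card F \<le> k \<and> (\<forall>a\<in>A. \<exists>f\<in>F. a - f \<in> B))"
lemma alm_almk: "A \<preceq> B \<longleftrightarrow> (\<exists>k. almk k A B)" unfolding alm_def almk_def by blast
lemma almk_mono: "almk k A B \<Longrightarrow> k \<le> l \<Longrightarrow> almk l A B" unfolding almk_def by (meson le_trans)
lemma almk_seq: assumes "almk k A B" and B: "sg B" and fin: "finite S" and S: "S \<subseteq> A"
    and d: "\<And>x y. x \<in> S \<Longrightarrow> y \<in> S \<Longrightarrow> x \<noteq> y \<Longrightarrow> x - y \<notin> B"
  shows "card S \<le> k"
proof -
  obtain F where F: "finite F" "card F \<le> k" "\<forall>a\<in>A. \<exists>f\<in>F. a - f \<in> B" using assms(1) unfolding almk_def by blast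
  have "\<forall>s\<in>S. \<exists>f. f \<in> F \<and> s - f \<in> B" using F(3) S by (meson bexE subsetD)
  then obtain f where f: "\<And>s. s \<in> S \<Longrightarrow> f s \<in> F \<and> s - f s \<in> B" using bchoice[of S "\<lambda>s f. f \<in> F \<and> s - f \<in> B"] by auto
  have "inj_on f S"
  proof
    fix x y assume "x \<in> S" "y \<in> S" "f x = f y"
    then show "x = y" using sg_diff[OF B, of "x - f x" "y - f y"] f d by force
  qed
  then have "card S \<le> card F" using f F(1) by (intro card_inj_on_le) auto
  then show ?thesis using F by simp
qed

section \<open>Tame families of definable relations\<close>

lemma mono_stabilises:
  fixes f :: "nat \<Rightarrow> 'b :: order"
  assumes "\<And>i. f i \<le> f (Suc i)" "finite (range f)"
  shows "\<exists>K. \<forall>k\<ge>K. f k = f K"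
proof -
  have m: "i \<le> j \<Longrightarrow> f i \<le> f j" for i j using assms(1) lift_Suc_mono_le by blast
  obtain K where "infinite {n \<in> UNIV. f n = f K}"
    using pigeonhole_infinite[of "UNIV :: nat set" f] assms(2) by auto
  then have inf: "\<exists>n>k. f n = f K" for k using infinite_nat_iff_unbounded[of "{n \<in> UNIV. f n = f K}"] by auto
  have "f k = f K" if "k \<ge> K" for k
  proof -
    obtain n where "n > k" "f n = f K" using inf by blast
    then show ?thesis using m[of K k] m[of k n] that by simp
  qed
  then show ?thesis by blast
qed
lemma antimono_stabilises:
  fixes f :: "nat \<Rightarrow> 'b :: order"
  assumes "\<And>i. f (Suc i) \<le> f i" "finite (range f)"
  shows "\<exists>K. \<forall>k\<ge>K. f k = f K"
proof -
  have m: "i \<le> j \<Longrightarrow> f j \<le> f i" for i j using assms(1) lift_Suc_antimono_le by blast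
  obtain K where "infinite {n \<in> UNIV. f n = f K}"
    using pigeonhole_infinite[of "UNIV :: nat set" f] assms(2) by auto
  then have inf: "\<exists>n>k. f n = f K" for k using infinite_nat_iff_unbounded[of "{n \<in> UNIV. f n = f K}"] by auto
  have "f k = f K" if "k \<ge> K" for k
  proof -
    obtain n where "n > k" "f n = f K" using inf by blast
    then show ?thesis using m[of K k] m[of k n] that by simp
  qed
  then show ?thesis by blast
qed

lemma almk_0: "almk 0 S T \<longleftrightarrow> S = {}" unfolding almk_def by auto
lemma almk_Suc: "almk (Suc k) S T \<longleftrightarrow> (\<exists>c. almk k {a \<in> S. a - c \<notin> T} T)"
proof
  assume "almk (Suc k) S T"
  then obtain F where F: "finite F" "card F \<le> Suc k" "\<forall>a\<in>S. \<exists>f\<in>F. a - f \<in> T" unfolding almk_def by blast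
  show "\<exists>c. almk k {a \<in> S. a - c \<notin> T} T"
  proof (cases "F = {}")
    case True then show ?thesis using F(3) by (auto simp: almk_def intro!: exI[of _ "{}"])
  next
    case False
    then obtain c where "c \<in> F" by blast
    then have "card (F - {c}) \<le> k" using F by simp
    moreover have "\<forall>a\<in>{a \<in> S. a - c \<notin> T}. \<exists>f\<in>F - {c}. a - f \<in> T" using F(3) by (metis Diff_iff mem_Collect_eq singletonD)
    ultimately show ?thesis unfolding almk_def using F(1) by (intro exI[of _ c] exI[of _ "F - {c}"]) auto
  qed
next
  assume "\<exists>c. almk k {a \<in> S. a - c \<notin> T} T"
  then obtain c F where F: "finite F" "card F \<le> k" "\<forall>a\<in>{a \<in> S. a - c \<notin> T}. \<exists>f\<in>F. a - f \<in> T" unfolding almk_def by blast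
  then have "card (insert c F) \<le> Suc k" using card_insert_le_m1[of "Suc k" F c] by simp
  moreover have "\<forall>a\<in>S. \<exists>f\<in>insert c F. a - f \<in> T" using F(3) by blast
  ultimately show "almk (Suc k) S T" unfolding almk_def using F(1) by (intro exI[of _ "insert c F"]) auto
qed

named_theorems dintro

text \<open>What countable categoricity and finite burden say about a ring: \<open>df A\<close> holds of the relations on
  assignments that are definable with parameters from \<open>A\<close>; there are boundedly many of them in
  a given number of variables, and definable subgroups have bounded breadth.\<close>
locale tame =
  fixes df :: "'a :: ring set \<Rightarrow> ((nat \<Rightarrow> 'a) \<Rightarrow> bool) \<Rightarrow> bool" and nb :: nat
  assumes df_not: "df A P \<Longrightarrow> df A (\<lambda>e. \<not> P e)"
    and df_and: "df A P \<Longrightarrow> df A Q \<Longrightarrow> df A (\<lambda>e. P e \<and> Q e)"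
    and df_exS: "df A P \<Longrightarrow> df A (\<lambda>e. \<exists>x. P (case_nat x e))"
    and df_re: "df A P \<Longrightarrow> df A (\<lambda>e. P (\<lambda>i. e (f i)))"
    and df_eqv: "df A (\<lambda>e. e i = e j)"
    and df_addv: "df A (\<lambda>e. e i + e j = e k)"
    and df_mulv: "df A (\<lambda>e. e i * e j = e k)"
    and df_cst: "a \<in> A \<Longrightarrow> df A (\<lambda>e. e i = a)"
    and df_mono: "df A P \<Longrightarrow> A \<subseteq> B \<Longrightarrow> df B P"
    and df_supp: "df A P \<Longrightarrow> \<exists>n. \<forall>e e'. (\<forall>i<n. e i = e' i) \<longrightarrow> P e = P e'"
    and df_fin: "\<exists>N. \<forall>A. finite A \<and> card A \<le> m \<longrightarrow>
        (let X = {P. df A P \<and> (\<forall>e e'. (\<forall>i<n. e i = e' i) \<longrightarrow> P e = P e')} in finite X \<and> card X \<le> N)"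
    and breadth: "\<And>H :: nat \<Rightarrow> 'a set. (\<And>i. i \<le> nb \<Longrightarrow> sg (H i) \<and> (\<exists>A. finite A \<and> df A (\<lambda>e. e 0 \<in> H i))) \<Longrightarrow>
        \<exists>i\<le>nb. (\<Inter>j\<in>{..nb}-{i}. H j) \<preceq> H i"
begin

definition tm :: "'a set \<Rightarrow> ((nat \<Rightarrow> 'a) \<Rightarrow> 'a) \<Rightarrow> bool" where
  "tm A f \<longleftrightarrow> df A (\<lambda>e. f (\<lambda>i. e (Suc i)) = e 0)"
definition ds :: "'a set \<Rightarrow> ((nat \<Rightarrow> 'a) \<Rightarrow> 'a set) \<Rightarrow> bool" where
  "ds A S \<longleftrightarrow> df A (\<lambda>e. e 0 \<in> S (\<lambda>i. e (Suc i)))"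

lemma df_iff: "df A P \<Longrightarrow> (\<And>e. P e \<longleftrightarrow> Q e) \<Longrightarrow> df A Q"
  using ext[of P Q] by simp
lemma df_ex[dintro]: "df A (\<lambda>e. P (e 0) (\<lambda>i. e (Suc i))) \<Longrightarrow> df A (\<lambda>e. \<exists>x. P x e)"
  using df_exS[of A "\<lambda>e. P (e 0) (\<lambda>i. e (Suc i))"] by simp
lemmas [dintro] = df_not df_and
lemma df_or[dintro]: "df A P \<Longrightarrow> df A Q \<Longrightarrow> df A (\<lambda>e. P e \<or> Q e)"
  by (rule df_iff[OF df_not[OF df_and[OF df_not df_not]], of A P Q]) auto
lemma df_imp[dintro]: "df A P \<Longrightarrow> df A Q \<Longrightarrow> df A (\<lambda>e. P e \<longrightarrow> Q e)"
  by (rule df_iff[OF df_or[OF df_not], of A P Q]) auto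
lemma df_eqb[dintro]: "df A P \<Longrightarrow> df A Q \<Longrightarrow> df A (\<lambda>e. P e = Q e)"
  by (rule df_iff[OF df_and[OF df_imp df_imp], of A P Q Q P]) auto
lemma df_all[dintro]: "df A (\<lambda>e. P (e 0) (\<lambda>i. e (Suc i))) \<Longrightarrow> df A (\<lambda>e. \<forall>x. P x e)"
  by (rule df_iff[OF df_not[OF df_ex[OF df_not]]]) auto
lemma df_subst: assumes "df A (\<lambda>e. P (e 0) (\<lambda>i. e (Suc i)))" "tm A f" shows "df A (\<lambda>e. P (f e) e)"
proof -
  have "df A (\<lambda>e. \<exists>x. f e = x \<and> P x e)"
    by (rule df_ex, rule df_and) (use assms in \<open>simp_all add: tm_def\<close>)
  then show ?thesis by (rule df_iff) simp
qed
lemma tm_re: "tm A f \<Longrightarrow> tm A (\<lambda>e. f (\<lambda>i. e (g i)))"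
  unfolding tm_def using df_re[of A "\<lambda>e. f (\<lambda>i. e (Suc i)) = e 0" "case_nat 0 (\<lambda>i. Suc (g i))"] by simp
lemma tm_var[dintro]: "tm A (\<lambda>e. e i)" unfolding tm_def by (rule df_eqv)
lemma tm_cst[dintro]: "a \<in> A \<Longrightarrow> tm A (\<lambda>e. a)"
  unfolding tm_def using df_cst[of a A 0] by (rule df_iff) auto
lemma tm_2: assumes h: "df A (\<lambda>e. h (e 0) (e 1) = e 2)" and fg: "tm A f" "tm A g"
  shows "tm A (\<lambda>e. h (f e) (g e))"
proof -
  have "df A (\<lambda>e. h (f (\<lambda>i. e (Suc (Suc i)))) (e 0) = e (Suc 0))"
    by (rule df_subst[where P = "\<lambda>x e. h x (e 0) = e (Suc 0)", OF _ tm_re[OF fg(1)]])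
      (use h in \<open>simp add: eval_nat_numeral\<close>)
  then have "df A (\<lambda>e. h (f (\<lambda>i. e (Suc i))) (g (\<lambda>i. e (Suc i))) = e 0)"
    by (intro df_subst[where P = "\<lambda>x e. h (f (\<lambda>i. e (Suc i))) x = e 0", OF _ tm_re[OF fg(2)]]) simp
  then show ?thesis by (simp add: tm_def)
qed
lemma tm_add[dintro]: "tm A f \<Longrightarrow> tm A g \<Longrightarrow> tm A (\<lambda>e. f e + g e)" by (rule tm_2[where h = "(+)", OF df_addv])
lemma tm_mul[dintro]: "tm A f \<Longrightarrow> tm A g \<Longrightarrow> tm A (\<lambda>e. f e * g e)" by (rule tm_2[where h = "(*)", OF df_mulv])
lemma tm_diff[dintro]: "tm A f \<Longrightarrow> tm A g \<Longrightarrow> tm A (\<lambda>e. f e - g e)"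
  by (rule tm_2[where h = "(-)"]) (rule df_iff[OF df_addv[of A 2 1 0]], auto simp: algebra_simps)
lemma tm_0[dintro]: "tm A (\<lambda>e. 0)"
proof -
  have "tm A (\<lambda>e. e 0 - e 0)" by (intro dintro)
  then show ?thesis by simp
qed
lemma df_eq[dintro]: assumes "tm A f" "tm A g" shows "df A (\<lambda>e. f e = g e)"
  by (rule df_subst[where P = "\<lambda>x e. f e = x", OF _ assms(2)]) (use assms(1) in \<open>simp add: tm_def\<close>)
lemma ds_re: "ds A S \<Longrightarrow> ds A (\<lambda>e. S (\<lambda>i. e (g i)))"
  unfolding ds_def using df_re[of A "\<lambda>e. e 0 \<in> S (\<lambda>i. e (Suc i))" "case_nat 0 (\<lambda>i. Suc (g i))"] by simp
lemma df_mem[dintro]: "tm A f \<Longrightarrow> ds A S \<Longrightarrow> df A (\<lambda>e. f e \<in> S e)"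
  by (rule df_subst[where P = "\<lambda>x e. x \<in> S e"]) (simp_all add: ds_def)
lemma ds_Collect[dintro]: "df A (\<lambda>e. P (e 0) (\<lambda>i. e (Suc i))) \<Longrightarrow> ds A (\<lambda>e. {x. P x e})"
  by (simp add: ds_def)
lemma ds_Int[dintro]: "ds A S \<Longrightarrow> ds A T \<Longrightarrow> ds A (\<lambda>e. S e \<inter> T e)" unfolding ds_def Int_iff by (rule df_and)
lemma ds_mono: "ds A S \<Longrightarrow> A \<subseteq> B \<Longrightarrow> ds B S" unfolding ds_def by (rule df_mono)
lemma ds_UNIV[dintro]: "ds A (\<lambda>e. UNIV)" unfolding ds_def by (rule df_iff[OF df_eqv[of A 0 0]]) simp
lemma ds_zero[dintro]: "ds A (\<lambda>e. {0})"
proof -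
  have "ds A (\<lambda>e. {x. x = 0})" by (intro dintro)
  then show ?thesis by simp
qed
lemma df_bex[dintro]: assumes "ds A S" "df A (\<lambda>e. P (e 0) (\<lambda>i. e (Suc i)))" shows "df A (\<lambda>e. \<exists>x\<in>S e. P x e)"
  unfolding Bex_def by (rule df_ex, rule df_and[OF df_mem[OF tm_var ds_re[OF assms(1)]] assms(2)])
lemma df_ball[dintro]: assumes "ds A S" "df A (\<lambda>e. P (e 0) (\<lambda>i. e (Suc i)))" shows "df A (\<lambda>e. \<forall>x\<in>S e. P x e)"
  unfolding Ball_def by (rule df_all, rule df_imp[OF df_mem[OF tm_var ds_re[OF assms(1)]] assms(2)])
lemma ds_ssum[dintro]: assumes "ds A S" "ds A T" shows "ds A (\<lambda>e. S e \<uplus> T e)"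
proof -
  have "ds A (\<lambda>e. {x. \<exists>a\<in>S e. \<exists>b\<in>T e. x = a + b})" by (intro dintro ds_re[OF assms(1)] ds_re[OF assms(2)])
  moreover have "{x. \<exists>a\<in>S e. \<exists>b\<in>T e. x = a + b} = S e \<uplus> T e" for e by (auto simp: ssum_def)
  ultimately show ?thesis by simp
qed
lemma df_almk: "ds A S \<Longrightarrow> ds A T \<Longrightarrow> df A (\<lambda>e. almk k (S e) (T e))"
proof (induction k arbitrary: S T)
  case 0
  have "df A (\<lambda>e. \<not> (\<exists>x. x \<in> S e))" by (intro dintro ds_re[OF 0(1)])
  then show ?case by (rule df_iff) (auto simp: almk_0)
next
  case (Suc k)
  have "df A (\<lambda>e. \<exists>c. almk k {a. a \<in> S e \<and> a - c \<notin> T e} (T e))"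
    by (intro df_ex Suc.IH dintro ds_re[OF Suc.prems(1)] ds_re[OF Suc.prems(2)])
  then show ?case by (simp add: almk_Suc)
qed
lemma ds_supp: assumes "ds A S" shows "\<exists>n. \<forall>e e'. (\<forall>i<n. e i = e' i) \<longrightarrow> S e = S e'"
proof -
  obtain n where n: "\<And>e e'. (\<forall>i<n. e i = e' i) \<Longrightarrow> (e 0 \<in> S (\<lambda>i. e (Suc i))) = (e' 0 \<in> S (\<lambda>i. e' (Suc i)))"
    using df_supp[OF assms[unfolded ds_def]] by auto
  have "S e = S e'" if "\<forall>i<n. e i = e' i" for e e'
  proof (intro Set.set_eqI)
    fix x
    have "\<forall>i<n. case_nat x e i = case_nat x e' i" using that by (auto split: nat.split)
    from n[OF this] show "x \<in> S e \<longleftrightarrow> x \<in> S e'" by simp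
  qed
  then show ?thesis by blast
qed
lemma df_finite: assumes "finite A" shows "finite {P. df A P \<and> (\<forall>e e'. (\<forall>i<n. e i = e' i) \<longrightarrow> P e = P e')}"
  using df_fin[of "card A" n] assms by (auto simp: Let_def)

text \<open>The relation ``at most \<open>k\<close> cosets suffice'' is definable and grows with \<open>k\<close>. There are only
  finitely many definable relations in the variables involved, so it becomes stationary. This makes
  almost containment itself definable.\<close>
lemma alm_bound: assumes "finite A" "ds A S" "ds A T"
  shows "\<exists>K. \<forall>e. S e \<preceq> T e \<longrightarrow> almk K (S e) (T e)"
proof -
  obtain n1 where n1: "\<And>e e'. (\<forall>i<n1. e i = e' i) \<Longrightarrow> S e = S e'" using ds_supp[OF assms(2)] by blast
  obtain n2 where n2: "\<And>e e'. (\<forall>i<n2. e i = e' i) \<Longrightarrow> T e = T e'" using ds_supp[OF assms(3)] by blast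
  let ?f = "\<lambda>k e. almk k (S e) (T e)"
  have "almk k (S e) (T e) = almk k (S e') (T e')" if "\<forall>i<max n1 n2. e i = e' i" for k e e'
    using n1[of e e'] n2[of e e'] that by simp
  then have "range ?f \<subseteq> {P. df A P \<and> (\<forall>e e'. (\<forall>i<max n1 n2. e i = e' i) \<longrightarrow> P e = P e')}"
    using df_almk[OF assms(2,3)] by blast
  then have fin: "finite (range ?f)" using df_finite[OF assms(1)] finite_subset by blast
  have "?f i \<le> ?f (Suc i)" for i by (auto simp: le_fun_def intro: almk_mono)
  then obtain K where K: "\<forall>k\<ge>K. ?f k = ?f K" using mono_stabilises[of ?f] fin by blast
  have "almk K (S e) (T e)" if st: "S e \<preceq> T e" for e
  proof -
    obtain k where "almk k (S e) (T e)" using st alm_almk by blast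
    then have "almk (max k K) (S e) (T e)" by (rule almk_mono) simp
    moreover have "?f (max k K) = ?f K" by (rule K[rule_format]) simp
    ultimately show ?thesis by (simp add: fun_eq_iff)
  qed
  then show ?thesis by blast
qed
lemma df_alm[dintro]: assumes "ds A S" "ds A T" "finite A" shows "df A (\<lambda>e. S e \<preceq> T e)"
proof -
  obtain K where K: "\<forall>e. S e \<preceq> T e \<longrightarrow> almk K (S e) (T e)" using alm_bound assms by blast
  show ?thesis by (rule df_iff[OF df_almk[OF assms(1,2), of K]]) (use K alm_almk in blast)
qed

lemma ds_finite: assumes "finite A" shows "finite {X. ds A (\<lambda>e. X)}"
proof (rule finite_imageD)
  let ?g = "\<lambda>X (e :: nat \<Rightarrow> 'a). e 0 \<in> X"
  have "?g ` {X. ds A (\<lambda>e. X)} \<subseteq> {P. df A P \<and> (\<forall>e e'. (\<forall>i<1. e i = e' i) \<longrightarrow> P e = P e')}"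
    by (auto simp: ds_def)
  then show "finite (?g ` {X. ds A (\<lambda>e. X)})" using df_finite[OF assms] finite_subset by blast
  show "inj_on ?g {X. ds A (\<lambda>e. X)}"
  proof (rule inj_onI)
    fix X Y :: "'a set" assume "?g X = ?g Y"
    then have "?g X (\<lambda>_. x) = ?g Y (\<lambda>_. x)" for x by (rule fun_cong)
    then show "X = Y" by blast
  qed
qed
lemma dec_stabilises: assumes "finite A" "\<And>i. ds A (\<lambda>e. X i)" "\<And>i :: nat. X (Suc i) \<subseteq> X i"
  shows "\<exists>K. \<forall>k\<ge>K. X k = X K"
proof (rule antimono_stabilises)
  show "finite (range X)" by (rule finite_subset[OF _ ds_finite[OF assms(1)]]) (use assms(2) in auto)
qed (use assms in auto)
lemma inc_stabilises: assumes "finite A" "\<And>i. ds A (\<lambda>e. X i)" "\<And>i :: nat. X i \<subseteq> X (Suc i)"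
  shows "\<exists>K. \<forall>k\<ge>K. X k = X K"
proof (rule mono_stabilises)
  show "finite (range X)" by (rule finite_subset[OF _ ds_finite[OF assms(1)]]) (use assms(2) in auto)
qed (use assms in auto)

definition dset :: "'a set \<Rightarrow> bool" where "dset X \<longleftrightarrow> (\<exists>A. finite A \<and> ds A (\<lambda>e. X))"
definition dsub :: "'a set \<Rightarrow> bool" where "dsub X \<longleftrightarrow> sg X \<and> dset X"

lemma dsub_sg: "dsub X \<Longrightarrow> sg X" by (simp add: dsub_def)
lemma dsub_params: assumes "finite Q" "\<And>X. X \<in> Q \<Longrightarrow> dsub X"
  shows "\<exists>A. finite A \<and> (\<forall>X\<in>Q. ds A (\<lambda>e. X))"
  using assms
proof (induction Q)
  case (insert X Q)
  then obtain A where A: "finite A" "\<forall>X\<in>Q. ds A (\<lambda>e. X)" by auto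
  obtain B where B: "finite B" "ds B (\<lambda>e. X)" using insert.prems[of X] by (auto simp: dsub_def dset_def)
  show ?case using A B ds_mono[of A _ "A \<union> B"] ds_mono[of B _ "A \<union> B"]
    by (intro exI[of _ "A \<union> B"]) auto
qed auto
lemma dsub_Int: assumes "dsub X" "dsub Y" shows "dsub (X \<inter> Y)"
proof -
  obtain A where A: "finite A" "ds A (\<lambda>e. X)" "ds A (\<lambda>e. Y)"
    using dsub_params[of "{X, Y}"] assms by auto
  show ?thesis unfolding dsub_def dset_def using assms A ds_Int[OF A(2,3)] by (auto simp: dsub_def sg_Int)
qed
lemma dsub_ssum: assumes "dsub X" "dsub Y" shows "dsub (X \<uplus> Y)"
proof -
  obtain A where A: "finite A" "ds A (\<lambda>e. X)" "ds A (\<lambda>e. Y)"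
    using dsub_params[of "{X, Y}"] assms by auto
  show ?thesis unfolding dsub_def dset_def using assms A ds_ssum[OF A(2,3)] by (auto simp: dsub_def sg_plus)
qed
lemma dsub_UNIV: "dsub UNIV" and dsub_zero: "dsub {0}"
  unfolding dsub_def dset_def using ds_UNIV[of "{}"] ds_zero[of "{}"] by auto

end

section \<open>Definable biadditive maps\<close>

lemma alm_seqE: assumes "\<not> A \<preceq> B" "sg B"
  obtains x :: "nat \<Rightarrow> 'a :: ab_group_add" where "\<And>i. x i \<in> A" "\<And>i j. i \<noteq> j \<Longrightarrow> x i - x j \<notin> B"
proof -
  from alm_seq[OF assms(2,1)] obtain x :: "nat \<Rightarrow> 'a"
    where x: "(\<forall>i. x i \<in> A) \<and> (\<forall>i j. i \<noteq> j \<longrightarrow> x i - x j \<notin> B)" ..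
  show ?thesis by (rule that[of x]) (use x in simp_all)
qed
lemma alm_subseqE: assumes "A \<preceq> B" "sg B" "\<And>i. x i \<in> A"
  obtains r :: "nat \<Rightarrow> nat" where "strict_mono r" "\<And>i j. x (r i) - x (r j) \<in> B"
proof -
  from alm_subseq[of A B x, OF assms] obtain r :: "nat \<Rightarrow> nat"
    where r: "strict_mono r \<and> (\<forall>i j. x (r i) - x (r j) \<in> B)" ..
  show ?thesis by (rule that[of r]) (use r in simp_all)
qed

lemma avoiding_seq:
  assumes V: "sg V" and fin: "finite Q" and Q: "\<And>H. H \<in> Q \<Longrightarrow> sg H" "\<And>H. H \<in> Q \<Longrightarrow> \<not> V \<preceq> H"
    and inf: "\<not> V \<preceq> {0}"
  shows "\<exists>x :: nat \<Rightarrow> 'a :: ab_group_add. (\<forall>i. x i \<in> V) \<and> (\<forall>i j. i \<noteq> j \<longrightarrow> (\<forall>H\<in>Q. x i - x j \<notin> H))"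
  using fin Q
proof (induction Q)
  case empty
  then show ?case using alm_seq[OF sg_zero inf] by auto
next
  case (insert H Q)
  have H: "sg H" "\<not> V \<preceq> H" using insert.prems by auto
  have "\<exists>x :: nat \<Rightarrow> 'a. (\<forall>i. x i \<in> V) \<and> (\<forall>i j. i \<noteq> j \<longrightarrow> (\<forall>H\<in>Q. x i - x j \<notin> H))"
    by (rule insert.IH) (use insert.prems in auto)
  then obtain x :: "nat \<Rightarrow> 'a" where "(\<forall>i. x i \<in> V) \<and> (\<forall>i j. i \<noteq> j \<longrightarrow> (\<forall>H\<in>Q. x i - x j \<notin> H))" ..
  then have x: "\<And>i. x i \<in> V" "\<And>i j G. i \<noteq> j \<Longrightarrow> G \<in> Q \<Longrightarrow> x i - x j \<notin> G" by simp_all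
  show ?case
  proof (cases "range x \<preceq> H")
    case False
    obtain y where y: "\<And>i. y i \<in> range x" "\<And>i j :: nat. i \<noteq> j \<Longrightarrow> y i - y j \<notin> H"
      by (rule alm_seqE[OF False H(1)]) blast
    have "\<forall>i. \<exists>k. y i = x k" using y(1) by auto
    then obtain k where k: "\<And>i. y i = x (k i)" by metis
    have kk: "k i \<noteq> k j" if "i \<noteq> j" for i j using y(2)[OF that] k sg_0[OF H(1)] by auto
    show ?thesis using x y(2) kk by (intro exI[of _ y]) (auto simp: k)
  next
    case True
    obtain r :: "nat \<Rightarrow> nat" where r: "strict_mono r" "\<And>i j. x (r i) - x (r j) \<in> H"
      by (rule alm_subseqE[OF True H(1), of x]) auto
    obtain t where t: "\<And>i. t i \<in> V" "\<And>i j :: nat. i \<noteq> j \<Longrightarrow> t i - t j \<notin> H" by (rule alm_seqE[OF H(2,1)]) blast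
    define z where "z k n = x (r k) + t n" for k n
    have one: "finite {k. z k n - c \<in> G}" if G: "G \<in> Q" for n c G
    proof -
      have sG: "sg G" using insert.prems G by auto
      have "k = k'" if "z k n - c \<in> G" "z k' n - c \<in> G" for k k'
      proof (rule ccontr)
        assume "k \<noteq> k'"
        then have "x (r k) - x (r k') \<notin> G" using x(2)[OF _ G] strict_mono_eq[OF r(1)] by auto
        moreover have "(z k n - c) - (z k' n - c) \<in> G" by (rule sg_diff[OF sG that])
        ultimately show False by (simp add: z_def)
      qed
      then have "{k. z k n - c \<in> G} = {} \<or> (\<exists>k. {k. z k n - c \<in> G} = {k})" by blast
      then show ?thesis by auto
    qed
    have "\<exists>k. \<forall>n. (\<forall>j<n. \<forall>G\<in>Q. z (k n) n - z (k j) j \<notin> G)"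
    proof (rule dependent_wellorder_choice)
      fix n k
      have "finite (\<Union>j\<in>{..<n}. \<Union>G\<in>Q. {l. z l n - z (k j) j \<in> G})"
        using insert.hyps one by auto
      then obtain l where "l \<notin> (\<Union>j\<in>{..<n}. \<Union>G\<in>Q. {l. z l n - z (k j) j \<in> G})"
        using ex_new_if_finite[OF infinite_UNIV_nat] by blast
      then show "\<exists>l. \<forall>j<n. \<forall>G\<in>Q. z l n - z (k j) j \<notin> G" by auto
    qed auto
    then obtain k where k: "\<And>n j G. j < n \<Longrightarrow> G \<in> Q \<Longrightarrow> z (k n) n - z (k j) j \<notin> G" by auto
    define y where "y n = z (k n) n" for n
    have yV: "y n \<in> V" for n using sg_add[OF V] x(1) t(1) by (simp add: y_def z_def)
    have yH: "y i - y j \<notin> H" if "i \<noteq> j" for i j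
    proof
      assume "y i - y j \<in> H"
      from sg_diff[OF H(1) this r(2)[of "k i" "k j"]] have "t i - t j \<in> H" by (simp add: y_def z_def)
      then show False using t(2)[OF that] by simp
    qed
    have yG: "y i - y j \<notin> G" if "i \<noteq> j" "G \<in> Q" for i j G
    proof (cases "j < i")
      case True then show ?thesis using k that by (simp add: y_def)
    next
      case False
      then have "y j - y i \<notin> G" using k[of i j G] that by (simp add: y_def)
      moreover have "sg G" using insert.prems that by auto
      ultimately show ?thesis using sg_neg[of G "y i - y j"] by auto
    qed
    show ?thesis using yV yH yG by (intro exI[of _ y]) auto
  qed
qed

text \<open>The theorem of B. H. Neumann that a group is not a finite union of subgroups of infinite index.\<close>
lemma avoid_subgroups:
  assumes V: "sg V" and "finite Q" "\<And>H. H \<in> Q \<Longrightarrow> sg H" "\<And>H. H \<in> Q \<Longrightarrow> \<not> V \<preceq> H"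
  shows "\<exists>v\<in>V. \<forall>H\<in>Q. v \<notin> H"
proof (cases "Q = {}")
  case True then show ?thesis using sg_0[OF V] by blast
next
  case False
  then obtain H where H: "sg H" "\<not> V \<preceq> H" using assms by blast
  then have "\<not> V \<preceq> {0}" using alm_mono[of V "{0}" V H] sg_0[of H] by auto
  from avoiding_seq[OF assms this] obtain x :: "nat \<Rightarrow> 'a"
    where "(\<forall>i. x i \<in> V) \<and> (\<forall>i j. i \<noteq> j \<longrightarrow> (\<forall>H\<in>Q. x i - x j \<notin> H))" ..
  then have x: "\<And>i. x i \<in> V" "\<And>i j H. i \<noteq> j \<Longrightarrow> H \<in> Q \<Longrightarrow> x i - x j \<notin> H" by simp_all
  show ?thesis using sg_diff[OF V x(1)[of 0] x(1)[of 1]] x(2)[of 0 1] by auto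
qed

definition fl :: "('a \<Rightarrow> 'a \<Rightarrow> 'a) \<Rightarrow> 'a \<Rightarrow> 'a \<Rightarrow> 'a" where "fl m = (\<lambda>x y. m y x)"
lemma fl_fl[simp]: "fl (fl m) = m" by (simp add: fl_def)
lemma fl_app: "fl m x y = m y x" by (simp add: fl_def)

text \<open>The elements of \<open>V\<close> that send \<open>P\<close> almost into \<open>K\<close>: an annihilator up to finite index.\<close>
definition lz :: "('a \<Rightarrow> 'a \<Rightarrow> 'a :: ab_group_add) \<Rightarrow> 'a set \<Rightarrow> 'a set \<Rightarrow> 'a set \<Rightarrow> 'a set" where
  "lz m V K P = {v \<in> V. m v ` P \<preceq> K}"
lemma lz_sub: "lz m V K P \<subseteq> V" by (auto simp: lz_def)

definition ann :: "('a \<Rightarrow> 'a \<Rightarrow> 'a :: ab_group_add) \<Rightarrow> 'a set \<Rightarrow> 'a set \<Rightarrow> 'a \<Rightarrow> 'a set" where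
  "ann m W K v = {w \<in> W. m v w \<in> K}"

lemma alm_diff_img:
  fixes K :: "'a :: ab_group_add set"
  assumes "f ` P \<preceq> K" "g ` P \<preceq> K" "sg K"
  shows "(\<lambda>x. f x - g x) ` P \<preceq> K"
proof -
  have u: "addv (uminus :: 'a \<Rightarrow> 'a)" by (simp add: addv_def)
  have "uminus ` (g ` P) \<preceq> uminus ` K" by (rule alm_img[OF u assms(2)])
  moreover have "uminus ` K \<subseteq> K" using sg_neg[OF assms(3)] by auto
  ultimately have "uminus ` (g ` P) \<preceq> K" by (rule alm_mono[OF _ subset_refl])
  from alm_plus[OF assms(1) this assms(3)] have "f ` P \<uplus> uminus ` (g ` P) \<preceq> K" .
  moreover have "(\<lambda>x. f x - g x) ` P \<subseteq> f ` P \<uplus> uminus ` (g ` P)"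
    using ssumI[of _ "f ` P" _ "uminus ` (g ` P)"] by fastforce
  ultimately show ?thesis by (rule alm_mono) simp
qed

locale bil = tame +
  fixes m :: "'a \<Rightarrow> 'a \<Rightarrow> 'a"
  assumes addR: "addv (m v)" and addL: "addv (\<lambda>v. m v w)" and df_m: "df {} (\<lambda>e. m (e 0) (e 1) = e 2)"
begin

lemma bil_fl: "bil df nb (fl m)"
proof (unfold_locales)
  show "addv (fl m v)" for v using addL by (simp add: fl_def)
  show "addv (\<lambda>v. fl m v w)" for w using addR by (simp add: fl_def addv_def)
  show "df {} (\<lambda>e. fl m (e 0) (e 1) = e 2)"
    using df_re[OF df_m, of "case_nat 1 (case_nat 0 (\<lambda>_. 2))"] by (simp add: fl_def eval_nat_numeral)
qed

lemma tm_m[dintro]: "tm A f \<Longrightarrow> tm A g \<Longrightarrow> tm A (\<lambda>e. m (f e) (g e))"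
  by (rule tm_2[where h = m, OF df_mono[OF df_m]]) auto

lemma m_0[simp]: "m v 0 = 0" "m 0 w = 0" using addv_0[OF addR] addv_0[OF addL] by auto
lemma m_diff: "m v (x - y) = m v x - m v y" "m (v - u) x = m v x - m u x"
  using addv_diff[OF addR] addv_diff[OF addL] by auto
lemma m_add: "m v (x + y) = m v x + m v y" "m (v + u) x = m v x + m u x"
  using addv_add[OF addR] addv_add[OF addL] by auto

lemma ds_img[dintro]: assumes "tm A f" "ds A S" shows "ds A (\<lambda>e. m (f e) ` S e)"
proof -
  have "ds A (\<lambda>e. {x. \<exists>s\<in>S e. x = m (f e) s})"
    by (intro dintro ds_re[OF assms(2)] tm_re[OF assms(1)])
  moreover have "{x. \<exists>s\<in>S e. x = m (f e) s} = m (f e) ` S e" for e by auto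
  ultimately show ?thesis by simp
qed
lemma ds_lz[dintro]: assumes "ds A S" "ds A T" "ds A U" "finite A" shows "ds A (\<lambda>e. lz m (S e) (T e) (U e))"
  unfolding lz_def by (intro dintro ds_re[OF assms(1)] ds_re[OF assms(2)] ds_re[OF assms(3)] assms(4))
lemma sg_lz: assumes "sg V" "sg K" shows "sg (lz m V K P)"
proof (rule sg_I)
  show "0 \<in> lz m V K P" using assms sg_0 by (auto simp: lz_def intro!: alm_sub)
  fix x y assume "x \<in> lz m V K P" "y \<in> lz m V K P"
  then show "x - y \<in> lz m V K P" using alm_diff_img[of "m x" P K "m y"] assms
    by (auto simp: lz_def m_diff sg_diff)
qed
lemma dsub_lz: assumes "dsub V" "dsub K" "dsub P" shows "dsub (lz m V K P)"
proof -
  obtain A where A: "finite A" "ds A (\<lambda>e. V)" "ds A (\<lambda>e. K)" "ds A (\<lambda>e. P)"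
    using dsub_params[of "{V, K, P}"] assms by auto
  have "ds A (\<lambda>e. lz m V K P)" by (intro dintro A)
  then show ?thesis unfolding dsub_def dset_def using A assms sg_lz[of V K P] by (auto simp: dsub_def)
qed
lemma lz_anti: assumes "P \<preceq> P'" shows "lz m V K P' \<subseteq> lz m V K P"
  using alm_trans[OF alm_img[OF addR assms]] by (auto simp: lz_def)
lemma lz_monoK: assumes "K \<preceq> K'" shows "lz m V K P \<subseteq> lz m V K' P"
  using alm_trans[OF _ assms] by (auto simp: lz_def)

lemma sg_ann: "sg W \<Longrightarrow> sg K \<Longrightarrow> sg (ann m W K v)"
  unfolding ann_def by (rule sg_pre[OF addR])
lemma ds_ann[dintro]: assumes "ds A S" "ds A T" "tm A f" shows "ds A (\<lambda>e. ann m (S e) (T e) (f e))"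
  unfolding ann_def by (intro dintro ds_re[OF assms(1)] ds_re[OF assms(2)] tm_re[OF assms(3)])
lemma dsub_ann: assumes "dsub W" "dsub K" shows "dsub (ann m W K v)"
proof -
  obtain A where A: "finite A" "ds A (\<lambda>e. W)" "ds A (\<lambda>e. K)"
    using dsub_params[of "{W, K}"] assms by auto
  have "ds (insert v A) (\<lambda>e. ann m W K v)"
    by (intro dintro ds_mono[OF A(2)] ds_mono[OF A(3)]) auto
  then show ?thesis unfolding dsub_def dset_def using A assms sg_ann[of W K v] by (auto simp: dsub_def)
qed
lemma dsub_img: assumes "dsub P" shows "dsub (m v ` P)"
proof -
  obtain A where A: "finite A" "ds A (\<lambda>e. P)"
    using dsub_params[of "{P}"] assms by auto
  have "ds (insert v A) (\<lambda>e. m v ` P)" by (intro dintro ds_mono[OF A(2)]) auto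
  then show ?thesis unfolding dsub_def dset_def using A assms sg_img[OF addR, of P v] by (auto simp: dsub_def)
qed
lemma img_alm_iff: assumes "sg W" "sg K" "P \<subseteq> W" shows "m v ` P \<preceq> K \<longleftrightarrow> P \<preceq> ann m W K v"
proof
  assume "m v ` P \<preceq> K"
  then show "P \<preceq> ann m W K v" unfolding ann_def using alm_pre[OF addR assms(2,1)] assms(3) by blast
next
  assume "P \<preceq> ann m W K v"
  from alm_img[OF addR this, of v] have "m v ` P \<preceq> m v ` ann m W K v" .
  then show "m v ` P \<preceq> K" by (rule alm_mono) (auto simp: ann_def)
qed

text \<open>By definability the indices are bounded by some \<open>k\<close>. If the conclusion failed there would be infinitely many
  elements of \<open>P\<close> distinct modulo the annihilator, and by B. H. Neumann's theorem a single \<open>v\<close>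
  separates more than \<open>k\<close> of them modulo \<open>K\<close>. This exchange of the two arguments makes the
  annihilators a Galois connection.\<close>
lemma neumann: assumes d: "dsub V" "dsub P" "dsub K" and b: "\<And>v. v \<in> V \<Longrightarrow> m v ` P \<preceq> K"
  shows "P \<preceq> lz (fl m) P K V"
proof (rule ccontr)
  assume n: "\<not> P \<preceq> lz (fl m) P K V"
  obtain A where A: "finite A" "ds A (\<lambda>e. V)" "ds A (\<lambda>e. K)" "ds A (\<lambda>e. P)"
    using dsub_params[of "{V, K, P}"] d by auto
  have "ds A (\<lambda>e. m (e 0) ` P)" by (intro dintro A)
  then obtain k where k: "\<And>e :: nat \<Rightarrow> 'a. m (e 0) ` P \<preceq> K \<Longrightarrow> almk k (m (e 0) ` P) K"
    using alm_bound[OF A(1) _ A(3)] by blast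
  have k: "almk k (m v ` P) K" if "v \<in> V" for v using k[of "\<lambda>_. v"] b[OF that] by simp
  have s: "sg V" "sg P" "sg K" using d by (auto simp: dsub_def)
  have sl: "sg (lz (fl m) P K V)" by (rule bil.sg_lz[OF bil_fl s(2,3)])
  obtain w where w: "\<And>i. w i \<in> P" "\<And>i j :: nat. i \<noteq> j \<Longrightarrow> w i - w j \<notin> lz (fl m) P K V"
    by (rule alm_seqE[OF n sl]) blast
  define H where "H p = ann (fl m) V K (w (fst p) - w (snd p))" for p
  define Q where "Q = H ` {(i, j). i < j \<and> j \<le> k}"
  have "{(i, j). i < j \<and> j \<le> k} \<subseteq> {..k} \<times> {..k}" by auto
  then have fQ: "finite Q" unfolding Q_def using finite_subset by blast
  have sH: "sg (H p)" for p unfolding H_def by (rule bil.sg_ann[OF bil_fl s(1,3)])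
  have nH: "\<not> V \<preceq> H p" if "fst p \<noteq> snd p" for p
  proof -
    have "w (fst p) - w (snd p) \<in> P" using w(1) s sg_diff by blast
    then have "\<not> fl m (w (fst p) - w (snd p)) ` V \<preceq> K" using w(2)[OF that] by (simp add: lz_def)
    then show ?thesis unfolding H_def using bil.img_alm_iff[OF bil_fl s(1,3) subset_refl] by simp
  qed
  obtain v where v: "v \<in> V" "\<And>H. H \<in> Q \<Longrightarrow> v \<notin> H"
    using avoid_subgroups[OF s(1) fQ] sH nH unfolding Q_def by fastforce
  have dd: "m v (w i) - m v (w j) \<notin> K" if "i < j" "j \<le> k" for i j
  proof
    assume "m v (w i) - m v (w j) \<in> K"
    then have "v \<in> H (i, j)" using v(1) by (simp add: H_def ann_def fl_app m_diff)
    then show False using v(2) that by (auto simp: Q_def)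
  qed
  have dd: "m v (w i) - m v (w j) \<notin> K" if "i \<noteq> j" "i \<le> k" "j \<le> k" for i j
    using dd[of i j] dd[of j i] that sg_neg[OF s(3), of "m v (w i) - m v (w j)"] by (cases "i < j") auto
  let ?S = "(\<lambda>i. m v (w i)) ` {..k}"
  have "inj_on (\<lambda>i. m v (w i)) {..k}"
  proof
    fix i j assume "i \<in> {..k}" "j \<in> {..k}" "m v (w i) = m v (w j)"
    then show "i = j" using dd[of i j] sg_0[OF s(3)] by auto
  qed
  then have "card ?S = Suc k" by (simp add: card_image)
  moreover have "card ?S \<le> k"
  proof (rule almk_seq[OF k[OF v(1)] s(3)])
    fix x y assume "x \<in> ?S" "y \<in> ?S" "x \<noteq> y"
    then obtain i j where "i \<le> k" "j \<le> k" "x = m v (w i)" "y = m v (w j)" by auto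
    then show "x - y \<notin> K" using dd[of i j] \<open>x \<noteq> y\<close> by metis
  qed (use w(1) in auto)
  ultimately show False by simp
qed

lemma galois: assumes d: "dsub V" "dsub W" "dsub P" "dsub Q" "dsub K" and sub: "Q \<subseteq> V" "P \<subseteq> W"
    and q: "Q \<preceq> lz m V K P"
  shows "P \<preceq> lz (fl m) W K Q"
proof -
  have dl: "dsub (lz m V K P)" by (rule dsub_lz[OF d(1,5,3)])
  let ?Q = "Q \<inter> lz m V K P"
  have dQ: "dsub ?Q" by (rule dsub_Int[OF d(4) dl])
  have qq: "Q \<preceq> ?Q" by (rule alm_int2[OF q]) (use d(4) dl in \<open>auto simp: dsub_def\<close>)
  have "P \<preceq> lz (fl m) P K ?Q" by (rule neumann[OF dQ d(3,5)]) (auto simp: lz_def)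
  moreover have "lz (fl m) P K ?Q \<subseteq> lz (fl m) W K Q"
    using bil.lz_anti[OF bil_fl qq, of P K] sub(2) by (auto simp: lz_def)
  ultimately show ?thesis by (rule alm_mono[OF _ subset_refl])
qed
lemma galois': assumes d: "dsub V" "dsub W" "dsub P" "dsub Q" "dsub K" and sub: "Q \<subseteq> V" "P \<subseteq> W"
    and q: "P \<preceq> lz (fl m) W K Q"
  shows "Q \<preceq> lz m V K P"
  using bil.galois[OF bil_fl d(2,1,4,3,5) sub(2,1)] q by simp

end

section \<open>Breadth and minimal nontrivial forms\<close>

lemma ssum_commute: "A \<uplus> B = B \<uplus> A" unfolding ssum_def by (metis add.commute)
lemma alm_le [trans]: "A \<preceq> B \<Longrightarrow> B \<subseteq> C \<Longrightarrow> A \<preceq> C" by (rule alm_mono) auto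
lemma le_alm [trans]: "A \<subseteq> B \<Longrightarrow> B \<preceq> C \<Longrightarrow> A \<preceq> C" by (rule alm_mono) auto
declare alm_trans [trans]

context tame
begin

definition irr :: "'a set \<Rightarrow> 'a set \<Rightarrow> nat \<Rightarrow> bool" where
  "irr D C k \<longleftrightarrow> (\<exists>H. (\<forall>i<k. dsub (H i) \<and> D \<preceq> H i \<and> H i \<preceq> C) \<and>
     (\<forall>i<k. \<not> C \<inter> (\<Inter>j\<in>{..<k}-{i}. H j) \<preceq> H i))"
definition bd :: "'a set \<Rightarrow> 'a set \<Rightarrow> nat" where "bd D C = Max {k. irr D C k}"

lemma irr_0: "irr D C 0" by (simp add: irr_def)
lemma irr_le: assumes "irr D C k" shows "k \<le> nb"
proof (rule ccontr)
  assume "\<not> k \<le> nb"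
  then have k: "{..nb} \<subseteq> {..<k}" by auto
  obtain H where H: "\<And>i. i < k \<Longrightarrow> dsub (H i)" "\<And>i. i < k \<Longrightarrow> \<not> C \<inter> (\<Inter>j\<in>{..<k}-{i}. H j) \<preceq> H i"
    using assms unfolding irr_def by blast
  have "\<exists>i\<le>nb. (\<Inter>j\<in>{..nb}-{i}. H j) \<preceq> H i"
    by (rule breadth) (use H(1) k in \<open>auto simp: dsub_def dset_def ds_def\<close>)
  then obtain i where i: "i \<le> nb" "(\<Inter>j\<in>{..nb}-{i}. H j) \<preceq> H i" by blast
  have "C \<inter> (\<Inter>j\<in>{..<k}-{i}. H j) \<preceq> H i" by (rule alm_mono[OF i(2)]) (use k in auto)
  then show False using H(2)[of i] i(1) k by auto
qed
lemma finite_irr: "finite {k. irr D C k}"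
  by (rule finite_subset[of _ "{..nb}"]) (use irr_le in auto)
lemma irr_bd: "irr D C (bd D C)"
  using Max_in[OF finite_irr, of D C] irr_0[of D C] by (auto simp: bd_def)
lemma bd_ge: "irr D C k \<Longrightarrow> k \<le> bd D C"
  using Max_ge[OF finite_irr, of k D C] by (simp add: bd_def)
lemma sg_Inter_H: "(\<And>i. i < k \<Longrightarrow> sg (H i)) \<Longrightarrow> sg (\<Inter>j\<in>{..<k}-{i}. H j)"
  by (rule sg_INT) auto
lemma irr_mono: assumes "irr D' C' k" "D \<preceq> D'" "C' \<preceq> C" "sg C" "sg C'" shows "irr D C k"
proof -
  obtain H where H: "\<And>i. i < k \<Longrightarrow> dsub (H i) \<and> D' \<preceq> H i \<and> H i \<preceq> C'"
    "\<And>i. i < k \<Longrightarrow> \<not> C' \<inter> (\<Inter>j\<in>{..<k}-{i}. H j) \<preceq> H i"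
    using assms unfolding irr_def by blast
  have "\<not> C \<inter> (\<Inter>j\<in>{..<k}-{i}. H j) \<preceq> H i" if i: "i < k" for i
  proof
    let ?X = "\<Inter>j\<in>{..<k}-{i}. H j"
    assume c: "C \<inter> ?X \<preceq> H i"
    have X: "sg ?X" by (rule sg_Inter_H) (use H(1) in \<open>auto simp: dsub_def\<close>)
    have "C' \<inter> ?X \<preceq> C" by (rule alm_mono[OF assms(3)]) auto
    moreover have "C' \<inter> ?X \<preceq> ?X" by (rule alm_sub[OF X]) auto
    ultimately have "C' \<inter> ?X \<preceq> C \<inter> ?X" using alm_int assms(4) X by blast
    then show False using H(2)[OF i] alm_trans c by blast
  qed
  moreover have "dsub (H i) \<and> D \<preceq> H i \<and> H i \<preceq> C" if "i < k" for i
    using H(1)[OF that] alm_trans assms(2,3) by blast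
  ultimately show ?thesis unfolding irr_def by blast
qed
lemma bd_mono: assumes "D \<preceq> D'" "C' \<preceq> C" "sg C" "sg C'" shows "bd D' C' \<le> bd D C"
  using bd_ge[OF irr_mono[OF irr_bd assms]] .

lemma modular: "sg B \<Longrightarrow> A \<subseteq> B \<Longrightarrow> B \<inter> (A \<uplus> C) \<subseteq> A \<uplus> (B \<inter> C)"
proof
  fix x assume s: "sg B" "A \<subseteq> B" and "x \<in> B \<inter> (A \<uplus> C)"
  then obtain a c where ac: "a \<in> A" "c \<in> C" "x = a + c" "x \<in> B" by (auto elim: ssumE)
  then have "c \<in> B" using sg_diff[OF s(1) ac(4), of a] s(2) by auto
  then show "x \<in> A \<uplus> (B \<inter> C)" using ac by (auto intro: ssumI)
qed

text \<open>An irredundant family in the interval \<open>[P \<inter> P', P]\<close> can be lengthened inside \<open>[D, C]\<close> by \<open>P'\<close>, so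
  the smaller interval has smaller breadth.\<close>
lemma bd_Int_less: assumes d: "dsub P" "dsub P'" "D \<preceq> P" "D \<preceq> P'" "P \<preceq> C" "P' \<preceq> C" "dsub C" and n: "\<not> P' \<preceq> P"
  shows "bd (P \<inter> P') P < bd D C"
proof -
  define k where "k = bd (P \<inter> P') P"
  obtain H where H: "\<And>i. i < k \<Longrightarrow> dsub (H i) \<and> P \<inter> P' \<preceq> H i \<and> H i \<preceq> P"
    "\<And>i. i < k \<Longrightarrow> \<not> P \<inter> (\<Inter>j\<in>{..<k}-{i}. H j) \<preceq> H i"
    using irr_bd[of "P \<inter> P'" P] unfolding irr_def k_def by blast
  have s: "sg P" "sg P'" "sg C" using d by (auto simp: dsub_def)
  have sH: "sg (H i)" if "i < k" for i using H(1)[OF that] by (simp add: dsub_def)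
  define G where "G i = (if i < k then (H i \<inter> P) \<uplus> P' else P)" for i
  have dG: "dsub (G i) \<and> D \<preceq> G i \<and> G i \<preceq> C" if "i < Suc k" for i
  proof (cases "i < k")
    case True
    have "D \<preceq> H i \<inter> P \<uplus> P'" by (rule alm_mono[OF d(4) subset_refl plus_sub2]) (use sH[OF True] s sg_Int in blast)
    moreover have "H i \<inter> P \<uplus> P' \<preceq> C"
      by (rule alm_plus[OF alm_mono[OF d(5)] d(6) s(3)]) auto
    ultimately show ?thesis using True H(1)[OF True] d by (auto simp: G_def intro: dsub_ssum dsub_Int)
  next
    case False
    then show ?thesis using d by (simp add: G_def)
  qed
  have "\<not> C \<inter> (\<Inter>j\<in>{..<Suc k}-{i}. G j) \<preceq> G i" if i: "i < Suc k" for i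
  proof
    assume c: "C \<inter> (\<Inter>j\<in>{..<Suc k}-{i}. G j) \<preceq> G i"
    show False
    proof (cases "i < k")
      case True
      let ?X = "P \<inter> (\<Inter>j\<in>{..<k}-{i}. H j)"
      have sX: "sg ?X" using sg_Int[OF s(1) sg_Inter_H[of k H i]] sH by blast
      have "?X \<subseteq> (\<Inter>j\<in>{..<Suc k}-{i}. G j)"
      proof (rule INT_greatest)
        fix j assume j: "j \<in> {..<Suc k}-{i}"
        show "?X \<subseteq> G j"
        proof (cases "j < k")
          case True
          then have "?X \<subseteq> H j \<inter> P" using j by auto
          then show ?thesis using True plus_sub1[OF s(2), of "H j \<inter> P"] by (auto simp: G_def)
        qed (auto simp: G_def)
      qed
      moreover have "?X \<preceq> C" by (rule alm_mono[OF d(5)]) auto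
      then have "?X \<preceq> C \<inter> ?X" using alm_int[OF _ alm_refl[OF sX] s(3) sX] by blast
      ultimately have "?X \<preceq> G i" using alm_trans[OF _ alm_mono[OF c]] by (metis Int_mono subset_refl)
      then have "?X \<preceq> P \<inter> (H i \<inter> P \<uplus> P')"
        using alm_int[OF alm_sub[OF s(1), of ?X] _ s(1) sg_plus[OF sg_Int[OF sH s(1)] s(2)]] True by (auto simp: G_def)
      also have "P \<inter> (H i \<inter> P \<uplus> P') \<subseteq> (H i \<inter> P) \<uplus> (P \<inter> P')" by (rule modular[OF s(1)]) auto
      finally have "?X \<preceq> (H i \<inter> P) \<uplus> (P \<inter> P')" .
      moreover have "(H i \<inter> P) \<uplus> (P \<inter> P') \<preceq> H i"
        by (rule alm_plus) (use H(1)[OF True] sH[OF True] in \<open>auto intro: alm_sub\<close>)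
      ultimately show False using H(2)[OF True] alm_trans by blast
    next
      case False
      then have i: "i = k" using i by simp
      have "P' \<subseteq> (\<Inter>j\<in>{..<Suc k}-{i}. G j)"
      proof (rule INT_greatest)
        fix j assume "j \<in> {..<Suc k}-{i}"
        then have j: "j < k" using i by auto
        show "P' \<subseteq> G j" using plus_sub2[OF sg_Int[OF sH[OF j] s(1)], of P'] j by (simp add: G_def)
      qed
      moreover have "P' \<preceq> C \<inter> P'" using alm_int[OF d(6) alm_refl[OF s(2)] s(3) s(2)] .
      ultimately have "P' \<preceq> G i" using alm_trans[OF _ alm_mono[OF c]] by (metis Int_mono subset_refl)
      then show False using n by (simp add: G_def i)
    qed
  qed
  then have "irr D C (Suc k)" unfolding irr_def using dG by blast
  then show ?thesis using bd_ge by (fastforce simp: k_def)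
qed

text \<open>The dual statement: an irredundant family in the interval \<open>[P', P + P']\<close> can be lengthened as well.\<close>
lemma bd_plus_less: assumes d: "dsub P" "dsub P'" "D \<preceq> P" "D \<preceq> P'" "P \<preceq> C" "P' \<preceq> C" "dsub C" and n: "\<not> P' \<preceq> P"
  shows "bd P' (P \<uplus> P') < bd D C"
proof -
  define k where "k = bd P' (P \<uplus> P')"
  obtain H where H: "\<And>i. i < k \<Longrightarrow> dsub (H i) \<and> P' \<preceq> H i \<and> H i \<preceq> P \<uplus> P'"
    "\<And>i. i < k \<Longrightarrow> \<not> (P \<uplus> P') \<inter> (\<Inter>j\<in>{..<k}-{i}. H j) \<preceq> H i"
    using irr_bd[of "P'" "P \<uplus> P'"] unfolding irr_def k_def by blast
  have s: "sg P" "sg P'" "sg C" using d by (auto simp: dsub_def)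
  have sH: "sg (H i)" if "i < k" for i using H(1)[OF that] by (simp add: dsub_def)
  define G where "G i = (if i < k then H i else P)" for i
  have pc: "P \<uplus> P' \<preceq> C" using alm_plus d s by blast
  have dG: "dsub (G i) \<and> D \<preceq> G i \<and> G i \<preceq> C" if "i < Suc k" for i
    using H(1)[of i] d pc alm_trans by (auto simp: G_def)
  have P'X: "P' \<preceq> (\<Inter>j\<in>J. H j)" if J: "J \<subseteq> {..<k}" for J
  proof -
    have "finite J" using J finite_subset by blast
    then show ?thesis using J
    proof (induction J)
      case empty then show ?case by (simp add: alm_sub)
    next
      case (insert j J)
      have "P' \<preceq> H j \<inter> (\<Inter>j\<in>J. H j)"
        by (rule alm_int) (use insert H(1)[of j] sH in \<open>auto intro!: sg_INT\<close>)
      then show ?case by simp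
    qed
  qed
  have "\<not> C \<inter> (\<Inter>j\<in>{..<Suc k}-{i}. G j) \<preceq> G i" if i: "i < Suc k" for i
  proof
    assume c: "C \<inter> (\<Inter>j\<in>{..<Suc k}-{i}. G j) \<preceq> G i"
    show False
    proof (cases "i < k")
      case True
      let ?X = "\<Inter>j\<in>{..<k}-{i}. H j"
      let ?Q = "P' \<inter> ?X"
      have sX: "sg ?X" by (rule sg_Inter_H) (use sH in blast)
      have "P' \<preceq> ?Q" using alm_int[OF alm_refl[OF s(2)] P'X[of "{..<k}-{i}"] s(2) sX] by auto
      then have "P \<uplus> P' \<preceq> P \<uplus> ?Q" using alm_plus_mono[OF alm_refl[OF s(1)]] s sg_Int[OF s(2) sX] by blast
      then have "(P \<uplus> P') \<inter> ?X \<preceq> P \<uplus> ?Q" by (rule alm_mono) auto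
      moreover have "(P \<uplus> P') \<inter> ?X \<preceq> ?X" by (rule alm_sub[OF sX]) auto
      ultimately have "(P \<uplus> P') \<inter> ?X \<preceq> ?X \<inter> (P \<uplus> ?Q)"
        using alm_int[OF _ _ sX sg_plus[OF s(1) sg_Int[OF s(2) sX]]] by blast
      moreover have "?X \<inter> (P \<uplus> ?Q) \<subseteq> ?Q \<uplus> (?X \<inter> P)"
      proof -
        have "P \<uplus> ?Q = ?Q \<uplus> P" by (rule ssum_commute)
        then show ?thesis using modular[OF sX, of ?Q P] by auto
      qed
      moreover have "?Q \<uplus> (?X \<inter> P) \<preceq> H i"
      proof (rule alm_plus)
        show "?Q \<preceq> H i" by (rule alm_mono[of P' "H i"]) (use H(1)[OF True] in auto)
        have "?X \<inter> P \<preceq> C \<inter> (\<Inter>j\<in>{..<Suc k}-{i}. G j)"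
        proof -
          have "?X \<inter> P \<preceq> C" by (rule alm_mono[OF d(5)]) auto
          moreover have sXP: "sg (?X \<inter> P)" using sX s sg_Int by blast
          ultimately have "?X \<inter> P \<preceq> C \<inter> (?X \<inter> P)" using alm_int[OF _ alm_refl[OF sXP] s(3) sXP] by blast
          then show ?thesis by (rule alm_mono) (auto simp: G_def less_Suc_eq)
        qed
        then show "?X \<inter> P \<preceq> H i" using alm_trans[OF _ c] True by (simp add: G_def)
      qed (rule sH[OF True])
      ultimately have "(P \<uplus> P') \<inter> ?X \<preceq> H i" by (meson alm_mono alm_trans subset_refl)
      then show False using H(2)[OF True] by blast
    next
      case False
      then have i: "i = k" using i by simp
      have "(\<Inter>j\<in>{..<Suc k}-{i}. G j) = (\<Inter>j\<in>{..<k}. H j)" by (auto simp: i G_def)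
      then have "P' \<preceq> C \<inter> (\<Inter>j\<in>{..<Suc k}-{i}. G j)"
        using alm_int[OF d(6) P'X[of "{..<k}"] s(3)] sH by (auto intro!: sg_INT)
      then have "P' \<preceq> G i" using alm_trans c by blast
      then show False using n by (simp add: G_def i)
    qed
  qed
  then have "irr D C (Suc k)" unfolding irr_def using dG by blast
  then show ?thesis using bd_ge by (fastforce simp: k_def)
qed

end

context bil
begin

text \<open>A biadditive map from \<open>V\<close> and \<open>W\<close> to \<open>L\<close>, regarded modulo \<open>K\<close>; \<open>mu\<close> measures the
  three groups involved, and minimal counterexamples are taken with respect to it.\<close>
definition form :: "'a set \<Rightarrow> 'a set \<Rightarrow> 'a set \<Rightarrow> 'a set \<Rightarrow> bool" where
  "form V W K L \<longleftrightarrow> dsub V \<and> dsub W \<and> dsub K \<and> dsub L \<and> K \<preceq> L \<and>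
     (\<forall>v\<in>V. m v ` W \<preceq> L) \<and> (\<forall>w\<in>W. fl m w ` V \<preceq> L)"
definition triv :: "'a set \<Rightarrow> 'a set \<Rightarrow> 'a set \<Rightarrow> bool" where
  "triv V W K \<longleftrightarrow> V \<preceq> lz m V K W"
definition mu :: "'a set \<Rightarrow> 'a set \<Rightarrow> 'a set \<Rightarrow> 'a set \<Rightarrow> nat" where
  "mu V W K L = bd (lz m V K W) V + bd (lz (fl m) W K V) W + bd K L"

lemma bilfl_lz: "dsub V \<Longrightarrow> dsub K \<Longrightarrow> dsub P \<Longrightarrow> dsub (lz (fl m) V K P)"
  by (rule bil.dsub_lz[OF bil_fl])
lemma triv_fl: assumes "dsub V" "dsub W" "dsub K"
  shows "triv V W K \<longleftrightarrow> W \<preceq> lz (fl m) W K V"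
  unfolding triv_def using galois[OF assms(1,2,2,1,3)] galois'[OF assms(1,2,2,1,3)] by blast

text \<open>Cutting \<open>V\<close> and \<open>W\<close> down to the elements that respect the two kernels loses only finite index, by the Galois
  connection, so neither the breadths nor triviality change.\<close>
lemma reduce: assumes f: "form V W K L"
  defines "V' \<equiv> lz m V K (lz (fl m) W K V)" and "W' \<equiv> lz (fl m) W K (lz m V K W)"
  shows "V' \<subseteq> V" "W' \<subseteq> W" "V \<preceq> V'" "W \<preceq> W'" "form V' W' K L" "mu V' W' K L = mu V W K L"
    "triv V' W' K \<Longrightarrow> triv V W K"
    "\<forall>v\<in>V'. m v ` lz (fl m) W' K V' \<preceq> K" "\<forall>w\<in>W'. fl m w ` lz m V' K W' \<preceq> K"
proof -
  have d: "dsub V" "dsub W" "dsub K" "dsub L" using f by (auto simp: form_def)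
  show sub: "V' \<subseteq> V" "W' \<subseteq> W" by (auto simp: V'_def W'_def lz_def)
  have dr: "dsub (lz (fl m) W K V)" by (rule bilfl_lz[OF d(2,3,1)])
  have dl: "dsub (lz m V K W)" by (rule dsub_lz[OF d(1,3,2)])
  have dV': "dsub V'" unfolding V'_def by (rule dsub_lz[OF d(1,3) dr])
  have dW': "dsub W'" unfolding W'_def by (rule bilfl_lz[OF d(2,3) dl])
  show VV': "V \<preceq> V'" unfolding V'_def
    by (rule galois'[OF d(1,2) dr d(1,3) subset_refl lz_sub]) (rule alm_refl[OF dsub_sg[OF dr]])
  show WW': "W \<preceq> W'" unfolding W'_def
    by (rule galois[OF d(1,2,2) dl d(3) lz_sub subset_refl]) (rule alm_refl[OF dsub_sg[OF dl]])
  have l: "lz m V' K W' = lz m V K W \<inter> V'"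
    using lz_anti[OF WW', of V K] lz_anti[of W' W V K] sub alm_sub[OF dsub_sg[OF d(2)] sub(2)]
    by (auto simp: lz_def)
  have r: "lz (fl m) W' K V' = lz (fl m) W K V \<inter> W'"
    using bil.lz_anti[OF bil_fl VV', of W K] bil.lz_anti[OF bil_fl, of V' V W K] sub alm_sub[OF dsub_sg[OF d(1)] sub(1)]
    by (auto simp: lz_def)
  show "form V' W' K L" using f dV' dW' sub alm_mono[OF _ image_mono[OF sub(2)] subset_refl]
      alm_mono[OF _ image_mono[OF sub(1)] subset_refl] unfolding form_def by (metis subsetD)
  have al: "lz m V K W \<preceq> lz m V' K W'" unfolding l
    by (rule alm_int[OF alm_refl alm_mono[OF VV']]) (use dl dV' in \<open>auto simp: dsub_def lz_def\<close>)
  have al': "lz m V' K W' \<preceq> lz m V K W" unfolding l by (rule alm_sub) (use dl in \<open>auto simp: dsub_def\<close>)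
  have ar: "lz (fl m) W K V \<preceq> lz (fl m) W' K V'" unfolding r
    by (rule alm_int[OF alm_refl alm_mono[OF WW']]) (use dr dW' in \<open>auto simp: dsub_def lz_def\<close>)
  have ar': "lz (fl m) W' K V' \<preceq> lz (fl m) W K V" unfolding r by (rule alm_sub) (use dr in \<open>auto simp: dsub_def\<close>)
  have s: "sg V" "sg W" "sg V'" "sg W'" using d dV' dW' by (auto simp: dsub_def)
  have "bd (lz m V' K W') V' = bd (lz m V K W) V"
    by (rule order_antisym; rule bd_mono) (use al al' VV' alm_sub[OF s(1) sub(1)] s in auto)
  moreover have "bd (lz (fl m) W' K V') W' = bd (lz (fl m) W K V) W"
    by (rule order_antisym; rule bd_mono) (use ar ar' WW' alm_sub[OF s(2) sub(2)] s in auto)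
  ultimately show "mu V' W' K L = mu V W K L" by (simp add: mu_def)
  show "triv V W K" if "triv V' W' K"
    using alm_trans[OF VV'] alm_trans[OF that[unfolded triv_def] al'] by (simp add: triv_def)
  show "\<forall>v\<in>V'. m v ` lz (fl m) W' K V' \<preceq> K"
  proof
    fix v assume "v \<in> V'"
    then have "m v ` lz (fl m) W K V \<preceq> K" by (auto simp: V'_def lz_def)
    then show "m v ` lz (fl m) W' K V' \<preceq> K" by (rule alm_mono) (use r in auto)
  qed
  show "\<forall>w\<in>W'. fl m w ` lz m V' K W' \<preceq> K"
  proof
    fix v assume "v \<in> W'"
    then have "fl m v ` lz m V K W \<preceq> K" by (auto simp: W'_def lz_def)
    then show "fl m v ` lz m V' K W' \<preceq> K" by (rule alm_mono) (use l in auto)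
  qed
qed

end

locale minform = bil +
  fixes V W K L :: "'a set"
  assumes form: "form V W K L" and ntriv: "\<not> triv V W K"
    and redV: "v \<in> V \<Longrightarrow> m v ` lz (fl m) W K V \<preceq> K"
    and redW: "w \<in> W \<Longrightarrow> fl m w ` lz m V K W \<preceq> K"
    and minimal: "form V1 W1 K1 L1 \<Longrightarrow> mu V1 W1 K1 L1 < mu V W K L \<Longrightarrow> triv V1 W1 K1"
begin

lemma dV: "dsub V" and dW: "dsub W" and dK: "dsub K" and dL: "dsub L" and KL: "K \<preceq> L"
  and VL: "v \<in> V \<Longrightarrow> m v ` W \<preceq> L" and WL: "w \<in> W \<Longrightarrow> fl m w ` V \<preceq> L"
  using form by (auto simp: form_def)
lemma sV: "sg V" and sW: "sg W" and sK: "sg K" and sL: "sg L"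
  using dV dW dK dL by (auto simp: dsub_def)

lemma form_fl: "bil.form df (fl m) V1 W1 K1 L1 \<longleftrightarrow> form W1 V1 K1 L1"
  unfolding bil.form_def[OF bil_fl] form_def by auto
lemma mu_fl: "bil.mu df (fl m) V1 W1 K1 L1 = mu W1 V1 K1 L1"
  unfolding bil.mu_def[OF bil_fl] mu_def by simp
lemma minform_fl: "minform df nb (fl m) W V K L"
proof -
  interpret f: bil df nb "fl m" by (rule bil_fl)
  show ?thesis
  proof
    show "f.form W V K L" using form form_fl by simp
    show "\<not> f.triv W V K" using ntriv f.triv_def triv_fl[OF dV dW dK] by simp
    show "fl m v ` lz (fl (fl m)) V K W \<preceq> K" if "v \<in> W" for v using redW[OF that] by simp
    show "fl (fl m) w ` lz (fl m) W K V \<preceq> K" if "w \<in> V" for w using redV[OF that] by simp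
    show "f.triv V1 W1 K1" if "f.form V1 W1 K1 L1" "f.mu V1 W1 K1 L1 < f.mu W V K L" for V1 W1 K1 L1
    proof -
      have F: "form W1 V1 K1 L1" using that(1) form_fl by simp
      have "triv W1 V1 K1" using minimal[OF F] that(2) mu_fl by simp
      then show ?thesis using triv_fl[of W1 V1 K1] F by (simp add: form_def f.triv_def)
    qed
  qed
qed

abbreviation "Z \<equiv> lz m V K W"
abbreviation "D \<equiv> lz (fl m) W K V"
lemma dZ: "dsub Z" by (rule dsub_lz[OF dV dK dW])
lemma dD: "dsub D" by (rule bilfl_lz[OF dW dK dV])

text \<open>On \<open>lz (P \<inter> P')\<close> and \<open>P\<close> the form almost kills \<open>P \<inter> P'\<close>, so it lives on the interval
  \<open>[P \<inter> P', P]\<close>. That interval has smaller breadth, and minimality makes the restricted form trivial.\<close>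
lemma S1: assumes P: "dsub P" "dsub P'" "P \<subseteq> W" "P' \<subseteq> W" "D \<preceq> P" "D \<preceq> P'" and n: "\<not> P' \<preceq> P"
  shows "lz m V K (P \<inter> P') \<preceq> lz m V K P"
proof -
  have s: "sg P" "sg P'" using P by (auto simp: dsub_def)
  have dPP: "dsub (P \<inter> P')" using P dsub_Int by blast
  define V1 where "V1 = lz m V K (P \<inter> P')"
  have dV1: "dsub V1" unfolding V1_def by (rule dsub_lz[OF dV dK dPP])
  have V1: "V1 \<subseteq> V" by (simp add: V1_def lz_sub)
  have F: "form V1 P K L" unfolding form_def
  proof (intro conjI ballI)
    fix v assume "v \<in> V1"
    then have "v \<in> V" using V1 by blast
    from VL[OF this] show "m v ` P \<preceq> L" by (rule alm_mono) (use P in auto)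
  next
    fix w assume "w \<in> P"
    then have "w \<in> W" using P(3) by blast
    from WL[OF this] show "fl m w ` V1 \<preceq> L" by (rule alm_mono) (use V1 in auto)
  qed (use dV1 P dK dL KL in auto)
  have sub: "lz m V1 K P = lz m V K P"
    using lz_anti[OF alm_sub[OF s(1), of "P \<inter> P'"], of V K] by (auto simp: V1_def lz_def)
  have dl: "dsub (lz m V K P)" by (rule dsub_lz[OF dV dK P(1)])
  have "Z \<subseteq> lz m V K P" by (rule lz_anti[OF alm_sub[OF sW P(3)]])
  then have 1: "bd (lz m V1 K P) V1 \<le> bd Z V" unfolding sub
    by (intro bd_mono) (use dl dV1 sV V1 in \<open>auto simp: dsub_def intro: alm_sub\<close>)
  have "P \<inter> P' \<preceq> lz (fl m) P K V1"
  proof -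
    have "P \<inter> P' \<preceq> lz (fl m) (P \<inter> P') K V1"
      by (rule neumann[OF dV1 dPP dK]) (auto simp: V1_def lz_def)
    then show ?thesis by (rule alm_mono) (auto simp: lz_def)
  qed
  then have "bd (lz (fl m) P K V1) P \<le> bd (P \<inter> P') P"
    by (intro bd_mono) (use s in \<open>auto intro: alm_refl\<close>)
  also have "\<dots> < bd D W"
    by (rule bd_Int_less[OF P(1,2,5,6)]) (use P n sW dW in \<open>auto intro: alm_sub\<close>)
  finally have "mu V1 P K L < mu V W K L" using 1 by (simp add: mu_def)
  from minimal[OF F this] show ?thesis unfolding triv_def sub by (simp add: V1_def)
qed

text \<open>On the elements with image almost in \<open>H + H'\<close> the form takes values in the interval \<open>[H', H + H']\<close> when
  read modulo \<open>H'\<close>. That interval has smaller breadth, so minimality applies.\<close>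
lemma S3: assumes H: "dsub H" "dsub H'" "K \<preceq> H" "K \<preceq> H'" "H \<preceq> L" "H' \<preceq> L" and n: "\<not> H' \<preceq> H"
  shows "lz m V (H \<uplus> H') W \<preceq> lz m V H' W"
proof -
  have s: "sg H" "sg H'" using H by (auto simp: dsub_def)
  define L1 where "L1 = H \<uplus> H'"
  have dL1: "dsub L1" unfolding L1_def by (rule dsub_ssum[OF H(1,2)])
  have H'L1: "H' \<preceq> L1" unfolding L1_def by (rule alm_sub[OF sg_plus[OF s] plus_sub2[OF s(1)]])
  define V1 where "V1 = lz m V L1 W"
  have dV1: "dsub V1" unfolding V1_def by (rule dsub_lz[OF dV dL1 dW])
  have V1: "V1 \<subseteq> V" by (simp add: V1_def lz_sub)
  define W1 where "W1 = lz (fl m) W L1 V1"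
  have dW1: "dsub W1" unfolding W1_def by (rule bilfl_lz[OF dW dL1 dV1])
  have W1: "W1 \<subseteq> W" by (simp add: W1_def lz_sub)
  have WW1: "W \<preceq> W1" unfolding W1_def by (rule neumann[OF dV1 dW dL1]) (auto simp: V1_def lz_def)
  have F: "form V1 W1 H' L1" unfolding form_def
  proof (intro conjI ballI)
    fix v assume "v \<in> V1"
    then have "m v ` W \<preceq> L1" by (simp add: V1_def lz_def)
    then show "m v ` W1 \<preceq> L1" by (rule alm_mono) (use W1 in auto)
  next
    fix w assume "w \<in> W1"
    then show "fl m w ` V1 \<preceq> L1" by (simp add: W1_def lz_def)
  qed (use dV1 dW1 H dL1 H'L1 in auto)
  have sub: "lz m V1 H' W1 = lz m V H' W"
  proof -
    have "lz m V H' W1 = lz m V H' W"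
      using lz_anti[OF WW1, of V H'] lz_anti[OF alm_sub[OF sW W1], of V H'] by auto
    moreover have "lz m V H' W \<subseteq> V1" unfolding V1_def by (rule lz_monoK[OF H'L1])
    ultimately show ?thesis using V1 by (auto simp: lz_def)
  qed
  have dl: "dsub (lz m V H' W)" by (rule dsub_lz[OF dV H(2) dW])
  have "Z \<subseteq> lz m V H' W" by (rule lz_monoK[OF H(4)])
  then have 1: "bd (lz m V1 H' W1) V1 \<le> bd Z V" unfolding sub
    by (intro bd_mono) (use dl dV1 sV V1 in \<open>auto simp: dsub_def intro: alm_sub\<close>)
  have dl1: "dsub (lz (fl m) W1 H' V1)" by (rule bilfl_lz[OF dW1 H(2) dV1])
  have "D \<inter> W1 \<subseteq> lz (fl m) W1 H' V1"
  proof
    fix w assume w: "w \<in> D \<inter> W1"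
    then have "fl m w ` V1 \<preceq> K" using V1 alm_mono[of "fl m w ` V" K "fl m w ` V1" K] by (auto simp: lz_def)
    then show "w \<in> lz (fl m) W1 H' V1" using w alm_trans[OF _ H(4)] by (simp add: lz_def)
  qed
  moreover have "D \<preceq> D \<inter> W1"
    by (rule alm_int2) (use dD dW1 alm_mono[OF WW1 lz_sub subset_refl] in \<open>auto simp: dsub_def\<close>)
  ultimately have "D \<preceq> lz (fl m) W1 H' V1" using alm_mono by blast
  then have 2: "bd (lz (fl m) W1 H' V1) W1 \<le> bd D W"
    by (intro bd_mono) (use dW1 sW W1 in \<open>auto simp: dsub_def intro: alm_sub\<close>)
  have "bd H' L1 < bd K L" unfolding L1_def by (rule bd_plus_less[OF H dL n])
  then have "mu V1 W1 H' L1 < mu V W K L" using 1 2 by (simp add: mu_def)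
  from minimal[OF F this] show ?thesis unfolding triv_def sub by (simp add: V1_def L1_def)
qed

end

lemma (in bil) ex_minform: assumes "form V W K L" "\<not> triv V W K"
  shows "\<exists>V W K L. minform df nb m V W K L"
proof -
  let ?Q = "\<lambda>(V, W, K, L). form V W K L \<and> \<not> triv V W K"
  define x where "x = arg_min (\<lambda>(V, W, K, L). mu V W K L) ?Q"
  have x: "?Q x" "\<And>y. ?Q y \<Longrightarrow> (\<lambda>(V, W, K, L). mu V W K L) x \<le> (\<lambda>(V, W, K, L). mu V W K L) y"
    using arg_min_nat_lemma[of ?Q "(V, W, K, L)" "\<lambda>(V, W, K, L). mu V W K L"] assms unfolding x_def by auto
  obtain V0 W0 K0 L0 where x0: "x = (V0, W0, K0, L0)" by (cases x)
  have F: "form V0 W0 K0 L0" "\<not> triv V0 W0 K0"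
    and mn: "\<And>V1 W1 K1 L1. form V1 W1 K1 L1 \<Longrightarrow> \<not> triv V1 W1 K1 \<Longrightarrow> mu V0 W0 K0 L0 \<le> mu V1 W1 K1 L1"
    using x unfolding x0 by auto
  note r = reduce[OF F(1)]
  have "minform df nb m (lz m V0 K0 (lz (fl m) W0 K0 V0)) (lz (fl m) W0 K0 (lz m V0 K0 W0)) K0 L0"
  proof unfold_locales
    fix V1 W1 K1 L1 assume "form V1 W1 K1 L1"
      and "mu V1 W1 K1 L1 < mu (lz m V0 K0 (lz (fl m) W0 K0 V0)) (lz (fl m) W0 K0 (lz m V0 K0 W0)) K0 L0"
    then show "triv V1 W1 K1" using mn[of V1 W1 K1 L1] r(6) by fastforce
  qed (use r F in auto)
  then show ?thesis by blast
qed

section \<open>Factoring one multiplication through another\<close>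

fun sumL :: "'a :: ab_group_add set \<Rightarrow> ('x \<Rightarrow> 'a set) \<Rightarrow> 'x list \<Rightarrow> 'a set" where
  "sumL X0 X [] = X0"
| "sumL X0 X (u # us) = X u \<uplus> sumL X0 X us"

lemma sg_sumL: "sg X0 \<Longrightarrow> (\<And>u. u \<in> set us \<Longrightarrow> sg (X u)) \<Longrightarrow> sg (sumL X0 X us)"
  by (induction us) (auto intro: sg_plus)
lemma sumL_base: assumes "sg X0" "\<And>u. sg (X u)" shows "X0 \<subseteq> sumL X0 X us"
proof (induction us)
  case (Cons u us)
  then show ?case using plus_sub2[OF assms(2)[of u], of "sumL X0 X us"] by auto
qed simp
lemma sumL_mem: assumes "sg X0" "\<And>u. sg (X u)" shows "u \<in> set us \<Longrightarrow> X u \<subseteq> sumL X0 X us"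
proof (induction us)
  case (Cons v us)
  have s: "sg (sumL X0 X us)" by (rule sg_sumL[OF assms])
  show ?case using Cons plus_sub2[OF assms(2)[of v], of "sumL X0 X us"] plus_sub1[OF s, of "X v"] by auto
qed simp
lemma sumL_least: "sg C \<Longrightarrow> X0 \<preceq> C \<Longrightarrow> (\<And>u. u \<in> set us \<Longrightarrow> X u \<preceq> C) \<Longrightarrow> sumL X0 X us \<preceq> C"
  by (induction us) (auto intro: alm_plus)

context tame
begin

lemma dsub_sumL: "dsub X0 \<Longrightarrow> (\<And>u. dsub (X u)) \<Longrightarrow> dsub (sumL X0 X us)"
  by (induction us) (auto intro: dsub_ssum)

lemma breadth_dsub: assumes "\<And>i. i \<le> nb \<Longrightarrow> dsub (H i)" shows "\<exists>i\<le>nb. (\<Inter>j\<in>{..nb}-{i}. H j) \<preceq> H i"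
  by (rule breadth) (use assms in \<open>auto simp: dsub_def dset_def ds_def\<close>)

text \<open>A list of minimal length with almost the same sum is irredundant, so its length is at most the breadth.\<close>
lemma few_summands: assumes d: "dsub X0" "\<And>u. dsub (X u)"
  shows "\<exists>us. set us \<subseteq> set vs \<and> length us \<le> nb \<and> sumL X0 X vs \<preceq> sumL X0 X us"
proof -
  let ?Q = "\<lambda>us. set us \<subseteq> set vs \<and> (\<forall>v\<in>set vs. X v \<preceq> sumL X0 X us)"
  have s: "sg X0" "\<And>u. sg (X u)" using d by (auto simp: dsub_def)
  have sS: "sg (sumL X0 X us)" for us by (rule sg_sumL[OF s])
  have "?Q vs" using sumL_mem[of X0 X] s alm_sub[OF sS] by blast
  then obtain us where us: "?Q us" "\<And>ws. ?Q ws \<Longrightarrow> length us \<le> length ws"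
    using arg_min_nat_lemma[of ?Q vs length] by blast
  have "length us \<le> nb"
  proof (rule ccontr)
    assume n: "\<not> length us \<le> nb"
    define R where "R i = take i us @ drop (Suc i) us" for i
    have "\<exists>i\<le>nb. (\<Inter>j\<in>{..nb}-{i}. sumL X0 X (R j)) \<preceq> sumL X0 X (R i)"
      by (rule breadth_dsub) (rule dsub_sumL[OF d])
    then obtain i where i: "i \<le> nb" "(\<Inter>j\<in>{..nb}-{i}. sumL X0 X (R j)) \<preceq> sumL X0 X (R i)" by blast
    have il: "i < length us" using i n by simp
    have "us ! i \<in> set (R j)" if "j \<noteq> i" for j
    proof (cases "i < j")
      case True then show ?thesis using il nth_take[of i j us] nth_mem[of i "take j us"] by (auto simp: R_def)
    next
      case False
      then have "drop (Suc j) us ! (i - Suc j) = us ! i" "i - Suc j < length (drop (Suc j) us)"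
        using that il by (auto simp: nth_drop)
      then show ?thesis using nth_mem[of "i - Suc j" "drop (Suc j) us"] by (auto simp: R_def)
    qed
    then have "X (us ! i) \<subseteq> (\<Inter>j\<in>{..nb}-{i}. sumL X0 X (R j))" using sumL_mem[of X0 X] s by blast
    then have Xi: "X (us ! i) \<preceq> sumL X0 X (R i)" using le_alm i(2) by blast
    have e: "us = take i us @ us ! i # drop (Suc i) us" by (rule id_take_nth_drop[OF il])
    have "set us = insert (us ! i) (set (R i))" using arg_cong[OF e, of set] by (simp add: R_def)
    then have "sumL X0 X us \<preceq> sumL X0 X (R i)"
      by (intro sumL_least[OF sS alm_sub[OF sS sumL_base]])
        (use Xi s alm_sub[OF sS sumL_mem[of X0 X]] in auto)
    then have "X v \<preceq> sumL X0 X (R i)" if "v \<in> set vs" for v using us(1) alm_trans that by blast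
    moreover have "set (R i) \<subseteq> set vs" using us(1) \<open>set us = insert (us ! i) (set (R i))\<close> by auto
    ultimately have "?Q (R i)" by blast
    from us(2)[OF this] show False using il by (simp add: R_def)
  qed
  moreover have "sumL X0 X vs \<preceq> sumL X0 X us"
    by (intro sumL_least[OF sS alm_sub[OF sS sumL_base]]) (use us s in auto)
  ultimately show ?thesis using us(1) by blast
qed

lemma few_meets: assumes d: "\<And>u. dsub (B u)"
  shows "\<exists>us. set us \<subseteq> set vs \<and> length us \<le> nb \<and> (\<Inter>u\<in>set us. B u) \<preceq> (\<Inter>u\<in>set vs. B u)"
proof -
  let ?Q = "\<lambda>us. set us \<subseteq> set vs \<and> (\<Inter>u\<in>set us. B u) \<preceq> (\<Inter>u\<in>set vs. B u)"
  have s: "sg (B u)" for u using d by (auto simp: dsub_def)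
  have sI: "sg (\<Inter>u\<in>S. B u)" for S by (rule sg_INT) (rule s)
  have "?Q vs" using alm_refl[OF sI] by blast
  then obtain us where us: "?Q us" "\<And>ws. ?Q ws \<Longrightarrow> length us \<le> length ws"
    using arg_min_nat_lemma[of ?Q vs length] by blast
  have "length us \<le> nb"
  proof (rule ccontr)
    assume n: "\<not> length us \<le> nb"
    have "\<exists>i\<le>nb. (\<Inter>j\<in>{..nb}-{i}. B (us ! j)) \<preceq> B (us ! i)"
      by (rule breadth_dsub) (rule d)
    then obtain i where i: "i \<le> nb" "(\<Inter>j\<in>{..nb}-{i}. B (us ! j)) \<preceq> B (us ! i)" by blast
    have il: "i < length us" using i n by simp
    define R where "R = take i us @ drop (Suc i) us"
    have "us ! j \<in> set R" if "j \<noteq> i" "j \<le> nb" for j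
    proof (cases "j < i")
      case True then show ?thesis using il nth_take[of j i us] nth_mem[of j "take i us"] by (auto simp: R_def)
    next
      case False
      then have "drop (Suc i) us ! (j - Suc i) = us ! j" "j - Suc i < length (drop (Suc i) us)"
        using that il n by (auto simp: nth_drop)
      then show ?thesis using nth_mem[of "j - Suc i" "drop (Suc i) us"] by (auto simp: R_def)
    qed
    then have "(\<Inter>u\<in>set R. B u) \<subseteq> (\<Inter>j\<in>{..nb}-{i}. B (us ! j))" by auto
    then have Bi: "(\<Inter>u\<in>set R. B u) \<preceq> B (us ! i)" using le_alm i(2) by blast
    have e: "us = take i us @ us ! i # drop (Suc i) us" by (rule id_take_nth_drop[OF il])
    have st: "set us = insert (us ! i) (set R)" using arg_cong[OF e, of set] by (simp add: R_def)
    have "(\<Inter>u\<in>set R. B u) \<preceq> B (us ! i) \<inter> (\<Inter>u\<in>set R. B u)"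
      by (rule alm_int[OF Bi alm_refl[OF sI] s sI])
    then have "(\<Inter>u\<in>set R. B u) \<preceq> (\<Inter>u\<in>set us. B u)" by (simp add: st)
    then have "?Q R" using us(1) alm_trans st by blast
    from us(2)[OF this] show False using il by (simp add: R_def)
  qed
  then show ?thesis using us(1) by blast
qed

end

context bil
begin

definition im :: "'a set \<Rightarrow> 'a set \<Rightarrow> 'a \<Rightarrow> 'a set" where "im W K v = m v ` W \<uplus> K"
lemma sg_im: "sg W \<Longrightarrow> sg K \<Longrightarrow> sg (im W K v)"
  unfolding im_def by (rule sg_plus[OF sg_img[OF addR]])
lemma dsub_im: "dsub W \<Longrightarrow> dsub K \<Longrightarrow> dsub (im W K v)"
  unfolding im_def by (rule dsub_ssum[OF dsub_img])
lemma ds_im[dintro]: assumes "ds A S" "ds A T" "tm A f" shows "ds A (\<lambda>e. im (S e) (T e) (f e))"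
  unfolding im_def by (intro dintro assms)
lemma im_sub: "sg K \<Longrightarrow> m v ` W \<subseteq> im W K v" unfolding im_def by (rule plus_sub1)
lemma im_subK: "sg W \<Longrightarrow> K \<subseteq> im W K v" unfolding im_def by (rule plus_sub2[OF sg_img[OF addR]])
lemma im_alm: "sg H \<Longrightarrow> K \<preceq> H \<Longrightarrow> m v ` W \<preceq> H \<Longrightarrow> im W K v \<preceq> H"
  unfolding im_def by (rule alm_plus)
lemma im_mono: "P \<preceq> Q \<Longrightarrow> sg Q \<Longrightarrow> sg K \<Longrightarrow> im P K v \<preceq> im Q K v"
  unfolding im_def by (rule alm_plus_mono[OF alm_img[OF addR]]) (auto intro: alm_refl sg_img[OF addR])

text \<open>If \<open>v'\<close> factors through \<open>v\<close> then it cannot have a properly larger image: the corresponding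
  partial endomorphism would generate an infinite descending sequence of definable subgroups.\<close>
lemma no_larger_image: assumes d: "dsub P" "dsub K" and k: "m v' ` ann m P K v \<preceq> K"
    and le: "im P K v \<preceq> im P K v'"
  shows "im P K v' \<preceq> im P K v"
proof -
  obtain A where A: "finite A" "ds A (\<lambda>e. P)" "ds A (\<lambda>e. K)"
    using dsub_params[of "{P, K}"] d by auto
  let ?A = "insert v (insert v' A)"
  have s: "sg P" "sg K" using d by (auto simp: dsub_def)
  define Q where "Q = rec_nat P (\<lambda>_ S. {w \<in> P. m v' w \<in> im S K v})"
  have Q: "Q 0 = P" "\<And>i. Q (Suc i) = {w \<in> P. m v' w \<in> im (Q i) K v}" by (simp_all add: Q_def)
  have dsQ: "ds ?A (\<lambda>e. Q i)" for i
  proof (induction i)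
    case 0
    have "ds ?A (\<lambda>e. P)" by (rule ds_mono[OF A(2)]) auto
    then show ?case by (simp add: Q)
  next
    case (Suc i)
    show ?case unfolding Q by (intro dintro Suc ds_mono[OF A(2)] ds_mono[OF A(3)]) auto
  qed
  have sQ: "sg (Q i)" for i
    by (induction i) (use s sg_pre[OF addR s(1) sg_im[OF _ s(2)]] in \<open>auto simp: Q\<close>)
  have QP: "Q i \<subseteq> P" for i by (cases i) (auto simp: Q)
  have dec: "Q (Suc i) \<subseteq> Q i" for i
  proof (induction i)
    case (Suc i)
    then have "im (Q (Suc i)) K v \<subseteq> im (Q i) K v" by (auto simp: im_def ssum_def)
    then show ?case using Q(2)[of i] Q(2)[of "Suc i"] by auto
  qed (auto simp: Q)
  obtain N where N: "\<forall>k\<ge>N. Q k = Q N" using dec_stabilises[of ?A Q, OF _ dsQ dec] A(1) by auto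
  have a0: "ann m P K v \<preceq> Q i" for i
  proof (cases i)
    case 0 then show ?thesis using s by (auto simp: Q ann_def intro: alm_sub)
  next
    case (Suc j)
    have "ann m P K v \<preceq> {w \<in> P. m v' w \<in> K}"
      by (rule alm_pre[OF addR s(2,1) k]) (auto simp: ann_def)
    then show ?thesis by (rule alm_mono) (use im_subK[OF sQ] in \<open>auto simp: Suc Q\<close>)
  qed
  have up: "m v ` Q i \<preceq> im (Q (Suc i)) K v'" for i
  proof -
    have "m v ` Q i \<preceq> im P K v'" using le_alm[OF _ le, of "m v ` Q i"] QP im_sub[OF s(2), of v P] by blast
    moreover have "m v ` Q i \<preceq> im (Q i) K v" by (rule alm_sub[OF sg_im[OF sQ s(2)] im_sub[OF s(2)]])
    ultimately have "m v ` Q i \<preceq> im P K v' \<inter> im (Q i) K v"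
      by (rule alm_int) (use sg_im s sQ in auto)
    moreover have "im P K v' \<inter> im (Q i) K v \<subseteq> im (Q (Suc i)) K v'"
    proof
      fix x assume x: "x \<in> im P K v' \<inter> im (Q i) K v"
      then obtain w k where wk: "w \<in> P" "k \<in> K" "x = m v' w + k" by (auto simp: im_def ssum_def)
      have "x - k \<in> im (Q i) K v" using x wk im_subK[OF sQ] sg_diff[OF sg_im[OF sQ s(2)]] by blast
      then have "w \<in> Q (Suc i)" using wk by (simp add: Q)
      then show "x \<in> im (Q (Suc i)) K v'" using wk by (auto simp: im_def intro: ssumI)
    qed
    ultimately show ?thesis by (rule alm_le)
  qed
  have down: "Q i \<preceq> Q (Suc i)" if "Q (Suc i) \<preceq> Q (Suc (Suc i))" for i
  proof -
    have "m v ` Q i \<preceq> im (Q (Suc i)) K v'" by (rule up)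
    also have "\<dots> \<preceq> im (Q (Suc (Suc i))) K v'" by (rule im_mono[OF that sQ s(2)])
    also have "\<dots> \<preceq> im (Q (Suc i)) K v"
      by (rule im_alm[OF sg_im[OF sQ s(2)] alm_sub[OF sg_im[OF sQ s(2)] im_subK[OF sQ]]])
        (rule alm_sub[OF sg_im[OF sQ s(2)]], use Q(2)[of "Suc i"] in auto)
    finally have "Q i \<preceq> {w \<in> P. m v w \<in> im (Q (Suc i)) K v}"
      by (rule alm_pre[OF addR sg_im[OF sQ s(2)] s(1) _ QP])
    also have "\<dots> \<subseteq> Q (Suc i) \<uplus> ann m P K v"
    proof
      fix w assume w: "w \<in> {w \<in> P. m v w \<in> im (Q (Suc i)) K v}"
      then obtain q k where q: "q \<in> Q (Suc i)" "k \<in> K" "m v w = m v q + k" by (auto simp: im_def ssum_def)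
      then have "w - q \<in> ann m P K v" using w QP[of "Suc i"] sg_diff[OF s(1)] by (auto simp: ann_def m_diff)
      from ssumI[OF q(1) this] show "w \<in> Q (Suc i) \<uplus> ann m P K v" by simp
    qed
    also have "\<dots> \<preceq> Q (Suc i)" by (rule alm_plus[OF alm_refl[OF sQ] a0 sQ])
    finally show ?thesis .
  qed
  have "Q i \<preceq> Q (Suc i)" for i
  proof (rule ccontr)
    assume n: "\<not> Q i \<preceq> Q (Suc i)"
    have "\<not> Q (i + k) \<preceq> Q (Suc (i + k))" for k by (induction k) (use n down in auto)
    from this[of N] show False using N[rule_format, of "i + N"] N[rule_format, of "Suc (i + N)"] alm_refl[OF sQ] by simp
  qed
  from this[of 0] have "P \<preceq> Q (Suc 0)" by (simp add: Q)
  from alm_img[OF addR this] have "m v' ` P \<preceq> m v' ` Q (Suc 0)" .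
  also have "\<dots> \<subseteq> im P K v" by (auto simp: Q)
  finally show ?thesis
    by (intro im_alm[OF sg_im[OF s] alm_sub[OF sg_im[OF s] im_subK[OF s(1)]]])
qed

end

context minform
begin

abbreviation "A v \<equiv> ann m W K v"
abbreviation "X v \<equiv> im W K v"

lemma dA: "dsub (A v)" by (rule dsub_ann[OF dW dK])
lemma sA: "sg (A v)" using dA by (simp add: dsub_def)
lemma AW: "A v \<subseteq> W" by (auto simp: ann_def)
lemma DA: assumes "v \<in> V" shows "D \<preceq> A v"
  using redV[OF assms] img_alm_iff[OF sW sK lz_sub[of "fl m" W K V], of v] by blast
lemma dX: "dsub (X v)" by (rule dsub_im[OF dW dK])
lemma sX: "sg (X v)" using dX by (simp add: dsub_def)
lemma KX: "K \<preceq> X v" by (rule alm_sub[OF sX im_subK[OF sW]])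
lemma XL: assumes "v \<in> V" shows "X v \<preceq> L" by (rule im_alm[OF sL KL VL[OF assms]])
lemma lzA: "u \<in> lz m V K (A v) \<longleftrightarrow> u \<in> V \<and> A v \<preceq> A u"
  using img_alm_iff[OF sW sK AW, of u v] by (auto simp: lz_def)
text \<open>The images are added one at a time: an image that almost contains the sum so far is not larger than that of
  \<open>v0\<close> by \<open>no_larger_image\<close>, and in the other case \<open>S3\<close> applies.\<close>
lemma lu_sum: assumes v0: "v0 \<in> V" and us: "set us \<subseteq> lz m V K (A v0)"
  shows "lz m V (sumL (X v0) X us) W \<preceq> lz m V (X v0) W"
  using us
proof (induction us)
  case Nil
  show ?case using alm_refl[OF sg_lz[OF sV sX]] by simp
next
  case (Cons u us)
  let ?H = "sumL (X v0) X us"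
  have dH: "dsub ?H" by (rule dsub_sumL[OF dX dX])
  then have sH: "sg ?H" by (simp add: dsub_def)
  have base: "X v0 \<preceq> ?H" by (rule alm_sub[OF sH sumL_base[OF sX sX]])
  have u: "u \<in> V" "m u ` A v0 \<preceq> K" using Cons.prems by (auto simp: lz_def)
  have IH: "lz m V ?H W \<preceq> lz m V (X v0) W" using Cons by simp
  have "lz m V (X u \<uplus> ?H) W \<preceq> lz m V ?H W"
  proof (cases "?H \<preceq> X u")
    case True
    have "X u \<preceq> X v0" by (rule no_larger_image[OF dW dK u(2) alm_trans[OF base True]])
    then have "X u \<uplus> ?H \<preceq> ?H" using alm_plus[OF alm_trans[OF _ base] alm_refl[OF sH] sH] by blast
    from alm_sub[OF sg_lz[OF sV sH] lz_monoK[OF this]] show ?thesis .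
  next
    case False
    have "?H \<preceq> L" by (rule sumL_least[OF sL XL[OF v0]]) (use Cons.prems in \<open>auto intro!: XL simp: lz_def\<close>)
    then show ?thesis by (intro S3[OF dX dH KX alm_trans[OF KX base] XL[OF u(1)] _ False])
  qed
  then show ?case using alm_trans IH by simp
qed

lemma ds_sumL: assumes "ds E S" "ds E T" "ds E U"
  shows "ds E (\<lambda>e. sumL (U e) (im (S e) (T e)) (map e js))"
proof (induction js)
  case (Cons j js)
  show ?case unfolding list.map sumL.simps by (intro dintro assms Cons)
qed (use assms in simp)

text \<open>This makes division by \<open>v0\<close> possible for almost all multiples.\<close>
lemma X2: assumes v0: "v0 \<in> V" shows "lz m V K (A v0) \<preceq> lz m V (X v0) W"
proof (rule ccontr)
  let ?V0 = "lz m V K (A v0)" and ?T = "lz m V (X v0) W"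
  have sT: "sg ?T" by (rule sg_lz[OF sV sX])
  assume "\<not> ?V0 \<preceq> ?T"
  then obtain v where v: "\<And>i. v i \<in> ?V0" "\<And>i j :: nat. i \<noteq> j \<Longrightarrow> v i - v j \<notin> ?T"
    by (rule alm_seqE[OF _ sT]) blast
  obtain B where B: "finite B" "ds B (\<lambda>e. V)" "ds B (\<lambda>e. W)" "ds B (\<lambda>e. K)" "ds B (\<lambda>e. X v0)"
    using dsub_params[of "{V, W, K, X v0}"] dV dW dK dX by auto
  have "\<exists>q. \<forall>e. lz m V (sumL (X v0) X (map e [0..<k])) W \<preceq> ?T \<longrightarrow> almk q (lz m V (sumL (X v0) X (map e [0..<k])) W) ?T" for k
    by (rule alm_bound[OF B(1)]) (intro dintro ds_sumL B)+
  then obtain q where q: "\<And>k e. lz m V (sumL (X v0) X (map e [0..<k])) W \<preceq> ?T \<Longrightarrow>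
      almk (q k) (lz m V (sumL (X v0) X (map e [0..<k])) W) ?T" by metis
  define Q where "Q = Max (q ` {..nb})"
  let ?vs = "map v [0..<Suc Q]"
  obtain us where us: "set us \<subseteq> set ?vs" "length us \<le> nb" "sumL (X v0) X ?vs \<preceq> sumL (X v0) X us"
    using few_summands[of "X v0" X ?vs] dX by blast
  have "set us \<subseteq> ?V0" using us(1) v(1) by auto
  from lu_sum[OF v0 this] have "almk (q (length us)) (lz m V (sumL (X v0) X us) W) ?T"
    using q[of "\<lambda>i. us ! i" "length us"] by (simp add: map_nth)
  moreover have "q (length us) \<le> Q" unfolding Q_def by (rule Max_ge) (use us(2) in auto)
  ultimately have ak: "almk Q (lz m V (sumL (X v0) X us) W) ?T" by (rule almk_mono)
  have inj: "inj_on v {..<Suc Q}"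
  proof
    fix i j assume "v i = v j"
    then show "i = j" using v(2)[of i j] sg_0[OF sT] by auto
  qed
  have "card (v ` {..<Suc Q}) \<le> Q"
  proof (rule almk_seq[OF ak sT])
    show "v ` {..<Suc Q} \<subseteq> lz m V (sumL (X v0) X us) W"
    proof (rule image_subsetI)
      fix i assume "i \<in> {..<Suc Q}"
      then have "v i \<in> set ?vs" by (simp add: image_iff del: upt_Suc) auto
      then have "m (v i) ` W \<subseteq> sumL (X v0) X ?vs"
        by (intro order_trans[OF im_sub[OF sK] sumL_mem[of "X v0" X, OF sX sX]])
      then have "m (v i) ` W \<preceq> sumL (X v0) X us" using le_alm us(3) by blast
      then show "v i \<in> lz m V (sumL (X v0) X us) W" using v(1)[of i] by (auto simp: lz_def)
    qed
    fix x y assume "x \<in> v ` {..<Suc Q}" "y \<in> v ` {..<Suc Q}" "x \<noteq> y"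
    then show "x - y \<notin> ?T" using v(2) by (metis imageE)
  qed simp
  then show False using card_image[OF inj] by simp
qed

end

section \<open>Endomorphisms of a quotient as relations\<close>

locale subquotient =
  fixes U N :: "'g :: ab_group_add set"
  assumes U: "sg U" and N: "sg N" and NU: "N \<subseteq> U"
begin

text \<open>Endomorphisms of the quotient of \<open>U\<close> by \<open>N\<close> are represented by their full inverse images in \<open>U \<times> U\<close>.
  Composition and pointwise addition of relations then give the ring operations without quotient
  types, and by maximality an inclusion between two such relations is an equality.\<close>
definition endo :: "('g \<times> 'g) set \<Rightarrow> bool" where
  "endo F \<longleftrightarrow> F \<subseteq> U \<times> U \<and> (\<forall>x y x' y'. (x, y) \<in> F \<longrightarrow> (x', y') \<in> F \<longrightarrow> (x - x', y - y') \<in> F) \<and>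
     N \<times> N \<subseteq> F \<and> (\<forall>x\<in>U. \<exists>y. (x, y) \<in> F) \<and> (\<forall>x y. (x, y) \<in> F \<longrightarrow> x \<in> N \<longrightarrow> y \<in> N)"

lemma endo_U: "endo F \<Longrightarrow> (x, y) \<in> F \<Longrightarrow> x \<in> U \<and> y \<in> U" unfolding endo_def by blast
lemma endo_diff: "endo F \<Longrightarrow> (x, y) \<in> F \<Longrightarrow> (x', y') \<in> F \<Longrightarrow> (x - x', y - y') \<in> F" unfolding endo_def by blast
lemma endo_N: "endo F \<Longrightarrow> x \<in> N \<Longrightarrow> y \<in> N \<Longrightarrow> (x, y) \<in> F" unfolding endo_def by blast
lemma endo_total: "endo F \<Longrightarrow> x \<in> U \<Longrightarrow> \<exists>y. (x, y) \<in> F" unfolding endo_def by blast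
lemma endo_small: "endo F \<Longrightarrow> (x, y) \<in> F \<Longrightarrow> x \<in> N \<Longrightarrow> y \<in> N" unfolding endo_def by blast
lemma endo_add: assumes F: "endo F" and "(x, y) \<in> F" "(x', y') \<in> F" shows "(x + x', y + y') \<in> F"
proof -
  have "(0 - x', 0 - y') \<in> F" using endo_diff[OF F endo_N[OF F sg_0[OF N] sg_0[OF N]] assms(3)] .
  from endo_diff[OF F assms(2) this] show ?thesis by simp
qed
lemma endo_shift: assumes F: "endo F" and "(x', y') \<in> F" "x - x' \<in> N" "y - y' \<in> N" shows "(x, y) \<in> F"
  using endo_add[OF F assms(2) endo_N[OF F assms(3,4)]] by simp
lemma endo_unique: assumes F: "endo F" and "(x, y) \<in> F" "(x', y') \<in> F" "x - x' \<in> N" shows "y - y' \<in> N"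
  using endo_small[OF F endo_diff[OF F assms(2,3)] assms(4)] .
lemma endo_eqI: assumes F: "endo F" and G: "endo G" and "F \<subseteq> G" shows "F = G"
proof (intro equalityI subrelI)
  fix x y assume xy: "(x, y) \<in> G"
  then have "x \<in> U" using endo_U[OF G] by blast
  then obtain y' where y': "(x, y') \<in> F" using endo_total[OF F] by blast
  have "y - y' \<in> N" by (rule endo_unique[OF G xy]) (use y' assms(3) sg_0[OF N] in auto)
  then show "(x, y) \<in> F" using endo_shift[OF F y', of x y] sg_0[OF N] by simp
qed (use assms in blast)

definition eadd :: "('g \<times> 'g) set \<Rightarrow> ('g \<times> 'g) set \<Rightarrow> ('g \<times> 'g) set" where
  "eadd F G = {(x, y + y') | x y y'. (x, y) \<in> F \<and> (x, y') \<in> G}"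
definition ezero :: "('g \<times> 'g) set" where "ezero = U \<times> N"
definition eone :: "('g \<times> 'g) set" where "eone = {(x, y). x \<in> U \<and> y \<in> U \<and> x - y \<in> N}"
definition eneg :: "('g \<times> 'g) set \<Rightarrow> ('g \<times> 'g) set" where "eneg F = {(x, - y) | x y. (x, y) \<in> F}"

lemma endo_zero: "endo ezero"
  unfolding endo_def ezero_def using sg_diff[OF U] sg_diff[OF N] sg_0[OF N] NU by auto
lemma endo_one: "endo eone"
  unfolding endo_def
proof (intro conjI allI impI ballI subsetI)
  fix p assume "p \<in> eone" then show "p \<in> U \<times> U" by (auto simp: eone_def)
next
  fix x y x' y' assume *: "(x, y) \<in> eone" "(x', y') \<in> eone"
  have e: "x - x' - (y - y') = x - y - (x' - y')" by simp
  have "x - x' - (y - y') \<in> N" unfolding e by (rule sg_diff[OF N]) (use * in \<open>simp_all add: eone_def\<close>)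
  then show "(x - x', y - y') \<in> eone" using * sg_diff[OF U] by (simp add: eone_def)
next
  fix p assume "p \<in> N \<times> N"
  then show "p \<in> eone" using sg_diff[OF N] NU by (auto simp: eone_def)
next
  fix x assume "x \<in> U"
  then have "(x, x) \<in> eone" using sg_0[OF N] by (simp add: eone_def)
  then show "\<exists>y. (x, y) \<in> eone" ..
next
  fix x y assume "(x, y) \<in> eone" "x \<in> N"
  then show "y \<in> N" using sg_diff[OF N, of x "x - y"] by (simp add: eone_def)
qed
lemma endo_eneg: assumes F: "endo F" shows "endo (eneg F)"
  unfolding endo_def
proof (intro conjI allI impI ballI subsetI)
  fix p assume "p \<in> eneg F"
  then show "p \<in> U \<times> U" unfolding eneg_def using endo_U[OF F] sg_neg[OF U] by auto
next
  fix x y x' y' assume "(x, y) \<in> eneg F" "(x', y') \<in> eneg F"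
  then have "(x, - y) \<in> F" "(x', - y') \<in> F" by (auto simp: eneg_def)
  from endo_diff[OF F this] show "(x - x', y - y') \<in> eneg F"
    unfolding eneg_def by (intro CollectI exI[of _ "x - x'"] exI[of _ "- y - - y'"]) simp
next
  fix p assume "p \<in> N \<times> N"
  then obtain x y where p: "p = (x, y)" "x \<in> N" "- y \<in> N" using sg_neg[OF N] by auto
  then show "p \<in> eneg F" unfolding eneg_def using endo_N[OF F p(2,3)] by force
next
  fix x assume "x \<in> U" then show "\<exists>y. (x, y) \<in> eneg F" using endo_total[OF F] by (auto simp: eneg_def)
next
  fix x y assume "(x, y) \<in> eneg F" "x \<in> N"
  then show "y \<in> N" unfolding eneg_def using endo_small[OF F] sg_neg[OF N] by auto
qed
lemma endo_eadd: assumes F: "endo F" and G: "endo G" shows "endo (eadd F G)"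
  unfolding endo_def
proof (intro conjI allI impI ballI subsetI)
  fix p assume "p \<in> eadd F G"
  then show "p \<in> U \<times> U" unfolding eadd_def using endo_U[OF F] endo_U[OF G] sg_add[OF U] by auto
next
  fix x y x' y' assume "(x, y) \<in> eadd F G" "(x', y') \<in> eadd F G"
  then obtain a b a' b' where *: "y = a + b" "y' = a' + b'" "(x, a) \<in> F" "(x, b) \<in> G" "(x', a') \<in> F" "(x', b') \<in> G"
    by (auto simp: eadd_def)
  have e: "y - y' = (a - a') + (b - b')" using * by simp
  show "(x - x', y - y') \<in> eadd F G" unfolding eadd_def e
    using endo_diff[OF F *(3,5)] endo_diff[OF G *(4,6)] by blast
next
  fix p assume "p \<in> N \<times> N"
  then obtain x y where p: "p = (x, y + 0)" "x \<in> N" "y \<in> N" by auto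
  then show "p \<in> eadd F G" unfolding eadd_def using endo_N[OF F p(2,3)] endo_N[OF G p(2) sg_0[OF N]] by blast
next
  fix x assume x: "x \<in> U"
  then show "\<exists>y. (x, y) \<in> eadd F G" using endo_total[OF F x] endo_total[OF G x] by (auto simp: eadd_def)
next
  fix x y assume "(x, y) \<in> eadd F G" "x \<in> N"
  then show "y \<in> N" unfolding eadd_def using endo_small[OF F] endo_small[OF G] sg_add[OF N] by auto
qed
lemma endo_comp: assumes F: "endo F" and G: "endo G" shows "endo (F O G)"
  unfolding endo_def
proof (intro conjI allI impI ballI subsetI)
  fix p assume "p \<in> F O G"
  then show "p \<in> U \<times> U" using endo_U[OF F] endo_U[OF G] by auto
next
  fix x y x' y' assume "(x, y) \<in> F O G" "(x', y') \<in> F O G"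
  then obtain a a' where *: "(x, a) \<in> F" "(x', a') \<in> F" "(a, y) \<in> G" "(a', y') \<in> G" by auto
  show "(x - x', y - y') \<in> F O G" using endo_diff[OF F *(1,2)] endo_diff[OF G *(3,4)] by blast
next
  fix p assume "p \<in> N \<times> N"
  then obtain x y where p: "p = (x, y)" "x \<in> N" "y \<in> N" by auto
  then show "p \<in> F O G" using endo_N[OF F p(2) sg_0[OF N]] endo_N[OF G sg_0[OF N] p(3)] by blast
next
  fix x assume x: "x \<in> U"
  then obtain y where y: "(x, y) \<in> F" using endo_total[OF F] by blast
  then obtain z where "(y, z) \<in> G" using endo_total[OF G] endo_U[OF F] by blast
  then show "\<exists>z. (x, z) \<in> F O G" using y by blast
next
  fix x y assume "(x, y) \<in> F O G" "x \<in> N"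
  then show "y \<in> N" using endo_small[OF F] endo_small[OF G] by blast
qed

definition endo_ring :: "('g \<times> 'g) set set \<Rightarrow> ('g \<times> 'g) set ring" where
  "endo_ring C = \<lparr>carrier = C, monoid.mult = (O), one = eone, zero = ezero, add = eadd\<rparr>"

lemma eadd_comm: "eadd F G = eadd G F"
proof -
  have "eadd F G \<subseteq> eadd G F" for F G
  proof
    fix p assume "p \<in> eadd F G"
    then obtain x y y' where "p = (x, y' + y)" "(x, y) \<in> F" "(x, y') \<in> G" by (auto simp: eadd_def add.commute)
    then show "p \<in> eadd G F" unfolding eadd_def by blast
  qed
  then show ?thesis by blast
qed
lemma eadd_assoc: "eadd (eadd F G) H = eadd F (eadd G H)"
proof (intro equalityI subsetI)
  fix p assume "p \<in> eadd (eadd F G) H"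
  then obtain x a b c where "p = (x, a + (b + c))" "(x, a) \<in> F" "(x, b) \<in> G" "(x, c) \<in> H"
    by (auto simp: eadd_def add.assoc)
  then show "p \<in> eadd F (eadd G H)" unfolding eadd_def by blast
next
  fix p assume "p \<in> eadd F (eadd G H)"
  then obtain x a b c where "p = (x, a + b + c)" "(x, a) \<in> F" "(x, b) \<in> G" "(x, c) \<in> H"
    by (auto simp: eadd_def add.assoc)
  then show "p \<in> eadd (eadd F G) H" unfolding eadd_def by blast
qed
lemma eadd_zero: assumes F: "endo F" shows "eadd ezero F = F"
proof (rule endo_eqI[OF F endo_eadd[OF endo_zero F], symmetric], rule subrelI)
  fix x y assume xy: "(x, y) \<in> F"
  then have "(x, 0) \<in> ezero" using endo_U[OF F] sg_0[OF N] by (auto simp: ezero_def)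
  then have "(x, 0 + y) \<in> eadd ezero F" unfolding eadd_def using xy by blast
  then show "(x, y) \<in> eadd ezero F" by simp
qed
lemma eadd_eneg: assumes F: "endo F" shows "eadd (eneg F) F = ezero"
proof (rule endo_eqI[OF endo_eadd[OF endo_eneg[OF F] F] endo_zero], rule subrelI)
  fix x z assume "(x, z) \<in> eadd (eneg F) F"
  then obtain y y' where z: "z = - y + y'" "(x, y) \<in> F" "(x, y') \<in> F" by (auto simp: eadd_def eneg_def)
  have "y' - y \<in> N" by (rule endo_unique[OF F z(3,2)]) (use sg_0[OF N] in simp)
  then show "(x, z) \<in> ezero" using z endo_U[OF F] by (auto simp: ezero_def)
qed
lemma comp_one: assumes F: "endo F" shows "F O eone = F" "eone O F = F"
proof -
  have i: "(x, x) \<in> eone" if "x \<in> U" for x using that sg_0[OF N] by (auto simp: eone_def)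
  show "F O eone = F" by (rule endo_eqI[OF F endo_comp[OF F endo_one], symmetric], rule subrelI) (use i endo_U[OF F] in blast)
  show "eone O F = F" by (rule endo_eqI[OF F endo_comp[OF endo_one F], symmetric], rule subrelI) (use i endo_U[OF F] in blast)
qed
lemma comp_distr_l: assumes F: "endo F" and G: "endo G" and H: "endo H"
  shows "(eadd F G) O H = eadd (F O H) (G O H)"
proof (rule endo_eqI[OF endo_eadd[OF endo_comp[OF F H] endo_comp[OF G H]] endo_comp[OF endo_eadd[OF F G] H], symmetric], rule subrelI)
  fix x z assume "(x, z) \<in> eadd (F O H) (G O H)"
  then obtain a b y y' where *: "z = a + b" "(x, y) \<in> F" "(x, y') \<in> G" "(y, a) \<in> H" "(y', b) \<in> H" unfolding eadd_def by blast
  have "(x, y + y') \<in> eadd F G" using * unfolding eadd_def by blast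
  then show "(x, z) \<in> eadd F G O H" using endo_add[OF H *(4,5)] *(1) by blast
qed
lemma comp_distr_r: assumes F: "endo F" and G: "endo G" and H: "endo H"
  shows "H O (eadd F G) = eadd (H O F) (H O G)"
proof (rule endo_eqI[OF endo_comp[OF H endo_eadd[OF F G]] endo_eadd[OF endo_comp[OF H F] endo_comp[OF H G]]], rule subrelI)
  fix x z assume "(x, z) \<in> H O eadd F G"
  then obtain a b y where *: "z = a + b" "(x, y) \<in> H" "(y, a) \<in> F" "(y, b) \<in> G" unfolding eadd_def by blast
  then show "(x, z) \<in> eadd (H O F) (H O G)" unfolding eadd_def by blast
qed

lemma ring_endo_ring:
  assumes C: "\<And>F. F \<in> C \<Longrightarrow> endo F" "ezero \<in> C" "eone \<in> C"
    "\<And>F G. F \<in> C \<Longrightarrow> G \<in> C \<Longrightarrow> eadd F G \<in> C" "\<And>F G. F \<in> C \<Longrightarrow> G \<in> C \<Longrightarrow> F O G \<in> C"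
    "\<And>F. F \<in> C \<Longrightarrow> eneg F \<in> C"
  shows "ring (endo_ring C)"
proof (rule ringI)
  show "abelian_group (endo_ring C)"
  proof (rule abelian_groupI)
    fix F assume "F \<in> carrier (endo_ring C)"
    then have "F \<in> C" by (simp add: endo_ring_def)
    then show "\<exists>G\<in>carrier (endo_ring C). G \<oplus>\<^bsub>endo_ring C\<^esub> F = \<zero>\<^bsub>endo_ring C\<^esub>"
      using C(6) eadd_eneg[OF C(1)] by (auto simp: endo_ring_def)
  qed (use C eadd_assoc eadd_comm eadd_zero in \<open>auto simp: endo_ring_def\<close>)
  show "Group.monoid (endo_ring C)"
    by (rule monoidI) (use C comp_one in \<open>auto simp: endo_ring_def O_assoc\<close>)
qed (use C comp_distr_l comp_distr_r in \<open>auto simp: endo_ring_def\<close>)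

end

lemma (in abelian_group) minus_eqI: "x \<in> carrier G \<Longrightarrow> y \<in> carrier G \<Longrightarrow> z \<in> carrier G \<Longrightarrow> z \<oplus> y = x \<Longrightarrow> x \<ominus> y = z"
  by (auto simp: a_minus_def a_assoc r_neg)

section \<open>The residue ring\<close>

lemma range_diff: "range x \<preceq> K \<Longrightarrow> range y \<preceq> K \<Longrightarrow> sg K \<Longrightarrow> range (\<lambda>i. x i - y i) \<preceq> (K :: 'a :: ab_group_add set)"
  by (rule alm_diff_img)
lemma range_neg: assumes "range y \<preceq> K" "sg K" shows "range (\<lambda>i. - y i) \<preceq> (K :: 'a :: ab_group_add set)"
proof -
  have "range (\<lambda>i. 0 :: 'a) \<preceq> K" by (rule alm_sub[OF assms(2)]) (use sg_0[OF assms(2)] in auto)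
  from range_diff[OF this assms(1), OF assms(2)] show ?thesis by simp
qed
lemma range_add: assumes "range x \<preceq> K" "range y \<preceq> K" "sg K" shows "range (\<lambda>i. x i + y i) \<preceq> (K :: 'a :: ab_group_add set)"
  using range_diff[OF assms(1) range_neg[OF assms(2,3)] assms(3)] by simp
lemma finite_alm: "finite F \<Longrightarrow> sg B \<Longrightarrow> F \<preceq> B"
  unfolding alm_def using sg_0[of B] by (intro exI[of _ F]) force

text \<open>Let \<open>v0\<close> be such that the elements killing its annihilator are not almost all in \<open>Z\<close>. An element \<open>u\<close> with the same
  annihilator and image up to finite index defines a map ``divide \<open>u x\<close> by \<open>v0\<close>'' from \<open>W\<close> to itself up to
  finite index. To obtain honest endomorphisms, \<open>W\<close> is replaced by sequences in \<open>W\<close>, modulo the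
  sequences whose range is almost contained in \<open>A v0\<close>.\<close>
locale residue_setting = minform +
  fixes v0 :: 'a
  assumes v0: "v0 \<in> V" and big: "\<not> lz m V K (A v0) \<preceq> Z"
begin

definition sqs :: "(nat \<Rightarrow> 'a) set" where "sqs = {x. range x \<subseteq> W}"
definition small :: "(nat \<Rightarrow> 'a) set" where "small = {x \<in> sqs. range x \<preceq> A v0}"

lemma sqsD: "x \<in> sqs \<Longrightarrow> x i \<in> W" unfolding sqs_def by blast
lemma sqsI: "(\<And>i. x i \<in> W) \<Longrightarrow> x \<in> sqs" unfolding sqs_def by blast

sublocale sq: subquotient sqs small
proof
  show "sg sqs" unfolding sqs_def by (rule sg_I) (use sg_0[OF sW] sg_diff[OF sW] in auto)
  then have d: "x - y \<in> sqs" if "x \<in> sqs" "y \<in> sqs" for x y using that by (rule sg_diff)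
  show "sg small"
  proof (rule sg_I)
    show "0 \<in> small" unfolding small_def using sg_0[OF \<open>sg sqs\<close>] alm_sub[OF sA, of "range 0" v0] sg_0[OF sA] by auto
    fix x y assume "x \<in> small" "y \<in> small"
    then show "x - y \<in> small" unfolding small_def using d range_diff[of x "A v0" y] sA by (auto simp: fun_diff_def)
  qed
  show "small \<subseteq> sqs" by (auto simp: small_def)
qed

lemma smallI: "x \<in> sqs \<Longrightarrow> range x \<preceq> A v0 \<Longrightarrow> x \<in> small" by (simp add: small_def)
lemma smallD: "x \<in> small \<Longrightarrow> range x \<preceq> A v0" by (simp add: small_def)
lemma small_A: "(\<And>i. x i \<in> A v0) \<Longrightarrow> x \<in> small"
  by (rule smallI[OF sqsI alm_sub[OF sA]]) (use AW[of v0] in auto)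

text \<open>A sequence with finitely many values is small.\<close>
lemma pick: assumes "W \<preceq> P" "sg P" "x \<in> sqs" shows "\<exists>x'. (\<forall>i. x' i \<in> P) \<and> x - x' \<in> small"
proof -
  from alm_reps[OF assms(1,2)] obtain F where F: "finite F" "F \<subseteq> W" "\<forall>a\<in>W. \<exists>f\<in>F. a - f \<in> P" by blast
  have "\<forall>i. \<exists>f. f \<in> F \<and> x i - f \<in> P" using F(3) sqsD[OF assms(3)] by blast
  from choice[OF this] obtain f where f: "\<And>i. f i \<in> F" "\<And>i. x i - f i \<in> P" by blast
  have "f \<in> small"
  proof (rule smallI[OF sqsI])
    show "f i \<in> W" for i using f F by blast
    have "finite (range f)" by (rule finite_subset[OF _ F(1)]) (use f in blast)
    then show "range f \<preceq> A v0" by (rule finite_alm) (rule sA)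
  qed
  then show ?thesis using f(2) by (intro exI[of _ "\<lambda>i. x i - f i"]) (simp add: fun_diff_def)
qed

text \<open>The additive relation \<open>G\<close> on \<open>W\<close>, applied termwise to sequences, induces the endomorphism \<open>F\<close>.\<close>
definition represents :: "('a \<Rightarrow> 'a \<Rightarrow> bool) \<Rightarrow> ((nat \<Rightarrow> 'a) \<times> (nat \<Rightarrow> 'a)) set \<Rightarrow> bool" where
  "represents G F \<longleftrightarrow> sq.endo F \<and> G 0 0 \<and> (\<forall>x y x' y'. G x y \<longrightarrow> G x' y' \<longrightarrow> G (x - x') (y - y')) \<and>
     (\<forall>x y. G x y \<longrightarrow> x \<in> W \<and> y \<in> W) \<and> W \<preceq> {x. \<exists>y. G x y} \<and>
     (\<forall>x y. (\<forall>i. G (x i) (y i)) \<longrightarrow> (x, y) \<in> F)"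

lemma rep_endo: "represents G F \<Longrightarrow> sq.endo F" unfolding represents_def by blast
lemma rep_0: "represents G F \<Longrightarrow> G 0 0" unfolding represents_def by blast
lemma rep_diff: "represents G F \<Longrightarrow> G x y \<Longrightarrow> G x' y' \<Longrightarrow> G (x - x') (y - y')" unfolding represents_def by blast
lemma rep_W: "represents G F \<Longrightarrow> G x y \<Longrightarrow> x \<in> W \<and> y \<in> W" unfolding represents_def by blast
lemma rep_dom: "represents G F \<Longrightarrow> W \<preceq> {x. \<exists>y. G x y}" unfolding represents_def by blast
lemma rep_seq: "represents G F \<Longrightarrow> (\<And>i. G (x i) (y i)) \<Longrightarrow> (x, y) \<in> F" unfolding represents_def by blast
lemma rep_sg: assumes "represents G F" shows "sg {x. \<exists>y. G x y}"
  by (rule sg_I) (use rep_0[OF assms] rep_diff[OF assms] in blast)+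

lemma rep_pick: assumes G: "represents G F" and x: "x \<in> sqs"
  shows "\<exists>x' y'. (\<forall>i. G (x' i) (y' i)) \<and> x - x' \<in> small"
proof -
  obtain x' where x': "\<forall>i. x' i \<in> {x. \<exists>y. G x y}" "x - x' \<in> small"
    using pick[OF rep_dom[OF G] rep_sg[OF G] x] by blast
  then have "\<forall>i. \<exists>y. G (x' i) y" by blast
  from choice[OF this] show ?thesis using x'(2) by blast
qed

text \<open>Termwise \<open>G\<close> already meets every class of sequences modulo small ones, hence determines \<open>F\<close>.
  So there are no more definable endomorphisms than definable binary relations.\<close>
lemma represents_unique: assumes G: "represents G F" "represents G F'" shows "F = F'"
proof -
  have "F \<subseteq> F'" if G: "represents G F" "represents G F'" for F F'
  proof (rule subrelI)
    note E = rep_endo[OF G(1)] rep_endo[OF G(2)]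
    fix x y assume xy: "(x, y) \<in> F"
    obtain x' y' where *: "\<And>i. G (x' i) (y' i)" "x - x' \<in> small"
      using rep_pick[OF G(1)] sq.endo_U[OF E(1) xy] by blast
    have "(x', y') \<in> F" "(x', y') \<in> F'" using rep_seq G *(1) by blast+
    then show "(x, y) \<in> F'" using sq.endo_shift[OF E(2) _ *(2)] sq.endo_unique[OF E(1) xy _ *(2)] by blast
  qed
  then show ?thesis using G by blast
qed

lemma representsI:
  assumes "sq.endo F" "G 0 0" "\<And>x y x' y'. G x y \<Longrightarrow> G x' y' \<Longrightarrow> G (x - x') (y - y')"
    "\<And>x y. G x y \<Longrightarrow> x \<in> W \<and> y \<in> W" "W \<preceq> {x. \<exists>y. G x y}"
    "\<And>x y. (\<And>i. G (x i) (y i)) \<Longrightarrow> (x, y) \<in> F"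
  shows "represents G F"
  unfolding represents_def using assms by (intro conjI allI impI) blast+
lemma represents_one: "represents (\<lambda>x y. x = y \<and> x \<in> W) sq.eone"
proof (rule representsI[OF sq.endo_one])
  fix x y :: "nat \<Rightarrow> 'a" assume *: "\<And>i. x i = y i \<and> x i \<in> W"
  then have "x = y" "x \<in> sqs" by (auto intro: sqsI)
  then show "(x, y) \<in> sq.eone" using sg_0[OF sq.N] by (simp add: sq.eone_def)
next
  show "W \<preceq> {x. \<exists>y. x = y \<and> x \<in> W}" using alm_refl[OF sW] by simp
qed (use sg_0[OF sW] sg_diff[OF sW] in simp_all)
lemma represents_zero: "represents (\<lambda>x y. y = 0 \<and> x \<in> W) sq.ezero"
proof (rule representsI[OF sq.endo_zero])
  fix x y :: "nat \<Rightarrow> 'a" assume *: "\<And>i. y i = 0 \<and> x i \<in> W"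
  then have "y = 0" "x \<in> sqs" by (auto intro: sqsI)
  then show "(x, y) \<in> sq.ezero" using sg_0[OF sq.N] by (simp add: sq.ezero_def)
next
  show "W \<preceq> {x. \<exists>y. y = 0 \<and> x \<in> W}" using alm_refl[OF sW] by simp
qed (use sg_0[OF sW] sg_diff[OF sW] in simp_all)
lemma represents_eneg: assumes G: "represents G F" shows "represents (\<lambda>x y. G x (- y)) (sq.eneg F)"
  unfolding represents_def
proof (intro conjI allI impI)
  show "sq.endo (sq.eneg F)" by (rule sq.endo_eneg[OF rep_endo[OF G]])
  show "G 0 (- 0)" using rep_0[OF G] by simp
  show "G (x - x') (- (y - y'))" if "G x (- y)" "G x' (- y')" for x y x' y'
    using rep_diff[OF G that] by (simp add: algebra_simps)
  show "x \<in> W" "y \<in> W" if "G x (- y)" for x y using rep_W[OF G that] sg_neg[OF sW, of "- y"] by auto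
  have "(\<exists>y. G x (- y)) \<longleftrightarrow> (\<exists>y. G x y)" for x by (metis minus_minus)
  then show "W \<preceq> {x. \<exists>y. G x (- y)}" using rep_dom[OF G] by simp
  show "(x, y) \<in> sq.eneg F" if "\<forall>i. G (x i) (- y i)" for x y
    using rep_seq[OF G, of x "\<lambda>i. - y i"] that unfolding sq.eneg_def
    by (intro CollectI exI[of _ x] exI[of _ "- y"]) (simp add: fun_Compl_def)
qed
lemma represents_eadd: assumes G: "represents G F" and H: "represents H F'"
  shows "represents (\<lambda>x y. \<exists>a. G x a \<and> H x (y - a)) (sq.eadd F F')"
  unfolding represents_def
proof (intro conjI allI impI)
  show "sq.endo (sq.eadd F F')" by (rule sq.endo_eadd[OF rep_endo[OF G] rep_endo[OF H]])
  show "\<exists>a. G 0 a \<and> H 0 (0 - a)" using rep_0[OF G] rep_0[OF H] by (intro exI[of _ 0]) simp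
  show "\<exists>a. G (x - x') a \<and> H (x - x') (y - y' - a)"
    if p: "\<exists>a. G x a \<and> H x (y - a)" "\<exists>a. G x' a \<and> H x' (y' - a)" for x y x' y'
  proof -
    obtain a a' where a: "G x a" "H x (y - a)" "G x' a'" "H x' (y' - a')" using p by blast
    have e: "y - y' - (a - a') = y - a - (y' - a')" by simp
    show ?thesis by (rule exI[of _ "a - a'"], unfold e) (use rep_diff[OF G a(1,3)] rep_diff[OF H a(2,4)] in blast)
  qed
  show "x \<in> W" "y \<in> W" if *: "\<exists>a. G x a \<and> H x (y - a)" for x y
  proof -
    obtain a where a: "G x a" "H x (y - a)" using * by blast
    show "x \<in> W" using rep_W[OF G a(1)] by blast
    show "y \<in> W" using rep_W[OF G a(1)] rep_W[OF H a(2)] sg_add[OF sW, of a "y - a"] by simp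
  qed
  have "{x. \<exists>y. G x y} \<inter> {x. \<exists>y. H x y} \<subseteq> {x. \<exists>y a. G x a \<and> H x (y - a)}"
  proof
    fix x assume "x \<in> {x. \<exists>y. G x y} \<inter> {x. \<exists>y. H x y}"
    then obtain a b where "G x a" "H x b" by blast
    then show "x \<in> {x. \<exists>y a. G x a \<and> H x (y - a)}"
      by (intro CollectI exI[of _ "a + b"] exI[of _ a]) simp
  qed
  then show "W \<preceq> {x. \<exists>y a. G x a \<and> H x (y - a)}"
    by (rule alm_mono[OF alm_int[OF rep_dom[OF G] rep_dom[OF H] rep_sg[OF G] rep_sg[OF H]] subset_refl])
  show "(x, y) \<in> sq.eadd F F'" if *: "\<forall>i. \<exists>a. G (x i) a \<and> H (x i) (y i - a)" for x y
  proof -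
    from choice[OF *] obtain a where a: "\<And>i. G (x i) (a i)" "\<And>i. H (x i) (y i - a i)" by blast
    have "(x, a) \<in> F" "(x, y - a) \<in> F'" using rep_seq[OF G a(1)] rep_seq[OF H a(2)] by (auto simp: fun_diff_def)
    then show ?thesis unfolding sq.eadd_def by (intro CollectI exI[of _ x] exI[of _ a] exI[of _ "y - a"]) simp
  qed
qed
lemma represents_comp: assumes G: "represents G F" and H: "represents H F'"
  shows "represents (\<lambda>x z. \<exists>y. G x y \<and> H y z) (F O F')"
  unfolding represents_def
proof (intro conjI allI impI)
  show "sq.endo (F O F')" by (rule sq.endo_comp[OF rep_endo[OF G] rep_endo[OF H]])
  show "\<exists>y. G 0 y \<and> H y 0" using rep_0[OF G] rep_0[OF H] by blast
  show d: "\<exists>y. G (x - x') y \<and> H y (z - z')"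
    if "\<exists>y. G x y \<and> H y z" "\<exists>y. G x' y \<and> H y z'" for x z x' z'
    using that rep_diff[OF G] rep_diff[OF H] by blast
  show "x \<in> W" "z \<in> W" if "\<exists>y. G x y \<and> H y z" for x z using that rep_W[OF G] rep_W[OF H] by blast+
  have s: "sg {x. \<exists>z y. G x y \<and> H y z}"
  proof (rule sg_I)
    show "0 \<in> {x. \<exists>z y. G x y \<and> H y z}" using rep_0[OF G] rep_0[OF H] by blast
    fix x x' assume "x \<in> {x. \<exists>z y. G x y \<and> H y z}" "x' \<in> {x. \<exists>z y. G x y \<and> H y z}"
    then show "x - x' \<in> {x. \<exists>z y. G x y \<and> H y z}" using d[of x _ x'] by blast
  qed
  have "{x. \<exists>y. G x y} \<preceq> {x. \<exists>z y. G x y \<and> H y z}"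
  proof (rule ccontr)
    assume "\<not> {x. \<exists>y. G x y} \<preceq> {x. \<exists>z y. G x y \<and> H y z}"
    then obtain x where x: "\<And>i. x i \<in> {x. \<exists>y. G x y}"
      "\<And>i j :: nat. i \<noteq> j \<Longrightarrow> x i - x j \<notin> {x. \<exists>z y. G x y \<and> H y z}" by (rule alm_seqE[OF _ s]) blast
    have "\<forall>i. \<exists>y. G (x i) y" using x(1) by blast
    from choice[OF this] obtain y where y: "\<And>i. G (x i) (y i)" by blast
    have yW: "y i \<in> W" for i using rep_W[OF G y] by blast
    obtain r :: "nat \<Rightarrow> nat"
      where r: "strict_mono r" "\<And>i j. y (r i) - y (r j) \<in> {x. \<exists>y. H x y}"
      by (rule alm_subseqE[where x = y, OF rep_dom[OF H] rep_sg[OF H] yW]) blast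
    have "x (r 0) - x (r 1) \<in> {x. \<exists>z y. G x y \<and> H y z}"
      using rep_diff[OF G y[of "r 0"] y[of "r 1"]] r(2)[of 0 1] by blast
    moreover have "r 0 \<noteq> r 1" using r(1) by (simp add: strict_mono_eq)
    ultimately show False using x(2) by blast
  qed
  with rep_dom[OF G] show "W \<preceq> {x. \<exists>z y. G x y \<and> H y z}" by (rule alm_trans)
  show "(x, z) \<in> F O F'" if *: "\<forall>i. \<exists>y. G (x i) y \<and> H y (z i)" for x z
  proof -
    from choice[OF *] obtain y where y: "\<And>i. G (x i) (y i)" "\<And>i. H (y i) (z i)" by blast
    then show ?thesis using rep_seq[OF G, of x y, OF y(1)] rep_seq[OF H, of y z, OF y(2)] by blast
  qed
qed

text \<open>The endomorphism induced by \<open>u\<close> followed by division by \<open>v0\<close>.\<close>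
definition lam :: "'a \<Rightarrow> ((nat \<Rightarrow> 'a) \<times> (nat \<Rightarrow> 'a)) set" where
  "lam u = {(x, y). x \<in> sqs \<and> y \<in> sqs \<and> range (\<lambda>i. m u (x i) - m v0 (y i)) \<preceq> K}"
definition good :: "'a set" where "good = lz m V K (A v0) \<inter> lz m V (X v0) W"

lemma sg_good: "sg good" unfolding good_def by (intro sg_Int sg_lz sV sK sX)
lemma small_img: assumes "x \<in> small" "m u ` A v0 \<preceq> K" shows "range (\<lambda>i. m u (x i)) \<preceq> K"
proof -
  have "m u ` range x \<preceq> m u ` A v0" by (rule alm_img[OF addR smallD[OF assms(1)]])
  also note assms(2)
  finally show ?thesis by (simp add: image_image)
qed
lemma small_iff: assumes "x \<in> sqs" shows "x \<in> small \<longleftrightarrow> range (\<lambda>i. m v0 (x i)) \<preceq> K"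
  using img_alm_iff[OF sW sK, of "range x" v0] assms unfolding small_def sqs_def by (simp add: image_image)

lemma lam_rep: assumes u: "u \<in> good" shows "represents (\<lambda>x y. x \<in> W \<and> y \<in> W \<and> m u x - m v0 y \<in> K) (lam u)"
proof -
  have uA: "m u ` A v0 \<preceq> K" and uX: "m u ` W \<preceq> X v0" using u by (auto simp: good_def lz_def)
  have vA: "m v0 ` A v0 \<preceq> K" by (rule alm_sub[OF sK]) (auto simp: ann_def)
  have W: "W \<preceq> {x. \<exists>y. x \<in> W \<and> y \<in> W \<and> m u x - m v0 y \<in> K}"
  proof -
    have "W \<preceq> {x \<in> W. m u x \<in> X v0}" by (rule alm_pre[OF addR sX sW uX subset_refl])
    moreover have "{x \<in> W. m u x \<in> X v0} \<subseteq> {x. \<exists>y. x \<in> W \<and> y \<in> W \<and> m u x - m v0 y \<in> K}"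
      by (auto simp: im_def ssum_def)
    ultimately show ?thesis by (rule alm_mono[OF _ subset_refl])
  qed
  have d: "(x - x', y - y') \<in> lam u" if "(x, y) \<in> lam u" "(x', y') \<in> lam u" for x y x' y'
  proof -
    have "range (\<lambda>i. (m u (x i) - m v0 (y i)) - (m u (x' i) - m v0 (y' i))) \<preceq> K"
      by (rule range_diff) (use that sK in \<open>auto simp: lam_def\<close>)
    moreover have "(m u (x i) - m v0 (y i)) - (m u (x' i) - m v0 (y' i)) = m u ((x - x') i) - m v0 ((y - y') i)" for i
      by (simp add: m_diff)
    ultimately show ?thesis using that sg_diff[OF sq.U] by (auto simp: lam_def)
  qed
  have nn: "(x, y) \<in> lam u" if "x \<in> small" "y \<in> small" for x y
    using range_diff[OF small_img[OF that(1) uA] small_img[OF that(2) vA] sK] that sq.NU by (auto simp: lam_def)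
  have G0: "m u 0 - m v0 0 \<in> K" using sg_0[OF sK] by simp
  have Gd: "m u (x - x') - m v0 (y - y') \<in> K" if "m u x - m v0 y \<in> K" "m u x' - m v0 y' \<in> K" for x y x' y'
    using sg_diff[OF sK that] by (simp add: m_diff algebra_simps)
  have sq: "(x, y) \<in> lam u" if w: "\<And>i. x i \<in> W \<and> y i \<in> W \<and> m u (x i) - m v0 (y i) \<in> K" for x y
  proof -
    have "x \<in> sqs" "y \<in> sqs" using w sqsI by simp_all
    moreover have "range (\<lambda>i. m u (x i) - m v0 (y i)) \<subseteq> K" using w by blast
    ultimately show ?thesis unfolding lam_def using alm_sub[OF sK] by simp
  qed
  have Gd': "x - x' \<in> W \<and> y - y' \<in> W \<and> m u (x - x') - m v0 (y - y') \<in> K"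
    if "x \<in> W \<and> y \<in> W \<and> m u x - m v0 y \<in> K" "x' \<in> W \<and> y' \<in> W \<and> m u x' - m v0 y' \<in> K" for x y x' y'
    using that Gd sg_diff[OF sW] by simp
  have G0': "0 \<in> W \<and> 0 \<in> W \<and> m u 0 - m v0 0 \<in> K" using G0 sg_0[OF sW] by simp
  have sgG: "sg {x. \<exists>y. x \<in> W \<and> y \<in> W \<and> m u x - m v0 y \<in> K}"
  proof (rule sg_I)
    show "0 \<in> {x. \<exists>y. x \<in> W \<and> y \<in> W \<and> m u x - m v0 y \<in> K}" using G0' by blast
    fix x x' assume "x \<in> {x. \<exists>y. x \<in> W \<and> y \<in> W \<and> m u x - m v0 y \<in> K}" "x' \<in> {x. \<exists>y. x \<in> W \<and> y \<in> W \<and> m u x - m v0 y \<in> K}"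
    then obtain y y' where "x \<in> W \<and> y \<in> W \<and> m u x - m v0 y \<in> K" "x' \<in> W \<and> y' \<in> W \<and> m u x' - m v0 y' \<in> K" by blast
    from Gd'[OF this] show "x - x' \<in> {x. \<exists>y. x \<in> W \<and> y \<in> W \<and> m u x - m v0 y \<in> K}" by blast
  qed
  have tot: "\<exists>y. (x, y) \<in> lam u" if x: "x \<in> sqs" for x
  proof -
    obtain x' where x': "\<forall>i. x' i \<in> {x. \<exists>y. x \<in> W \<and> y \<in> W \<and> m u x - m v0 y \<in> K}" "x - x' \<in> small"
      using pick[OF W sgG x] by blast
    then have "\<forall>i. \<exists>y. x' i \<in> W \<and> y \<in> W \<and> m u (x' i) - m v0 y \<in> K" by blast
    from choice[OF this] obtain y where "\<And>i. x' i \<in> W \<and> y i \<in> W \<and> m u (x' i) - m v0 (y i) \<in> K" by blast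
    then have "(x', y) \<in> lam u" by (rule sq)
    moreover have "(0 - (x - x'), 0 - 0) \<in> lam u" by (rule d[OF nn[OF sg_0[OF sq.N] sg_0[OF sq.N]] nn[OF x'(2) sg_0[OF sq.N]]])
    ultimately have "(x' - (0 - (x - x')), y - (0 - 0)) \<in> lam u" by (rule d)
    moreover have "x' - (0 - (x - x')) = x" by simp
    ultimately show ?thesis by auto
  qed
  have sm: "y \<in> small" if "(x, y) \<in> lam u" "x \<in> small" for x y
  proof -
    have y: "y \<in> sqs" using that by (simp add: lam_def)
    have "range (\<lambda>i. m u (x i) - (m u (x i) - m v0 (y i))) \<preceq> K"
      by (rule range_diff[OF small_img[OF that(2) uA] _ sK]) (use that in \<open>simp add: lam_def\<close>)
    then show ?thesis using small_iff[OF y] by simp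
  qed
  have "sq.endo (lam u)" unfolding sq.endo_def
  proof (intro conjI allI impI ballI subsetI)
    show "p \<in> sqs \<times> sqs" if "p \<in> lam u" for p using that by (auto simp: lam_def)
    show "p \<in> lam u" if "p \<in> small \<times> small" for p using that nn by auto
  qed (fact d tot sm)+
  then show ?thesis
  proof (rule representsI)
    show "0 \<in> W \<and> 0 \<in> W \<and> m u 0 - m v0 0 \<in> K" by (rule G0')
  next
    show "W \<preceq> {x. \<exists>y. x \<in> W \<and> y \<in> W \<and> m u x - m v0 y \<in> K}" by (rule W)
  next
    show "(x, y) \<in> lam u" if "\<And>i. x i \<in> W \<and> y i \<in> W \<and> m u (x i) - m v0 (y i) \<in> K" for x y using that by (rule sq)
  qed (use Gd' in blast)+
qed

text \<open>A small annihilator makes the induced endomorphism injective modulo small sequences.\<close>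
lemma lam_inj: assumes "A u \<preceq> A v0" "(x, y) \<in> lam u" "y \<in> small" shows "x \<in> small"
proof -
  have s: "x \<in> sqs" "y \<in> sqs" using assms by (auto simp: lam_def)
  have "range (\<lambda>i. (m u (x i) - m v0 (y i)) + m v0 (y i)) \<preceq> K"
    by (rule range_add) (use assms small_iff[OF s(2)] sK in \<open>auto simp: lam_def\<close>)
  then have "m u ` range x \<preceq> K" by (simp add: image_image)
  then have "range x \<preceq> A u" using img_alm_iff[OF sW sK, of "range x" u] s by (simp add: sqs_def)
  then show ?thesis using alm_trans[OF _ assms(1)] s by (simp add: small_def)
qed
lemma lam_add: assumes "u \<in> good" "w \<in> good" shows "sq.eadd (lam (u - w)) (lam w) = lam u"
proof (rule sq.endo_eqI)
  have uw: "u - w \<in> good" by (rule sg_diff[OF sg_good assms])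
  show "sq.endo (lam u)" by (rule rep_endo[OF lam_rep[OF assms(1)]])
  show "sq.endo (sq.eadd (lam (u - w)) (lam w))"
    by (rule sq.endo_eadd[OF rep_endo[OF lam_rep[OF uw]] rep_endo[OF lam_rep[OF assms(2)]]])
  show "sq.eadd (lam (u - w)) (lam w) \<subseteq> lam u"
  proof
    fix p assume "p \<in> sq.eadd (lam (u - w)) (lam w)"
    then obtain x y y' where p: "p = (x, y + y')" "(x, y) \<in> lam (u - w)" "(x, y') \<in> lam w" by (auto simp: sq.eadd_def)
    have "range (\<lambda>i. (m (u - w) (x i) - m v0 (y i)) + (m w (x i) - m v0 (y' i))) \<preceq> K"
      by (rule range_add) (use p sK in \<open>auto simp: lam_def\<close>)
    moreover have "(m (u - w) (x i) - m v0 (y i)) + (m w (x i) - m v0 (y' i)) = m u (x i) - m v0 ((y + y') i)" for i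
      by (simp add: m_diff m_add)
    ultimately show "p \<in> lam u" using p sg_add[OF sq.U] by (auto simp: lam_def)
  qed
qed

end

lemma (in abelian_group) minus_add_cancel: "x \<in> carrier G \<Longrightarrow> y \<in> carrier G \<Longrightarrow> (x \<ominus> y) \<oplus> y = x"
  by (simp add: a_minus_def a_assoc l_neg)

context residue_setting
begin

definition qdef :: "'a set \<Rightarrow> ((nat \<Rightarrow> 'a) \<times> (nat \<Rightarrow> 'a)) set \<Rightarrow> bool" where
  "qdef E F \<longleftrightarrow> (\<exists>G. df E (\<lambda>e. G (e 0) (e 1)) \<and> represents G F)"

lemma qdef_bound: "\<exists>B. \<forall>E. finite E \<and> card E \<le> k \<longrightarrow> finite {F. qdef E F} \<and> card {F. qdef E F} \<le> B"
proof -
  let ?P = "\<lambda>E. {P. df E P \<and> (\<forall>e e'. (\<forall>i<2. e i = e' i) \<longrightarrow> P e = P e')}"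
  from df_fin[of k 2, unfolded Let_def] obtain B where
    B0: "\<forall>E. finite E \<and> card E \<le> k \<longrightarrow> finite (?P E) \<and> card (?P E) \<le> B" ..
  note B = B0[rule_format]
  have "finite {F. qdef E F} \<and> card {F. qdef E F} \<le> B" if E: "finite E \<and> card E \<le> k" for E
  proof -
    let ?X = "{P. df E P \<and> (\<forall>e e'. (\<forall>i<2. e i = e' i) \<longrightarrow> P e = P e')}"
    have "\<forall>F\<in>{F. qdef E F}. \<exists>G. df E (\<lambda>e. G (e 0) (e 1)) \<and> represents G F" by (simp add: qdef_def)
    from bchoice[OF this] obtain g where g: "\<And>F. qdef E F \<Longrightarrow> df E (\<lambda>e. g F (e 0) (e 1)) \<and> represents (g F) F" by blast
    define h where "h F = (\<lambda>e :: nat \<Rightarrow> 'a. g F (e 0) (e 1))" for F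
    have "inj_on h {F. qdef E F}"
    proof (rule inj_onI)
      fix F F' assume *: "F \<in> {F. qdef E F}" "F' \<in> {F. qdef E F}" "h F = h F'"
      have "g F x y = g F' x y" for x y using fun_cong[OF *(3), of "\<lambda>i. if i = 0 then x else y"] by (simp add: h_def)
      then have "g F = g F'" by blast
      then show "F = F'" using g[of F] g[of F'] * represents_unique[of "g F" F F'] by simp
    qed
    moreover have "h ` {F. qdef E F} \<subseteq> ?X" using g by (auto simp: h_def)
    ultimately have i: "inj_on h {F. qdef E F}" "h ` {F. qdef E F} \<subseteq> ?X" .
    have f: "finite ?X" "card ?X \<le> B" using B[OF E] by simp_all
    show ?thesis using inj_on_finite[OF i f(1)] card_inj_on_le[OF i f(1)] f(2) by simp
  qed
  then show ?thesis by blast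
qed

lemma qdef_mono: "qdef E F \<Longrightarrow> E \<subseteq> E' \<Longrightarrow> qdef E' F" unfolding qdef_def using df_mono by blast
lemma qdef_endo: "qdef E F \<Longrightarrow> sq.endo F" unfolding qdef_def using rep_endo by blast

lemma dfG: assumes "df E (\<lambda>e. G (e 0) (e 1))" "tm E f" "tm E g" shows "df E (\<lambda>e. G (f e) (g e))"
proof -
  have "df E (\<lambda>e. G (f (\<lambda>i. e (Suc i))) (e 0))"
    by (rule df_subst[where P = "\<lambda>x e. G x (e 0)", OF _ tm_re[OF assms(2)]]) (use assms(1) in simp)
  then show ?thesis by (rule df_subst[where P = "\<lambda>y e. G (f e) y", OF _ assms(3)])
qed

lemma qdefI: "represents G F \<Longrightarrow> df E (\<lambda>e. G (e 0) (e 1)) \<Longrightarrow> qdef E F" unfolding qdef_def by blast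

lemma qdef_comp: assumes "qdef E F" "qdef E F'" shows "qdef E (F O F')"
proof -
  obtain G H where G: "df E (\<lambda>e. G (e 0) (e 1))" "represents G F" and H: "df E (\<lambda>e. H (e 0) (e 1))" "represents H F'"
    using assms by (auto simp: qdef_def)
  have "df E (\<lambda>e. \<exists>y. G (e 0) y \<and> H y (e 1))" by (intro df_ex df_and dfG[OF G(1)] dfG[OF H(1)] dintro)
  then show ?thesis by (rule qdefI[OF represents_comp[OF G(2) H(2)]])
qed
lemma qdef_eadd: assumes "qdef E F" "qdef E F'" shows "qdef E (sq.eadd F F')"
proof -
  obtain G H where G: "df E (\<lambda>e. G (e 0) (e 1))" "represents G F" and H: "df E (\<lambda>e. H (e 0) (e 1))" "represents H F'"
    using assms by (auto simp: qdef_def)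
  have "df E (\<lambda>e. \<exists>a. G (e 0) a \<and> H (e 0) (e 1 - a))" by (intro df_ex df_and dfG[OF G(1)] dfG[OF H(1)] dintro)
  then show ?thesis by (rule qdefI[OF represents_eadd[OF G(2) H(2)]])
qed
lemma qdef_eneg: assumes "qdef E F" shows "qdef E (sq.eneg F)"
proof -
  obtain G where G: "df E (\<lambda>e. G (e 0) (e 1))" "represents G F"
    using assms by (auto simp: qdef_def)
  have "df E (\<lambda>e. G (e 0) (0 - e 1))" by (intro dfG[OF G(1)] dintro)
  then have "df E (\<lambda>e. G (e 0) (- e 1))" by simp
  then show ?thesis by (rule qdefI[OF represents_eneg[OF G(2)]])
qed
lemma qdef_one: assumes W: "ds E (\<lambda>e. W)" shows "qdef E sq.eone"
proof -
  have "df E (\<lambda>e. e 0 = e 1 \<and> e 0 \<in> W)" by (intro dintro W)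
  then show ?thesis by (rule qdefI[OF represents_one])
qed
lemma qdef_zero: assumes W: "ds E (\<lambda>e. W)" shows "qdef E sq.ezero"
proof -
  have "df E (\<lambda>e. e 1 = 0 \<and> e 0 \<in> W)" by (intro dintro W)
  then show ?thesis by (rule qdefI[OF represents_zero])
qed
lemma qdef_lam: assumes "ds E (\<lambda>e. W)" "ds E (\<lambda>e. K)" "u \<in> E" "v0 \<in> E" "u \<in> good" shows "qdef E (lam u)"
proof -
  have "df E (\<lambda>e. e 0 \<in> W \<and> e 1 \<in> W \<and> m u (e 0) - m v0 (e 1) \<in> K)" by (intro dintro assms)
  then show ?thesis by (rule qdefI[OF lam_rep[OF assms(5)]])
qed

lemma ring_qdef: assumes "ds E (\<lambda>e. W)" shows "ring (sq.endo_ring {F. qdef E F})"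
  by (rule sq.ring_endo_ring) (simp_all add: qdef_endo qdef_one[OF assms] qdef_zero[OF assms] qdef_eadd qdef_comp qdef_eneg)

lemma not_W_A0: "\<not> W \<preceq> A v0"
proof
  assume "W \<preceq> A v0"
  then have "lz m V K (A v0) \<subseteq> Z" by (rule lz_anti)
  then show False using big alm_sub[OF dsub_sg[OF dZ]] by blast
qed
lemma not_small: "\<exists>x\<in>sqs. x \<notin> small"
proof -
  obtain x where x: "\<And>i. x i \<in> W" "\<And>i j :: nat. i \<noteq> j \<Longrightarrow> x i - x j \<notin> A v0"
    using not_W_A0 by (rule alm_seqE[OF _ sA]) blast
  have "\<not> range x \<preceq> A v0" by (rule seq_not_alm[OF sA, of x]) (use x in auto)
  then show ?thesis using x by (intro bexI[of _ x] sqsI) (auto simp: small_def)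
qed

text \<open>Kernel and image of an idempotent almost intersect in \<open>A v0\<close> and almost span \<open>W\<close>. If they were incomparable,
  \<open>S1\<close> would show that almost everything that kills \<open>A v0\<close> kills both, hence \<open>W\<close>.\<close>
lemma qdef_idem: assumes E: "finite E" and F: "qdef E F" and idem: "F O F = F"
  shows "F = sq.ezero \<or> F = sq.eone"
proof -
  obtain G where G: "df E (\<lambda>e. G (e 0) (e 1))" "represents G F" using F by (auto simp: qdef_def)
  have eF: "sq.endo F" by (rule qdef_endo[OF F])
  define P1 where "P1 = {x. \<exists>y. G x y \<and> x - y \<in> A v0}"
  define P0 where "P0 = {x. \<exists>y. G x y \<and> y \<in> A v0}"
  obtain E1 where E1: "finite E1" "ds E1 (\<lambda>e. A v0)" using dA by (auto simp: dsub_def dset_def)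
  define E' where "E' = E \<union> E1"
  have E': "finite E'" "ds E' (\<lambda>e. A v0)" "df E' (\<lambda>e. G (e 0) (e 1))"
    unfolding E'_def using E E1 ds_mono[OF E1(2)] df_mono[OF G(1)] by auto
  have s1: "sg P1"
  proof (rule sg_I)
    show "0 \<in> P1" unfolding P1_def using rep_0[OF G(2)] sg_0[OF sA] by (intro CollectI exI[of _ 0]) simp
    fix x x' assume "x \<in> P1" "x' \<in> P1"
    then obtain y y' where y: "G x y" "x - y \<in> A v0" "G x' y'" "x' - y' \<in> A v0" by (auto simp: P1_def)
    have e: "x - x' - (y - y') = x - y - (x' - y')" by simp
    show "x - x' \<in> P1" unfolding P1_def
      by (rule CollectI, rule exI[of _ "y - y'"], unfold e) (use rep_diff[OF G(2) y(1,3)] sg_diff[OF sA y(2,4)] in blast)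
  qed
  have s0: "sg P0"
  proof (rule sg_I)
    show "0 \<in> P0" unfolding P0_def using rep_0[OF G(2)] sg_0[OF sA] by blast
    fix x x' assume "x \<in> P0" "x' \<in> P0"
    then show "x - x' \<in> P0" unfolding P0_def using rep_diff[OF G(2)] sg_diff[OF sA] by blast
  qed
  have "ds E' (\<lambda>e. {x. \<exists>y. G x y \<and> x - y \<in> A v0})" "ds E' (\<lambda>e. {x. \<exists>y. G x y \<and> y \<in> A v0})"
    by (intro ds_Collect df_ex df_and dfG[OF E'(3)] dintro E'(2))+
  then have d: "dsub P1" "dsub P0" unfolding dsub_def dset_def P1_def[symmetric] P0_def[symmetric] using s1 s0 E'(1) by auto
  have PW: "P1 \<subseteq> W" "P0 \<subseteq> W" unfolding P1_def P0_def using rep_W[OF G(2)] by blast+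
  let ?P = "P1 \<uplus> A v0" and ?Q = "P0 \<uplus> A v0"
  have dP: "dsub ?P" "dsub ?Q" by (intro dsub_ssum d dA)+
  have sP: "sg ?P" "sg ?Q" using dP by (auto simp: dsub_def)
  have PW': "?P \<subseteq> W" "?Q \<subseteq> W" by (intro plus_least[OF sW] PW AW)+
  have AP: "A v0 \<subseteq> ?P" "A v0 \<subseteq> ?Q" by (intro plus_sub2 s1 s0)+
  have mem1: "\<exists>p q. G p q \<and> p - q \<in> A v0 \<and> x - p \<in> A v0" if "x \<in> ?P" for x
    using that
  proof (rule ssumE)
    fix p b assume *: "p \<in> P1" "b \<in> A v0" "x = p + b"
    then have "x - p \<in> A v0" by simp
    then show ?thesis using *(1) unfolding P1_def by blast
  qed
  have mem0: "\<exists>p q. G p q \<and> q \<in> A v0 \<and> x - p \<in> A v0" if "x \<in> ?Q" for x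
    using that
  proof (rule ssumE)
    fix p b assume *: "p \<in> P0" "b \<in> A v0" "x = p + b"
    then have "x - p \<in> A v0" by simp
    then show ?thesis using *(1) unfolding P0_def by blast
  qed
  \<comment> \<open>idempotency: almost all \<open>x\<close> with image \<open>y\<close> split as \<open>(x - y) + y\<close>\<close>
  define H where "H = {x. \<exists>y z. G x y \<and> G y z \<and> y - z \<in> A v0}"
  have sH: "sg H"
  proof (rule sg_I)
    show "0 \<in> H" unfolding H_def using rep_0[OF G(2)] sg_0[OF sA] by (intro CollectI exI[of _ 0]) simp
    fix x x' assume "x \<in> H" "x' \<in> H"
    then obtain y z y' z' where y: "G x y" "G y z" "y - z \<in> A v0" "G x' y'" "G y' z'" "y' - z' \<in> A v0" by (auto simp: H_def)
    have e: "y - y' - (z - z') = y - z - (y' - z')" by simp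
    show "x - x' \<in> H" unfolding H_def
      by (rule CollectI, rule exI[of _ "y - y'"], rule exI[of _ "z - z'"], unfold e)
        (use rep_diff[OF G(2) y(1,4)] rep_diff[OF G(2) y(2,5)] sg_diff[OF sA y(3,6)] in blast)
  qed
  have GG: "represents (\<lambda>x z. \<exists>y. G x y \<and> G y z) (F O F)" by (rule represents_comp[OF G(2) G(2)])
  have "{x. \<exists>z y. G x y \<and> G y z} \<preceq> H"
  proof (rule ccontr)
    assume "\<not> {x. \<exists>z y. G x y \<and> G y z} \<preceq> H"
    then obtain x where x: "\<And>i. x i \<in> {x. \<exists>z y. G x y \<and> G y z}" "\<And>i j :: nat. i \<noteq> j \<Longrightarrow> x i - x j \<notin> H"
      by (rule alm_seqE[OF _ sH]) blast
    have "\<forall>i. \<exists>y z. G (x i) y \<and> G y z" using x(1) by blast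
    from choice[OF this] obtain y where "\<forall>i. \<exists>z. G (x i) (y i) \<and> G (y i) z" by blast
    from choice[OF this] obtain z where yz: "\<And>i. G (x i) (y i)" "\<And>i. G (y i) (z i)" by blast
    have 1: "(x, y) \<in> F" "(y, z) \<in> F" using rep_seq[OF G(2), of x y, OF yz(1)] rep_seq[OF G(2), of y z, OF yz(2)] .
    then have "(x, z) \<in> F" using idem by blast
    from sq.endo_unique[OF eF 1(1) this] have yz_s: "y - z \<in> small" using sg_0[OF sq.N] by simp
    obtain r :: "nat \<Rightarrow> nat" where r: "strict_mono r" "\<And>i j. (y - z) (r i) - (y - z) (r j) \<in> A v0"
      by (rule alm_subseqE[where x = "y - z", OF smallD[OF yz_s] sA]) blast+
    have e: "y (r 0) - y (r 1) - (z (r 0) - z (r 1)) = (y - z) (r 0) - (y - z) (r 1)" by simp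
    have "x (r 0) - x (r 1) \<in> H" unfolding H_def
      by (rule CollectI, rule exI[of _ "y (r 0) - y (r 1)"], rule exI[of _ "z (r 0) - z (r 1)"], unfold e)
        (use rep_diff[OF G(2) yz(1) yz(1)] rep_diff[OF G(2) yz(2) yz(2)] r(2) in blast)
    moreover have "r 0 \<noteq> r 1" using r(1) by (simp add: strict_mono_eq)
    ultimately show False using x(2) by blast
  qed
  with rep_dom[OF GG] have "W \<preceq> H" by (rule alm_trans)
  moreover have "H \<subseteq> ?P \<uplus> ?Q"
  proof
    fix x assume "x \<in> H"
    then obtain y z where y: "G x y" "G y z" "y - z \<in> A v0" by (auto simp: H_def)
    have "x - y \<in> P0" unfolding P0_def using rep_diff[OF G(2) y(1,2)] y(3) by blast
    moreover have "y \<in> P1" unfolding P1_def using y by blast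
    ultimately have "y + (x - y) \<in> ?P \<uplus> ?Q" using plus_sub1[OF sA, of P1] plus_sub1[OF sA, of P0] by (intro ssumI) auto
    then show "x \<in> ?P \<uplus> ?Q" by simp
  qed
  ultimately have WPQ: "W \<preceq> ?P \<uplus> ?Q" by (rule alm_mono[OF _ subset_refl])
  have PQ: "?P \<inter> ?Q \<preceq> A v0"
  proof (rule ccontr)
    assume "\<not> ?P \<inter> ?Q \<preceq> A v0"
    then obtain x where x: "\<And>i. x i \<in> ?P \<inter> ?Q" "\<And>i j :: nat. i \<noteq> j \<Longrightarrow> x i - x j \<notin> A v0"
      by (rule alm_seqE[OF _ sA]) blast
    have xs: "x \<in> sqs" by (rule sqsI) (use x(1) PW' in blast)
    have "\<forall>i. \<exists>p q. G p q \<and> p - q \<in> A v0 \<and> x i - p \<in> A v0" using x(1) mem1 by blast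
    from choice[OF this] obtain p where "\<forall>i. \<exists>q. G (p i) q \<and> p i - q \<in> A v0 \<and> x i - p i \<in> A v0" by blast
    from choice[OF this] obtain q where p: "\<And>i. G (p i) (q i)" "\<And>i. p i - q i \<in> A v0" "\<And>i. x i - p i \<in> A v0" by blast
    have "\<forall>i. \<exists>p q. G p q \<and> q \<in> A v0 \<and> x i - p \<in> A v0" using x(1) mem0 by blast
    from choice[OF this] obtain p' where "\<forall>i. \<exists>q. G (p' i) q \<and> q \<in> A v0 \<and> x i - p' i \<in> A v0" by blast
    from choice[OF this] obtain q' where p': "\<And>i. G (p' i) (q' i)" "\<And>i. q' i \<in> A v0" "\<And>i. x i - p' i \<in> A v0" by blast
    have sm: "p - q \<in> small" "x - p \<in> small" "q' \<in> small" "x - p' \<in> small"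
      using p(2,3) p'(2,3) by (auto intro: small_A)
    have "p - p' = (x - p') - (x - p)" by simp
    then have pp: "p - p' \<in> small" using sg_diff[OF sq.N sm(4,2)] by simp
    have "q - q' \<in> small" by (rule sq.endo_unique[OF eF rep_seq[OF G(2), of p q, OF p(1)] rep_seq[OF G(2), of p' q', OF p'(1)] pp])
    then have "q \<in> small" using sg_add[OF sq.N _ sm(3), of "q - q'"] by simp
    then have "p \<in> small" using sg_add[OF sq.N sm(1), of q] by simp
    then have "x \<in> small" using sg_add[OF sq.N sm(2), of p] by simp
    then show False using seq_not_alm[OF sA, of x "range x"] x(2) smallD by blast
  qed
  have DP: "D \<preceq> ?P" "D \<preceq> ?Q" using alm_mono[OF DA[OF v0] subset_refl] AP by blast+
  have lzPQ: "lz m V K (A v0) \<subseteq> lz m V K (?P \<inter> ?Q)" by (rule lz_anti[OF PQ])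
  have "?Q \<preceq> ?P \<or> ?P \<preceq> ?Q"
  proof (rule ccontr)
    assume n: "\<not> (?Q \<preceq> ?P \<or> ?P \<preceq> ?Q)"
    have slz: "sg (lz m V K B)" for B by (rule sg_lz[OF sV sK])
    have "lz m V K (?P \<inter> ?Q) \<preceq> lz m V K ?P" by (rule S1[OF dP PW' DP]) (use n in blast)
    then have 1: "lz m V K (A v0) \<preceq> lz m V K ?P" by (rule alm_mono[OF _ lzPQ subset_refl])
    have "lz m V K (?Q \<inter> ?P) \<preceq> lz m V K ?Q" by (rule S1[OF dP(2,1) PW'(2,1) DP(2,1)]) (use n in blast)
    then have 2: "lz m V K (A v0) \<preceq> lz m V K ?Q" by (rule alm_mono[OF _ _ subset_refl]) (subst Int_commute, rule lzPQ)
    have "lz m V K (A v0) \<preceq> lz m V K ?P \<inter> lz m V K ?Q" by (rule alm_int[OF 1 2 slz slz])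
    then have 3: "lz m V K (A v0) \<preceq> lz m V K ?P \<inter> lz m V K ?Q" .
    have "lz m V K ?P \<inter> lz m V K ?Q \<subseteq> lz m V K (?P \<uplus> ?Q)"
    proof
      fix v assume v: "v \<in> lz m V K ?P \<inter> lz m V K ?Q"
      then have "m v ` ?P \<uplus> m v ` ?Q \<preceq> K" by (intro alm_plus sK) (auto simp: lz_def)
      moreover have "m v ` (?P \<uplus> ?Q) \<subseteq> m v ` ?P \<uplus> m v ` ?Q"
      proof
        fix y assume "y \<in> m v ` (?P \<uplus> ?Q)"
        then obtain a b where ab: "a \<in> ?P" "b \<in> ?Q" "y = m v (a + b)" unfolding ssum_def[of ?P] by blast
        have "m v a + m v b \<in> m v ` ?P \<uplus> m v ` ?Q" by (intro ssumI imageI ab)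
        then show "y \<in> m v ` ?P \<uplus> m v ` ?Q" using ab(3) by (simp add: m_add)
      qed
      ultimately have "m v ` (?P \<uplus> ?Q) \<preceq> K" by (rule alm_mono[OF _ _ subset_refl])
      then show "v \<in> lz m V K (?P \<uplus> ?Q)" using v by (simp add: lz_def)
    qed
    also have "lz m V K (?P \<uplus> ?Q) \<subseteq> Z" by (rule lz_anti[OF WPQ])
    finally have "lz m V K (A v0) \<preceq> Z" by (rule alm_mono[OF 3 subset_refl])
    then show False using big by blast
  qed
  then show ?thesis
  proof
    assume "?Q \<preceq> ?P"
    then have W: "W \<preceq> ?P" using alm_trans[OF WPQ alm_plus[OF alm_refl[OF sP(1)] _ sP(1)]] by blast
    have "sq.eone \<subseteq> F"
    proof (rule subrelI)
      fix x y assume "(x, y) \<in> sq.eone"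
      then have xy: "x \<in> sqs" "y \<in> sqs" "x - y \<in> small" by (auto simp: sq.eone_def)
      obtain x' where x': "\<forall>i. x' i \<in> ?P" "x - x' \<in> small" using pick[OF W sP(1) xy(1)] by blast
      have "\<forall>i. \<exists>p q. G p q \<and> p - q \<in> A v0 \<and> x' i - p \<in> A v0" using x'(1) mem1 by blast
      from choice[OF this] obtain p where "\<forall>i. \<exists>q. G (p i) q \<and> p i - q \<in> A v0 \<and> x' i - p i \<in> A v0" by blast
      from choice[OF this] obtain q where p: "\<And>i. G (p i) (q i)" "\<And>i. p i - q i \<in> A v0" "\<And>i. x' i - p i \<in> A v0" by blast
      have sm: "p - q \<in> small" "x' - p \<in> small" using p(2,3) by (auto intro: small_A)
      have "x - p \<in> small" using sg_add[OF sq.N x'(2) sm(2)] by simp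
      moreover have "y - q \<in> small" using sg_diff[OF sq.N sg_add[OF sq.N calculation sm(1)] xy(3)] by simp
      ultimately show "(x, y) \<in> F" by (rule sq.endo_shift[OF eF rep_seq[OF G(2), of p q, OF p(1)]])
    qed
    then show ?thesis using sq.endo_eqI[OF sq.endo_one eF] by blast
  next
    assume "?P \<preceq> ?Q"
    then have W: "W \<preceq> ?Q" using alm_trans[OF WPQ alm_plus[OF _ alm_refl[OF sP(2)] sP(2)]] by blast
    have "sq.ezero \<subseteq> F"
    proof (rule subrelI)
      fix x y assume "(x, y) \<in> sq.ezero"
      then have xy: "x \<in> sqs" "y \<in> small" by (auto simp: sq.ezero_def)
      obtain x' where x': "\<forall>i. x' i \<in> ?Q" "x - x' \<in> small" using pick[OF W sP(2) xy(1)] by blast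
      have "\<forall>i. \<exists>p q. G p q \<and> q \<in> A v0 \<and> x' i - p \<in> A v0" using x'(1) mem0 by blast
      from choice[OF this] obtain p where "\<forall>i. \<exists>q. G (p i) q \<and> q \<in> A v0 \<and> x' i - p i \<in> A v0" by blast
      from choice[OF this] obtain q where p: "\<And>i. G (p i) (q i)" "\<And>i. q i \<in> A v0" "\<And>i. x' i - p i \<in> A v0" by blast
      have sm: "q \<in> small" "x' - p \<in> small" using p(2,3) by (auto intro: small_A)
      have "x - p \<in> small" using sg_add[OF sq.N x'(2) sm(2)] by simp
      moreover have "y - q \<in> small" by (rule sg_diff[OF sq.N xy(2) sm(1)])
      ultimately show "(x, y) \<in> F" by (rule sq.endo_shift[OF eF rep_seq[OF G(2), of p q, OF p(1)]])
    qed
    then show ?thesis using sq.endo_eqI[OF sq.endo_zero eF] by blast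
  qed
qed

text \<open>The exponent \<open>t\<close> comes from counting the endomorphisms definable over \<open>v0\<close>, one \<open>u i\<close> and the parameters
  of the form, so it does not depend on how many of the \<open>u i\<close> are considered. More than \<open>t\<close> of
  them violate the bound on roots of unity in the finite ring of endomorphisms definable over all of them.\<close>
lemma residue_false: assumes u: "\<And>i. u i \<in> good" "\<And>i. A (u i) \<preceq> A v0"
    "\<And>i j :: nat. i \<noteq> j \<Longrightarrow> A (u i - u j) \<preceq> A v0"
  shows False
proof -
  obtain E0 where E0: "finite E0" "ds E0 (\<lambda>e. W)" "ds E0 (\<lambda>e. K)"
    using dsub_params[of "{W, K}"] dW dK by auto
  obtain B where B: "\<And>E. finite E \<and> card E \<le> card E0 + 2 \<Longrightarrow> finite {F. qdef E F} \<and> card {F. qdef E F} \<le> B"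
    using qdef_bound[of "card E0 + 2"] by blast
  define t where "t = (fact B :: nat)"
  define E where "E = E0 \<union> {v0} \<union> u ` {..t}"
  have E: "finite E" "ds E (\<lambda>e. W)" "ds E (\<lambda>e. K)"
    using E0(1) by (simp add: E_def, intro ds_mono[OF E0(2)], simp add: E_def subset_eq, intro ds_mono[OF E0(3)], simp add: E_def subset_eq)
  define C where "C = {F. qdef E F}"
  let ?R = "sq.endo_ring C"
  interpret R: ring ?R unfolding C_def by (rule ring_qdef[OF E(2)])
  have car: "carrier ?R = C" and one: "\<one>\<^bsub>?R\<^esub> = sq.eone" and zero: "\<zero>\<^bsub>?R\<^esub> = sq.ezero"
    and mlt: "F \<otimes>\<^bsub>?R\<^esub> F' = F O F'" and ad: "F \<oplus>\<^bsub>?R\<^esub> F' = sq.eadd F F'" for F F'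
    by (simp_all add: sq.endo_ring_def)
  have finC: "finite C"
    using qdef_bound[of "card E"] E(1) unfolding C_def by blast
  define injv where "injv F \<longleftrightarrow> (\<forall>x y. (x, y) \<in> F \<longrightarrow> y \<in> small \<longrightarrow> x \<in> small)" for F
  have inz: "\<not> injv sq.ezero" using not_small sg_0[OF sq.N] unfolding injv_def sq.ezero_def by blast
  have ine: "injv sq.eone" unfolding injv_def
  proof (intro allI impI)
    fix x y assume "(x, y) \<in> sq.eone" "y \<in> small"
    then show "x \<in> small" using sg_add[OF sq.N, of "x - y" y] by (simp add: sq.eone_def)
  qed
  have inp: "injv (F [^]\<^bsub>?R\<^esub> (n :: nat))" if "injv F" for F n
  proof (induction n)
    case (Suc n) then show ?case using \<open>injv F\<close> by (simp add: mlt injv_def) blast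
  qed (use ine one in simp)
  have nnil: "F [^]\<^bsub>?R\<^esub> (n :: nat) \<noteq> \<zero>\<^bsub>?R\<^esub>" if "injv F" for F n
    using inp[OF that, of n] inz zero by metis
  have lu: "lam (u i) \<in> C" if "i \<le> t" for i
    unfolding C_def by (rule CollectI, rule qdef_lam[OF E(2,3) _ _ u(1)]) (use that in \<open>auto simp: E_def\<close>)
  have li: "injv (lam (u i))" for i unfolding injv_def using lam_inj[OF u(2)] by blast
  have df: "lam (u i) \<ominus>\<^bsub>?R\<^esub> lam (u j) = lam (u i - u j)" "injv (lam (u i - u j))"
    if ij: "i \<le> t" "j \<le> t" "i \<noteq> j" for i j
  proof -
    define E2 where "E2 = insert (u i - u j) E"
    have a: "sq.eadd (lam (u i - u j)) (lam (u j)) = lam (u i)" by (rule lam_add[OF u(1) u(1)])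
    have "lam (u i) = sq.eadd (lam (u i) \<ominus>\<^bsub>?R\<^esub> lam (u j)) (lam (u j))"
      using R.minus_add_cancel[of "lam (u i)" "lam (u j)", unfolded car ad, OF lu[OF ij(1)] lu[OF ij(2)]] by (rule sym)
    let ?S = "sq.endo_ring {F. qdef E2 F}"
    have E2: "ds E2 (\<lambda>e. W)" "ds E2 (\<lambda>e. K)"
      by (intro ds_mono[OF E(2)], simp add: E2_def subset_insertI, intro ds_mono[OF E(3)], simp add: E2_def subset_insertI)
    interpret S: ring ?S by (rule ring_qdef[OF E2(1)])
    have c: "lam (u i) \<in> carrier ?S" "lam (u j) \<in> carrier ?S" "lam (u i - u j) \<in> carrier ?S"
      "lam (u i) \<ominus>\<^bsub>?R\<^esub> lam (u j) \<in> carrier ?S"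
    proof -
      have m: "F \<in> carrier ?S" if "F \<in> C" for F
        using that qdef_mono[of E F E2] by (auto simp: C_def E2_def sq.endo_ring_def)
      show "lam (u i) \<in> carrier ?S" "lam (u j) \<in> carrier ?S" using m lu ij by auto
      show "lam (u i) \<ominus>\<^bsub>?R\<^esub> lam (u j) \<in> carrier ?S"
        using m R.minus_closed[of "lam (u i)" "lam (u j)"] lu[OF ij(1)] lu[OF ij(2)] car by auto
      show "lam (u i - u j) \<in> carrier ?S" unfolding sq.endo_ring_def
        using qdef_lam[OF E2, of "u i - u j"] sg_diff[OF sg_good u(1) u(1)] by (simp add: E2_def E_def)
    qed
    have ad2: "F \<oplus>\<^bsub>?S\<^esub> F' = sq.eadd F F'" for F F' by (simp add: sq.endo_ring_def)
    show "lam (u i) \<ominus>\<^bsub>?R\<^esub> lam (u j) = lam (u i - u j)"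
      using S.minus_eqI[OF c(1,2,3)] S.minus_eqI[OF c(1,2,4)] a \<open>lam (u i) = sq.eadd _ _\<close> ad2 by simp
    show "injv (lam (u i - u j))" unfolding injv_def using lam_inj[OF u(3)[OF ij(3)]] by blast
  qed
  have ne: "\<one>\<^bsub>?R\<^esub> \<noteq> \<zero>\<^bsub>?R\<^esub>" using ine inz one zero by metis
  have idem: "F = \<zero>\<^bsub>?R\<^esub> \<or> F = \<one>\<^bsub>?R\<^esub>" if "F \<in> carrier ?R" "F \<otimes>\<^bsub>?R\<^esub> F = F" for F
  proof -
    have "qdef E F" using that(1) unfolding car by (simp add: C_def)
    then show ?thesis using qdef_idem[OF E(1), of F] that(2) unfolding one zero mlt by blast
  qed
  have root: "lam (u i) [^]\<^bsub>?R\<^esub> t = \<one>\<^bsub>?R\<^esub>" if i: "i \<le> t" for i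
  proof -
    let ?x = "lam (u i)"
    have xc: "?x \<in> carrier ?R" using lu[OF i] car by simp
    define Ei where "Ei = E0 \<union> {v0, u i}"
    have Ei: "ds Ei (\<lambda>e. W)" "ds Ei (\<lambda>e. K)" "finite Ei"
      using E0(1) by (intro ds_mono[OF E0(2)], simp add: Ei_def subset_eq, intro ds_mono[OF E0(3)], simp add: Ei_def subset_eq, simp add: Ei_def)
    have "card Ei \<le> card E0 + card {v0, u i}" unfolding Ei_def by (rule card_Un_le)
    also have "\<dots> \<le> card E0 + 2" by (simp add: card_insert_if)
    finally have b: "finite {F. qdef Ei F}" "card {F. qdef Ei F} \<le> B" using B Ei(3) by auto
    have q: "qdef Ei (?x [^]\<^bsub>?R\<^esub> (n :: nat))" for n
    proof (induction n)
      case 0 then show ?case using qdef_one[OF Ei(1)] by (simp add: one)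
    next
      case (Suc n)
      have "qdef Ei ?x" by (rule qdef_lam[OF Ei(1,2) _ _ u(1)]) (auto simp: Ei_def)
      then show ?case using qdef_comp Suc by (simp add: mlt)
    qed
    have "\<not> inj_on (\<lambda>n. ?x [^]\<^bsub>?R\<^esub> n) {..B}"
    proof
      assume "inj_on (\<lambda>n. ?x [^]\<^bsub>?R\<^esub> n) {..B}"
      from card_inj_on_le[OF this, of "{F. qdef Ei F}"] show False using q b by auto
    qed
    then obtain a c where ac: "a < c" "c \<le> B" "?x [^]\<^bsub>?R\<^esub> a = ?x [^]\<^bsub>?R\<^esub> c"
      unfolding inj_on_def by (metis atMost_iff linorder_neqE_nat)
    obtain n where n: "n > 0" "?x [^]\<^bsub>?R\<^esub> (n :: nat) \<otimes>\<^bsub>?R\<^esub> ?x [^]\<^bsub>?R\<^esub> n = ?x [^]\<^bsub>?R\<^esub> n"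
      using R.pow_idem[OF _ xc] finC car by auto
    have n1: "?x [^]\<^bsub>?R\<^esub> n = \<one>\<^bsub>?R\<^esub>" using idem[OF _ n(2)] nnil[OF li] xc by simp
    have na: "?x [^]\<^bsub>?R\<^esub> (n * a) = \<one>\<^bsub>?R\<^esub>" using n1 xc by (simp add: R.nat_pow_pow[symmetric])
    have e1: "c - a + n * a = c + (n - 1) * a" and e2: "n * a = a + (n - 1) * a"
      using ac(1) n(1) by (auto simp: algebra_simps diff_mult_distrib)
    have "?x [^]\<^bsub>?R\<^esub> (c - a) = ?x [^]\<^bsub>?R\<^esub> (c - a) \<otimes>\<^bsub>?R\<^esub> ?x [^]\<^bsub>?R\<^esub> (n * a)" using na xc by simp
    also have "\<dots> = ?x [^]\<^bsub>?R\<^esub> (c + (n - 1) * a)" using xc e1 by (simp only: R.nat_pow_mult)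
    also have "\<dots> = ?x [^]\<^bsub>?R\<^esub> c \<otimes>\<^bsub>?R\<^esub> ?x [^]\<^bsub>?R\<^esub> ((n - 1) * a)" using xc by (simp only: R.nat_pow_mult)
    also have "\<dots> = ?x [^]\<^bsub>?R\<^esub> a \<otimes>\<^bsub>?R\<^esub> ?x [^]\<^bsub>?R\<^esub> ((n - 1) * a)" using ac(3) by simp
    also have "\<dots> = ?x [^]\<^bsub>?R\<^esub> (n * a)" using xc e2 by (simp only: R.nat_pow_mult)
    finally have p: "?x [^]\<^bsub>?R\<^esub> (c - a) = \<one>\<^bsub>?R\<^esub>" using na by simp
    have "c - a dvd t" unfolding t_def by (rule dvd_fact) (use ac in auto)
    then obtain d where "t = (c - a) * d" by (auto elim: dvdE)
    then show ?thesis using p xc by (simp add: R.nat_pow_pow[symmetric])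
  qed
  have inj: "inj_on (\<lambda>i. lam (u i)) {..t}"
  proof (rule inj_onI)
    fix i j assume ij: "i \<in> {..t}" "j \<in> {..t}" "lam (u i) = lam (u j)"
    show "i = j"
    proof (rule ccontr)
      assume "i \<noteq> j"
      then have "lam (u i - u j) = \<zero>\<^bsub>?R\<^esub>" "injv (lam (u i - u j))"
        using df[of i j] ij lu[of j] car R.r_neg[of "lam (u j)"] by (auto simp: R.minus_eq)
      then show False using inz zero by metis
    qed
  qed
  have "card ((\<lambda>i. lam (u i)) ` {..t}) \<le> t"
  proof (rule R.local_ring_roots)
    show "finite (carrier ?R)" using finC car by simp
    show "\<one>\<^bsub>?R\<^esub> \<noteq> \<zero>\<^bsub>?R\<^esub>" by (rule ne)
    show "F = \<zero>\<^bsub>?R\<^esub> \<or> F = \<one>\<^bsub>?R\<^esub>" if "F \<in> carrier ?R" "F \<otimes>\<^bsub>?R\<^esub> F = F" for F by (rule idem[OF that])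
    show "(\<lambda>i. lam (u i)) ` {..t} \<subseteq> carrier ?R" using lu car by auto
    show "x [^]\<^bsub>?R\<^esub> t = \<one>\<^bsub>?R\<^esub>" if "x \<in> (\<lambda>i. lam (u i)) ` {..t}" for x using root that by auto
    show "t > 0" by (simp add: t_def)
    fix x y and k :: nat
    assume "x \<in> (\<lambda>i. lam (u i)) ` {..t}" "y \<in> (\<lambda>i. lam (u i)) ` {..t}" "x \<noteq> y"
    then obtain i j where ij: "i \<le> t" "j \<le> t" "x = lam (u i)" "y = lam (u j)" "i \<noteq> j" by auto
    show "(x \<ominus>\<^bsub>?R\<^esub> y) [^]\<^bsub>?R\<^esub> k \<noteq> \<zero>\<^bsub>?R\<^esub>"
      using nnil[OF df(2)[OF ij(1,2,5)]] df(1)[OF ij(1,2,5)] ij by simp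
  qed
  then show False using card_image[OF inj] by simp
qed

end

lemma (in minform) residue: assumes v0: "v0 \<in> V" and big: "\<not> lz m V K (A v0) \<preceq> Z" and v: "\<And>i. v i \<in> lz m V K (A v0)"
    and dv: "\<And>i j :: nat. i \<noteq> j \<Longrightarrow> A (v i - v j) \<preceq> A v0"
  shows False
proof -
  interpret residue_setting df nb m V W K L v0 by (unfold_locales) (fact v0, fact big)
  have s: "sg (lz m V (X v0) W)" by (rule sg_lz[OF sV sX])
  obtain r :: "nat \<Rightarrow> nat" where r: "strict_mono r" "\<And>i j. v (r i) - v (r j) \<in> lz m V (X v0) W"
    by (rule alm_subseqE[where x = v, OF X2[OF v0] s v]) blast
  have ne: "r i \<noteq> r j" if "i \<noteq> j" for i j using that r(1) by (simp add: strict_mono_eq)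
  have e: "v (r (Suc i)) - v (r 0) - (v (r (Suc j)) - v (r 0)) = v (r (Suc i)) - v (r (Suc j))" for i j by simp
  show False
  proof (rule residue_false[of "\<lambda>i. v (r (Suc i)) - v (r 0)"])
    show "v (r (Suc i)) - v (r 0) \<in> good" for i
      unfolding good_def using r(2) sg_diff[OF sg_lz[OF sV sK] v v] by blast
    show "A (v (r (Suc i)) - v (r 0)) \<preceq> A v0" for i by (rule dv[OF ne]) simp
    show "A (v (r (Suc i)) - v (r 0) - (v (r (Suc j)) - v (r 0))) \<preceq> A v0" if "i \<noteq> j" for i j
      unfolding e by (rule dv[OF ne]) (use that in simp)
  qed
qed

section \<open>Minimal nontrivial forms do not exist\<close>

lemma finite_chain_least:
  assumes "finite S" "S \<noteq> {}" "\<And>i j. i \<in> S \<Longrightarrow> j \<in> S \<Longrightarrow> (C i :: 'a :: ab_group_add set) \<preceq> C j \<or> C j \<preceq> C i"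
  shows "\<exists>j\<in>S. \<forall>i\<in>S. C j \<preceq> C i"
  using assms
proof (induction S rule: finite_ne_induct)
  case (insert x S)
  have "\<exists>j\<in>S. \<forall>i\<in>S. C j \<preceq> C i" by (rule insert.IH) (use insert.prems in auto)
  then obtain j where j: "j \<in> S" "\<forall>i\<in>S. C j \<preceq> C i" by blast
  show ?case
  proof (cases "C j \<preceq> C x")
    case True then show ?thesis using j by auto
  next
    case False
    then have "C x \<preceq> C j" using insert.prems[of x j] j by auto
    then have "\<forall>i\<in>insert x S. C x \<preceq> C i" using j alm_trans insert.prems[of x x] by (metis insert_iff)
    then show ?thesis by blast
  qed
qed auto

fun meetL :: "'a set \<Rightarrow> ('x \<Rightarrow> 'a set) \<Rightarrow> 'x list \<Rightarrow> 'a set" where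
  "meetL V B [] = V"
| "meetL V B (u # us) = B u \<inter> meetL V B us"
lemma meetL_eq: "meetL V B us = V \<inter> (\<Inter>u\<in>set us. B u)" by (induction us) auto

context tame begin
lemma ds_card: "\<exists>N. \<forall>A. finite A \<and> card A \<le> k \<longrightarrow> finite {X. ds A (\<lambda>e. X)} \<and> card {X. ds A (\<lambda>e. X)} \<le> N"
proof -
  let ?Y = "\<lambda>A. {P. df A P \<and> (\<forall>e e'. (\<forall>i<1. e i = e' i) \<longrightarrow> P e = P e')}"
  obtain N where N: "\<And>A. finite A \<Longrightarrow> card A \<le> k \<Longrightarrow> finite (?Y A) \<and> card (?Y A) \<le> N"
    using df_fin[of k 1] by (auto simp: Let_def)
  have "finite {X. ds A (\<lambda>e. X)} \<and> card {X. ds A (\<lambda>e. X)} \<le> N" if A: "finite A" "card A \<le> k" for A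
  proof -
    let ?g = "\<lambda>X (e :: nat \<Rightarrow> 'a). e 0 \<in> X"
    have "inj_on ?g {X. ds A (\<lambda>e. X)}"
    proof (rule inj_onI)
      fix X Y :: "'a set" assume "?g X = ?g Y"
      then have "?g X (\<lambda>_. x) = ?g Y (\<lambda>_. x)" for x by (rule fun_cong)
      then show "X = Y" by blast
    qed
    moreover have "?g ` {X. ds A (\<lambda>e. X)} \<subseteq> ?Y A" by (auto simp: ds_def)
    ultimately show ?thesis using N[OF A] card_inj_on_le[of ?g _ "?Y A"] ds_finite[OF A(1)] by (meson le_trans)
  qed
  then show ?thesis by blast
qed
end

context minform
begin

lemma rz_absorb: assumes P: "dsub P" "P \<subseteq> W" "D \<preceq> P" and B: "dsub B" "B \<subseteq> V" and n: "\<not> B \<preceq> lz m V K P"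
  shows "lz (fl m) W K B \<preceq> P"
proof (rule ccontr)
  let ?S = "lz (fl m) W K B"
  assume c: "\<not> ?S \<preceq> P"
  have dS: "dsub ?S" by (rule bilfl_lz[OF dW dK B(1)])
  have DS: "D \<preceq> ?S" by (rule alm_sub[OF dsub_sg[OF dS] bil.lz_anti[OF bil_fl alm_sub[OF sV B(2)]]])
  have "B \<preceq> lz m V K ?S"
    by (rule galois'[OF dV dW dS B(1) dK B(2) lz_sub alm_refl[OF dsub_sg[OF dS]]])
  also have "\<dots> \<subseteq> lz m V K (P \<inter> ?S)" by (rule lz_anti[OF alm_sub[OF dsub_sg[OF dS]]]) auto
  also have "\<dots> \<preceq> lz m V K P" by (rule S1[OF P(1) dS P(2) lz_sub P(3) DS c])
  finally show False using n by blast
qed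

text \<open>Together with the Galois connection this says that a definable subgroup above the kernel is determined, up to
  finite index, by its annihilator.\<close>
lemma closed: assumes P: "dsub P" "P \<subseteq> W" "D \<preceq> P"
  shows "lz (fl m) W K (lz m V K P) \<preceq> P"
proof (rule ccontr)
  interpret f: minform df nb "fl m" W V K L by (rule minform_fl)
  let ?Q = "lz m V K P"
  let ?T = "lz (fl m) W K ?Q"
  let ?n = "\<lambda>w. ann (fl m) V K w"
  assume c: "\<not> ?T \<preceq> P"
  have dQ: "dsub ?Q" by (rule dsub_lz[OF dV dK P(1)])
  have dT: "dsub ?T" by (rule bilfl_lz[OF dW dK dQ])
  have sQ: "sg ?Q" and sT: "sg ?T" and sP: "sg P" using dQ dT P by (auto simp: dsub_def)
  have dn: "dsub (?n w)" for w by (rule f.dA)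
  have sn: "sg (?n w)" for w by (rule f.sA)
  have Zn: "Z \<preceq> ?n w" if "w \<in> W" for w using f.DA[OF that] by simp
  let ?B = "meetL V ?n"
  have dB: "dsub (?B ws)" for ws by (induction ws) (auto intro: dV dsub_Int dn)
  have BV: "?B ws \<subseteq> V" for ws by (auto simp: meetL_eq)
  have ZB: "Z \<preceq> ?B ws" if "set ws \<subseteq> W" for ws
    using that
  proof (induction ws)
    case Nil then show ?case using alm_sub[OF sV lz_sub] by simp
  next
    case (Cons w ws)
    then show ?case using alm_int[OF Zn _ sn dsub_sg[OF dB], of w ws] by simp
  qed
  define T2 where "T2 = {w \<in> ?T. \<not> ?n w \<preceq> ?Q}"
  have T2W: "T2 \<subseteq> W" by (auto simp: T2_def lz_def)
  have nB: "\<not> ?B ws \<preceq> ?Q" if "set ws \<subseteq> T2" for ws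
    using that
  proof (induction ws)
    case Nil
    have "V \<preceq> ?Q \<Longrightarrow> ?T \<subseteq> D" by (rule f.lz_anti)
    then show ?case using c le_alm P(3) by auto
  next
    case (Cons w ws)
    then have w: "w \<in> T2" "w \<in> W" and nB: "\<not> ?B ws \<preceq> ?Q" "set ws \<subseteq> W" using T2W by auto
    show ?case
    proof
      assume q: "?B (w # ws) \<preceq> ?Q"
      show False
      proof (cases "?n w \<preceq> ?B ws")
        case True
        have "?n w \<preceq> ?B (w # ws)" using alm_int[OF alm_refl[OF sn] True sn dsub_sg[OF dB]] by simp
        then show False using w(1) alm_trans[OF _ q] by (simp add: T2_def)
      next
        case False
        have "?T \<subseteq> lz (fl m) W K (?B (w # ws))" by (rule f.lz_anti[OF q])
        also have "\<dots> = lz (fl m) W K (?B ws \<inter> ?n w)" by (simp add: Int_commute)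
        also have "\<dots> \<preceq> lz (fl m) W K (?B ws)"
          by (rule f.S1[OF dB dn BV _ _ _ False]) (use ZB[OF nB(2)] Zn[OF w(2)] in \<open>auto simp: ann_def\<close>)
        also have "\<dots> \<preceq> P" by (rule rz_absorb[OF P dB BV nB(1)])
        finally show False using c by blast
      qed
    qed
  qed
  have T20: "sg T2"
  proof (rule sg_I)
    show "0 \<in> T2" using nB[of "[]"] sg_0[OF sT] by (simp add: T2_def ann_def fl_app sg_0[OF sK])
    fix x y assume xy: "x \<in> T2" "y \<in> T2"
    have "?B [x, y] \<subseteq> ?n (x - y)" using sg_diff[OF sK] by (auto simp: ann_def fl_app m_diff)
    then have "\<not> ?n (x - y) \<preceq> ?Q" using nB[of "[x, y]"] xy le_alm by auto
    then show "x - y \<in> T2" using xy sg_diff[OF sT] by (auto simp: T2_def)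
  qed
  have "T2 \<preceq> P"
  proof (rule ccontr)
    assume "\<not> T2 \<preceq> P"
    then obtain w where w: "\<And>i. w i \<in> T2" "\<And>i j :: nat. i \<noteq> j \<Longrightarrow> w i - w j \<notin> P"
      by (rule alm_seqE[OF _ sP]) blast
    obtain E where E: "finite E" "ds E (\<lambda>e. V)" "ds E (\<lambda>e. W)" "ds E (\<lambda>e. K)" "ds E (\<lambda>e. P)"
      using dsub_params[of "{V, W, K, P}"] dV dW dK P by auto
    have "ds E (\<lambda>e. meetL V ?n (map e js))" for js
      by (induction js) (auto intro!: dintro f.ds_ann E)
    then have "\<exists>q. \<forall>e. lz (fl m) W K (?B (map e [0..<k])) \<preceq> P \<longrightarrow> almk q (lz (fl m) W K (?B (map e [0..<k]))) P" for k
      by (intro alm_bound[OF E(1)] f.ds_lz E) auto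
    then obtain q where q: "\<And>k e. lz (fl m) W K (?B (map e [0..<k])) \<preceq> P \<Longrightarrow> almk (q k) (lz (fl m) W K (?B (map e [0..<k]))) P"
      by metis
    define N where "N = Max (q ` {..nb})"
    let ?vs = "map w [0..<Suc N]"
    obtain us where us: "set us \<subseteq> set ?vs" "length us \<le> nb" "(\<Inter>u\<in>set us. ?n u) \<preceq> (\<Inter>u\<in>set ?vs. ?n u)"
      using few_meets[of ?n ?vs] dn by blast
    have "set us \<subseteq> T2" using us(1) w(1) by auto
    from rz_absorb[OF P dB BV nB[OF this]]
    have "almk (q (length us)) (lz (fl m) W K (?B us)) P"
      using q[of "\<lambda>i. us ! i" "length us"] by (simp add: map_nth)
    moreover have "q (length us) \<le> N" unfolding N_def by (rule Max_ge) (use us(2) in auto)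
    ultimately have ak: "almk N (lz (fl m) W K (?B us)) P" by (rule almk_mono)
    have inj: "inj_on w {..<Suc N}"
    proof
      fix i j assume "w i = w j"
      then show "i = j" using w(2)[of i j] sg_0[OF sP] by auto
    qed
    have "card (w ` {..<Suc N}) \<le> N"
    proof (rule almk_seq[OF ak sP])
      show "w ` {..<Suc N} \<subseteq> lz (fl m) W K (?B us)"
      proof (rule image_subsetI)
        fix i assume "i \<in> {..<Suc N}"
        then have "w i \<in> set ?vs" by (simp add: image_iff del: upt_Suc) auto
        then have "(\<Inter>u\<in>set ?vs. ?n u) \<subseteq> ?n (w i)" by blast
        then have "?B us \<preceq> ?n (w i)" using alm_mono[OF alm_le[OF us(3)], of "?n (w i)" "?B us"] by (auto simp: meetL_eq)
        then have "fl m (w i) ` ?B us \<preceq> K" using f.img_alm_iff[OF sV sK BV] by blast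
        then show "w i \<in> lz (fl m) W K (?B us)" using w(1)[of i] T2W by (auto simp: lz_def)
      qed
      fix x y assume "x \<in> w ` {..<Suc N}" "y \<in> w ` {..<Suc N}" "x \<noteq> y"
      then show "x - y \<notin> P" using w(2) by (metis imageE)
    qed simp
    then show False using card_image[OF inj] by simp
  qed
  then have "\<not> ?T \<preceq> T2" using c alm_trans by blast
  then obtain w where w: "\<And>i. w i \<in> ?T" "\<And>i j :: nat. i \<noteq> j \<Longrightarrow> w i - w j \<notin> T2"
    by (rule alm_seqE[OF _ T20]) blast
  have nQ: "?n (w i - w j) \<preceq> ?Q" if "i \<noteq> j" for i j
    using w(2)[OF that] sg_diff[OF sT w(1) w(1), of i j] by (auto simp: T2_def)
  let ?w = "w 1 - w 0"
  have wT: "?w \<in> ?T" by (rule sg_diff[OF sT w(1) w(1)])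
  then have wW: "?w \<in> W" by (simp add: lz_def)
  have Qn: "?Q \<preceq> ?n ?w" using wT f.img_alm_iff[OF sV sK lz_sub[of m V K P], of ?w] by (simp add: lz_def)
  have e: "lz (fl m) W K (?n ?w) = ?T"
    by (rule equalityI; rule f.lz_anti) (use Qn nQ[of 1 0] in auto)
  show False
  proof (rule f.residue[OF wW])
    show "\<not> lz (fl m) W K (?n ?w) \<preceq> D" unfolding e using c alm_trans P(3) by blast
    show "w i \<in> lz (fl m) W K (?n ?w)" for i unfolding e by (rule w(1))
    show "?n (w i - w j) \<preceq> ?n ?w" if "i \<noteq> j" for i j using alm_trans[OF nQ[OF that] Qn] .
  qed
qed

lemma closed_galois: assumes "dsub P" "P \<subseteq> W" shows "P \<preceq> lz (fl m) W K (lz m V K P)"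
proof -
  have d: "dsub (lz m V K P)" by (rule dsub_lz[OF dV dK assms(1)])
  show ?thesis by (rule galois[OF dV dW assms(1) d dK lz_sub assms(2) alm_refl[OF dsub_sg[OF d]]])
qed

text \<open>By \<open>S1\<close>, incomparable \<open>P\<close> and \<open>P'\<close> would have the same annihilator as their intersection, and the Galois
  connection recovers the groups from the annihilators.\<close>
lemma chain: assumes P: "dsub P" "P \<subseteq> W" "D \<preceq> P" and P': "dsub P'" "P' \<subseteq> W" "D \<preceq> P'"
  shows "P \<preceq> P' \<or> P' \<preceq> P"
proof (cases "P' \<preceq> P")
  case False
  have DP: "D \<preceq> P \<inter> P'" by (rule alm_int) (use P P' in \<open>auto simp: dsub_def\<close>)
  have "P \<preceq> lz (fl m) W K (lz m V K P)" by (rule closed_galois[OF P(1,2)])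
  also have "\<dots> \<subseteq> lz (fl m) W K (lz m V K (P \<inter> P'))"
    by (rule bil.lz_anti[OF bil_fl S1[OF P(1) P'(1) P(2) P'(2) P(3) P'(3) False]])
  also have "\<dots> \<preceq> P \<inter> P'" by (rule closed[OF dsub_Int[OF P(1) P'(1)] _ DP]) (use P in auto)
  finally show ?thesis using alm_le[of P "P \<inter> P'" P'] by auto
qed auto

text \<open>Otherwise the elements that kill \<open>A v\<close> lie in boundedly many cosets of \<open>Z\<close>, uniformly in \<open>v\<close>. Of more elements
  than this bound, distinct modulo \<open>Z\<close>, one has the least annihilator because annihilators form a
  chain, and all of them kill it.\<close>
lemma ex_deep: "\<exists>v0\<in>V. \<not> lz m V K (A v0) \<preceq> Z"
proof (rule ccontr)
  assume "\<not> ?thesis"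
  then have c: "\<And>v. v \<in> V \<Longrightarrow> lz m V K (A v) \<preceq> Z" by blast
  have sZ: "sg Z" using dZ by (simp add: dsub_def)
  obtain B where B: "finite B" "ds B (\<lambda>e. V)" "ds B (\<lambda>e. W)" "ds B (\<lambda>e. K)"
    using dsub_params[of "{V, W, K}"] dV dW dK by auto
  obtain q where q: "\<And>e :: nat \<Rightarrow> 'a. lz m V K (A (e 0)) \<preceq> Z \<Longrightarrow> almk q (lz m V K (A (e 0))) Z"
  proof -
    have "ds B (\<lambda>e. lz m V K (A (e 0)))" "ds B (\<lambda>e. Z)" by (intro dintro B)+
    from alm_bound[OF B(1) this] show ?thesis using that by blast
  qed
  have "\<not> V \<preceq> Z" using ntriv by (simp add: triv_def)
  then obtain v where v: "\<And>i. v i \<in> V" "\<And>i j :: nat. i \<noteq> j \<Longrightarrow> v i - v j \<notin> Z"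
    by (rule alm_seqE[OF _ sZ]) blast
  have "\<exists>j\<in>{..q}. \<forall>i\<in>{..q}. A (v j) \<preceq> A (v i)"
    by (rule finite_chain_least) (use chain[OF dA AW DA dA AW DA] v(1) in auto)
  then obtain j where j: "\<And>i. i \<le> q \<Longrightarrow> A (v j) \<preceq> A (v i)" by auto
  have inj: "inj_on v {..q}"
  proof
    fix i j assume "v i = v j"
    then show "i = j" using v(2)[of i j] sg_0[OF sZ] by auto
  qed
  have "card (v ` {..q}) \<le> q"
  proof (rule almk_seq[OF _ sZ])
    show "almk q (lz m V K (A (v j))) Z" using q[of "\<lambda>_. v j"] c[OF v(1)] by simp
    show "v ` {..q} \<subseteq> lz m V K (A (v j))" using j v(1) by (auto simp: lzA)
    fix x y assume "x \<in> v ` {..q}" "y \<in> v ` {..q}" "x \<noteq> y"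
    then show "x - y \<notin> Z" using v(2) by (metis imageE)
  qed simp
  then show False using card_image[OF inj] by simp
qed

text \<open>By \<open>chain\<close> the elements of \<open>V1\<close> whose annihilator properly exceeds that of \<open>v0\<close> form a subgroup \<open>J\<close>.
  Representatives of infinitely many of its cosets would contradict \<open>residue\<close>, so \<open>J\<close> is almost all of \<open>V1\<close>.
  For \<open>v\<close> in \<open>J\<close> the groups \<open>s v P\<close>, obtained from \<open>P\<close> by multiplication with \<open>v\<close> and division by \<open>v0\<close>,
  are then compared with one another.\<close>
theorem impossible: False
proof -
  obtain v0 where v0: "v0 \<in> V" "\<not> lz m V K (A v0) \<preceq> Z" using ex_deep by blast
  define V0 where "V0 = lz m V K (A v0)"
  define V1 where "V1 = V0 \<inter> lz m V (X v0) W"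
  define J where "J = {v \<in> V1. \<not> A v \<preceq> A v0}"
  have dV0: "dsub V0" unfolding V0_def by (rule dsub_lz[OF dV dK dA])
  have dV1: "dsub V1" unfolding V1_def by (rule dsub_Int[OF dV0 dsub_lz[OF dV dX dW]])
  have sV0: "sg V0" and sV1: "sg V1" using dV0 dV1 by (auto simp: dsub_def)
  have V01: "V0 \<preceq> V1" unfolding V1_def
    by (rule alm_int[OF alm_refl[OF sV0] _ sV0 sg_lz[OF sV sX]]) (use X2[OF v0(1)] in \<open>simp add: V0_def\<close>)
  have V1V: "V1 \<subseteq> V" by (auto simp: V1_def lz_def)
  have sJ: "sg J"
  proof (rule sg_I)
    have "\<not> W \<preceq> A v0"
    proof
      assume "W \<preceq> A v0"
      then have "lz m V K (A v0) \<subseteq> Z" by (rule lz_anti)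
      then show False using v0(2) alm_sub[of Z] dZ by (auto simp: dsub_def)
    qed
    moreover have "A 0 = W" using sg_0[OF sK] by (auto simp: ann_def)
    ultimately show "0 \<in> J" using sg_0[OF sV1] by (simp add: J_def)
    fix x y assume xy: "x \<in> J" "y \<in> J"
    have sub: "A x \<inter> A y \<subseteq> A (x - y)" using sg_diff[OF sK] by (auto simp: ann_def m_diff)
    have xV: "x \<in> V" "y \<in> V" using xy V1V by (auto simp: J_def)
    have "\<not> A (x - y) \<preceq> A v0"
    proof
      assume a: "A (x - y) \<preceq> A v0"
      consider "A x \<preceq> A y" | "A y \<preceq> A x" using chain[OF dA AW DA[OF xV(1)] dA AW DA[OF xV(2)]] by blast
      then show False
      proof cases
        case 1
        then have "A x \<preceq> A x \<inter> A y" using alm_int alm_refl sA by blast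
        then have "A x \<preceq> A v0" using alm_trans[OF alm_le[OF _ sub] a] by blast
        then show False using xy by (simp add: J_def)
      next
        case 2
        then have "A y \<preceq> A x \<inter> A y" using alm_int alm_refl sA by blast
        then have "A y \<preceq> A v0" using alm_trans[OF alm_le[OF _ sub] a] by blast
        then show False using xy by (simp add: J_def)
      qed
    qed
    then show "x - y \<in> J" using xy sg_diff[OF sV1] by (simp add: J_def)
  qed
  have V1J: "V1 \<preceq> J"
  proof (rule ccontr)
    assume "\<not> V1 \<preceq> J"
    then obtain v where v: "\<And>i. v i \<in> V1" "\<And>i j :: nat. i \<noteq> j \<Longrightarrow> v i - v j \<notin> J"
      by (rule alm_seqE[OF _ sJ]) blast
    show False
    proof (rule residue[OF v0])
      show "v i \<in> lz m V K (A v0)" for i using v(1)[of i] by (simp add: V1_def V0_def)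
      show "A (v i - v j) \<preceq> A v0" if "i \<noteq> j" for i j
        using v(2)[OF that] sg_diff[OF sV1 v(1) v(1), of i j] by (simp add: J_def)
    qed
  qed
  have JA: "A v0 \<preceq> A v" and JX: "m v ` W \<preceq> X v0" and JV: "v \<in> V" and Jn: "\<not> A v \<preceq> A v0" if "v \<in> J" for v
    using that lzA[of v v0] by (auto simp: J_def V1_def V0_def lz_def)
  define s where "s v P = {y \<in> W. m v0 y \<in> im P K v}" for v P
  have sW': "s v P \<subseteq> W" for v P by (auto simp: s_def)
  have ss: "sg (s v P)" if "sg P" for v P unfolding s_def by (rule sg_pre[OF addR sW sg_im[OF that sK]])
  have ds_s: "ds E (\<lambda>e. s v P)" if "ds E (\<lambda>e. W)" "ds E (\<lambda>e. K)" "ds E (\<lambda>e. P)" "v0 \<in> E" "v \<in> E" for E v P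
    unfolding s_def by (intro dintro that)
  have dss: "dsub (s v P)" if dP: "dsub P" for v P
  proof -
    obtain B where B: "finite B" "ds B (\<lambda>e. W)" "ds B (\<lambda>e. K)" "ds B (\<lambda>e. P)"
      using dsub_params[of "{W, K, P}"] dW dK dP by auto
    have "ds (insert v0 (insert v B)) (\<lambda>e. s v P)"
      by (rule ds_s) (auto intro: ds_mono[OF B(2)] ds_mono[OF B(3)] ds_mono[OF B(4)])
    moreover have "finite (insert v0 (insert v B))" using B(1) by simp
    ultimately show ?thesis unfolding dsub_def dset_def using ss[OF dsub_sg[OF dP], of v] by blast
  qed
  have A0s: "A v0 \<subseteq> s v P" if "sg P" for v P using im_subK[OF that] by (auto simp: s_def ann_def)
  have Ds: "D \<preceq> s v P" if "sg P" for v P using alm_le[OF DA[OF v0(1)] A0s[OF that]] .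
  have s_alm: "Q \<preceq> s v P" if "Q \<subseteq> W" "m v0 ` Q \<preceq> im P K v" "sg P" for Q v P
    unfolding s_def by (rule alm_pre[OF addR sg_im[OF that(3) sK] sW that(2,1)])
  have s_img: "m v0 ` s v P \<subseteq> im P K v" for v P by (auto simp: s_def)
  have s_mono: "s v P \<preceq> s v P'" if "P \<preceq> P'" "sg P'" for v P P'
    by (rule s_alm[OF sW' le_alm[OF s_img im_mono[OF that sK]] that(2)])
  have im_s: "m v ` P \<preceq> im (s v P) K v0" if v: "v \<in> J" and P: "sg P" "P \<subseteq> W" for v P
  proof -
    have "m v ` P \<preceq> X v0" by (rule alm_mono[OF JX[OF v]]) (use P in auto)
    moreover have "m v ` P \<preceq> im P K v" by (rule alm_sub[OF sg_im[OF P(1) sK] im_sub[OF sK]])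
    ultimately have "m v ` P \<preceq> X v0 \<inter> im P K v" by (rule alm_int[OF _ _ sX sg_im[OF P(1) sK]])
    also have "\<dots> \<subseteq> im (s v P) K v0"
    proof
      fix x assume x: "x \<in> X v0 \<inter> im P K v"
      then obtain y k where y: "y \<in> W" "k \<in> K" "x = m v0 y + k" by (auto simp: im_def ssum_def)
      have "x - k \<in> im P K v" using x y im_subK[OF P(1)] sg_diff[OF sg_im[OF P(1) sK]] by blast
      then have "y \<in> s v P" using y by (simp add: s_def)
      then show "x \<in> im (s v P) K v0" using y by (auto simp: im_def intro: ssumI)
    qed
    finally show ?thesis .
  qed
  have best: "s v1 P \<preceq> s v P" if v: "v \<in> J" "v1 \<in> J" "A v \<preceq> A v1" and P: "dsub P" "P \<subseteq> W" for v v1 P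
  proof -
    have sP: "sg P" using P by (simp add: dsub_def)
    consider "s v1 P \<preceq> s v P" | "s v P \<preceq> s v1 P"
      using chain[OF dss[OF P(1)] sW' Ds[OF sP] dss[OF P(1)] sW' Ds[OF sP]] by blast
    then show ?thesis
    proof cases
      case 2
      have "m v ` P \<preceq> im (s v P) K v0" by (rule im_s[OF v(1) sP P(2)])
      also have "\<dots> \<preceq> im (s v1 P) K v0" by (rule im_mono[OF 2 ss[OF sP] sK])
      also have "\<dots> \<preceq> im P K v1"
        by (rule im_alm[OF sg_im[OF sP sK] alm_sub[OF sg_im[OF sP sK] im_subK[OF sP]]
            alm_sub[OF sg_im[OF sP sK] s_img]])
      finally have le: "im P K v \<preceq> im P K v1"
        by (intro im_alm[OF sg_im[OF sP sK] alm_sub[OF sg_im[OF sP sK] im_subK[OF sP]]])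
      have "ann m P K v \<preceq> A v1" by (rule alm_mono[OF v(3)]) (use P in \<open>auto simp: ann_def\<close>)
      from alm_img[OF addR this, of v1] have "m v1 ` ann m P K v \<preceq> K"
        by (rule alm_mono) (auto simp: ann_def)
      from no_larger_image[OF P(1) dK this le] have "im P K v1 \<preceq> im P K v" .
      from s_alm[OF sW' le_alm[OF s_img this] sP] show ?thesis .
    qed
  qed
  have step: "\<exists>v\<in>J. \<not> s v P \<preceq> A v0" if P: "dsub P" "P \<subseteq> W" and n: "\<not> P \<preceq> A v0" for P
  proof (rule ccontr)
    assume c: "\<not> ?thesis"
    have sP: "sg P" using P by (simp add: dsub_def)
    have "J \<subseteq> lz m V K P"
    proof
      fix v assume v: "v \<in> J"
      then have "s v P \<preceq> A v0" using c by blast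
      from alm_img[OF addR this] have "m v0 ` s v P \<preceq> K" by (rule alm_mono) (auto simp: ann_def)
      then have "im (s v P) K v0 \<preceq> K" by (rule im_alm[OF sK alm_refl[OF sK]])
      then have "m v ` P \<preceq> K" using im_s[OF v sP P(2)] alm_trans by blast
      then show "v \<in> lz m V K P" using JV[OF v] by (simp add: lz_def)
    qed
    then have "V0 \<preceq> lz m V K P" using alm_le[OF alm_trans[OF V01 V1J]] by blast
    then have "lz (fl m) W K (lz m V K P) \<subseteq> lz (fl m) W K V0" by (rule bil.lz_anti[OF bil_fl])
    also have "\<dots> \<preceq> A v0" unfolding V0_def by (rule closed[OF dA AW DA[OF v0(1)]])
    finally show False using n alm_trans[OF closed_galois[OF P]] by blast
  qed
  have WA: "\<not> W \<preceq> A v0"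
  proof
    assume "W \<preceq> A v0"
    then have "lz m V K (A v0) \<subseteq> Z" by (rule lz_anti)
    then show False using v0(2) alm_sub[of Z] dZ by (auto simp: dsub_def)
  qed
  have dF: "dsub (foldr s vs W)" and FW: "foldr s vs W \<subseteq> W" for vs
    by (induction vs) (auto intro: dW dss simp: sW'[THEN subsetD])
  have long: "\<exists>vs. length vs = N \<and> set vs \<subseteq> J \<and> \<not> foldr s vs W \<preceq> A v0" for N
  proof (induction N)
    case 0 then show ?case using WA by simp
  next
    case (Suc N)
    then obtain vs where vs: "length vs = N" "set vs \<subseteq> J" "\<not> foldr s vs W \<preceq> A v0" by blast
    obtain v where "v \<in> J" "\<not> s v (foldr s vs W) \<preceq> A v0" using step[OF dF FW vs(3)] by blast
    then show ?case using vs by (intro exI[of _ "v # vs"]) auto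
  qed
  obtain B where B: "finite B" "ds B (\<lambda>e. W)" "ds B (\<lambda>e. K)"
    using dsub_params[of "{W, K}"] dW dK by auto
  obtain N where N: "\<And>E. finite E \<Longrightarrow> card E \<le> card B + 2 \<Longrightarrow> finite {X. ds E (\<lambda>e. X)} \<and> card {X. ds E (\<lambda>e. X)} \<le> N"
    using ds_card[of "card B + 2"] by auto
  obtain vs where vs: "length vs = Suc N" "set vs \<subseteq> J" "\<not> foldr s vs W \<preceq> A v0" using long by blast
  have "\<exists>j\<in>set vs. \<forall>i\<in>set vs. A j \<preceq> A i"
    by (rule finite_chain_least) (use chain[OF dA AW DA dA AW DA] vs JV in auto)
  then obtain v where v: "v \<in> set vs" "\<And>u. u \<in> set vs \<Longrightarrow> A v \<preceq> A u" by blast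
  have vJ: "v \<in> J" using v(1) vs(2) by blast
  define C where "C i = ((s v) ^^ i) W" for i
  have C: "C 0 = W" "\<And>i. C (Suc i) = s v (C i)" by (simp_all add: C_def)
  have dC: "dsub (C i)" and CW: "C i \<subseteq> W" for i by (induction i) (auto simp: C intro: dW dss simp: sW'[THEN subsetD])
  have sC: "sg (C i)" for i using dC by (simp add: dsub_def)
  have "foldr s us W \<preceq> C (length us)" if "set us \<subseteq> set vs" for us
    using that
  proof (induction us)
    case Nil then show ?case using alm_refl[OF sW] by (simp add: C)
  next
    case (Cons u us)
    have "s u (foldr s us W) \<preceq> s v (foldr s us W)"
      by (rule best[OF vJ _ v(2) dF FW]) (use Cons.prems vs(2) in auto)
    also have "\<dots> \<preceq> s v (C (length us))" by (rule s_mono[OF Cons.IH sC]) (use Cons.prems in auto)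
    finally show ?case by (simp add: C)
  qed
  from this[of vs] have CN: "\<not> C (Suc N) \<preceq> A v0" using alm_trans vs(1,3) by auto
  let ?E = "insert v0 (insert v B)"
  have EB: "B \<subseteq> ?E" by auto
  have cE: "finite ?E" "card ?E \<le> card B + 2"
    using B(1) card_insert_le_m1 by (auto simp: card_insert_if)
  have dsE: "ds ?E (\<lambda>e. W)" "ds ?E (\<lambda>e. K)" using ds_mono[OF B(2) EB] ds_mono[OF B(3) EB] .
  have dsC: "ds ?E (\<lambda>e. C i)" for i
    by (induction i) (auto simp: C intro: dsE ds_s)
  have smono: "s v P \<subseteq> s v P'" if "P \<subseteq> P'" for P P' using that by (auto simp: s_def im_def ssum_def)
  have dec: "C (Suc i) \<subseteq> C i" for i
    by (induction i) (auto simp: C sW'[THEN subsetD] smono[THEN subsetD])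
  have "\<not> inj_on C {..N}"
  proof
    assume "inj_on C {..N}"
    then have "card {..N} \<le> card {X. ds ?E (\<lambda>e. X)}"
      by (rule card_inj_on_le) (use dsC N[OF cE] in auto)
    then show False using N[OF cE] by simp
  qed
  then obtain i j where ij: "i \<noteq> j" "i \<le> N" "j \<le> N" "C i = C j" by (auto simp: inj_on_def)
  have anti: "a \<le> b \<Longrightarrow> C b \<subseteq> C a" for a b using lift_Suc_antimono_le[of C, OF dec] by blast
  define a where "a = min i j"
  have "C (max i j) \<subseteq> C (Suc a)" by (rule anti) (use ij in \<open>auto simp: a_def\<close>)
  moreover have "C a = C (max i j)" using ij by (auto simp: a_def min_def max_def)
  ultimately have Ca: "C (Suc a) = C a" using dec[of a] by auto
  have Cab: "C (a + b) = C a" for b by (induction b) (use Ca C in auto)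
  have "a \<le> N" using ij by (simp add: a_def)
  then have "C (Suc N) = C a" using Cab[of "Suc N - a"] by simp
  define P where "P = C a"
  have Pn: "\<not> P \<preceq> A v0" using CN \<open>C (Suc N) = C a\<close> by (simp add: P_def)
  have Ps: "P = s v P" using Ca C(2)[of a] by (simp add: P_def)
  have dP: "dsub P" and PW: "P \<subseteq> W" and sP: "sg P" and dsP: "ds ?E (\<lambda>e. P)" using dC CW sC dsC by (auto simp: P_def)
  have A0P: "A v0 \<subseteq> P" using A0s[OF sP, of v] Ps by simp
  have v0P: "m v0 ` P \<subseteq> im P K v" using s_img[of v P] Ps by simp
  have to_A0: "R \<preceq> A v0" if "R \<subseteq> W" "m v0 ` R \<preceq> K" for R using that img_alm_iff[OF sW sK] by blast
  have "\<not> P \<preceq> A v"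
  proof
    assume "P \<preceq> A v"
    from alm_img[OF addR this, of v] have "m v ` P \<preceq> K" by (rule alm_mono) (auto simp: ann_def)
    from le_alm[OF v0P im_alm[OF sK alm_refl[OF sK] this]] show False using to_A0[OF PW] Pn by blast
  qed
  then have AP: "A v \<preceq> P"
    using chain[OF dP PW alm_le[OF DA[OF v0(1)] A0P] dA AW DA[OF JV[OF vJ]]] by blast
  define Y where "Y = rec_nat (A v \<inter> P) (\<lambda>_ S. {w \<in> P. m v w \<in> im S K v0})"
  have Y: "Y 0 = A v \<inter> P" "\<And>i. Y (Suc i) = {w \<in> P. m v w \<in> im (Y i) K v0}" by (simp_all add: Y_def)
  have dsY: "ds ?E (\<lambda>e. Y i)" for i
  proof (induction i)
    case 0 show ?case unfolding Y by (intro dintro dsE dsP) auto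
  next
    case (Suc i) show ?case unfolding Y by (intro dintro Suc dsE dsP) auto
  qed
  have sY: "sg (Y i)" for i
    by (induction i) (use sg_Int[OF sA sP] sg_pre[OF addR sP sg_im[OF _ sK]] in \<open>auto simp: Y\<close>)
  have YP: "Y i \<subseteq> P" for i by (cases i) (auto simp: Y)
  have inc: "Y i \<subseteq> Y (Suc i)" for i
  proof (induction i)
    case 0
    show ?case using im_subK[OF sY[of 0], of K v0] by (auto simp: Y ann_def)
  next
    case (Suc i)
    then have "im (Y i) K v0 \<subseteq> im (Y (Suc i)) K v0" by (auto simp: im_def ssum_def)
    then show ?case using Y(2)[of i] Y(2)[of "Suc i"] by auto
  qed
  obtain M where M: "\<forall>k\<ge>M. Y k = Y M" using inc_stabilises[of ?E Y, OF cE(1) dsY inc] by blast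
  have A0Y: "A v0 \<preceq> Y i" for i
  proof -
    have "A v0 \<preceq> A v \<inter> P" by (rule alm_int[OF JA[OF vJ] alm_sub[OF sP A0P] sA sP])
    moreover have "Y 0 \<subseteq> Y i" using lift_Suc_mono_le[of Y, OF inc] by blast
    ultimately show ?thesis using alm_le by (simp add: Y)
  qed
  have fwd: "m v0 ` Y i \<preceq> im (Y (Suc i)) K v" for i
  proof (rule alm_sub[OF sg_im[OF sY sK]], rule image_subsetI)
    fix c assume c: "c \<in> Y i"
    then have "c \<in> P" using YP[of i] by blast
    then have "m v0 c \<in> im P K v" using v0P by blast
    then obtain w k where wk: "w \<in> P" "k \<in> K" "m v0 c = m v w + k" by (auto simp: im_def ssum_def)
    have "m v0 c \<in> im (Y i) K v0" using im_sub[OF sK, of v0 "Y i"] c by blast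
    moreover have "k \<in> im (Y i) K v0" using im_subK[OF sY[of i], of K v0] wk(2) by blast
    ultimately have "m v0 c - k \<in> im (Y i) K v0" by (rule sg_diff[OF sg_im[OF sY sK]])
    then have "w \<in> Y (Suc i)" using wk by (simp add: Y)
    then show "m v0 c \<in> im (Y (Suc i)) K v" using wk by (auto simp: im_def intro: ssumI)
  qed
  have bwd: "Y (Suc i) \<preceq> Y i" if "Y (Suc (Suc i)) \<preceq> Y (Suc i)" for i
  proof -
    have "m v0 ` Y (Suc i) \<preceq> im (Y (Suc (Suc i))) K v" by (rule fwd)
    also have "\<dots> \<preceq> im (Y (Suc i)) K v" by (rule im_mono[OF that sY sK])
    also have "\<dots> \<preceq> im (Y i) K v0"
      by (rule im_alm[OF sg_im[OF sY sK] alm_sub[OF sg_im[OF sY sK] im_subK[OF sY]]])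
        (rule alm_sub[OF sg_im[OF sY sK]], auto simp: Y)
    finally have "Y (Suc i) \<preceq> {w \<in> W. m v0 w \<in> im (Y i) K v0}"
      by (rule alm_pre[OF addR sg_im[OF sY sK] sW]) (use YP PW in blast)
    also have "\<dots> \<subseteq> Y i \<uplus> A v0"
    proof
      fix w assume w: "w \<in> {w \<in> W. m v0 w \<in> im (Y i) K v0}"
      then obtain q k where q: "q \<in> Y i" "k \<in> K" "m v0 w = m v0 q + k" by (auto simp: im_def ssum_def)
      moreover have "q \<in> W" using q(1) YP[of i] PW by blast
      ultimately have "w - q \<in> A v0" using w sg_diff[OF sW] by (auto simp: ann_def m_diff)
      from ssumI[OF q(1) this] show "w \<in> Y i \<uplus> A v0" by simp
    qed
    also have "\<dots> \<preceq> Y i" by (rule alm_plus[OF alm_refl[OF sY] A0Y sY])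
    finally show ?thesis .
  qed
  have "Y (Suc i) \<preceq> Y i" for i
  proof (rule ccontr)
    assume n: "\<not> Y (Suc i) \<preceq> Y i"
    have "\<not> Y (Suc (i + k)) \<preceq> Y (i + k)" for k by (induction k) (use n bwd in auto)
    from this[of M] show False using M[rule_format, of "i + M"] M[rule_format, of "Suc (i + M)"] alm_refl[OF sY] by simp
  qed
  from this[of 0] have "m v0 ` Y 0 \<preceq> im (Y 0) K v" using alm_trans[OF fwd im_mono[OF _ sY sK]] by blast
  also have "\<dots> \<preceq> K"
    by (rule im_alm[OF sK alm_refl[OF sK]]) (rule alm_sub[OF sK], auto simp: Y ann_def)
  finally have "Y 0 \<preceq> A v0" by (rule to_A0[rotated]) (use YP PW in blast)
  moreover have "A v \<preceq> Y 0" using alm_int[OF alm_refl[OF sA] AP sA sP] by (simp add: Y)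
  ultimately show False using Jn[OF vJ] alm_trans by blast
qed

end

section \<open>Tame rings are virtually finite-by-null\<close>

lemma alm_zero: "S \<preceq> {0} \<longleftrightarrow> finite S"
proof
  assume "S \<preceq> {0}"
  then obtain F where "finite F" "\<forall>a\<in>S. \<exists>f\<in>F. a = f" unfolding alm_def by auto
  then show "finite S" using finite_subset[of S F] by auto
qed (auto simp: alm_def)
lemma almk_zero: "almk k S {0} \<longleftrightarrow> finite S \<and> card S \<le> k"
proof
  assume "almk k S {0}"
  then obtain F where F: "finite F" "card F \<le> k" "\<forall>a\<in>S. \<exists>f\<in>F. a = f" unfolding almk_def by auto
  then have "S \<subseteq> F" by auto
  then show "finite S \<and> card S \<le> k" using F card_mono[of F S] finite_subset[of S F] by auto
qed (auto simp: almk_def)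
lemma alm_INT: assumes "finite F" "\<And>i. i \<in> F \<Longrightarrow> A \<preceq> B i" "\<And>i. i \<in> F \<Longrightarrow> sg (B i)"
  shows "A \<preceq> (\<Inter>i\<in>F. B i)"
  using assms
proof (induction F)
  case empty then show ?case by (simp add: alm_sub)
next
  case (insert i F)
  have "A \<preceq> B i \<inter> (\<Inter>i\<in>F. B i)"
    by (rule alm_int) (use insert in \<open>auto intro: sg_INT\<close>)
  then show ?case by simp
qed
lemma sg_additive: "sg H \<longleftrightarrow> Defs.additive_subgroup H" by (simp add: sg_def Defs.additive_subgroup_def)
lemma finite_index: assumes "UNIV \<preceq> H" "sg H" shows "finite_additive_index H"
proof -
  obtain F where F: "finite F" "\<And>a. \<exists>f\<in>F. a - f \<in> H" using assms unfolding alm_def by auto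
  have "(\<lambda>h. x + h) ` H \<in> (\<lambda>f. (\<lambda>h. f + h) ` H) ` F" for x
  proof -
    obtain f where f: "f \<in> F" "x - f \<in> H" using F by blast
    have "(\<lambda>h. x + h) ` H = (\<lambda>h. f + h) ` H"
    proof (intro equalityI image_subsetI)
      fix h assume "h \<in> H"
      then have "(x - f) + h \<in> H" using sg_add[OF assms(2) f(2)] by blast
      then show "x + h \<in> (\<lambda>h. f + h) ` H" by (intro image_eqI[of _ _ "(x - f) + h"]) simp_all
    next
      fix h assume "h \<in> H"
      then have "h - (x - f) \<in> H" using sg_diff[OF assms(2) _ f(2)] by blast
      then show "f + h \<in> (\<lambda>h. x + h) ` H" by (intro image_eqI[of _ _ "h - (x - f)"]) simp_all
    qed
    then show ?thesis using f(1) by blast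
  qed
  then have "range (\<lambda>x. (\<lambda>h. x + h) ` H) \<subseteq> (\<lambda>f. (\<lambda>h. f + h) ` H) ` F" by blast
  then show ?thesis unfolding finite_additive_index_def
    by (rule finite_subset) (rule finite_imageI[OF F(1)])
qed

context tame begin

lemma bil_mult: "bil df nb (*)"
  by unfold_locales (auto simp: addv_def distrib_left distrib_right intro: df_mulv)

text \<open>Triviality of multiplication modulo \<open>0\<close> gives subgroups \<open>Z\<close> and \<open>D\<close> of finite index whose elements have finite
  images, and definability bounds the sizes of the groups \<open>v D\<close>. For \<open>v\<close> with \<open>v D\<close> of maximal size, every
  \<open>u\<close> that annihilates representatives of \<open>v D\<close> satisfies \<open>(v + u) D = v D\<close>, so \<open>u D\<close> lies in this one
  finite group.\<close>
theorem virtually_finite_by_null: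
  "\<exists>R\<^sub>0 I :: 'a set. nonunital_subring R\<^sub>0 \<and> finite_additive_index R\<^sub>0 \<and> two_sided_ideal_in I R\<^sub>0 \<and> finite I \<and>
    (\<forall>x \<in> R\<^sub>0. \<forall>y \<in> R\<^sub>0. x * y \<in> I)"
proof -
  interpret b: bil df nb "(*)" by (rule bil_mult)
  interpret f: bil df nb "fl (*)" by (rule b.bil_fl)
  have F: "b.form UNIV UNIV {0} UNIV" unfolding b.form_def
    using dsub_UNIV dsub_zero by (auto intro: alm_sub)
  have tr: "b.triv UNIV UNIV {0}"
  proof (rule ccontr)
    assume "\<not> b.triv UNIV UNIV {0}"
    from b.ex_minform[OF F this] obtain V W K L where "minform df nb (*) V W K L" by blast
    then show False by (rule minform.impossible)
  qed
  define Z where "Z = lz (*) UNIV {0} (UNIV :: 'a set)"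
  define D where "D = lz (fl (*)) UNIV {0} (UNIV :: 'a set)"
  have Z: "UNIV \<preceq> Z" using tr by (simp add: b.triv_def Z_def)
  have D: "UNIV \<preceq> D" using tr b.triv_fl[OF dsub_UNIV dsub_UNIV dsub_zero] by (simp add: D_def)
  have dZ: "dsub Z" unfolding Z_def by (rule b.dsub_lz[OF dsub_UNIV dsub_zero dsub_UNIV])
  have dD: "dsub D" unfolding D_def by (rule f.dsub_lz[OF dsub_UNIV dsub_zero dsub_UNIV])
  have sZ: "sg Z" and sD: "sg D" using dZ dD by (auto simp: dsub_def)
  have finZ: "finite (range ((*) v))" if "v \<in> Z" for v using that by (simp add: Z_def lz_def alm_zero)
  have finD: "finite (range (\<lambda>v. v * w))" if "w \<in> D" for w using that by (simp add: D_def lz_def alm_zero fl_def)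
  obtain E where E: "finite E" "ds E (\<lambda>e. D)" using dD by (auto simp: dsub_def dset_def)
  have "ds E (\<lambda>e. (*) (e 0) ` D)" by (intro dintro E)
  from alm_bound[OF E(1) this ds_zero]
  obtain k where k: "\<And>e :: nat \<Rightarrow> 'a. (*) (e 0) ` D \<preceq> {0} \<Longrightarrow> almk k ((*) (e 0) ` D) {0}" by blast
  have k: "card ((*) v ` D) \<le> k" if "v \<in> Z" for v
  proof -
    have "finite ((*) v ` D)" by (rule finite_subset[OF _ finZ[OF that]]) auto
    then show ?thesis using k[of "\<lambda>_. v"] by (simp add: alm_zero almk_zero)
  qed
  have "\<exists>v. v \<in> Z \<and> (\<forall>u. u \<in> Z \<longrightarrow> card ((*) u ` D) \<le> card ((*) v ` D))"
    by (rule ex_has_greatest_nat[of "\<lambda>v. v \<in> Z" 0 _ "Suc k"]) (use sg_0[OF sZ] k in \<open>auto simp: less_Suc_eq_le\<close>)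
  then obtain v where v: "v \<in> Z" "\<And>u. u \<in> Z \<Longrightarrow> card ((*) u ` D) \<le> card ((*) v ` D)" by blast
  define S where "S = (*) v ` D"
  have fS: "finite S" unfolding S_def by (rule finite_subset[OF _ finZ[OF v(1)]]) auto
  have sS: "sg S" unfolding S_def by (rule sg_img[OF b.addR sD])
  obtain F where F: "finite F" "F \<subseteq> D" "S = (*) v ` F"
    using finite_subset_image[of S "(*) v" D] fS by (auto simp: S_def)
  define V0 where "V0 = Z \<inter> (\<Inter>w\<in>F. {u. u * w = 0})"
  have z1: "UNIV \<preceq> {u. u * w = 0}" if "finite (range (\<lambda>u. u * w))" for w :: 'a
    using alm_pre[of "\<lambda>u. u * w" "{0}" UNIV UNIV] that by (simp add: alm_zero b.addL)
  have z2: "UNIV \<preceq> {u. w * u = 0}" if "finite (range ((*) w))" for w :: 'a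
    using alm_pre[of "(*) w" "{0}" UNIV UNIV] that by (simp add: alm_zero b.addR)
  have s1: "sg {u. u * w = 0}" and s2: "sg {u. w * u = 0}" for w :: 'a
    by (auto simp: sg_def left_diff_distrib right_diff_distrib)
  have V0: "UNIV \<preceq> V0" unfolding V0_def
    by (intro alm_int Z alm_INT F(1) sZ sg_INT s1 z1 finD) (use F(2) in auto)
  have sV0: "sg V0" unfolding V0_def by (intro sg_Int sZ sg_INT s1)
  have V0D: "u * d \<in> S" if u: "u \<in> V0" and d: "d \<in> D" for u d
  proof -
    have uZ: "v + u \<in> Z" using u v(1) sg_add[OF sZ] by (auto simp: V0_def)
    have "(v + u) * w = v * w" if "w \<in> F" for w using u that by (simp add: V0_def distrib_right)
    then have "S = (*) (v + u) ` F" using F(3) by (auto simp: image_iff)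
    then have "S \<subseteq> (*) (v + u) ` D" using F(2) by blast
    moreover have "finite ((*) (v + u) ` D)" by (rule finite_subset[OF _ finZ[OF uZ]]) auto
    ultimately have "S = (*) (v + u) ` D" using v(2)[OF uZ] card_seteq[of "(*) (v + u) ` D" S] by (auto simp: S_def)
    then have "(v + u) * d \<in> S" "v * d \<in> S" using d by (auto simp: S_def)
    from sg_diff[OF sS this] show ?thesis by (simp add: distrib_right)
  qed
  define R2 where "R2 = V0 \<inter> D \<inter> (\<Inter>s\<in>S. {x. x * s = 0}) \<inter> (\<Inter>s\<in>S. {x. s * x = 0})"
  have fs1: "finite (range (\<lambda>x. x * s))" and fs2: "finite (range ((*) s))" if "s \<in> S" for s
  proof -
    obtain d where d: "d \<in> D" "s = v * d" using \<open>s \<in> S\<close> by (auto simp: S_def)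
    show "finite (range (\<lambda>x. x * s))"
      by (rule finite_subset[OF _ finD[OF d(1)]]) (auto simp: d(2) simp flip: mult.assoc)
    show "finite (range ((*) s))"
      by (rule finite_subset[OF _ finZ[OF v(1)]]) (auto simp: d(2) mult.assoc)
  qed
  have R2: "UNIV \<preceq> R2" unfolding R2_def
    by (intro alm_int V0 D alm_INT fS sV0 sD sg_Int sg_INT s1 s2 z1 z2 fs1 fs2)
  have sR2: "sg R2" unfolding R2_def by (intro sV0 sD sg_Int sg_INT s1 s2)
  define good where "good U \<longleftrightarrow> S \<subseteq> U \<and> sg U \<and> (\<forall>x\<in>U. \<forall>y\<in>U. x * y \<in> U)" for U
  define T where "T = \<Inter>{U. good U}"
  have gT: "good T" unfolding T_def good_def sg_def by blast
  have sT: "sg T" and ST: "S \<subseteq> T" and TT: "\<And>x y. x \<in> T \<Longrightarrow> y \<in> T \<Longrightarrow> x * y \<in> T" using gT by (auto simp: good_def)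
  have "finite T"
  proof -
    let ?U = "{t. ds S (\<lambda>e. {t})}"
    have eq: "ds S (\<lambda>e. {t}) \<longleftrightarrow> tm S (\<lambda>e. t)" for t
      unfolding ds_def tm_def by (auto simp: eq_commute)
    have "good ?U" unfolding good_def sg_def eq
      by (auto intro: tm_cst tm_0 tm_diff tm_mul)
    then have "T \<subseteq> ?U" by (auto simp: T_def)
    moreover have "finite ?U"
    proof (rule finite_imageD)
      show "finite ((\<lambda>t. {t}) ` ?U)" by (rule finite_subset[OF _ ds_finite[OF fS]]) auto
    qed auto
    ultimately show ?thesis by (rule finite_subset)
  qed
  have R2T: "x * t = 0 \<and> t * x = 0" if "x \<in> R2" "t \<in> T" for x t
  proof -
    have p: "x * (a * b) = 0" if "x * a = 0" for x a b :: 'a using that by (simp flip: mult.assoc)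
    have q: "a * b * x = 0" if "b * x = 0" for x a b :: 'a using that by (simp add: mult.assoc)
    have RS: "x * s = 0 \<and> s * x = 0" if "x \<in> R2" "s \<in> S" for x s using that by (auto simp: R2_def)
    have "good {t. \<forall>x\<in>R2. x * t = 0 \<and> t * x = 0}"
      unfolding good_def sg_def by (auto simp: RS p q left_diff_distrib right_diff_distrib)
    then show ?thesis using that by (auto simp: T_def)
  qed
  define R0 where "R0 = R2 \<uplus> T"
  have sR0: "sg R0" unfolding R0_def by (rule sg_plus[OF sR2 sT])
  have R0: "UNIV \<preceq> R0" unfolding R0_def by (rule alm_le[OF R2 plus_sub1[OF sT]])
  have TR0: "T \<subseteq> R0" unfolding R0_def by (rule plus_sub2[OF sR2])
  have prod: "x * y \<in> T" if xy: "x \<in> R0" "y \<in> R0" for x y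
  proof -
    obtain r t r' t' where rt: "r \<in> R2" "t \<in> T" "x = r + t" "r' \<in> R2" "t' \<in> T" "y = r' + t'"
      using xy unfolding R0_def by (auto elim!: ssumE)
    have "r * r' \<in> T" using V0D[of r r'] rt ST by (auto simp: R2_def)
    then have "r * r' + t * t' \<in> T" using sg_add[OF sT] TT rt by blast
    then show ?thesis using R2T[OF rt(1,5)] R2T[OF rt(4,2)] by (simp add: rt distrib_left distrib_right)
  qed
  have "nonunital_subring R0" unfolding nonunital_subring_def using prod TR0 sR0 by (auto simp: sg_additive)
  moreover have "finite_additive_index R0" by (rule finite_index[OF R0 sR0])
  moreover have "two_sided_ideal_in T R0" unfolding two_sided_ideal_in_def
    using TR0 sT prod by (auto simp: sg_additive)
  ultimately show ?thesis using \<open>finite T\<close> prod by blast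
qed

end

section \<open>Formulas and satisfaction\<close>

abbreviation (input) Neg :: "('f, 'r) fm \<Rightarrow> ('f, 'r) fm" where "Neg p \<equiv> Imp p Falsum"
abbreviation (input) And :: "('f, 'r) fm \<Rightarrow> ('f, 'r) fm \<Rightarrow> ('f, 'r) fm" where "And p q \<equiv> Neg (Imp p (Neg q))"
abbreviation (input) Exi :: "nat \<Rightarrow> ('f, 'r) fm \<Rightarrow> ('f, 'r) fm" where "Exi v p \<equiv> Neg (All v (Neg p))"

primrec ConjL :: "('f, 'r) fm list \<Rightarrow> ('f, 'r) fm" where
  "ConjL [] = Neg Falsum" | "ConjL (p # ps) = And p (ConjL ps)"
primrec Alls :: "nat list \<Rightarrow> ('f, 'r) fm \<Rightarrow> ('f, 'r) fm" where
  "Alls [] p = p" | "Alls (v # vs) p = All v (Alls vs p)"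
abbreviation (input) Exs :: "nat list \<Rightarrow> ('f, 'r) fm \<Rightarrow> ('f, 'r) fm" where "Exs vs p \<equiv> Neg (Alls vs (Neg p))"

lemma ConjL_simps[simp]: "sat M s (ConjL ps) \<longleftrightarrow> (\<forall>p\<in>set ps. sat M s p)"
  "fm_in L (ConjL ps) \<longleftrightarrow> (\<forall>p\<in>set ps. fm_in L p)" "fv (ConjL ps) = (\<Union>p\<in>set ps. fv p)"
  by (induction ps) auto
lemma Alls_simps[simp]: "fm_in L (Alls vs p) \<longleftrightarrow> fm_in L p" "fv (Alls vs p) = fv p - set vs"
  by (induction vs) auto

lemma finite_fv_tm[simp]: "finite (fv_tm t)" by (induction t) auto
lemma finite_fv[simp]: "finite (fv p)" by (induction p) auto
lemma fv_bound: "\<exists>b. fv p \<subseteq> {..<b}" by (rule finite_nat_bounded) simp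

lemma val_cong: "(\<And>i. i \<in> fv_tm t \<Longrightarrow> s i = s' i) \<Longrightarrow> val M s t = val M s' t"
proof (induction t)
  case (Fn F ts)
  have "map (val M s) ts = map (val M s') ts" using Fn by (intro map_cong refl) auto
  then show ?case by (simp only: val.simps)
qed simp
lemma sat_cong: "(\<And>i. i \<in> fv p \<Longrightarrow> s i = s' i) \<Longrightarrow> sat M s p = sat M s' p"
proof (induction p arbitrary: s s')
  case (Equal t u)
  then show ?case using val_cong[of t s s' M] val_cong[of u s s' M] by auto
next
  case (Rel r ts)
  have "map (val M s) ts = map (val M s') ts" by (intro map_cong refl val_cong) (use Rel in auto)
  then show ?case by (simp only: sat.simps)
next
  case (Imp p q)
  have "sat M s p = sat M s' p" "sat M s q = sat M s' q"
    by (rule Imp.IH, use Imp.prems in simp)+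
  then show ?case by simp
next
  case (All v p)
  have "sat M (s(v := x)) p = sat M (s'(v := x)) p" for x by (rule All.IH) (use All.prems in auto)
  then show ?case by simp
qed simp

text \<open>Assignments with values in the domain; the quantifiers of formulas range over the domain only.\<close>
definition iv :: "('f, 'r, 'm) struct \<Rightarrow> (nat \<Rightarrow> 'm) \<Rightarrow> bool" where "iv M s \<longleftrightarrow> (\<forall>i. s i \<in> dom M)"
lemma iv_upd: "iv M s \<Longrightarrow> x \<in> dom M \<Longrightarrow> iv M (s(v := x))" by (simp add: iv_def)

lemma sat_Alls: "iv M s \<Longrightarrow> sat M s (Alls vs p) \<longleftrightarrow> (\<forall>t. iv M t \<longrightarrow> (\<forall>i. i \<notin> set vs \<longrightarrow> t i = s i) \<longrightarrow> sat M t p)"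
proof (induction vs arbitrary: s)
  case Nil
  have "t = s" if "\<forall>i. t i = s i" for t using that by blast
  then show ?case using Nil by auto
next
  case (Cons v vs)
  have "sat M s (Alls (v # vs) p) \<longleftrightarrow> (\<forall>x\<in>dom M. \<forall>t. iv M t \<longrightarrow> (\<forall>i. i \<notin> set vs \<longrightarrow> t i = (s(v := x)) i) \<longrightarrow> sat M t p)"
    by (simp only: Alls.simps sat.simps, intro ball_cong refl Cons.IH iv_upd Cons.prems)
  also have "\<dots> \<longleftrightarrow> (\<forall>t. iv M t \<longrightarrow> (\<forall>i. i \<notin> set (v # vs) \<longrightarrow> t i = s i) \<longrightarrow> sat M t p)"
  proof (intro iffI allI impI ballI)
    fix t assume h: "\<forall>x\<in>dom M. \<forall>t. iv M t \<longrightarrow> (\<forall>i. i \<notin> set vs \<longrightarrow> t i = (s(v := x)) i) \<longrightarrow> sat M t p"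
      and t: "iv M t" "\<forall>i. i \<notin> set (v # vs) \<longrightarrow> t i = s i"
    have "t v \<in> dom M" using t(1) by (simp add: iv_def)
    moreover have "\<forall>i. i \<notin> set vs \<longrightarrow> t i = (s(v := t v)) i" using t(2) by simp
    ultimately show "sat M t p" using h t(1) by blast
  next
    fix x t assume h: "\<forall>t. iv M t \<longrightarrow> (\<forall>i. i \<notin> set (v # vs) \<longrightarrow> t i = s i) \<longrightarrow> sat M t p"
      and t: "iv M t" "\<forall>i. i \<notin> set vs \<longrightarrow> t i = (s(v := x)) i"
    then have "\<forall>i. i \<notin> set (v # vs) \<longrightarrow> t i = s i" by simp
    then show "sat M t p" using h t(1) by blast
  qed
  finally show ?case .
qed
lemma sat_Exs: "iv M s \<Longrightarrow> sat M s (Exs vs p) \<longleftrightarrow> (\<exists>t. iv M t \<and> (\<forall>i. i \<notin> set vs \<longrightarrow> t i = s i) \<and> sat M t p)"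
  by (simp add: sat_Alls)

text \<open>Renaming of free variables along an arbitrary, possibly non-injective map; bound variables are renamed apart.\<close>
primrec rent :: "(nat \<Rightarrow> nat) \<Rightarrow> 'f tm \<Rightarrow> 'f tm" where
  "rent f (Var v) = Var (f v)" | "rent f (Fn g ts) = Fn g (map (rent f) ts)"
primrec ren :: "('f, 'r) fm \<Rightarrow> (nat \<Rightarrow> nat) \<Rightarrow> ('f, 'r) fm" where
  "ren Falsum f = Falsum"
| "ren (Equal t u) f = Equal (rent f t) (rent f u)"
| "ren (Rel r ts) f = Rel r (map (rent f) ts)"
| "ren (Imp p q) f = Imp (ren p f) (ren q f)"
| "ren (All v p) f = (let w = (LEAST w. w \<notin> f ` (fv p - {v})) in All w (ren p (f(v := w))))"

lemma rent_simps[simp]: "tm_in L (rent f t) \<longleftrightarrow> tm_in L t" "fv_tm (rent f t) = f ` fv_tm t"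
  "val M s (rent f t) = val M (s \<circ> f) t"
  by (induction t) (auto simp: o_def intro!: arg_cong[of _ _ "fn M _"])
lemma fresh: fixes f :: "nat \<Rightarrow> nat" shows "(LEAST w. w \<notin> f ` (fv p - {v})) \<notin> f ` (fv p - {v})"
proof -
  have "finite (f ` (fv p - {v}))" by simp
  then have "\<exists>w :: nat. w \<notin> f ` (fv p - {v})" using ex_new_if_finite[OF infinite_UNIV_nat] by blast
  then show ?thesis by (rule LeastI_ex)
qed
lemma ren_fm_in[simp]: "fm_in L (ren p f) \<longleftrightarrow> fm_in L p" by (induction p arbitrary: f) (auto simp: Let_def)
lemma ren_fv: "fv (ren p f) \<subseteq> f ` fv p"
proof (induction p arbitrary: f)
  case (All v p)
  let ?w = "LEAST w. w \<notin> f ` (fv p - {v})"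
  have "fv (ren p (f(v := ?w))) \<subseteq> (f(v := ?w)) ` fv p" by (rule All.IH)
  then show ?case by (auto simp: Let_def split: if_splits)
next
  case (Imp p q)
  have "fv (ren p f) \<subseteq> f ` fv p" "fv (ren q f) \<subseteq> f ` fv q" by (rule Imp.IH)+
  then show ?case by (simp add: image_Un) blast
qed auto
lemma ren_sat[simp]: "sat M s (ren p f) = sat M (s \<circ> f) p"
proof (induction p arbitrary: s f)
  case (Rel r ts)
  have "map (val M s) (map (rent f) ts) = map (val M (s \<circ> f)) ts" by simp
  then show ?case by (simp only: sat.simps ren.simps)
next
  case (All v p)
  let ?w = "LEAST w. w \<notin> f ` (fv p - {v})"
  have "sat M (s(?w := x)) (ren p (f(v := ?w))) = sat M ((s \<circ> f)(v := x)) p" for x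
  proof -
    have "sat M (s(?w := x) \<circ> f(v := ?w)) p = sat M ((s \<circ> f)(v := x)) p"
    proof (rule sat_cong)
      fix i assume i: "i \<in> fv p"
      show "(s(?w := x) \<circ> f(v := ?w)) i = ((s \<circ> f)(v := x)) i"
      proof (cases "i = v")
        case False
        then have "f i \<in> f ` (fv p - {v})" using i by blast
        then have "f i \<noteq> ?w" using fresh[of f p v] by metis
        then show ?thesis using False by simp
      qed simp
    qed
    then show ?thesis unfolding All.IH .
  qed
  then show ?case by (simp only: ren.simps Let_def sat.simps)
qed simp_all

lemma val_dom: assumes "structure_of L M" "iv M s" shows "tm_in L t \<Longrightarrow> val M s t \<in> dom M"
proof (induction t)
  case (Var v) then show ?case using assms(2) by (simp add: iv_def)
next
  case (Fn F ts)
  have "set (map (val M s) ts) \<subseteq> dom M" using Fn by auto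
  then show ?case using assms(1) Fn.prems unfolding structure_of_def by simp
qed
lemma iso_val: assumes "isomorphism L M M' g" "structure_of L M" "iv M s" and h: "\<And>i. h i = g (s i)"
  shows "tm_in L t \<Longrightarrow> val M' h t = g (val M s t)"
proof (induction t)
  case (Var v) then show ?case using h by simp
next
  case (Fn F ts)
  have 1: "map (val M' h) ts = map g (map (val M s) ts)" using Fn by simp
  have "set (map (val M s) ts) \<subseteq> dom M" using Fn.prems val_dom[OF assms(2,3)] by auto
  then have "g (fn M F (map (val M s) ts)) = fn M' F (map g (map (val M s) ts))"
    using assms(1) Fn.prems unfolding isomorphism_def by (metis length_map tm_in.simps(2))
  then show ?case using 1 by (simp only: val.simps)
qed
lemma iso_sat: assumes "isomorphism L M M' g" "structure_of L M"
  shows "fm_in L p \<Longrightarrow> iv M s \<Longrightarrow> (\<And>i. h i = g (s i)) \<Longrightarrow> sat M' h p = sat M s p"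
proof (induction p arbitrary: s h)
  case (Equal t u)
  have b: "inj_on g (dom M)" using assms(1) by (simp add: isomorphism_def bij_betw_def)
  have d: "val M s t \<in> dom M" "val M s u \<in> dom M" using Equal.prems val_dom[OF assms(2)] by auto
  have v: "val M' h t = g (val M s t)" "val M' h u = g (val M s u)"
    by (rule iso_val[OF assms Equal.prems(2,3)], use Equal.prems(1) in simp)+
  show ?case unfolding sat.simps v using inj_on_eq_iff[OF b d] .
next
  case (Rel r ts)
  have v: "val M' h t = g (val M s t)" if "t \<in> set ts" for t
    by (rule iso_val[OF assms Rel.prems(2,3)]) (use Rel.prems(1) that in simp)
  then have 1: "map (val M' h) ts = map g (map (val M s) ts)" by simp
  have "set (map (val M s) ts) \<subseteq> dom M" using Rel.prems val_dom[OF assms(2) Rel.prems(2)] by auto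
  then have "rel M r (map (val M s) ts) = rel M' r (map g (map (val M s) ts))"
    using assms(1) Rel.prems unfolding isomorphism_def by (metis length_map fm_in.simps(3))
  then show ?case using 1 by (simp only: sat.simps)
next
  case (All v p)
  have b: "g ` dom M = dom M'" using assms(1) by (auto simp: isomorphism_def bij_betw_def)
  have "sat M' (h(v := g x)) p = sat M (s(v := x)) p" if "x \<in> dom M" for x
    by (rule All.IH[OF _ iv_upd[OF All.prems(2) that]]) (use All.prems in auto)
  then show ?case unfolding sat.simps b[symmetric] by simp
next
  case (Imp p q)
  have "sat M' h p = sat M s p" "sat M' h q = sat M s q"
    by (rule Imp.IH[OF _ Imp.prems(2,3)], use Imp.prems(1) in simp)+
  then show ?case by simp
qed simp

instance tm :: (countable) countable by countable_datatype
instance fm :: (countable, countable) countable by countable_datatype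

lemma tm_syms: "tm_in L t \<Longrightarrow> set_tm t \<subseteq> fn_syms L" by (induction t) auto
lemma fm_syms: "fm_in L p \<Longrightarrow> set1_fm p \<subseteq> fn_syms L \<and> set2_fm p \<subseteq> rel_syms L"
  by (induction p) (auto dest: tm_syms)
lemma countable_fm: assumes "countable_language L" shows "countable {p. fm_in L p}"
proof -
  let ?f = "to_nat_on (fn_syms L)" and ?r = "to_nat_on (rel_syms L)"
  have i: "inj_on ?f (fn_syms L)" "inj_on ?r (rel_syms L)"
    using assms by (auto simp: countable_language_def intro: inj_on_to_nat_on)
  have "inj_on (map_fm ?f ?r) {p. fm_in L p}"
  proof (rule inj_onI)
    fix p q assume *: "p \<in> {p. fm_in L p}" "q \<in> {p. fm_in L p}" "map_fm ?f ?r p = map_fm ?f ?r q"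
    have s: "set1_fm p \<subseteq> fn_syms L" "set2_fm p \<subseteq> rel_syms L" "set1_fm q \<subseteq> fn_syms L" "set2_fm q \<subseteq> rel_syms L"
      using *(1,2) fm_syms[of L p] fm_syms[of L q] by auto
    show "p = q"
    proof (rule fm.inj_map_strong[OF _ _ *(3)])
      show "a = b" if "a \<in> set1_fm p" "b \<in> set1_fm q" "?f a = ?f b" for a b
        using inj_onD[OF i(1) that(3)] s that by blast
      show "a = b" if "a \<in> set2_fm p" "b \<in> set2_fm q" "?r a = ?r b" for a b
        using inj_onD[OF i(2) that(3)] s that by blast
    qed
  qed
  then show ?thesis by (rule countableI')
qed

text \<open>Existential projection of \<open>q\<close> to the variables \<open>h 0, ..., h (n - 1)\<close>, renamed to \<open>0, ..., n - 1\<close>.\<close>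
lemma project: assumes "fm_in L q"
  shows "\<exists>c. fm_in L c \<and> fv c \<subseteq> {..<n} \<and>
    (\<forall>t. iv M t \<longrightarrow> (sat M t c \<longleftrightarrow> (\<exists>s. iv M s \<and> (\<forall>i<n. s (h i) = t i) \<and> sat M s q)))"
proof -
  have "finite (fv q \<union> h ` {..<n})" by simp
  then obtain b where b: "fv q \<union> h ` {..<n} \<subseteq> {..<b}" using finite_nat_bounded by blast
  let ?E = "ConjL (map (\<lambda>i. Equal (Var i) (Var (n + h i))) [0..<n])"
  let ?p = "And ?E (ren q (\<lambda>i. n + i))"
  let ?c = "Exs [n..<n + b] ?p"
  have "fv (ren q (\<lambda>i. n + i)) \<subseteq> (\<lambda>i. n + i) ` fv q" by (rule ren_fv)
  then have "fv ?c \<subseteq> {..<n}" using b by (auto simp: subset_eq)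
  moreover have "sat M t ?c \<longleftrightarrow> (\<exists>s. iv M s \<and> (\<forall>i<n. s (h i) = t i) \<and> sat M s q)" if t: "iv M t" for t
  proof
    assume "sat M t ?c"
    then obtain u where u: "iv M u" "\<forall>i. i \<notin> set [n..<n + b] \<longrightarrow> u i = t i" "sat M u ?p"
      unfolding sat_Exs[OF t] by blast
    have "u i = t i" if "i < n" for i using u(2) that by simp
    then have "\<forall>i<n. u (n + h i) = t i" using u(3) by auto
    moreover have "sat M (u \<circ> (\<lambda>i. n + i)) q" using u(3) by auto
    ultimately show "\<exists>s. iv M s \<and> (\<forall>i<n. s (h i) = t i) \<and> sat M s q"
      using u(1) by (intro exI[of _ "u \<circ> (\<lambda>i. n + i)"]) (simp add: iv_def)
  next
    assume "\<exists>s. iv M s \<and> (\<forall>i<n. s (h i) = t i) \<and> sat M s q"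
    then obtain s where s: "iv M s" "\<forall>i<n. s (h i) = t i" "sat M s q" by blast
    define u where "u i = (if n \<le> i \<and> i < n + b then s (i - n) else t i)" for i
    have "iv M u" using s(1) t by (simp add: iv_def u_def)
    moreover have "\<forall>i. i \<notin> set [n..<n + b] \<longrightarrow> u i = t i" by (simp add: u_def)
    moreover have "sat M (u \<circ> (\<lambda>i. n + i)) q = sat M s q" by (rule sat_cong) (use b in \<open>auto simp: u_def\<close>)
    moreover have "h i < b" if "i < n" for i using b that by auto
    then have "sat M u ?E" using s(2) by (auto simp: u_def)
    ultimately have "iv M u \<and> (\<forall>i. i \<notin> set [n..<n + b] \<longrightarrow> u i = t i) \<and> sat M u ?p" using s(3) by simp
    then show "sat M t ?c" unfolding sat_Exs[OF t] by blast
  qed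
  ultimately show ?thesis using assms by (intro exI[of _ ?c]) auto
qed

section \<open>Countably categorical theories\<close>

locale cat_model =
  fixes L :: "('f, 'r) language" and R :: "('f, 'r, 'a) struct" and M :: "('f, 'r, 'm) struct" and \<kappa> :: "'k rel"
  assumes cl: "countable_language L" and domR: "dom R = UNIV"
    and model: "model_of L (complete_theory L R) M"
    and big: "(natLeq, \<kappa>) \<in> ordLess" and saturated: "saturated L \<kappa> M"
    and cat: "omega_categorical_theory L (complete_theory L R)"
begin

lemma str: "structure_of L M" using model by (simp add: model_of_def)
lemma ivR: "iv R s" by (simp add: iv_def domR)

lemma iv_ex: "\<exists>s. iv M s"
proof -
  obtain x where "x \<in> dom M" using str by (auto simp: structure_of_def)
  then show ?thesis by (intro exI[of _ "\<lambda>_. x"]) (simp add: iv_def)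
qed

text \<open>The universal closure of \<open>p\<close>, or else its negation, belongs to the complete theory.\<close>
lemma transfer: assumes p: "fm_in L p" shows "(\<forall>s. iv M s \<longrightarrow> sat M s p) \<longleftrightarrow> (\<forall>s. sat R s p)"
proof -
  obtain b where b: "fv p \<subseteq> {..<b}" using fv_bound by blast
  let ?p = "Alls [0..<b] p"
  have s: "sentence L ?p" "sentence L (Neg ?p)" using p b by (auto simp: sentence_def)
  have T: "holds M q" if "sentence L q" "holds R q" for q
    using model that by (auto simp: model_of_def complete_theory_def)
  have hM: "sat M s q" if "holds M q" "iv M s" for s q using that by (auto simp: holds_def iv_def)
  show ?thesis
  proof
    assume a: "\<forall>s. iv M s \<longrightarrow> sat M s p"
    show "\<forall>s. sat R s p"
    proof (rule ccontr)
      assume "\<not> (\<forall>s. sat R s p)"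
      then obtain s where s0: "\<not> sat R s p" by blast
      have "\<not> sat R t ?p" for t
      proof
        assume t: "sat R t ?p"
        let ?u = "\<lambda>i. if i < b then s i else t i"
        have "sat R ?u p" using t ivR unfolding sat_Alls[OF ivR] by auto
        moreover have "sat R ?u p = sat R s p" by (rule sat_cong) (use b in auto)
        ultimately show False using s0 by simp
      qed
      then have "holds R (Neg ?p)" by (simp add: holds_def)
      then have n: "holds M (Neg ?p)" by (rule T[OF s(2)])
      obtain t where t: "iv M t" using iv_ex by blast
      have "sat M t ?p" unfolding sat_Alls[OF t] using a by blast
      then show False using hM[OF n t] by simp
    qed
  next
    assume a: "\<forall>s. sat R s p"
    have "sat R s ?p" for s unfolding sat_Alls[OF ivR] using a by blast
    then have n: "holds M ?p" by (intro T[OF s(1)]) (simp add: holds_def)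
    show "\<forall>s. iv M s \<longrightarrow> sat M s p" using hM[OF n] sat_Alls by blast
  qed
qed

lemma finite_small: "finite A \<Longrightarrow> (card_of A, \<kappa>) \<in> ordLess"
  using finite_iff_ordLess_natLeq[of A] ordLess_transitive[OF _ big] by blast

text \<open>Saturation for one variable realizes the coordinates one after the other: what is kept is that each finite
  subset is still satisfiable with the coordinates chosen so far, which the existential projection
  expresses as a one-variable type.\<close>
lemma compact:
  assumes Th: "\<And>q. q \<in> Th \<Longrightarrow> fm_in L q" and s0: "iv M s0"
    and fin: "\<And>T0. finite T0 \<Longrightarrow> T0 \<subseteq> Th \<Longrightarrow> \<exists>s. iv M s \<and> (\<forall>i<n. s i = s0 i) \<and> (\<forall>q\<in>T0. sat M s q)"
  shows "\<exists>s. iv M s \<and> (\<forall>i<n. s i = s0 i) \<and> (\<forall>q\<in>Th. sat M s q)"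
proof -
  define good where "good k t \<longleftrightarrow> iv M t \<and>
    (\<forall>T0. finite T0 \<and> T0 \<subseteq> Th \<longrightarrow> (\<exists>s. iv M s \<and> (\<forall>i<k. s i = t i) \<and> (\<forall>q\<in>T0. sat M s q)))" for k :: nat and t
  have step: "\<exists>t'. good (Suc k) t' \<and> (\<forall>i<k. t' i = t i)" if g: "good k t" for k t
  proof -
    let ?h = "\<lambda>i. if i = 0 then k else i - 1"
    have t: "iv M t" using g by (simp add: good_def)
    have "\<forall>T0. \<exists>c. finite T0 \<and> T0 \<subseteq> Th \<longrightarrow> fm_in L c \<and> fv c \<subseteq> {..<Suc k} \<and>
      (\<forall>t. iv M t \<longrightarrow> (sat M t c \<longleftrightarrow> (\<exists>s. iv M s \<and> (\<forall>i<Suc k. s (?h i) = t i) \<and> (\<forall>q\<in>T0. sat M s q))))"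
    proof
      fix T0
      show "\<exists>c. finite T0 \<and> T0 \<subseteq> Th \<longrightarrow> fm_in L c \<and> fv c \<subseteq> {..<Suc k} \<and>
        (\<forall>t. iv M t \<longrightarrow> (sat M t c \<longleftrightarrow> (\<exists>s. iv M s \<and> (\<forall>i<Suc k. s (?h i) = t i) \<and> (\<forall>q\<in>T0. sat M s q))))"
      proof (cases "finite T0 \<and> T0 \<subseteq> Th")
        case True
        then obtain ps where ps: "set ps = T0" using finite_list by blast
        have "fm_in L (ConjL ps)" using ps True Th by auto
        from project[OF this, of "Suc k" M ?h] show ?thesis using ps by simp
      qed blast
    qed
    from choice[OF this] obtain c where c0: "\<forall>T0. finite T0 \<and> T0 \<subseteq> Th \<longrightarrow> fm_in L (c T0) \<and> fv (c T0) \<subseteq> {..<Suc k} \<and>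
      (\<forall>t. iv M t \<longrightarrow> (sat M t (c T0) \<longleftrightarrow> (\<exists>s. iv M s \<and> (\<forall>i<Suc k. s (?h i) = t i) \<and> (\<forall>q\<in>T0. sat M s q))))" ..
    let ?b = "map t [0..<k]" and ?F = "{T0. finite T0 \<and> T0 \<subseteq> Th}"
    have c: "fm_in L (c T0)" "fv (c T0) \<subseteq> {..<Suc k}" if "T0 \<in> ?F" for T0 using c0 that by simp_all
    have real: "sat M (nth ([x] @ ?b)) (c T0) \<longleftrightarrow> (\<exists>s. iv M s \<and> s k = x \<and> (\<forall>i<k. s i = t i) \<and> (\<forall>q\<in>T0. sat M s q))"
      if T0: "T0 \<in> ?F" and x: "x \<in> dom M" for T0 x
    proof -
      have iv: "iv M (case_nat x t)" using x t by (auto simp: iv_def split: nat.split)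
      have "sat M (nth ([x] @ ?b)) (c T0) = sat M (case_nat x t) (c T0)"
      proof (rule sat_cong)
        fix i assume "i \<in> fv (c T0)"
        then have "i < Suc k" using c(2)[OF T0] by auto
        then show "([x] @ ?b) ! i = case_nat x t i" by (auto split: nat.split)
      qed
      also have "\<dots> \<longleftrightarrow> (\<exists>s. iv M s \<and> (\<forall>i<Suc k. s (?h i) = case_nat x t i) \<and> (\<forall>q\<in>T0. sat M s q))"
        using c0 T0 iv by blast
      also have "\<dots> \<longleftrightarrow> (\<exists>s. iv M s \<and> s k = x \<and> (\<forall>i<k. s i = t i) \<and> (\<forall>q\<in>T0. sat M s q))"
        by (simp add: All_less_Suc2 conj_assoc)
      finally show ?thesis .
    qed
    define \<pi> where "\<pi> = (\<lambda>T0. (c T0, ?b)) ` ?F"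
    have "(c T0, ?b) \<in> formulas_over L 1 (t ` {..<k})" if "T0 \<in> ?F" for T0
    proof -
      have "set ?b \<subseteq> t ` {..<k}" by auto
      moreover have "fv (c T0) \<subseteq> {..<1 + length ?b}" using c(2)[OF that] by simp
      ultimately show ?thesis using c(1)[OF that] unfolding formulas_over_def by blast
    qed
    then have "\<pi> \<subseteq> formulas_over L 1 (t ` {..<k})" unfolding \<pi>_def by (rule image_subsetI)
    moreover have "consistent M 1 \<pi>" unfolding consistent_def
    proof (intro allI impI, elim conjE)
      fix \<pi>0 assume "finite \<pi>0" "\<pi>0 \<subseteq> \<pi>"
      then obtain F where F: "F \<subseteq> ?F" "finite F" "\<pi>0 = (\<lambda>T0. (c T0, ?b)) ` F"
        unfolding \<pi>_def using finite_subset_image[of \<pi>0 "\<lambda>T0. (c T0, ?b)" ?F] by blast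
      have "finite (\<Union>F)" "\<Union>F \<subseteq> Th" using F by auto
      then obtain s where s: "iv M s" "\<forall>i<k. s i = t i" "\<forall>q\<in>\<Union>F. sat M s q" using g unfolding good_def by blast
      have sk: "s k \<in> dom M" using s(1) by (simp add: iv_def)
      have "sat M (nth ([s k] @ ?b)) (c T0)" if "T0 \<in> F" for T0
        using real[of T0 "s k"] F(1) that sk s by blast
      then have "realizes M [s k] \<pi>0" by (auto simp: realizes_def F(3))
      then show "\<exists>x. length x = 1 \<and> set x \<subseteq> dom M \<and> realizes M x \<pi>0" using sk by (intro exI[of _ "[s k]"]) simp
    qed
    moreover have "t ` {..<k} \<subseteq> dom M" using t by (auto simp: iv_def)
    moreover have "(card_of (t ` {..<k}), \<kappa>) \<in> ordLess" by (rule finite_small) simp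
    ultimately obtain x where x: "x \<in> dom M" "realizes M [x] \<pi>" using saturated unfolding saturated_def by blast
    have "good (Suc k) (t(k := x))" unfolding good_def
    proof (intro conjI allI impI)
      show "iv M (t(k := x))" by (rule iv_upd[OF t x(1)])
      fix T0 assume T0: "finite T0 \<and> T0 \<subseteq> Th"
      then have "sat M (nth ([x] @ ?b)) (c T0)" using x(2) unfolding realizes_def \<pi>_def by auto
      then obtain s where "iv M s" "s k = x" "\<forall>i<k. s i = t i" "\<forall>q\<in>T0. sat M s q" using real[of T0 x] T0 x(1) by auto
      then show "\<exists>s. iv M s \<and> (\<forall>i<Suc k. s i = (t(k := x)) i) \<and> (\<forall>q\<in>T0. sat M s q)"
        by (intro exI[of _ s]) (auto simp: less_Suc_eq)
    qed
    then show ?thesis by (intro exI[of _ "t(k := x)"]) simp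
  qed
  have "\<exists>T. \<forall>k. (good (n + k) (T k) \<and> (k = 0 \<longrightarrow> T k = s0)) \<and> (\<forall>i<n + k. T (Suc k) i = T k i)"
  proof (rule dependent_nat_choice)
    show "\<exists>x. good (n + 0) x \<and> (0 = 0 \<longrightarrow> x = s0)" using s0 fin by (auto simp: good_def)
    show "\<exists>y. (good (n + Suc k) y \<and> (Suc k = 0 \<longrightarrow> y = s0)) \<and> (\<forall>i<n + k. y i = x i)"
      if "good (n + k) x \<and> (k = 0 \<longrightarrow> x = s0)" for x k using step[of "n + k" x] that by simp
  qed
  then obtain T where T: "\<And>k. good (n + k) (T k)" "T 0 = s0" "\<And>k i. i < n + k \<Longrightarrow> T (Suc k) i = T k i" by blast
  have st: "T (k + m) i = T k i" if "i < n + k" for i k m using that by (induction m) (auto simp: T(3))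
  define s where "s i = T (Suc i) i" for i
  have sT: "s i = T k i" if "i < n + k" for i k
    using st[of i k "Suc i"] st[of i "Suc i" k] that by (simp add: s_def add.commute)
  have "iv M s" using T(1) by (auto simp: iv_def s_def good_def)
  moreover have "\<forall>i<n. s i = s0 i" using sT[of _ 0] T(2) by simp
  moreover have "sat M s q" if q: "q \<in> Th" for q
  proof -
    obtain b where b: "fv q \<subseteq> {..<b}" using fv_bound by blast
    have "finite {q}" "{q} \<subseteq> Th" using q by auto
    then obtain u where u: "\<forall>i<n + b. u i = T b i" "sat M u q" using T(1)[of b] unfolding good_def by blast
    have "sat M s q = sat M u q" by (rule sat_cong) (use b u(1) sT[of _ b] in force)
    then show ?thesis using u(2) by simp
  qed
  ultimately show ?thesis by blast
qed

text \<open>Henkin's construction inside \<open>M\<close>: meet countably many dense sets of formulas and realize the resulting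
  decreasing sequence by compactness.\<close>
lemma generic:
  assumes s0: "iv M s0"
    and dense: "\<And>k q s. fm_in L q \<Longrightarrow> iv M s \<Longrightarrow> (\<forall>i<n. s i = s0 i) \<Longrightarrow> sat M s q \<Longrightarrow>
      \<exists>d\<in>D k. fm_in L d \<and> (\<exists>s'. iv M s' \<and> (\<forall>i<n. s' i = s0 i) \<and> sat M s' q \<and> sat M s' d)"
  shows "\<exists>s. iv M s \<and> (\<forall>i<n. s i = s0 i) \<and> (\<forall>k :: nat. \<exists>d\<in>D k. sat M s d)"
proof -
  let ?P = "\<lambda>q. fm_in L q \<and> (\<exists>s. iv M s \<and> (\<forall>i<n. s i = s0 i) \<and> sat M s q)"
  have "\<exists>f. \<forall>k. ?P (f k) \<and> (\<exists>d\<in>D k. f (Suc k) = And (f k) d)"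
  proof (rule dependent_nat_choice)
    show "\<exists>q. ?P q" using s0 by (intro exI[of _ "Neg Falsum"]) auto
    fix q k assume "?P q"
    then obtain s where s: "fm_in L q" "iv M s" "\<forall>i<n. s i = s0 i" "sat M s q" by blast
    from dense[OF this, of k] obtain d s' where d: "d \<in> D k" "fm_in L d" "iv M s'" "\<forall>i<n. s' i = s0 i" "sat M s' q" "sat M s' d" by blast
    then have "?P (And q d)" using s(1) by auto
    then show "\<exists>y. ?P y \<and> (\<exists>d\<in>D k. y = And q d)" using d(1) by blast
  qed
  then obtain f where f: "\<And>k. ?P (f k)" "\<And>k. \<exists>d\<in>D k. f (Suc k) = And (f k) d" by blast
  have s1: "sat M s (f k)" if "sat M s (f (Suc k))" for s k using f(2)[of k] that by auto
  have dn: "sat M s (f k)" if "sat M s (f (k + m))" for s k m using that by (induction m) (auto dest: s1)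
  have "\<exists>s. iv M s \<and> (\<forall>i<n. s i = s0 i) \<and> (\<forall>q\<in>range f. sat M s q)"
  proof (rule compact[OF _ s0])
    show "fm_in L q" if "q \<in> range f" for q using f(1) that by blast
    fix T0 assume "finite T0" "T0 \<subseteq> range f"
    then obtain I where I: "finite I" "T0 = f ` I" using finite_subset_image[of T0 f UNIV] by blast
    obtain K where K: "I \<subseteq> {..<K}" using finite_nat_bounded[OF I(1)] by blast
    obtain s where s: "iv M s" "\<forall>i<n. s i = s0 i" "sat M s (f K)" using f(1)[of K] by blast
    have "sat M s (f k)" if "k \<in> I" for k
    proof -
      have "k < K" using K that by blast
      then have "k + (K - k) = K" by simp
      then show ?thesis using dn[of s k "K - k"] s(3) by simp
    qed
    then show "\<exists>s. iv M s \<and> (\<forall>i<n. s i = s0 i) \<and> (\<forall>q\<in>T0. sat M s q)" using s I(2) by blast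
  qed
  then obtain s where s: "iv M s" "\<forall>i<n. s i = s0 i" "\<And>k. sat M s (f k)" by blast
  have "\<exists>d\<in>D k. sat M s d" for k using f(2)[of k] s(3)[of "Suc k"] by auto
  then show ?thesis using s by blast
qed

text \<open>The formulas that decide whether \<open>\<exists>v. p\<close> holds and, if so, name an entry of the sequence as witness.\<close>
definition witness_set :: "nat \<times> ('f, 'r) fm \<Rightarrow> ('f, 'r) fm set" where
  "witness_set vp = {d. (\<forall>s. iv M s \<longrightarrow> sat M s d \<longrightarrow> \<not> sat M s (Exi (fst vp) (snd vp))) \<or>
     (\<exists>j. \<forall>s. iv M s \<longrightarrow> sat M s d \<longrightarrow> sat M (s(fst vp := s j)) (snd vp))}"

lemma witness_dense: assumes p: "fm_in L p" and s: "fm_in L q" "iv M s" "\<forall>i<n. s i = s0 i" "sat M s q"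
  shows "\<exists>d\<in>witness_set (v, p). fm_in L d \<and> (\<exists>s'. iv M s' \<and> (\<forall>i<n. s' i = s0 i) \<and> sat M s' q \<and> sat M s' d)"
proof (cases "sat M s (Exi v p)")
  case False
  then show ?thesis using p s by (intro bexI[of _ "Neg (Exi v p)"]) (auto simp: witness_set_def)
next
  case True
  then obtain a where a: "a \<in> dom M" "sat M (s(v := a)) p" by auto
  have "finite (fv q \<union> fv p \<union> {v} \<union> {..<n})" by simp
  from ex_new_if_finite[OF infinite_UNIV_nat this] obtain j where j: "j \<notin> fv q \<union> fv p \<union> {v} \<union> {..<n}" ..
  let ?d = "Exi v (And (Equal (Var v) (Var j)) p)"
  let ?s = "s(j := a)"
  have "sat M (?s(v := a)) p = sat M (s(v := a)) p" by (rule sat_cong) (use j in auto)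
  then have "sat M ?s ?d" using a j by auto
  moreover have "sat M ?s q = sat M s q" by (rule sat_cong) (use j in auto)
  moreover have "?d \<in> witness_set (v, p)" using j by (auto simp: witness_set_def)
  moreover have "\<forall>i<n. ?s i = s0 i" using s(3) j by auto
  ultimately show ?thesis using p s iv_upd[OF s(2) a(1)]
    by (intro bexI[of _ ?d] conjI exI[of _ ?s]) (simp_all only: fm_in.simps tm_in.simps simp_thms)
qed

definition witn :: "(nat \<Rightarrow> 'm) \<Rightarrow> bool" where
  "witn s \<longleftrightarrow> iv M s \<and> (\<forall>v p. fm_in L p \<longrightarrow> sat M s (Exi v p) \<longrightarrow> (\<exists>j. sat M (s(v := s j)) p))"
lemma witnI: assumes "iv M s" "\<And>v p. fm_in L p \<Longrightarrow> \<exists>d\<in>witness_set (v, p). sat M s d" shows "witn s"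
  unfolding witn_def using assms unfolding witness_set_def by fastforce

lemma tasks: "\<exists>e :: nat \<Rightarrow> nat \<times> ('f, 'r) fm. range e = UNIV \<times> {p. fm_in L p}"
proof -
  let ?T = "(UNIV :: nat set) \<times> {p. fm_in L p}"
  have c: "countable ?T" using countable_fm[OF cl] by simp
  have "(0, Falsum) \<in> ?T" by simp
  then have "?T \<noteq> {}" by blast
  from range_from_nat_into[OF this c] have "range (from_nat_into ?T) = UNIV \<times> {p. fm_in L p}" .
  then show ?thesis by (intro exI[where x = "from_nat_into ?T"])
qed

lemma hull: assumes w: "witn s" and p: "fm_in L p" and a: "a \<in> dom M" "sat M ((s \<circ> f)(v := a)) p"
  shows "\<exists>j. sat M ((s \<circ> f)(v := s j)) p"
proof -
  have "finite (f ` fv p)" by simp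
  from ex_new_if_finite[OF infinite_UNIV_nat this] obtain u where u: "u \<notin> f ` fv p" ..
  have e: "sat M (s(u := x)) (ren p (f(v := u))) = sat M ((s \<circ> f)(v := x)) p" for x
    unfolding ren_sat by (rule sat_cong) (use u in auto)
  have "sat M s (Exi u (ren p (f(v := u))))" using a e by auto
  then show ?thesis using w p e unfolding witn_def by (metis ren_fm_in)
qed

text \<open>The substructure on the range of the sequence \<open>s\<close>, transported to the natural numbers: an element is named by
  its first index.\<close>
definition nat_str :: "(nat \<Rightarrow> 'm) \<Rightarrow> ('f, 'r, nat) struct" where
  "nat_str s = \<lparr>dom = {i. \<forall>j<i. s j \<noteq> s i}, fn = (\<lambda>F xs. LEAST i. s i = fn M F (map s xs)), rel = (\<lambda>r xs. rel M r (map s xs))\<rparr>"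

lemma least_dom: assumes "\<exists>i. s i = a" shows "(LEAST i. s i = a) \<in> dom (nat_str s)" "s (LEAST i. s i = a) = a"
proof -
  show e: "s (LEAST i. s i = a) = a" by (rule LeastI_ex[OF assms])
  show "(LEAST i. s i = a) \<in> dom (nat_str s)"
    using not_less_Least[of _ "\<lambda>i. s i = a"] unfolding nat_str_def struct.simps mem_Collect_eq e by blast
qed

lemma nat_str_closed: assumes w: "witn s" and F: "F \<in> fn_syms L" "length xs = fn_arity L F"
  shows "\<exists>i. s i = fn M F (map s xs)"
proof -
  let ?k = "length xs"
  let ?p = "Equal (Var ?k) (Fn F (map Var [0..<?k]))"
  let ?f = "\<lambda>i. xs ! i"
  have iv: "iv M s" using w by (simp add: witn_def)
  have e: "map (val M ((s \<circ> ?f)(?k := x))) (map Var [0..<?k]) = map s xs" for x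
    by (rule nth_equalityI) auto
  have v: "val M ((s \<circ> ?f)(?k := x)) (Fn F (map Var [0..<?k])) = fn M F (map s xs)" for x
    by (simp only: val.simps e)
  have "set (map s xs) \<subseteq> dom M" using iv by (auto simp: iv_def)
  then have a: "fn M F (map s xs) \<in> dom M" using str F unfolding structure_of_def by simp
  have "\<exists>j. sat M ((s \<circ> ?f)(?k := s j)) ?p"
    by (rule hull[OF w _ a]) (use F v in \<open>auto simp del: val.simps(2)\<close>)
  then show ?thesis unfolding sat.simps v by auto
qed

lemma nat_str_val: assumes w: "witn s" and e: "iv (nat_str s) e"
  shows "tm_in L t \<Longrightarrow> val (nat_str s) e t \<in> dom (nat_str s) \<and> s (val (nat_str s) e t) = val M (s \<circ> e) t"
proof (induction t)
  case (Var v) then show ?case using e by (simp add: iv_def)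
next
  case (Fn F ts)
  let ?xs = "map (val (nat_str s) e) ts"
  have IH: "s (val (nat_str s) e t) = val M (s \<circ> e) t" if "t \<in> set ts" for t
    using Fn.IH[OF that] Fn.prems that by (meson tm_in.simps(2))
  have m: "map s ?xs = map (val M (s \<circ> e)) ts"
    unfolding map_map by (rule map_cong[OF refl]) (simp only: o_apply IH)
  have ex: "\<exists>i. s i = fn M F (map s ?xs)" by (rule nat_str_closed[OF w]) (use Fn.prems in auto)
  have v: "val (nat_str s) e (Fn F ts) = (LEAST i. s i = fn M F (map s ?xs))" by (simp add: nat_str_def)
  show ?case unfolding v using least_dom[OF ex] m by (simp only: val.simps)
qed

lemma nat_str_sat: assumes w: "witn s"
  shows "fm_in L p \<Longrightarrow> iv (nat_str s) e \<Longrightarrow> sat (nat_str s) e p = sat M (s \<circ> e) p"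
proof (induction p arbitrary: e)
  case (Equal t u)
  have d: "x = y" if "x \<in> dom (nat_str s)" "y \<in> dom (nat_str s)" "s x = s y" for x y
    using that unfolding nat_str_def by (auto simp: ) (metis linorder_neqE_nat)
  show ?case using nat_str_val[OF w Equal(2), of t] nat_str_val[OF w Equal(2), of u] Equal(1) d by (metis fm_in.simps(2) sat.simps(2))
next
  case (Rel r ts)
  have IH: "s (val (nat_str s) e t) = val M (s \<circ> e) t" if "t \<in> set ts" for t
    using nat_str_val[OF w Rel(2), of t] Rel(1) that by (meson fm_in.simps(3))
  have m: "map s (map (val (nat_str s) e) ts) = map (val M (s \<circ> e)) ts"
    unfolding map_map by (rule map_cong[OF refl]) (simp only: o_apply IH)
  have "rel (nat_str s) r xs = rel M r (map s xs)" for xs by (simp add: nat_str_def)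
  then show ?case unfolding sat.simps by (simp only: m)
next
  case (All v p)
  have iv: "iv M s" using w by (simp add: witn_def)
  have f: "fm_in L p" "fm_in L (Neg p)" using All.prems(1) by simp_all
  have IH: "sat (nat_str s) (e(v := x)) p = sat M ((s \<circ> e)(v := s x)) p" if "x \<in> dom (nat_str s)" for x
    using All.IH[OF f(1) iv_upd[OF All.prems(2) that, of v]] unfolding fun_upd_comp .
  show ?case
  proof
    assume a: "sat (nat_str s) e (All v p)"
    show "sat M (s \<circ> e) (All v p)"
    proof (rule ccontr)
      assume "\<not> sat M (s \<circ> e) (All v p)"
      then obtain b where b: "b \<in> dom M" "sat M ((s \<circ> e)(v := b)) (Neg p)" unfolding sat.simps by blast
      from hull[OF w f(2) b] obtain j where j: "sat M ((s \<circ> e)(v := s j)) (Neg p)" ..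
      have "\<exists>i. s i = s j" by blast
      note ld = least_dom[OF this]
      have "sat (nat_str s) (e(v := LEAST i. s i = s j)) p" using a ld(1) unfolding sat.simps by blast
      then have "sat M ((s \<circ> e)(v := s j)) p" unfolding IH[OF ld(1)] ld(2) .
      then show False using j unfolding sat.simps by blast
    qed
  next
    assume a: "sat M (s \<circ> e) (All v p)"
    show "sat (nat_str s) e (All v p)" unfolding sat.simps
    proof
      fix x assume x: "x \<in> dom (nat_str s)"
      have "s x \<in> dom M" using iv by (simp add: iv_def)
      then have "sat M ((s \<circ> e)(v := s x)) p" using a unfolding sat.simps by blast
      then show "sat (nat_str s) (e(v := x)) p" unfolding IH[OF x] .
    qed
  qed
next
  case (Imp p q)
  have "sat (nat_str s) e p = sat M (s \<circ> e) p" "sat (nat_str s) e q = sat M (s \<circ> e) q"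
    by (rule Imp.IH[OF _ Imp.prems(2)], use Imp.prems(1) in simp)+
  then show ?case unfolding sat.simps by (simp only:)
qed simp

lemma nat_str_model: assumes w: "witn s" shows "model_of L (complete_theory L R) (nat_str s)"
proof -
  have "structure_of L (nat_str s)" unfolding structure_of_def
  proof (intro conjI ballI allI impI)
    show "dom (nat_str s) \<noteq> {}" by (auto simp: nat_str_def)
    fix F xs assume F: "F \<in> fn_syms L" "length xs = fn_arity L F \<and> set xs \<subseteq> dom (nat_str s)"
    have ex: "\<exists>i. s i = fn M F (map s xs)" by (rule nat_str_closed[OF w F(1)]) (use F in simp)
    show "fn (nat_str s) F xs \<in> dom (nat_str s)" using least_dom(1)[OF ex] by (simp add: nat_str_def)
  qed
  moreover have "holds (nat_str s) p" if p: "p \<in> complete_theory L R" for p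
  proof -
    have 1: "holds M p" "fm_in L p" using model p by (auto simp: model_of_def complete_theory_def sentence_def)
    show ?thesis unfolding holds_def
    proof (intro allI impI)
      fix e :: "nat \<Rightarrow> nat" assume "range e \<subseteq> dom (nat_str s)"
      then have e: "iv (nat_str s) e" by (auto simp: iv_def)
      have "range (s \<circ> e) \<subseteq> dom M" using w by (auto simp: witn_def iv_def)
      then have "sat M (s \<circ> e) p" using 1(1) unfolding holds_def by blast
      then show "sat (nat_str s) e p" unfolding nat_str_sat[OF w 1(2) e] .
    qed
  qed
  ultimately show ?thesis by (simp add: model_of_def)
qed

definition nfm :: "nat \<Rightarrow> ('f, 'r) fm set" where "nfm n = {p. fm_in L p \<and> fv p \<subseteq> {..<n}}"

text \<open>If the type of \<open>s0\<close> in \<open>n\<close> variables were not isolated, one countable model would realize it and another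
  one omit it, which countable categoricity forbids. Both arise as ranges of generic sequences.\<close>
lemma isolated: assumes s0: "iv M s0"
  shows "\<exists>c\<in>nfm n. sat M s0 c \<and> (\<forall>t. iv M t \<longrightarrow> sat M t c \<longrightarrow> (\<forall>p\<in>nfm n. sat M t p = sat M s0 p))"
proof (rule ccontr)
  assume non: "\<not> ?thesis"
  obtain tk :: "nat \<Rightarrow> nat \<times> ('f, 'r) fm" where tk: "range tk = UNIV \<times> {p. fm_in L p}" using tasks by blast
  have tkm: "fm_in L (snd (tk k))" for k using tk by (metis (mono_tags) mem_Collect_eq mem_Sigma_iff prod.collapse rangeI)
  have wd: "\<exists>d\<in>witness_set (tk k). fm_in L d \<and> (\<exists>s'. iv M s' \<and> (\<forall>i<n. s' i = s0 i) \<and> sat M s' q \<and> sat M s' d)"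
    if "fm_in L q" "iv M s" "\<forall>i<n. s i = s0 i" "sat M s q" for k q s n and s0 :: "nat \<Rightarrow> 'm"
    using witness_dense[OF tkm[of k] that, of "fst (tk k)"] by simp
  have wi: "witn s" if s: "iv M s" "\<And>k. \<exists>d\<in>witness_set (tk k). sat M s d" for s
  proof (rule witnI[OF s(1)])
    fix v p assume "fm_in L p"
    then obtain k where "tk k = (v, p)" using tk by (metis (mono_tags) UNIV_I mem_Collect_eq mem_Sigma_iff rangeE)
    then show "\<exists>d\<in>witness_set (v, p). sat M s d" using s(2)[of k] by simp
  qed
  \<comment> \<open>a countable model realizing the type of \<open>s0\<close>\<close>
  obtain s1 where s1: "iv M s1" "\<forall>i<n. s1 i = s0 i" "\<And>k. \<exists>d\<in>witness_set (tk k). sat M s1 d"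
    using generic[OF s0, of n "\<lambda>k. witness_set (tk k)"] wd by blast
  \<comment> \<open>a countable model omitting it\<close>
  define omit where "omit h = {d. \<exists>p\<in>nfm n. sat M s0 p \<and> (\<forall>s. iv M s \<longrightarrow> sat M s d \<longrightarrow> \<not> sat M (s \<circ> h) p)}" for h
  have od: "\<exists>d\<in>omit h. fm_in L d \<and> (\<exists>s'. iv M s' \<and> sat M s' q \<and> sat M s' d)"
    if q: "fm_in L q" "iv M s" "sat M s q" for h q s
  proof (rule ccontr)
    assume no: "\<not> ?thesis"
    have all: "sat M (t \<circ> h) p" if "iv M t" "sat M t q" "p \<in> nfm n" "sat M s0 p" for t p
    proof (rule ccontr)
      assume n: "\<not> sat M (t \<circ> h) p"
      have "Neg (ren p h) \<in> omit h" unfolding omit_def using that by auto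
      moreover have "fm_in L (Neg (ren p h))" using that by (simp add: nfm_def)
      ultimately show False using no that(1,2) n by auto
    qed
    have allN: "sat M (t \<circ> h) p = sat M s0 p" if "iv M t" "sat M t q" "p \<in> nfm n" for t p
    proof -
      have "Neg p \<in> nfm n" using that(3) by (simp add: nfm_def)
      then show ?thesis using all[OF that(1,2,3)] all[OF that(1,2), of "Neg p"] by auto
    qed
    obtain c where c: "fm_in L c" "fv c \<subseteq> {..<n}"
      "\<And>t. iv M t \<Longrightarrow> sat M t c \<longleftrightarrow> (\<exists>s. iv M s \<and> (\<forall>i<n. s (h i) = t i) \<and> sat M s q)"
      using project[OF q(1), of n M h] by blast
    have cn: "c \<in> nfm n" using c by (simp add: nfm_def)
    have "iv M (s \<circ> h)" using q(2) by (simp add: iv_def)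
    then have "sat M (s \<circ> h) c" using c(3) q by auto
    then have 1: "sat M s0 c" using allN[OF q(2,3) cn] by simp
    have 2: "sat M t p = sat M s0 p" if t: "iv M t" "sat M t c" "p \<in> nfm n" for t p
    proof -
      obtain u where u: "iv M u" "\<forall>i<n. u (h i) = t i" "sat M u q" using c(3)[OF t(1)] t(2) by blast
      have "sat M t p = sat M (u \<circ> h) p" by (rule sat_cong) (use t(3) u(2) in \<open>auto simp: nfm_def\<close>)
      then show ?thesis using allN[OF u(1,3) t(3)] by simp
    qed
    show False using non 1 2 cn by blast
  qed
  let ?h = "\<lambda>k i. (from_nat k :: nat list) ! i"
  define D where "D k = (if even k then witness_set (tk (k div 2)) else omit (?h (k div 2)))" for k :: nat
  have "\<exists>s. iv M s \<and> (\<forall>i<0. s i = s0 i) \<and> (\<forall>k. \<exists>d\<in>D k. sat M s d)"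
  proof (rule generic[OF s0])
    fix k q s assume "fm_in L q" "iv M s" "\<forall>i<0. s i = s0 i" "sat M s q"
    then show "\<exists>d\<in>D k. fm_in L d \<and> (\<exists>s'. iv M s' \<and> (\<forall>i<0. s' i = s0 i) \<and> sat M s' q \<and> sat M s' d)"
      using wd[of q s 0 s0 "k div 2"] od[of q s "?h (k div 2)"] by (simp add: D_def)
  qed
  then obtain s2 where s2: "iv M s2" "\<And>k. \<exists>d\<in>D k. sat M s2 d" by blast
  have w1: "witn s1" by (rule wi) (use s1 in auto)
  have w2: "witn s2"
  proof (rule wi[OF s2(1)])
    show "\<exists>d\<in>witness_set (tk k). sat M s2 d" for k using s2(2)[of "2 * k"] by (simp add: D_def)
  qed
  have om: "\<exists>p\<in>nfm n. sat M s0 p \<and> \<not> sat M (s2 \<circ> h) p" for h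
  proof -
    let ?k = "to_nat (map h [0..<n])"
    obtain d where "d \<in> omit (?h ?k)" "sat M s2 d" using s2(2)[of "2 * ?k + 1"] by (auto simp: D_def)
    then obtain p where p: "p \<in> nfm n" "sat M s0 p" "\<not> sat M (s2 \<circ> ?h ?k) p" using s2(1) by (auto simp: omit_def)
    have "sat M (s2 \<circ> ?h ?k) p = sat M (s2 \<circ> h) p" by (rule sat_cong) (use p(1) in \<open>auto simp: nfm_def\<close>)
    then show ?thesis using p by blast
  qed
  obtain N :: "('f, 'r, nat) struct" where N: "model_of L (complete_theory L R) N"
    "\<And>N' :: ('f, 'r, nat) struct. model_of L (complete_theory L R) N' \<Longrightarrow> \<exists>g. isomorphism L N N' g"
    using cat unfolding omega_categorical_theory_def by blast
  obtain g1 g2 where g: "isomorphism L N (nat_str s1) g1" "isomorphism L N (nat_str s2) g2"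
    using N(2)[OF nat_str_model[OF w1]] N(2)[OF nat_str_model[OF w2]] by blast
  have sN: "structure_of L N" using N(1) by (simp add: model_of_def)
  define e1 where "e1 i = (LEAST j. s1 j = s1 i)" for i
  have e1: "e1 i \<in> dom (nat_str s1)" "s1 (e1 i) = s1 i" for i
    unfolding e1_def using least_dom[of s1 "s1 i"] by blast+
  have b1: "g1 ` dom N = dom (nat_str s1)" and b2: "g2 ` dom N = dom (nat_str s2)"
    using g by (auto simp: isomorphism_def bij_betw_def)
  have "\<forall>i. \<exists>x. x \<in> dom N \<and> g1 x = e1 i" using e1(1) b1 by (metis imageE)
  from choice[OF this] obtain e0 where e0: "\<And>i. e0 i \<in> dom N" "\<And>i. g1 (e0 i) = e1 i" by blast
  obtain p where p: "p \<in> nfm n" "sat M s0 p" "\<not> sat M (s2 \<circ> (g2 \<circ> e0)) p" using om by blast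
  have pf: "fm_in L p" using p(1) by (simp add: nfm_def)
  have iv0: "iv N e0" using e0 by (simp add: iv_def)
  have "sat M s0 p = sat M s1 p" by (rule sat_cong) (use p(1) s1(2) in \<open>auto simp: nfm_def\<close>)
  also have "\<dots> = sat M (s1 \<circ> e1) p" using e1(2) by (simp add: o_def)
  also have "\<dots> = sat (nat_str s1) e1 p" using nat_str_sat[OF w1 pf, of e1] e1(1) by (simp add: iv_def)
  also have "\<dots> = sat N e0 p" by (rule iso_sat[OF g(1) sN pf iv0]) (simp add: e0(2))
  also have "\<dots> = sat (nat_str s2) (g2 \<circ> e0) p" by (rule iso_sat[OF g(2) sN pf iv0, symmetric]) simp
  also have "\<dots> = sat M (s2 \<circ> (g2 \<circ> e0)) p" by (rule nat_str_sat[OF w2 pf]) (use b2 e0(1) in \<open>auto simp: iv_def\<close>)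
  finally show False using p by simp
qed

text \<open>The theorem of Ryll-Nardzewski: finitely many isolating formulas cover all assignments by compactness, and
  every formula is a disjunction of some of them.\<close>
theorem finitely_many: "finite ((\<lambda>p s. sat R s p) ` nfm n)"
proof -
  define iso where "iso c \<longleftrightarrow> c \<in> nfm n \<and> (\<forall>t t'. iv M t \<longrightarrow> iv M t' \<longrightarrow> sat M t c \<longrightarrow> sat M t' c \<longrightarrow> (\<forall>p\<in>nfm n. sat M t p = sat M t' p))" for c
  obtain s0 where s0: "iv M s0" using iv_ex by blast
  have cov: "\<exists>c. iso c \<and> sat M s c" if s: "iv M s" for s
  proof -
    obtain c where c: "c \<in> nfm n" "sat M s c" "\<forall>t. iv M t \<longrightarrow> sat M t c \<longrightarrow> (\<forall>p\<in>nfm n. sat M t p = sat M s p)"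
      using isolated[OF s, of n] by blast
    have "iso c" unfolding iso_def using c(1,3) by simp
    then show ?thesis using c(2) by blast
  qed
  have "\<exists>T0. finite T0 \<and> T0 \<subseteq> (\<lambda>c. Neg c) ` Collect iso \<and> \<not> (\<exists>s. iv M s \<and> (\<forall>q\<in>T0. sat M s q))"
  proof (rule ccontr)
    assume n: "\<not> ?thesis"
    have "\<exists>s. iv M s \<and> (\<forall>i<0. s i = s0 i) \<and> (\<forall>q\<in>(\<lambda>c. Neg c) ` Collect iso. sat M s q)"
    proof (rule compact[OF _ s0])
      show "fm_in L q" if "q \<in> (\<lambda>c. Neg c) ` Collect iso" for q using that by (auto simp: iso_def nfm_def)
      fix T0 assume "finite T0" "T0 \<subseteq> (\<lambda>c. Neg c) ` Collect iso"
      then have "\<exists>s. iv M s \<and> (\<forall>q\<in>T0. sat M s q)" using n by blast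
      then show "\<exists>s. iv M s \<and> (\<forall>i<0. s i = s0 i) \<and> (\<forall>q\<in>T0. sat M s q)" by simp
    qed
    then obtain s where s: "iv M s" "\<forall>q\<in>(\<lambda>c. Neg c) ` Collect iso. sat M s q" by blast
    obtain c where c: "iso c" "sat M s c" using cov[OF s(1)] by blast
    have "sat M s (Neg c)" using s(2) c(1) by blast
    then show False using c(2) by simp
  qed
  then obtain T0 where T0: "finite T0" "T0 \<subseteq> (\<lambda>c. Neg c) ` Collect iso" "\<not> (\<exists>s. iv M s \<and> (\<forall>q\<in>T0. sat M s q))" by (elim exE conjE)
  obtain C where C: "C \<subseteq> Collect iso" "finite C" "T0 = (\<lambda>c. Neg c) ` C" using finite_subset_image[OF T0(1,2)] by blast
  have cover: "\<exists>c\<in>C. sat M s c" if "iv M s" for s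
  proof -
    have "\<not> (\<forall>q\<in>T0. sat M s q)" using T0(3) that by blast
    then show ?thesis unfolding C(3) by simp
  qed
  define B where "B p = {c \<in> C. \<exists>t. iv M t \<and> sat M t c \<and> sat M t p}" for p
  have Bs: "sat M s p \<longleftrightarrow> (\<exists>c\<in>B p. sat M s c)" if s: "iv M s" and p: "p \<in> nfm n" for s p
  proof
    assume "sat M s p" then show "\<exists>c\<in>B p. sat M s c" using cover[OF s] s by (auto simp: B_def)
  next
    assume "\<exists>c\<in>B p. sat M s c"
    then obtain c t where "c \<in> C" "sat M s c" "iv M t" "sat M t c" "sat M t p" by (auto simp: B_def)
    then show "sat M s p" using C(1) s p unfolding iso_def by blast
  qed
  have eq: "(\<lambda>s. sat R s p) = (\<lambda>s. sat R s q)" if pq: "p \<in> nfm n" "q \<in> nfm n" "B p = B q" for p q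
  proof -
    let ?e = "And (Imp p q) (Imp q p)"
    have s: "sat M s ?e" if "iv M s" for s using Bs[OF that pq(1)] Bs[OF that pq(2)] pq(3) by simp
    have f: "fm_in L ?e" using pq by (simp add: nfm_def)
    have a: "\<forall>s. sat R s ?e" using transfer[OF f] s by blast
    have "sat R s p = sat R s q" for s using a[rule_format, of s] unfolding sat.simps by blast
    then show ?thesis by (rule ext)
  qed
  have "finite (B ` nfm n)" by (rule finite_subset[of _ "Pow C"]) (use C(2) in \<open>auto simp: B_def\<close>)
  moreover have "(\<lambda>p s. sat R s p) ` nfm n \<subseteq> (\<lambda>X s. sat R s (SOME p. p \<in> nfm n \<and> B p = X)) ` (B ` nfm n)"
  proof
    fix P assume "P \<in> (\<lambda>p s. sat R s p) ` nfm n"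
    then obtain p where p: "p \<in> nfm n" "P = (\<lambda>s. sat R s p)" by blast
    let ?q = "SOME q. q \<in> nfm n \<and> B q = B p"
    have "?q \<in> nfm n \<and> B ?q = B p" by (rule someI[of _ p]) (use p in simp)
    then have "P = (\<lambda>s. sat R s ?q)" using eq[of p ?q] p by simp
    then show "P \<in> (\<lambda>X s. sat R s (SOME p. p \<in> nfm n \<and> B p = X)) ` (B ` nfm n)" using p(1) by blast
  qed
  ultimately show ?thesis by (rule finite_surj)
qed

end

section \<open>Definable relations of a countably categorical ring\<close>

text \<open>Parameters occupy the even variables, arguments the odd ones.\<close>
definition jn :: "(nat \<Rightarrow> 'a) \<Rightarrow> (nat \<Rightarrow> 'a) \<Rightarrow> nat \<Rightarrow> 'a" where
  "jn c e i = (if even i then c (i div 2) else e (i div 2))"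
lemma jn_simps[simp]: "jn c e (2 * i) = c i" "jn c e (Suc (2 * i)) = e i" "jn c e 0 = c 0" "jn c e (Suc 0) = e 0"
  by (auto simp: jn_def)

lemma jn_nums[simp]: "jn c e 3 = e 1" "jn c e 5 = e 2" by (simp_all add: jn_def)
lemma jn_upd: "(jn z e)(Suc (2 * k) := x) = jn z (e(k := x))"
proof
  fix j
  show "((jn z e)(Suc (2 * k) := x)) j = jn z (e(k := x)) j"
  proof (cases "even j")
    case True
    then have "j \<noteq> Suc (2 * k)" by auto
    then show ?thesis using True by (simp add: jn_def)
  next
    case False
    then obtain l where "j = Suc (2 * l)" by (auto elim: oddE)
    then show ?thesis by (simp add: jn_def)
  qed
qed
definition rel1 :: "('f, 'r) fm \<Rightarrow> nat \<Rightarrow> ('f, 'r) fm" where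
  "rel1 p v = ren p (\<lambda>k. if even k then k else Suc (2 * v))"
definition rel2 :: "('f, 'r) fm \<Rightarrow> nat \<Rightarrow> nat \<Rightarrow> ('f, 'r) fm" where
  "rel2 p v w = ren p (\<lambda>k. if even k then k else if k = 1 then Suc (2 * v) else Suc (2 * w))"
lemma rel_fm[simp]: "fm_in L (rel1 p v) = fm_in L p" "fm_in L (rel2 p v w) = fm_in L p"
  by (simp_all add: rel1_def rel2_def)
lemma rel1_sat: "sat S (jn t e) (rel1 p v) = sat S (jn t (\<lambda>_. e v)) p"
proof -
  have "jn t e \<circ> (\<lambda>k. if even k then k else Suc (2 * v)) = jn t (\<lambda>_. e v)" by (rule ext) (auto simp: jn_def)
  then show ?thesis unfolding rel1_def ren_sat by (simp only:)
qed
lemma rel2_sat: "sat S (jn t e) (rel2 p v w) = sat S (jn t (case_nat (e v) (\<lambda>_. e w))) p"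
proof -
  have "jn t e \<circ> (\<lambda>k. if even k then k else if k = 1 then Suc (2 * v) else Suc (2 * w)) = jn t (case_nat (e v) (\<lambda>_. e w))"
  proof
    fix k
    show "(jn t e \<circ> (\<lambda>k. if even k then k else if k = 1 then Suc (2 * v) else Suc (2 * w))) k = jn t (case_nat (e v) (\<lambda>_. e w)) k"
    proof (cases "even k")
      case False
      then obtain l where "k = Suc (2 * l)" by (auto elim: oddE)
      then show ?thesis by (cases l) (auto simp: jn_def)
    qed (auto simp: jn_def)
  qed
  then show ?thesis unfolding rel2_def ren_sat by (simp only:)
qed

locale cat_ring = cat_model L R M \<kappa>
  for L :: "('f ring_fn, 'r) language" and R :: "('f ring_fn, 'r, 'a :: ring) struct"
    and M :: "('f ring_fn, 'r, 'm) struct" and \<kappa> :: "'k rel" +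
  assumes lang: "expands_ring_language L" and ring: "expands_ring R" and burden: "finite_burden L M"
begin

definition df :: "'a set \<Rightarrow> ((nat \<Rightarrow> 'a) \<Rightarrow> bool) \<Rightarrow> bool" where
  "df A P \<longleftrightarrow> (\<exists>p c. fm_in L p \<and> range c \<subseteq> insert 0 A \<and> P = (\<lambda>e. sat R (jn c e) p))"

lemma dfI: assumes "fm_in L p" "range c \<subseteq> insert 0 A" "\<And>e. P e \<longleftrightarrow> sat R (jn c e) p" shows "df A P"
  unfolding df_def using assms by (intro exI[of _ p] exI[of _ c]) auto
lemma dfE: assumes "df A P"
  obtains p c where "fm_in L p" "range c \<subseteq> insert 0 A" "\<And>e. P e \<longleftrightarrow> sat R (jn c e) p"
  using assms unfolding df_def by blast

lemma df_neg: assumes "df A P" shows "df A (\<lambda>e. \<not> P e)"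
proof -
  obtain p c where p: "fm_in L p" "range c \<subseteq> insert 0 A" "\<And>e. P e \<longleftrightarrow> sat R (jn c e) p" using assms by (rule dfE) blast
  show ?thesis by (rule dfI[of "Neg p" c]) (use p in auto)
qed
lemma df_conj: assumes P: "df A P" and Q: "df A Q" shows "df A (\<lambda>e. P e \<and> Q e)"
proof -
  obtain p c where p: "fm_in L p" "range c \<subseteq> insert 0 A" "\<And>e. P e \<longleftrightarrow> sat R (jn c e) p" using P by (rule dfE) blast
  obtain q d where q: "fm_in L q" "range d \<subseteq> insert 0 A" "\<And>e. Q e \<longleftrightarrow> sat R (jn d e) q" using Q by (rule dfE) blast
  let ?f = "\<lambda>i :: nat. if even i then 2 * i else i" and ?g = "\<lambda>i :: nat. if even i then 2 * i + 2 else i"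
  have f: "jn (jn c d) e \<circ> ?f = jn c e" for e :: "nat \<Rightarrow> 'a"
  proof
    fix i show "(jn (jn c d) e \<circ> ?f) i = jn c e i" by (cases "even i") (auto simp: jn_def elim!: evenE oddE)
  qed
  have g: "jn (jn c d) e \<circ> ?g = jn d e" for e :: "nat \<Rightarrow> 'a"
  proof
    fix i show "(jn (jn c d) e \<circ> ?g) i = jn d e i" by (cases "even i") (auto simp: jn_def elim!: evenE oddE)
  qed
  have "range (jn c d) \<subseteq> insert 0 A" using p(2) q(2) by (auto simp: jn_def)
  then show ?thesis by (rule dfI[of "And (ren p ?f) (ren q ?g)" "jn c d", rotated]) (use p q f g in auto)
qed
lemma df_exists: assumes "df A P" shows "df A (\<lambda>e. \<exists>x. P (case_nat x e))"
proof -
  obtain p c where p: "fm_in L p" "range c \<subseteq> insert 0 A" "\<And>e. P e \<longleftrightarrow> sat R (jn c e) p" using assms by (rule dfE) blast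
  let ?f = "\<lambda>i :: nat. if even i then i + 2 else if i = 1 then 0 else i - 2"
  have f: "(jn (case_nat 0 c) e)(0 := x) \<circ> ?f = jn c (case_nat x e)" for x and e :: "nat \<Rightarrow> 'a"
  proof
    fix i
    show "((jn (case_nat 0 c) e)(0 := x) \<circ> ?f) i = jn c (case_nat x e) i"
    proof (cases "even i")
      case True then show ?thesis by (auto simp: jn_def elim!: evenE)
    next
      case False
      then obtain k where k: "i = 2 * k + 1" by (elim oddE)
      then show ?thesis by (cases k) (auto simp: jn_def)
    qed
  qed
  have c: "range (case_nat 0 c) \<subseteq> insert 0 A"
  proof (rule image_subsetI)
    fix i
    have "c j \<in> insert 0 A" for j using p(2) by blast
    then show "case_nat 0 c i \<in> insert 0 A" by (cases i) simp_all
  qed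
  show ?thesis by (rule dfI[of "Exi 0 (ren p ?f)", OF _ c]) (use p f in \<open>auto simp: domR\<close>)
qed
lemma df_rename: assumes "df A P" shows "df A (\<lambda>e. P (\<lambda>i. e (h i)))"
proof -
  obtain p c where p: "fm_in L p" "range c \<subseteq> insert 0 A" "\<And>e. P e \<longleftrightarrow> sat R (jn c e) p" using assms by (rule dfE) blast
  let ?f = "\<lambda>i :: nat. if even i then i else Suc (2 * h (i div 2))"
  have f: "jn c e \<circ> ?f = jn c (\<lambda>i. e (h i))" for e :: "nat \<Rightarrow> 'a"
  proof
    fix i show "(jn c e \<circ> ?f) i = jn c (\<lambda>i. e (h i)) i" by (cases "even i") (auto simp: jn_def elim!: evenE oddE)
  qed
  show ?thesis by (rule dfI[of "ren p ?f", OF _ p(2)]) (use p f in auto)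
qed
lemma ring_syms: "Zero \<in> fn_syms L" "Plus \<in> fn_syms L" "Minus \<in> fn_syms L" "Times \<in> fn_syms L"
    "fn_arity L Zero = 0" "fn_arity L Plus = 2" "fn_arity L Minus = 1" "fn_arity L Times = 2"
  using lang by (auto simp: expands_ring_language_def)
lemma ring_ops: "fn R Zero [] = 0" "fn R Plus [x, y] = x + y" "fn R Minus [x] = - x" "fn R Times [x, y] = x * y"
  using ring by (auto simp: expands_ring_def)
lemma df_eqs: "df A (\<lambda>e. e i = e j)"
  by (rule dfI[of "Equal (Var (Suc (2 * i))) (Var (Suc (2 * j)))" "\<lambda>_. 0"]) auto
lemma df_adds: "df A (\<lambda>e. e i + e j = e k)"
  by (rule dfI[of "Equal (Fn Plus [Var (Suc (2 * i)), Var (Suc (2 * j))]) (Var (Suc (2 * k)))" "\<lambda>_. 0"])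
    (auto simp: ring_syms ring_ops)
lemma df_muls: "df A (\<lambda>e. e i * e j = e k)"
  by (rule dfI[of "Equal (Fn Times [Var (Suc (2 * i)), Var (Suc (2 * j))]) (Var (Suc (2 * k)))" "\<lambda>_. 0"])
    (auto simp: ring_syms ring_ops)
lemma df_const: "a \<in> A \<Longrightarrow> df A (\<lambda>e. e i = a)"
  by (rule dfI[of "Equal (Var (Suc (2 * i))) (Var 0)" "\<lambda>_. a"]) auto
lemma df_params: assumes "df A P" "A \<subseteq> B" shows "df B P"
proof -
  obtain p c where p: "fm_in L p" "range c \<subseteq> insert 0 A" "\<And>e. P e \<longleftrightarrow> sat R (jn c e) p" using assms(1) by (rule dfE) blast
  show ?thesis by (rule dfI[of p c]) (use p assms(2) in auto)
qed
lemma df_support: assumes "df A P" shows "\<exists>n. \<forall>e e'. (\<forall>i<n. e i = e' i) \<longrightarrow> P e = P e'"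
proof -
  obtain p c where p: "fm_in L p" "range c \<subseteq> insert 0 A" "\<And>e. P e \<longleftrightarrow> sat R (jn c e) p" using assms by (rule dfE) blast
  obtain b where b: "fv p \<subseteq> {..<b}" using fv_bound by blast
  have "sat R (jn c e) p = sat R (jn c e') p" if "\<forall>i<b. e i = e' i" for e e'
  proof (rule sat_cong)
    fix i assume "i \<in> fv p"
    then have "i div 2 < b" using b by (auto intro: le_less_trans[OF div_le_dividend])
    then show "jn c e i = jn c e' i" using that by (simp add: jn_def)
  qed
  then show ?thesis using p(3) by auto
qed
lemma df_finitely_many: "\<exists>N. \<forall>A. finite A \<and> card A \<le> m \<longrightarrow>
   (let X = {P. df A P \<and> (\<forall>e e'. (\<forall>i<n. e i = e' i) \<longrightarrow> P e = P e')} in finite X \<and> card X \<le> N)"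
proof -
  let ?m = "Suc m"
  define F where "F = (\<lambda>p s. sat R s p) ` nfm (?m + n)"
  have F: "finite F" unfolding F_def by (rule finitely_many)
  have "finite X \<and> card X \<le> card F"
    if A: "finite A" "card A \<le> m" and X: "X = {P. df A P \<and> (\<forall>e e'. (\<forall>i<n. e i = e' i) \<longrightarrow> P e = P e')}" for A X
  proof -
    have "card (insert 0 A) \<le> ?m" using A by (simp add: card_insert_if)
    then obtain xs where xs: "set xs = insert 0 A" "length xs \<le> ?m"
      using finite_distinct_list[of "insert 0 A"] A(1) by (metis distinct_card finite_insert)
    define a where "a j = (if j < length xs then xs ! j else 0)" for j
    have a: "\<exists>j<?m. a j = x" if "x \<in> insert 0 A" for x
    proof -
      have "x \<in> set xs" using that xs(1) by blast
      then obtain j where "j < length xs" "xs ! j = x" by (auto simp: in_set_conv_nth)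
      then show ?thesis using xs(2) by (intro exI[of _ j]) (auto simp: a_def)
    qed
    define v where "v e j = (if j < ?m then a j else e (j - ?m))" for e :: "nat \<Rightarrow> 'a" and j
    have "X \<subseteq> (\<lambda>f e. f (v e)) ` F"
    proof
      fix P assume "P \<in> X"
      then have P: "df A P" "\<And>e e'. (\<forall>i<n. e i = e' i) \<Longrightarrow> P e = P e'" using X by blast+
      obtain p c where p: "fm_in L p" "range c \<subseteq> insert 0 A" "\<And>e. P e \<longleftrightarrow> sat R (jn c e) p" using P(1) by (rule dfE) blast
      have "\<forall>i. \<exists>j<?m. a j = c i" using a p(2) by blast
      from choice[OF this] obtain g where g: "\<And>i. g i < ?m" "\<And>i. a (g i) = c i" by blast
      obtain z where z: "z < ?m" "a z = 0" using a[of 0] by blast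
      let ?f = "\<lambda>i :: nat. if even i then g (i div 2) else if i div 2 < n then ?m + i div 2 else z"
      let ?q = "ren p ?f"
      have f: "v e \<circ> ?f = jn c (\<lambda>i. if i < n then e i else 0)" for e
        by (rule ext) (use g z in \<open>auto simp: jn_def v_def\<close>)
      have "P e = sat R (v e) ?q" for e
        using P(2)[of e "\<lambda>i. if i < n then e i else 0"] p(3) f[of e] by simp
      moreover have "?f i < ?m + n" for i using g(1)[of "i div 2"] z(1) by auto
      then have "?f ` fv p \<subseteq> {..<?m + n}" by blast
      then have "fv ?q \<subseteq> {..<?m + n}" by (rule subset_trans[OF ren_fv])
      then have "?q \<in> nfm (?m + n)" unfolding nfm_def using p(1) by (intro CollectI conjI) (simp_all only: ren_fm_in)
      ultimately show "P \<in> (\<lambda>f e. f (v e)) ` F" unfolding F_def image_image by (intro image_eqI[of _ _ ?q]) auto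
    qed
    then show ?thesis using F by (meson card_image_le card_mono finite_imageI finite_subset order_trans)
  qed
  then show ?thesis unfolding Let_def by blast
qed

section \<open>Finite burden bounds chains of subgroups\<close>

text \<open>Each term may depend on the list of all its predecessors.\<close>
lemma greedy: assumes "\<And>xs. \<exists>x. Q xs x" shows "\<exists>f. \<forall>j :: nat. Q (map f [0..<j]) (f j)"
proof -
  define g where "g = rec_nat [] (\<lambda>_ xs. xs @ [SOME x. Q xs x])"
  define f where "f j = (SOME x. Q (g j) x)" for j
  have gs: "g (Suc j) = g j @ [f j]" "g 0 = []" for j by (simp_all add: g_def f_def)
  have "g j = map f [0..<j]" for j by (induction j) (simp_all add: gs)
  moreover have "Q (g j) (f j)" for j unfolding f_def by (rule someI_ex[OF assms])
  ultimately show ?thesis by auto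
qed

text \<open>The rows of the pattern are cosets: \<open>E i\<close> is an equivalence relation with infinitely many classes meeting
  \<open>G i\<close>, and the classes of different rows can be met simultaneously.\<close>
lemma pattern:
  fixes n :: nat
  assumes p: "\<And>i. fm_in L (p i)" and y: "iv M y"
    and inc: "\<And>i x z z'. i \<le> n \<Longrightarrow> x \<in> dom M \<Longrightarrow> z \<in> dom M \<Longrightarrow> z' \<in> dom M \<Longrightarrow> E i x z \<Longrightarrow> E i x z' \<Longrightarrow> E i z z'"
    and E: "\<And>i x z. E i x z = sat M (jn y (case_nat x (\<lambda>_. z))) (p i)"
    and con: "\<And>z. (\<forall>i\<le>n. z i \<in> dom M \<and> G i (z i)) \<Longrightarrow> \<exists>x\<in>dom M. \<forall>i\<le>n. E i x (z i)"
    and unb: "\<And>i zs. i \<le> n \<Longrightarrow> set zs \<subseteq> dom M \<Longrightarrow> \<exists>z\<in>dom M. G i z \<and> (\<forall>a\<in>set zs. \<not> E i z a)"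
  shows "\<exists>p l a. inp_pattern L M 1 {(Equal (Var 0) (Var 0), [])} {..<n + 1} p l a"
proof -
  have "\<forall>i. \<exists>f. i \<le> n \<longrightarrow> (\<forall>j :: nat. f j \<in> dom M \<and> G i (f j) \<and> (\<forall>l<j. \<not> E i (f j) (f l)))"
  proof
    fix i
    show "\<exists>f. i \<le> n \<longrightarrow> (\<forall>j :: nat. f j \<in> dom M \<and> G i (f j) \<and> (\<forall>l<j. \<not> E i (f j) (f l)))"
    proof (cases "i \<le> n")
      case True
      let ?Q = "\<lambda>xs x. set xs \<subseteq> dom M \<longrightarrow> x \<in> dom M \<and> G i x \<and> (\<forall>a\<in>set xs. \<not> E i x a)"
      have "\<exists>x. ?Q xs x" for xs using unb[OF True, of xs] by blast
      from greedy[of ?Q, OF this] obtain f where f: "\<And>j. ?Q (map f [0..<j]) (f j)" by blast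
      have d: "f j \<in> dom M" for j
      proof (induction j rule: less_induct)
        case (less j) then have "set (map f [0..<j]) \<subseteq> dom M" by auto
        then show ?case using f[of j] by blast
      qed
      then have "set (map f [0..<j]) \<subseteq> dom M" for j by auto
      then have "G i (f j) \<and> (\<forall>a\<in>set (map f [0..<j]). \<not> E i (f j) a)" for j using f[of j] by blast
      then show ?thesis using d by (intro exI[of _ f]) auto
    qed simp
  qed
  from choice[OF this] obtain a where
    a0: "\<forall>i. i \<le> n \<longrightarrow> (\<forall>j :: nat. a i j \<in> dom M \<and> G i (a i j) \<and> (\<forall>l<j. \<not> E i (a i j) (a i l)))" ..
  have a: "a i j \<in> dom M \<and> G i (a i j) \<and> (\<forall>l<j. \<not> E i (a i j) (a i l))" if "i \<le> n" for i j
    using a0 that by blast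
  have "finite (\<Union>i\<le>n. fv (p i))" by simp
  from finite_nat_bounded[OF this] obtain B where B: "(\<Union>i\<le>n. fv (p i)) \<subseteq> {..<B}" ..
  let ?f = "\<lambda>i :: nat. if even i then 2 + i div 2 else if i = 1 then 0 else 1"
  define q where "q i = ren (p i) ?f" for i
  define b where "b i j = a i j # map y [0..<B]" for i j
  have real: "sat M (nth ([x] @ b i j)) (q i) = E i x (a i j)" if i: "i \<le> n" for x i j
  proof -
    have "sat M (nth ([x] @ b i j)) (q i) = sat M (nth ([x] @ b i j) \<circ> ?f) (p i)" unfolding q_def by (rule ren_sat)
    also have "\<dots> = sat M (jn y (case_nat x (\<lambda>_. a i j))) (p i)"
    proof (rule sat_cong)
      fix k assume "k \<in> fv (p i)"
      then have k: "k < B" using B i by auto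
      show "(nth ([x] @ b i j) \<circ> ?f) k = jn y (case_nat x (\<lambda>_. a i j)) k"
      proof (cases "even k")
        case True
        then show ?thesis using k by (auto simp: b_def jn_def)
      next
        case False
        then obtain l where "k = 2 * l + 1" by (elim oddE)
        then show ?thesis by (cases l) (auto simp: b_def jn_def)
      qed
    qed
    finally show ?thesis using E by simp
  qed
  have "inp_pattern L M 1 {(Equal (Var 0) (Var 0), [])} {..<n + 1} q (\<lambda>_. Suc B) b"
    unfolding inp_pattern_def
  proof (intro conjI ballI allI)
    fix i j assume "i \<in> {..<n + 1}"
    then have i: "i \<le> n" by simp
    show "length (b i j) = Suc B" by (simp add: b_def)
    have "set (b i j) \<subseteq> dom M" using a[OF i] y by (auto simp: b_def iv_def)
    moreover have "?f k < 1 + length (b i j)" if "k \<in> fv (p i)" for k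
    proof -
      have "k < B" using that B i by auto
      then have "2 + k div 2 < Suc (Suc B)" if "even k" using that by (auto elim!: evenE)
      then show ?thesis using \<open>k < B\<close> by (auto simp: b_def)
    qed
    then have "?f ` fv (p i) \<subseteq> {..<1 + length (b i j)}" by blast
    then have "fv (q i) \<subseteq> {..<1 + length (b i j)}" unfolding q_def using ren_fv[of "p i" ?f] by blast
    ultimately show "(q i, b i j) \<in> formulas_over L 1 (dom M)" using p by (simp add: formulas_over_def q_def)
  next
    fix i assume "i \<in> {..<n + 1}"
    then have i: "i \<le> n" by simp
    have "\<not> consistent M 1 ((\<lambda>j. (q i, b i j)) ` J)" if J: "finite J \<and> card J = 2" for J
    proof
      assume c: "consistent M 1 ((\<lambda>j. (q i, b i j)) ` J)"
      obtain j l where jl: "J = {j, l}" "l < j" using J by (metis card_2_iff doubleton_eq_iff insert_commute linorder_neqE_nat)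
      obtain xs where xs: "length xs = 1" "set xs \<subseteq> dom M" "realizes M xs ((\<lambda>j. (q i, b i j)) ` J)"
        using c J unfolding consistent_def by (meson finite_imageI subset_refl)
      obtain x where x: "xs = [x]" using xs(1) by (auto simp: length_Suc_conv)
      have h: "\<forall>(p', b')\<in>(\<lambda>j. (q i, b i j)) ` {j, l}. sat M (nth ([x] @ b')) p'" using xs(3) unfolding x realizes_def jl(1) .
      have e: "E i x (a i j)" "E i x (a i l)"
        using bspec[OF h, of "(q i, b i j)"] bspec[OF h, of "(q i, b i l)"] unfolding real[OF i, symmetric] by simp_all
      have d: "x \<in> dom M" "a i j \<in> dom M" "a i l \<in> dom M" using xs(2) x a[OF i] by simp_all
      have "E i (a i j) (a i l)" by (rule inc[OF i d e])
      then show False using a[OF i, of j] jl(2) by blast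
    qed
    then show "\<exists>k. k_inconsistent M 1 k (\<lambda>j. (q i, b i j))" unfolding k_inconsistent_def by blast
  next
    fix \<eta> :: "nat \<Rightarrow> nat"
    have "\<exists>x\<in>dom M. \<forall>i\<le>n. E i x (a i (\<eta> i))" by (rule con) (use a in blast)
    then obtain x where x: "x \<in> dom M" "\<And>i. i \<le> n \<Longrightarrow> E i x (a i (\<eta> i))" by blast
    have "realizes M [x] ({(Equal (Var 0) (Var 0), [])} \<union> (\<lambda>i. (q i, b i (\<eta> i))) ` {..<n + 1})"
      unfolding realizes_def using real x by (auto simp: less_Suc_eq_le)
    then have "realizes M [x] \<pi>0" if "\<pi>0 \<subseteq> {(Equal (Var 0) (Var 0), [])} \<union> (\<lambda>i. (q i, b i (\<eta> i))) ` {..<n + 1}" for \<pi>0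
      using that unfolding realizes_def by blast
    then show "consistent M 1 ({(Equal (Var 0) (Var 0), [])} \<union> (\<lambda>i. (q i, b i (\<eta> i))) ` {..<n + 1})"
      unfolding consistent_def using x(1) by (intro allI impI exI[of _ "[x]"]) simp
  qed
  then show ?thesis by blast
qed

lemma jn_split: "s = jn (\<lambda>i. s (2 * i)) (\<lambda>i. s (Suc (2 * i)))" by (rule ext) (auto simp: jn_def elim!: oddE)

text \<open>Only finite satisfiability is transferred; compactness in \<open>M\<close> does the rest.\<close>
lemma transfer_params: assumes Th: "\<And>q. q \<in> Th \<Longrightarrow> fm_in L q" "\<And>q. q \<in> Th \<Longrightarrow> sat R s q"
  shows "\<exists>u. iv M u \<and> (\<forall>q\<in>Th. sat M u q)"
proof -
  obtain s0 where s0: "iv M s0" using iv_ex by blast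
  have "\<exists>u. iv M u \<and> (\<forall>i<0. u i = s0 i) \<and> (\<forall>q\<in>Th. sat M u q)"
  proof (rule compact[OF Th(1) s0])
    fix T0 assume T0: "finite T0" "T0 \<subseteq> Th"
    obtain ps where ps: "set ps = T0" using finite_list[OF T0(1)] by blast
    have f: "fm_in L (Neg (ConjL ps))" using Th(1) T0 ps by auto
    have "sat R s (ConjL ps)" using Th(2) T0 ps by auto
    then have "\<not> (\<forall>s. sat R s (Neg (ConjL ps)))" by auto
    then have "\<not> (\<forall>s. iv M s \<longrightarrow> sat M s (Neg (ConjL ps)))" unfolding transfer[OF f] .
    then obtain u where "iv M u" "\<not> sat M u (Neg (ConjL ps))" by blast
    then show "\<exists>u. iv M u \<and> (\<forall>i<0. u i = s0 i) \<and> (\<forall>q\<in>T0. sat M u q)" using ps by auto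
  qed auto
  then show ?thesis by blast
qed

text \<open>If no \<open>H i\<close> almost contained the intersection of the others, representatives of infinitely many cosets of
  \<open>H i\<close> could be chosen in that intersection. Sums of such representatives lie in prescribed cosets
  of all \<open>H i\<close> at once, so the cosets form an inp-pattern of depth \<open>n + 1\<close>.\<close>
lemma breadth_bound: "\<exists>n. \<forall>H :: nat \<Rightarrow> 'a set. (\<forall>i\<le>n. sg (H i) \<and> (\<exists>A. finite A \<and> df A (\<lambda>e. e 0 \<in> H i))) \<longrightarrow>
    (\<exists>i\<le>n. (\<Inter>j\<in>{..n}-{i}. H j) \<preceq> H i)"
proof -
  obtain n :: nat where n: "\<not> (\<exists>p l a. inp_pattern L M 1 {(Equal (Var 0) (Var 0), [])} {..<n + 1} p l a)"
    using burden unfolding finite_burden_def by blast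
  have False if H: "\<forall>i\<le>n. sg (H i) \<and> (\<exists>A. finite A \<and> df A (\<lambda>e. e 0 \<in> H i))"
    and c: "\<And>i. i \<le> n \<Longrightarrow> \<not> (\<Inter>j\<in>{..n}-{i}. H j) \<preceq> H i" for H :: "nat \<Rightarrow> 'a set"
  proof -
    have "\<forall>i. \<exists>pc. i \<le> n \<longrightarrow> fm_in L (fst pc) \<and> (\<forall>e. (e 0 \<in> H i) = sat R (jn (snd pc) e) (fst pc))"
    proof
      fix i show "\<exists>pc. i \<le> n \<longrightarrow> fm_in L (fst pc) \<and> (\<forall>e. (e 0 \<in> H i) = sat R (jn (snd pc) e) (fst pc))"
      proof (cases "i \<le> n")
        case True
        then obtain A where "df A (\<lambda>e. e 0 \<in> H i)" using H by blast
        then obtain p d where "fm_in L p" "\<And>e. (e 0 \<in> H i) = sat R (jn d e) p" by (rule dfE) blast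
        then show ?thesis by (intro exI[of _ "(p, d)"]) simp
      qed simp
    qed
    from choice[OF this] obtain pc where pc: "\<And>i. i \<le> n \<Longrightarrow> fm_in L (fst (pc i))"
      "\<And>i e. i \<le> n \<Longrightarrow> (e 0 \<in> H i) = sat R (jn (snd (pc i)) e) (fst (pc i))" by blast
    define y where "y k = snd (pc (fst (prod_decode k))) (snd (prod_decode k))" for k
    \<comment> \<open>\<open>mem i v\<close>: the variable \<open>2 * v + 1\<close> lies in \<open>H i\<close>\<close>
    define mem where "mem i v = (if i \<le> n then ren (fst (pc i)) (\<lambda>k. if even k then 2 * prod_encode (i, k div 2) else Suc (2 * v)) else Falsum)" for i v
    have memf: "fm_in L (mem i v)" for i v using pc(1) by (simp add: mem_def)
    have memR: "sat R (jn y e) (mem i v) \<longleftrightarrow> e v \<in> H i" if i: "i \<le> n" for i v e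
    proof -
      have "jn y e \<circ> (\<lambda>k. if even k then 2 * prod_encode (i, k div 2) else Suc (2 * v)) = jn (snd (pc i)) (\<lambda>_. e v)"
        by (rule ext) (auto simp: jn_def y_def)
      then have "sat R (jn y e) (mem i v) = sat R (jn (snd (pc i)) (\<lambda>_. e v)) (fst (pc i))" using i by (simp add: mem_def)
      also have "\<dots> \<longleftrightarrow> e v \<in> H i" using pc(2)[OF i, of "\<lambda>_. e v"] by simp
      finally show ?thesis .
    qed
    \<comment> \<open>\<open>E0 i\<close> says that the first two variables agree modulo \<open>H i\<close>, \<open>G0 i\<close> that the first one lies in all other \<open>H j\<close>\<close>
    define E0 where "E0 i = Exi 5 (And (Equal (Var 5) (Fn Plus [Var 1, Fn Minus [Var 3]])) (mem i 2))" for i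
    define G0 where "G0 i = ConjL (map (\<lambda>j. mem j 0) (filter (\<lambda>j. j \<noteq> i) [0..<Suc n]))" for i
    have E0f: "fm_in L (E0 i)" for i using memf by (simp add: E0_def ring_syms)
    have G0f: "fm_in L (G0 i)" for i using memf by (simp add: G0_def)
    have E0R: "sat R (jn y e) (E0 i) \<longleftrightarrow> e 0 - e 1 \<in> H i" if i: "i \<le> n" for i e
    proof -
      have u: "(jn y e)(5 := x) = jn y (e(2 := x))" for x using jn_upd[of y e 2 x] by simp
      then show ?thesis unfolding E0_def using memR[OF i, of "e(2 := _)" 2] by (simp add: u domR ring_ops)
    qed
    have G0R: "sat R (jn y e) (G0 i) \<longleftrightarrow> e 0 \<in> (\<Inter>j\<in>{..n}-{i}. H j)" for i e
      unfolding G0_def using memR by (auto simp: less_Suc_eq_le simp del: upt_Suc)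
    define Ef where "Ef i v w = rel2 (E0 i) v w" for i v w
    define Gf where "Gf i v = rel1 (G0 i) v" for i v
    have fs[simp]: "fm_in L (Ef i v w)" "fm_in L (Gf i v)" for i v w using E0f G0f by (simp_all add: Ef_def Gf_def)
    have ER: "sat R (jn y e) (Ef i v w) \<longleftrightarrow> e v - e w \<in> H i" if "i \<le> n" for i v w e
      unfolding Ef_def rel2_sat using E0R[OF that] by simp
    have GR: "sat R (jn y e) (Gf i v) \<longleftrightarrow> e v \<in> (\<Inter>j\<in>{..n}-{i}. H j)" for i v e
      unfolding Gf_def rel1_sat using G0R by simp
    \<comment> \<open>quantification over all odd variables below a bound\<close>
    let ?vs = "\<lambda>k. map (\<lambda>j. Suc (2 * j)) [0..<k]"
    have par: "2 * i \<noteq> Suc (2 * j)" for i j :: nat by presburger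
    have up: "\<exists>e'. t = jn y e'" if t: "\<forall>i. i \<notin> set (?vs k) \<longrightarrow> t i = jn y e i" for t e k
    proof -
      have "t (2 * i) = y i" for i
      proof -
        have "2 * i \<notin> set (?vs k)" using par by auto
        then show ?thesis using t by simp
      qed
      then have "(\<lambda>i. t (2 * i)) = y" by blast
      then show ?thesis using jn_split[of t] by metis
    qed
    define I where "I i = Alls (?vs 3) (Imp (Ef i 0 1) (Imp (Ef i 0 2) (Ef i 1 2)))" for i
    define C where "C = Alls (?vs (Suc n)) (Imp (ConjL (map (\<lambda>i. Gf i i) [0..<Suc n])) (Exi (Suc (2 * Suc n)) (ConjL (map (\<lambda>i. Ef i (Suc n) i) [0..<Suc n]))))"
    define U where "U i k = Alls (?vs k) (Exi (Suc (2 * k)) (And (Gf i k) (ConjL (map (\<lambda>a. Neg (Ef i k a)) [0..<k]))))" for i k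
    have allR: "sat R (jn y e) (Alls (?vs k) q)" if a: "\<And>e. sat R (jn y e) q" for e k q
      unfolding sat_Alls[OF ivR]
    proof (intro allI impI)
      fix t assume "\<forall>i. i \<notin> set (?vs k) \<longrightarrow> t i = jn y e i"
      then obtain e' where "t = jn y e'" using up by blast
      then show "sat R t q" using a by simp
    qed
    have sgH: "sg (H i)" if "i \<le> n" for i using H that by blast
    have IR: "sat R (jn y e) (I i)" if i: "i \<le> n" for i e
      unfolding I_def
    proof (rule allR)
      fix e :: "nat \<Rightarrow> 'a"
      have "e 1 - e 2 = (e 0 - e 2) - (e 0 - e 1)" by simp
      then show "sat R (jn y e) (Imp (Ef i 0 1) (Imp (Ef i 0 2) (Ef i 1 2)))"
        using sg_diff[OF sgH[OF i], of "e 0 - e 2" "e 0 - e 1"] by (simp add: ER[OF i])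
    qed
    have CR: "sat R (jn y e) C" for e
      unfolding C_def
    proof (rule allR)
      fix e :: "nat \<Rightarrow> 'a"
      have "\<exists>x. \<forall>i\<le>n. x - e i \<in> H i" if g: "\<forall>i\<le>n. e i \<in> (\<Inter>j\<in>{..n}-{i}. H j)"
      proof (intro exI[of _ "\<Sum>i\<le>n. e i"] allI impI)
        fix i assume i: "i \<le> n"
        have "(\<Sum>i\<le>n. e i) - e i = (\<Sum>j\<in>{..n}-{i}. e j)" using i by (simp add: sum_diff1)
        also have "\<dots> \<in> H i"
        proof -
          have "(\<Sum>j\<in>J. e j) \<in> H i" if "J \<subseteq> {..n}-{i}" "finite J" for J
            using that(2,1)
          proof (induction J)
            case (insert j J)
            have "j \<le> n" "i \<in> {..n}-{j}" using insert.prems i by auto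
            then have "e j \<in> H i" using g by blast
            then show ?case using insert sg_add[OF sgH[OF i]] by simp
          qed (simp add: sg_0[OF sgH[OF i]])
          then show ?thesis by simp
        qed
        finally show "(\<Sum>i\<le>n. e i) - e i \<in> H i" .
      qed
      note ex = this
      have "sat R (jn y e) (Exi (Suc (2 * Suc n)) (ConjL (map (\<lambda>i. Ef i (Suc n) i) [0..<Suc n])))" if a: "sat R (jn y e) (ConjL (map (\<lambda>i. Gf i i) [0..<Suc n]))"
      proof -
        have g: "\<forall>i\<le>n. e i \<in> (\<Inter>j\<in>{..n}-{i}. H j)"
        proof (intro allI impI)
          fix i assume "i \<le> n"
          then have "Gf i i \<in> set (map (\<lambda>i. Gf i i) [0..<Suc n])" by (auto simp: less_Suc_eq_le simp del: upt_Suc)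
          then have "sat R (jn y e) (Gf i i)" using a unfolding ConjL_simps by blast
          then show "e i \<in> (\<Inter>j\<in>{..n}-{i}. H j)" unfolding GR .
        qed
        from ex[OF this] obtain x where x: "\<forall>i\<le>n. x - e i \<in> H i" ..
        have "sat R (jn y (e(Suc n := x))) (ConjL (map (\<lambda>i. Ef i (Suc n) i) [0..<Suc n]))" unfolding ConjL_simps
        proof
          fix p assume "p \<in> set (map (\<lambda>i. Ef i (Suc n) i) [0..<Suc n])"
          then obtain i where i: "i \<le> n" "p = Ef i (Suc n) i" by (auto simp: less_Suc_eq_le simp del: upt_Suc)
          show "sat R (jn y (e(Suc n := x))) p" unfolding i(2) ER[OF i(1)] using x i(1) by simp
        qed
        then have "sat R ((jn y e)(Suc (2 * Suc n) := x)) (ConjL (map (\<lambda>i. Ef i (Suc n) i) [0..<Suc n]))" unfolding jn_upd .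
        then show ?thesis unfolding sat.simps domR by blast
      qed
      then show "sat R (jn y e) (Imp (ConjL (map (\<lambda>i. Gf i i) [0..<Suc n])) (Exi (Suc (2 * Suc n)) (ConjL (map (\<lambda>i. Ef i (Suc n) i) [0..<Suc n]))))" unfolding sat.simps by blast
    qed
    have UR: "sat R (jn y e) (U i k)" if i: "i \<le> n" for i k e
      unfolding U_def
    proof (rule allR)
      fix e :: "nat \<Rightarrow> 'a"
      have "\<exists>z\<in>(\<Inter>j\<in>{..n}-{i}. H j). \<forall>f\<in>e ` {..<k}. z - f \<notin> H i"
      proof (rule ccontr)
        assume "\<not> ?thesis"
        then have "\<forall>z\<in>(\<Inter>j\<in>{..n}-{i}. H j). \<exists>f\<in>e ` {..<k}. z - f \<in> H i" by blast
        moreover have "finite (e ` {..<k})" by simp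
        ultimately have "(\<Inter>j\<in>{..n}-{i}. H j) \<preceq> H i" unfolding alm_def by (intro exI[of _ "e ` {..<k}"] conjI)
        then show False using c[OF i] by (rule notE[rotated])
      qed
      then obtain z where z0: "z \<in> (\<Inter>j\<in>{..n}-{i}. H j)" "\<forall>f\<in>e ` {..<k}. z - f \<notin> H i" by (rule bexE)
      have z: "z - e a \<notin> H i" if "a < k" for a using z0(2) that by simp
      have 1: "sat R (jn y (e(k := z))) (Gf i k)" unfolding GR using z0(1) by (simp only: fun_upd_same)
      have 2: "sat R (jn y (e(k := z))) (ConjL (map (\<lambda>a. Neg (Ef i k a)) [0..<k]))" unfolding ConjL_simps
      proof
        fix p assume "p \<in> set (map (\<lambda>a. Neg (Ef i k a)) [0..<k])"
        then obtain a where a: "a < k" "p = Neg (Ef i k a)" by auto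
        show "sat R (jn y (e(k := z))) p" unfolding a(2) sat.simps ER[OF i] using z[OF a(1)] a(1) by simp
      qed
      have "sat R ((jn y e)(Suc (2 * k) := z)) (And (Gf i k) (ConjL (map (\<lambda>a. Neg (Ef i k a)) [0..<k])))"
        unfolding jn_upd using 1 2 unfolding sat.simps by blast
      then show "sat R (jn y e) (Exi (Suc (2 * k)) (And (Gf i k) (ConjL (map (\<lambda>a. Neg (Ef i k a)) [0..<k]))))"
        unfolding sat.simps domR by blast
    qed
    define Th where "Th = insert C (I ` {..n} \<union> (\<lambda>(i, k). U i k) ` ({..n} \<times> UNIV))"
    have "\<exists>u. iv M u \<and> (\<forall>q\<in>Th. sat M u q)"
    proof (rule transfer_params)
      show "fm_in L q" if "q \<in> Th" for q using that by (auto simp: Th_def I_def C_def U_def simp del: upt_Suc)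
      show "sat R (jn y (\<lambda>_. 0)) q" if "q \<in> Th" for q using that IR CR UR by (auto simp: Th_def)
    qed
    then obtain u where u: "iv M u" "\<And>q. q \<in> Th \<Longrightarrow> sat M u q" by blast
    define y' where "y' i = u (2 * i)" for i
    have iy: "iv M y'" using u(1) by (simp add: iv_def y'_def)
    have allM: "sat M (jn y' e) q" if "sat M u (Alls (?vs k) q)" "\<And>i. e i \<in> dom M" "\<And>i. i \<ge> k \<Longrightarrow> e i = u (Suc (2 * i))" for e k q
    proof -
      have "iv M (jn y' e)" using iy that(2) by (auto simp: iv_def jn_def)
      moreover have "jn y' e i = u i" if i: "i \<notin> set (?vs k)" for i
      proof (cases "even i")
        case True then show ?thesis by (auto simp: jn_def y'_def)
      next
        case False
        then obtain l where l: "i = Suc (2 * l)" by (auto elim!: oddE)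
        then have "l \<ge> k" using i by (auto simp: image_iff)
        then show ?thesis using \<open>\<And>i. i \<ge> k \<Longrightarrow> e i = u (Suc (2 * i))\<close> l by simp
      qed
      ultimately show ?thesis using that(1) unfolding sat_Alls[OF u(1)] by blast
    qed
    define E where "E i x z = sat M (jn y' (case_nat x (\<lambda>_. z))) (E0 i)" for i x z
    define G where "G i x = sat M (jn y' (\<lambda>_. x)) (G0 i)" for i x
    have EM: "sat M (jn y' e) (Ef i v w) = E i (e v) (e w)" for e i v w by (simp add: Ef_def rel2_sat E_def)
    have GM: "sat M (jn y' e) (Gf i v) = G i (e v)" for e i v by (simp add: Gf_def rel1_sat G_def)
    define pad where "pad k f i = (if i < k then f i else u (Suc (2 * i)))" for k :: nat and f :: "nat \<Rightarrow> 'm" and i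
    have pad: "pad k f i \<in> dom M" if "\<And>i. i < k \<Longrightarrow> f i \<in> dom M" for k f i
      using that u(1) by (simp add: pad_def iv_def)
    have "\<exists>p l a. inp_pattern L M 1 {(Equal (Var 0) (Var 0), [])} {..<n + 1} p l a"
    proof (rule pattern[where p = E0 and y = y' and n = n and E = E and G = G])
      show "fm_in L (E0 i)" for i by (rule E0f)
      show "iv M y'" by (rule iy)
      show "E i x z = sat M (jn y' (case_nat x (\<lambda>_. z))) (E0 i)" for i x z by (rule E_def)
      show "E i z z'" if "i \<le> n" "x \<in> dom M" "z \<in> dom M" "z' \<in> dom M" "E i x z" "E i x z'" for i x z z'
      proof -
        let ?e = "pad 3 (\<lambda>j. if j = 0 then x else if j = 1 then z else z')"
        have "sat M (jn y' ?e) (Imp (Ef i 0 1) (Imp (Ef i 0 2) (Ef i 1 2)))"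
        proof (rule allM)
          show "sat M u (Alls (?vs 3) (Imp (Ef i 0 1) (Imp (Ef i 0 2) (Ef i 1 2))))"
          proof -
            have "I i \<in> Th" unfolding Th_def using that(1) by simp
            from u(2)[OF this] show ?thesis unfolding I_def .
          qed
          show "?e j \<in> dom M" for j by (rule pad) (use that in simp)
          show "?e j = u (Suc (2 * j))" if "j \<ge> 3" for j using that by (simp add: pad_def)
        qed
        then show ?thesis using that(5,6) by (simp add: EM pad_def)
      qed
      show "\<exists>x\<in>dom M. \<forall>i\<le>n. E i x (z i)" if z: "\<forall>i\<le>n. z i \<in> dom M \<and> G i (z i)" for z
      proof -
        let ?e = "pad (Suc n) z"
        have "sat M (jn y' ?e) (Imp (ConjL (map (\<lambda>i. Gf i i) [0..<Suc n])) (Exi (Suc (2 * Suc n)) (ConjL (map (\<lambda>i. Ef i (Suc n) i) [0..<Suc n]))))"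
        proof (rule allM)
          show "sat M u (Alls (?vs (Suc n)) (Imp (ConjL (map (\<lambda>i. Gf i i) [0..<Suc n])) (Exi (Suc (2 * Suc n)) (ConjL (map (\<lambda>i. Ef i (Suc n) i) [0..<Suc n])))))"
            using u(2)[of C] unfolding Th_def C_def by blast
          show "?e j \<in> dom M" for j by (rule pad) (use z in \<open>simp add: less_Suc_eq_le\<close>)
          show "?e j = u (Suc (2 * j))" if "j \<ge> Suc n" for j using that by (simp add: pad_def)
        qed
        note im = this
        have "sat M (jn y' ?e) (ConjL (map (\<lambda>i. Gf i i) [0..<Suc n]))" unfolding ConjL_simps
        proof
          fix p assume "p \<in> set (map (\<lambda>i. Gf i i) [0..<Suc n])"
          then obtain i where i: "i \<le> n" "p = Gf i i" by (auto simp: less_Suc_eq_le simp del: upt_Suc)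
          show "sat M (jn y' ?e) p" unfolding i(2) GM using z i(1) by (simp add: pad_def)
        qed
        then have "sat M (jn y' ?e) (Exi (Suc (2 * Suc n)) (ConjL (map (\<lambda>i. Ef i (Suc n) i) [0..<Suc n])))" using im unfolding sat.simps by blast
        then obtain x where x: "x \<in> dom M" "sat M ((jn y' ?e)(Suc (2 * Suc n) := x)) (ConjL (map (\<lambda>i. Ef i (Suc n) i) [0..<Suc n]))" unfolding sat.simps by blast
        have "E i x (z i)" if i: "i \<le> n" for i
        proof -
          have "Ef i (Suc n) i \<in> set (map (\<lambda>i. Ef i (Suc n) i) [0..<Suc n])" using i by (auto simp: less_Suc_eq_le simp del: upt_Suc)
          then have "sat M (jn y' (?e(Suc n := x))) (Ef i (Suc n) i)" using x(2) unfolding jn_upd ConjL_simps by blast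
          then show ?thesis unfolding EM using i by (simp add: pad_def)
        qed
        then show ?thesis using x(1) by blast
      qed
      show "\<exists>z\<in>dom M. G i z \<and> (\<forall>a\<in>set zs. \<not> E i z a)" if "i \<le> n" "set zs \<subseteq> dom M" for i zs
      proof -
        let ?k = "length zs"
        let ?e = "pad ?k (\<lambda>j. zs ! j)"
        have "sat M (jn y' ?e) (Exi (Suc (2 * ?k)) (And (Gf i ?k) (ConjL (map (\<lambda>a. Neg (Ef i ?k a)) [0..<?k]))))"
        proof (rule allM)
          show "sat M u (Alls (?vs ?k) (Exi (Suc (2 * ?k)) (And (Gf i ?k) (ConjL (map (\<lambda>a. Neg (Ef i ?k a)) [0..<?k])))))"
          proof -
            have "(\<lambda>(i, k). U i k) (i, ?k) \<in> (\<lambda>(i, k). U i k) ` ({..n} \<times> UNIV)" by (rule imageI) (use that(1) in simp)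
            then have "U i ?k \<in> Th" unfolding Th_def by simp
            from u(2)[OF this] show ?thesis unfolding U_def .
          qed
          show "?e j \<in> dom M" for j by (rule pad) (use that(2) nth_mem in blast)
          show "?e j = u (Suc (2 * j))" if "j \<ge> ?k" for j using that by (simp add: pad_def)
        qed
        then obtain z where z: "z \<in> dom M" "sat M ((jn y' ?e)(Suc (2 * ?k) := z)) (And (Gf i ?k) (ConjL (map (\<lambda>a. Neg (Ef i ?k a)) [0..<?k])))"
          unfolding sat.simps by blast
        have z2: "sat M (jn y' (?e(?k := z))) (Gf i ?k)" "sat M (jn y' (?e(?k := z))) (ConjL (map (\<lambda>a. Neg (Ef i ?k a)) [0..<?k]))"
          using z(2) unfolding jn_upd sat.simps by blast+
        have "G i z" using z2(1) unfolding GM by simp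
        moreover have "\<not> E i z (zs ! a)" if a: "a < ?k" for a
        proof -
          have "Neg (Ef i ?k a) \<in> set (map (\<lambda>a. Neg (Ef i ?k a)) [0..<?k])" using a by auto
          then have "sat M (jn y' (?e(?k := z))) (Neg (Ef i ?k a))" using z2(2) unfolding ConjL_simps by blast
          then show ?thesis unfolding sat.simps EM using a by (simp add: pad_def)
        qed
        ultimately have "z \<in> dom M" "G i z" "\<And>a. a < ?k \<Longrightarrow> \<not> E i z (zs ! a)" using z(1) by blast+
        then show ?thesis by (metis in_set_conv_nth)
      qed
    qed
    then show False using n by blast
  qed
  then show ?thesis by blast
qed

lemma ex_tame: "\<exists>nb. tame df nb"
proof -
  from breadth_bound obtain n where n: "\<forall>H :: nat \<Rightarrow> 'a set. (\<forall>i\<le>n. sg (H i) \<and> (\<exists>A. finite A \<and> df A (\<lambda>e. e 0 \<in> H i))) \<longrightarrow>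
    (\<exists>i\<le>n. (\<Inter>j\<in>{..n}-{i}. H j) \<preceq> H i)" by (rule exE)
  have "tame df n"
  proof (rule tame.intro)
    show "\<exists>i\<le>n. (\<Inter>j\<in>{..n} - {i}. H j) \<preceq> H i"
      if "\<And>i. i \<le> n \<Longrightarrow> sg (H i) \<and> (\<exists>A. finite A \<and> df A (\<lambda>e. e 0 \<in> H i))" for H :: "nat \<Rightarrow> 'a set"
      by (rule n[rule_format]) (rule that)
  qed (fact df_neg df_conj df_exists df_rename df_eqs df_adds df_muls df_const df_params df_support df_finitely_many)+
  then show ?thesis ..
qed

end

section \<open>The theorem\<close>

theorem theorem7p10:
  fixes L :: "('f ring_fn, 'r) language"
    and R :: "('f ring_fn, 'r, 'a :: ring) struct"
    and M :: "('f ring_fn, 'r, 'm) struct"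
    and \<kappa> :: "'k rel"
  assumes "countable_language L"
    and "expands_ring_language L"
    and "expands_ring R"
    and "omega_categorical_theory L (complete_theory L R)"
    and "monster_model L (complete_theory L R) \<kappa> M"
    and "finite_burden L M"
  shows "\<exists>R\<^sub>0 I :: 'a set.
    nonunital_subring R\<^sub>0 \<and> finite_additive_index R\<^sub>0 \<and>
    two_sided_ideal_in I R\<^sub>0 \<and> finite I \<and>
    (\<forall>x \<in> R\<^sub>0. \<forall>y \<in> R\<^sub>0. x * y \<in> I)"
proof -
  have c: "cat_ring L R M \<kappa>"
    by unfold_locales (use assms in \<open>auto simp: expands_ring_def monster_model_def\<close>)
  from cat_ring.ex_tame[OF c] show ?thesis
    by (rule exE) (rule tame.virtually_finite_by_null)
qed

end
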